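(* There exists a weakly mixing Gaussian flow $T=(T_t)_{t\in\mathbb R}$ such that its group of self-similarities $I(T)=\{s\in\mathbb R^*\mid T\circ s \text{ is isomorphic to } T\}$ is uncountable and meager in $\mathbb R^*$.
   Context: $\mathbb R^*$ is the multiplicative group of nonzero reals with its usual topology; meager means of first Baire category. A flow is a measurable action $T=(T_t)_{t\in\mathbb R}$ of $\mathbb R$ by measure preserving transformations of a standard non-atomic probability space $(X,\mathfrak B,\mu)$. For $s\in\mathbb R^*$, $T\circ s$ denotes the flow $(T_{st})_{t\in\mathbb R}$. Two flows $T$ on $(X,\mu)$ and $S$ on $(Y,\nu)$ are isomorphic if there is a measure preserving bijection $R$ (modulo null sets) from $X$ to $Y$ with $RT_tR^{-1}=S_t$ almost everywhere for every $t\in\mathbb R$. $I(T)$ is a subgroup of $\mathbb R^*$, called the group of self-similarities of $T$. Given a finite symmetric Borel measure $\sigma$ on $\mathbb R$, the Gaussian flow associated with $\sigma$ is the shift flow of the real, centered, stationary Gaussian process $(\xi_t)_{t\in\mathbb R}$ with covariance $E(\xi_t\xi_0)=\int_{\mathbb R}e^{itx}\,d\sigma(x)$; that is, a flow $T$ on a standard probability space $(X,\mathfrak B,\mu)$ together with a real centered Gaussian random variable $\xi$ on $X$ such that $(\xi\circ T_t)_{t\in\mathbb R}$ is a Gaussian process with this covariance which generates $\mathfrak B$ modulo $\mu$-null sets. A flow is Gaussian if it is isomorphic to a flow of this form. *)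

theory Defs
  imports "HOL-Probability.Probability"
begin

section \<open>Flows on standard probability spaces\<close>

definition standard_borel_space :: "'a measure \<Rightarrow> bool" where
  "standard_borel_space M \<longleftrightarrow>
     (\<exists>X. topspace X = space M \<and> completely_metrizable_space X \<and> second_countable X \<and>
          sets M = sigma_sets (space M) {U. openin X U})"

definition nonatomic :: "'a measure \<Rightarrow> bool" where
  "nonatomic M \<longleftrightarrow>
     \<not> (\<exists>A\<in>sets M. emeasure M A > 0 \<and>
          (\<forall>B\<in>sets M. B \<subseteq> A \<longrightarrow> emeasure M B = 0 \<or> emeasure M B = emeasure M A))"

text \<open>The action is a genuine one (the group law holds everywhere on the space), and it is
  jointly measurable in time and space.\<close>

definition flow :: "'a measure \<Rightarrow> (real \<Rightarrow> 'a \<Rightarrow> 'a) \<Rightarrow> bool" where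
  "flow M T \<longleftrightarrow>
     prob_space M \<and> standard_borel_space M \<and> nonatomic M \<and>
     (\<lambda>(t, x). T t x) \<in> borel \<Otimes>\<^sub>M M \<rightarrow>\<^sub>M M \<and>
     (\<forall>x\<in>space M. T 0 x = x) \<and>
     (\<forall>s t. \<forall>x\<in>space M. T (s + t) x = T s (T t x)) \<and>
     (\<forall>t. distr M M (T t) = M)"

text \<open>The map \<open>R\<close> is an isomorphism between the conull sets \<open>X\<close> and \<open>Y\<close>. In the last clause,
  the (irrelevant) values of \<open>R\<close> outside \<open>X\<close> enter only for \<open>y\<close> in a null set.\<close>

definition isomorphic_flows ::
  "'a measure \<Rightarrow> (real \<Rightarrow> 'a \<Rightarrow> 'a) \<Rightarrow> 'b measure \<Rightarrow> (real \<Rightarrow> 'b \<Rightarrow> 'b) \<Rightarrow> bool" where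
  "isomorphic_flows M T N S \<longleftrightarrow>
     (\<exists>X\<in>sets M. \<exists>Y\<in>sets N. \<exists>R.
        emeasure M (space M - X) = 0 \<and> emeasure N (space N - Y) = 0 \<and>
        bij_betw R X Y \<and>
        R \<in> restrict_space M X \<rightarrow>\<^sub>M restrict_space N Y \<and>
        the_inv_into X R \<in> restrict_space N Y \<rightarrow>\<^sub>M restrict_space M X \<and>
        distr (restrict_space M X) (restrict_space N Y) R = restrict_space N Y \<and>
        (\<forall>t. AE y in N. R (T t (the_inv_into X R y)) = S t y))"

text \<open>Weak mixing as absence of nonconstant \<open>L\<^sup>2\<close> eigenfunctions; the case \<open>\<theta> = 0\<close> is
  ergodicity.\<close>

definition weakly_mixing :: "'a measure \<Rightarrow> (real \<Rightarrow> 'a \<Rightarrow> 'a) \<Rightarrow> bool" where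
  "weakly_mixing M T \<longleftrightarrow>
     (\<forall>(f :: 'a \<Rightarrow> complex) (\<theta> :: real).
        f \<in> borel_measurable M \<longrightarrow> integrable M (\<lambda>x. (cmod (f x))\<^sup>2) \<longrightarrow>
        (\<forall>t. AE x in M. f (T t x) = cis (\<theta> * t) * f x) \<longrightarrow>
        (\<exists>c. AE x in M. f x = c))"

definition self_similarities :: "'a measure \<Rightarrow> (real \<Rightarrow> 'a \<Rightarrow> 'a) \<Rightarrow> real set" where
  "self_similarities M T = {s. s \<noteq> 0 \<and> isomorphic_flows M (\<lambda>t. T (s * t)) M T}"


section \<open>Gaussian flows\<close>

text \<open>The constant \<open>0\<close> counts as (degenerate) centered Gaussian, as linear combinations of jointly
  Gaussian variables may vanish.\<close>

definition centered_gaussian :: "'a measure \<Rightarrow> ('a \<Rightarrow> real) \<Rightarrow> bool" where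
  "centered_gaussian M \<xi> \<longleftrightarrow>
     \<xi> \<in> borel_measurable M \<and>
     ((AE x in M. \<xi> x = 0) \<or> (\<exists>s>0. distributed M lborel \<xi> (normal_density 0 s)))"

definition centered_gaussian_process :: "'a measure \<Rightarrow> ('i \<Rightarrow> 'a \<Rightarrow> real) \<Rightarrow> bool" where
  "centered_gaussian_process M \<xi> \<longleftrightarrow>
     (\<forall>F c. finite F \<longrightarrow> centered_gaussian M (\<lambda>x. \<Sum>t\<in>F. c t * \<xi> t x))"

definition finite_symmetric_borel_measure :: "real measure \<Rightarrow> bool" where
  "finite_symmetric_borel_measure \<sigma> \<longleftrightarrow>
     finite_measure \<sigma> \<and> sets \<sigma> = sets borel \<and> distr \<sigma> borel uminus = \<sigma>"

definition generates_mod_null :: "'a measure \<Rightarrow> ('i \<Rightarrow> 'a \<Rightarrow> real) \<Rightarrow> bool" where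
  "generates_mod_null M \<xi> \<longleftrightarrow>
     (\<forall>A\<in>sets M. \<exists>B\<in>sigma_sets (space M) {\<xi> t -` C \<inter> space M |t C. C \<in> sets borel}.
        AE x in M. x \<in> A \<longleftrightarrow> x \<in> B)"

definition gaussian_shift_flow ::
  "real measure \<Rightarrow> 'a measure \<Rightarrow> (real \<Rightarrow> 'a \<Rightarrow> 'a) \<Rightarrow> bool" where
  "gaussian_shift_flow \<sigma> M T \<longleftrightarrow>
     flow M T \<and>
     (\<exists>\<xi>. centered_gaussian M \<xi> \<and>
          centered_gaussian_process M (\<lambda>t x. \<xi> (T t x)) \<and>
          (\<forall>t. complex_of_real (\<integral>x. \<xi> (T t x) * \<xi> x \<partial>M) = (\<integral>u. cis (t * u) \<partial>\<sigma>)) \<and>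
          generates_mod_null M (\<lambda>t x. \<xi> (T t x)))"

text \<open>It is no restriction to take the model \<open>S\<close> on a space of the same type as \<open>M\<close>: if \<open>R\<close> is
  an isomorphism from \<open>T\<close> to \<open>S\<close> and \<open>\<xi>\<close> is the Gaussian variable for \<open>S\<close>, then \<open>\<xi> \<circ> R\<close>
  is one for \<open>T\<close>.\<close>

definition gaussian_flow :: "'a measure \<Rightarrow> (real \<Rightarrow> 'a \<Rightarrow> 'a) \<Rightarrow> bool" where
  "gaussian_flow M T \<longleftrightarrow>
     flow M T \<and>
     (\<exists>(N :: 'a measure) S \<sigma>. finite_symmetric_borel_measure \<sigma> \<and>
        gaussian_shift_flow \<sigma> N S \<and> isomorphic_flows M T N S)"


section \<open>Meager sets\<close>

definition nowhere_dense_in :: "'a topology \<Rightarrow> 'a set \<Rightarrow> bool" where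
  "nowhere_dense_in X A \<longleftrightarrow> A \<subseteq> topspace X \<and> X interior_of (X closure_of A) = {}"

definition meager_in :: "'a topology \<Rightarrow> 'a set \<Rightarrow> bool" where
  "meager_in X A \<longleftrightarrow>
     (\<exists>\<A>. countable \<A> \<and> (\<forall>B\<in>\<A>. nowhere_dense_in X B) \<and> A = \<Union>\<A>)"

text \<open>Points of the underlying probability space can be taken in any type of cardinality at
  least the continuum, since every standard Borel space embeds into such a type. The type
  \<open>path\<close> of real sample paths is the natural one for shift flows of processes.\<close>

type_synonym path = "real \<Rightarrow> real"

end

theory Submission
  imports Defs "HOL-Real_Asymp.Real_Asymp" "HOL-Computational_Algebra.Polynomial"
begin

text \<open>If the spectral measure \<open>\<sigma>\<close> is quasi-invariant under multiplication by \<open>s\<close>, then multiplying by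
  the square root of the Radon--Nikodym density gives an isometry of \<open>L\<^sup>2(\<sigma>)\<close> that intertwines the
  rescaled translation group with the original one, and its second quantisation makes \<open>s\<close> a
  self-similarity. The flow is weakly mixing if \<open>\<sigma>\<close> has no atoms. If \<open>cis (t\<^sub>n x)\<close> tends to \<open>1\<close> for
  almost every \<open>x\<close> along some \<open>t\<^sub>n\<close> tending to infinity, then the flow is rigid along \<open>t\<^sub>n\<close>, hence along
  \<open>s t\<^sub>n\<close> for each self-similarity \<open>s\<close>; as the averages of \<open>Re (cis (s t\<^sub>n x))\<close> over an interval of \<open>s\<close>
  tend to \<open>0\<close>, the set of these \<open>s\<close> is meager.

  A measure with these properties is, up to a Gaussian weight, the law of a product
  \<open>\<plusminus>\<Prod>\<^sub>k (1 + 1/A\<^sub>k)\<^bsup>w\<^sub>k\<^esup>\<close> with independent integers \<open>w\<^sub>k\<close> whose two-sided geometric laws have ratios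
  tending to \<open>1\<close> so fast that adding \<open>0\<close> or \<open>1\<close> to each digit changes the joint law only by a bounded
  density. The uncountably many resulting products are self-similarities, whereas rapid growth of
  \<open>A\<^sub>k\<close> makes the common denominators of the partial products rigidity times.

  The weight gives \<open>\<sigma>\<close> moments so small that the Gaussian process has entire sample paths, which
  are determined by their Taylor coefficients; this realises the flow on a standard space of paths,
  with the Gaussian space spanned by countably many explicit functionals.\<close>

section \<open>Multiplicative classes of functions\<close>

text \<open>Quasi-invariance wants the digits spread out, rigidity wants them confined. The two
  demands are decoupled by the order of choice: the cost of a digit shift depends on the digit laws
  alone, with a log-density of at most \<open>(1/2) ^ k\<close> at place \<open>k\<close>, and the
  numbers \<open>Anum k\<close> are chosen only after these laws and their quantiles are fixed.
  Digit 0 has exponent zero; it carries the sign and makes the measure symmetric. An isomorphism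
  between Gaussian flows need not respect the Gaussian space. A self-similarity therefore transports
  rigidity only if rigidity is known for every bounded function and not just for the Gaussian
  process. Hence the function classes generated by characters; they also give the density of
  polynomials and the uniqueness of laws. Second quantisation is never formed as an operator on a
  Fock space. The isometry prescribes the Taylor coefficients of the image path, and this yields
  directly the point map that the definition of isomorphism asks for.\<close>

inductive_set trig_polys :: "('i \<Rightarrow> 'a \<Rightarrow> real) \<Rightarrow> ('a \<Rightarrow> complex) set"
  for X :: "'i \<Rightarrow> 'a \<Rightarrow> real" where
  cis: "finite F \<Longrightarrow> (\<lambda>x. cis (\<Sum>i\<in>F. u i * X i x)) \<in> trig_polys X"
| add: "f \<in> trig_polys X \<Longrightarrow> g \<in> trig_polys X \<Longrightarrow> (\<lambda>x. f x + g x) \<in> trig_polys X"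
| scale: "f \<in> trig_polys X \<Longrightarrow> (\<lambda>x. c * f x) \<in> trig_polys X"

lemma trig_polys_const: "(\<lambda>x. c) \<in> trig_polys X"
  using trig_polys.scale[OF trig_polys.cis[of "{}"], of c] by simp

lemma trig_polys_cis_mult:
  assumes "g \<in> trig_polys X" "finite F"
  shows "(\<lambda>x. cis (\<Sum>i\<in>F. u i * X i x) * g x) \<in> trig_polys X"
  using assms(1)
proof induction
  case (cis G v)
  define w where "w i = (if i \<in> F then u i else 0) + (if i \<in> G then v i else 0)" for i
  have "(\<Sum>i\<in>F. u i * X i x) + (\<Sum>i\<in>G. v i * X i x) = (\<Sum>i\<in>F \<union> G. w i * X i x)" for x
  proof -
    have "(\<Sum>i\<in>F. u i * X i x) = (\<Sum>i\<in>F \<union> G. (if i \<in> F then u i else 0) * X i x)"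
      by (rule sum.mono_neutral_cong_left) (use cis assms in auto)
    moreover have "(\<Sum>i\<in>G. v i * X i x) = (\<Sum>i\<in>F \<union> G. (if i \<in> G then v i else 0) * X i x)"
      by (rule sum.mono_neutral_cong_left) (use cis assms in auto)
    ultimately show ?thesis
      by (simp add: w_def sum.distrib[symmetric] distrib_right)
  qed
  then show ?case
    using trig_polys.cis[of "F \<union> G" w X] cis assms by (simp add: cis_mult)
next
  case (add f g)
  then show ?case using trig_polys.add by (fastforce simp: distrib_left)
next
  case (scale f c)
  from trig_polys.scale[OF scale.IH, of c] show ?case by (simp add: mult.left_commute)
qed

lemma trig_polys_mult:
  assumes "f \<in> trig_polys X" "g \<in> trig_polys X"
  shows "(\<lambda>x. f x * g x) \<in> trig_polys X"
  using assms(1)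
proof induction
  case (cis F u)
  then show ?case using trig_polys_cis_mult assms(2) by blast
next
  case (add f h)
  then show ?case using trig_polys.add by (fastforce simp: distrib_right)
next
  case (scale f c)
  from trig_polys.scale[OF scale.IH, of c] show ?case by (simp add: mult.assoc)
qed

lemma trig_polys_prod:
  assumes "\<And>i. i \<in> F \<Longrightarrow> f i \<in> trig_polys X"
  shows "(\<lambda>x. \<Prod>i\<in>F. f i x) \<in> trig_polys X"
  using assms
  by (induction F rule: infinite_finite_induct) (auto intro: trig_polys_const trig_polys_mult)

lemma sin_eq_cis: "(cis w - cis (- w)) / (2 * \<i>) = complex_of_real (sin w)"
  by (simp add: complex_eq_iff Re_divide Im_divide)

lemma trig_polys_sin: "(\<lambda>x. complex_of_real (sin (c * X i x + d))) \<in> trig_polys X"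
proof -
  have 1: "(\<lambda>x. cis (v * X i x)) \<in> trig_polys X" for v
    using trig_polys.cis[of "{i}" "\<lambda>_. v" X] by simp
  have "(\<lambda>x. (cis d / (2 * \<i>)) * cis (c * X i x) + (- cis (- d) / (2 * \<i>)) * cis (- c * X i x))
      \<in> trig_polys X"
    by (intro trig_polys.add trig_polys.scale 1)
  moreover have "(cis d / (2 * \<i>)) * cis (c * X i x) + (- cis (- d) / (2 * \<i>)) * cis (- c * X i x)
      = complex_of_real (sin (c * X i x + d))" for x
  proof -
    have "(cis d / (2 * \<i>)) * cis v + (- cis (- d) / (2 * \<i>)) * cis (- v)
        = complex_of_real (sin (v + d))" for v
    proof -
      have "(cis d / (2 * \<i>)) * cis v + (- cis (- d) / (2 * \<i>)) * cis (- v)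
          = (cis d * cis v - cis (- d) * cis (- v)) / (2 * \<i>)"
        by (simp add: field_simps)
      also have "cis d * cis v = cis (v + d)" by (simp add: cis_mult add.commute)
      also have "cis (- d) * cis (- v) = cis (- (v + d))" by (simp add: cis_mult add.commute)
      finally show ?thesis
        using sin_eq_cis[of "v + d"] by simp
    qed
    from this[of "c * X i x"] show ?thesis by simp
  qed
  ultimately show ?thesis by simp
qed

lemma trig_polys_polynomial:
  assumes "real_polynomial_function p" "(\<lambda>x. complex_of_real (f x)) \<in> trig_polys X"
  shows "(\<lambda>x. complex_of_real (p (f x))) \<in> trig_polys X"
  using assms(1)
proof induction
  case (linear h)
  then obtain c where "h = (\<lambda>y. y * c)" using real_bounded_linear by blast
  then show ?case using trig_polys.scale[OF assms(2), of "of_real c"] by (simp add: mult.commute)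
qed (auto intro: trig_polys_const trig_polys.add trig_polys_mult)

text \<open>The polynomials in \<open>sin ((y - u) / L)\<close> approximate a ramp of slope about \<open>L\<close> at \<open>u\<close>.\<close>

lemma half_line_limit_of_trig:
  obtains p :: "nat \<Rightarrow> real \<Rightarrow> real"
  where "\<And>n. real_polynomial_function (p n)"
    "\<And>n y. \<bar>p n (sin ((y - u) / real (Suc n)))\<bar> \<le> 2"
    "\<And>y. (\<lambda>n. p n (sin ((y - u) / real (Suc n)))) \<longlonglongrightarrow> indicator {u<..} y"
proof -
  \<comment> \<open>With \<open>L = Suc n\<close>, the quantity
    \<open>L^2 * sin ((y - u) / L)\<close> behaves like \<open>L * (y - u)\<close>, so the clipped
    ramp is eventually 1 to the right of \<open>u\<close>. At and to the left of \<open>u\<close>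
    the sine is nonpositive as soon as \<open>L\<close> reaches \<open>u - y\<close>, so the ramp is
    eventually 0.\<close>
  define \<psi> where "\<psi> n s = max 0 (min 1 ((real (Suc n))\<^sup>2 * s))" for n :: nat and s :: real
  have "\<exists>g. real_polynomial_function g \<and> (\<forall>s\<in>{-1..1}. \<bar>\<psi> n s - g s\<bar> < inverse (real (Suc n)))" for n
  proof -
    have "continuous_on {-1..1} (\<psi> n)"
      unfolding \<psi>_def by (intro continuous_intros)
    then show ?thesis
      by (rule Stone_Weierstrass_real_polynomial_function[OF compact_Icc, of _ _ _ "inverse (real (Suc n))"])
        auto
  qed
  then obtain p where p: "\<And>n. real_polynomial_function (p n)"
    and pe: "\<And>n s. s \<in> {-1..1} \<Longrightarrow> \<bar>\<psi> n s - p n s\<bar> < inverse (real (Suc n))"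
    by metis
  have \<psi>01: "0 \<le> \<psi> n s" "\<psi> n s \<le> 1" for n s by (auto simp: \<psi>_def)
  show thesis
  proof (rule that)
    show "real_polynomial_function (p n)" for n by (rule p)
    show "\<bar>p n (sin ((y - u) / real (Suc n)))\<bar> \<le> 2" for n y
      using pe[of "sin ((y - u) / real (Suc n))" n] \<psi>01[of n "sin ((y - u) / real (Suc n))"]
        le_imp_inverse_le[of 1 "real (Suc n)"] by (auto simp: abs_le_iff)
    show "(\<lambda>n. p n (sin ((y - u) / real (Suc n)))) \<longlonglongrightarrow> indicator {u<..} y" for y
    proof -
      have "eventually (\<lambda>n. \<psi> n (sin ((y - u) / real (Suc n))) = indicator {u<..} y) sequentially"
      proof (cases "y > u")
        case True
        define z where "z = y - u"
        have z: "z > 0" using True by (simp add: z_def)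

        have "filterlim (\<lambda>n. (real (Suc n))\<^sup>2 * sin (z / real (Suc n))) at_top sequentially"
          using z by real_asymp
        then have "eventually (\<lambda>n. (real (Suc n))\<^sup>2 * sin (z / real (Suc n)) \<ge> 1) sequentially"
          by (simp add: filterlim_at_top)
        then show ?thesis by eventually_elim (use True in \<open>auto simp: \<psi>_def z_def\<close>)
      next
        case False
        define z where "z = u - y"
        have z: "z \<ge> 0" using False by (simp add: z_def)
        have "eventually (\<lambda>n. real (Suc n) \<ge> z) sequentially"
          by real_asymp
        then show ?thesis
        proof eventually_elim
          case (elim n)
          then have "z / real (Suc n) \<le> 1" by (simp add: field_simps)
          then have "0 \<le> sin (z / real (Suc n))"
            using z pi_gt3 by (intro sin_ge_zero) (simp, linarith)
          moreover have "sin ((y - u) / real (Suc n)) = - sin (z / real (Suc n))"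
            unfolding z_def by (metis minus_diff_eq minus_divide_left sin_minus)
          ultimately have "(real (Suc n))\<^sup>2 * sin ((y - u) / real (Suc n)) \<le> 0"
            by (simp add: mult_nonneg_nonneg)
          then show ?case using False by (auto simp: \<psi>_def)
        qed
      qed
      then have 1: "(\<lambda>n. \<psi> n (sin ((y - u) / real (Suc n)))) \<longlonglongrightarrow> indicator {u<..} y"
        by (rule tendsto_eventually)
      have "(\<lambda>n. \<psi> n (sin ((y - u) / real (Suc n))) - p n (sin ((y - u) / real (Suc n)))) \<longlonglongrightarrow> 0"
        by (rule Lim_null_comparison[OF _ LIMSEQ_inverse_real_of_nat])
          (use pe in \<open>auto intro!: always_eventually less_imp_le simp del: of_nat_Suc\<close>)
      from tendsto_diff[OF 1 this] show ?thesis by simp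
    qed
  qed
qed

text \<open>A functional monotone class theorem. Products are supplied by the characters, whose span
  \<open>trig_polys\<close> is an algebra, so \<open>V\<close> can be a merely linear class, such as
  the functions whose integrals agree before and after a map. The outcome is
  \<open>bounded_in\<close>.\<close>

locale multiplicative_class =
  fixes M :: "'a measure" and X :: "'i \<Rightarrow> 'a \<Rightarrow> real" and V :: "('a \<Rightarrow> complex) set"
  assumes X_measurable: "\<And>i. X i \<in> borel_measurable M"
    and gen: "sets M = sigma_sets (space M) {X i -` {u<..} \<inter> space M | i u. True}"
    and cis_in: "\<And>F u. finite F \<Longrightarrow> (\<lambda>x. cis (\<Sum>i\<in>F. u i * X i x)) \<in> V"
    and add_in: "\<And>f g. f \<in> V \<Longrightarrow> g \<in> V \<Longrightarrow> (\<lambda>x. f x + g x) \<in> V"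
    and scale_in: "\<And>f c. f \<in> V \<Longrightarrow> (\<lambda>x. c * f x) \<in> V"
    and lim_in: "\<And>f g B. (\<And>n. f n \<in> V) \<Longrightarrow> (\<And>n. f n \<in> borel_measurable M) \<Longrightarrow>
      g \<in> borel_measurable M \<Longrightarrow> (\<And>n x. x \<in> space M \<Longrightarrow> cmod (f n x) \<le> B) \<Longrightarrow>
      (\<And>x. x \<in> space M \<Longrightarrow> (\<lambda>n. f n x) \<longlonglongrightarrow> g x) \<Longrightarrow> g \<in> V"
begin

lemma trig_in: "f \<in> trig_polys X \<Longrightarrow> f \<in> V"
  by (induction rule: trig_polys.induct) (auto intro: cis_in add_in scale_in)

lemma trig_measurable: "f \<in> trig_polys X \<Longrightarrow> f \<in> borel_measurable M"
proof (induction rule: trig_polys.induct)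
  case (cis F u)
  note X_measurable[measurable]
  show ?case unfolding cis_conv_exp by measurable
qed (auto intro: borel_measurable_add borel_measurable_times)

text \<open>A finite product of the half-line approximants is again a trigonometric polynomial,
  bounded by \<open>2 ^ card F\<close>, so bounded limits reach the indicator.\<close>

lemma cylinder_in:
  assumes "finite F"
  shows "(\<lambda>x. indicator {x \<in> space M. \<forall>i\<in>F. u i < X i x} x) \<in> V"
proof -
  define Q where "Q i p \<longleftrightarrow> (\<forall>n. real_polynomial_function (p n)) \<and>
      (\<forall>n y. \<bar>p n (sin ((y - u i) / real (Suc n)))\<bar> \<le> 2) \<and>
      (\<forall>y. (\<lambda>n. p n (sin ((y - u i) / real (Suc n)))) \<longlonglongrightarrow> indicator {u i<..} y)" for i p
  have "\<exists>p. Q i p" for i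
    by (rule half_line_limit_of_trig[of "u i"]) (auto simp: Q_def)
  then have "\<exists>p. \<forall>i. Q i (p i)" by (intro choice allI)
  then obtain p where "\<And>i. Q i (p i)" by blast
  then have p: "\<And>i n. real_polynomial_function (p i n)"
    and pb: "\<And>i n y. \<bar>p i n (sin ((y - u i) / real (Suc n)))\<bar> \<le> 2"
    and pl: "\<And>i y. (\<lambda>n. p i n (sin ((y - u i) / real (Suc n)))) \<longlonglongrightarrow> indicator {u i<..} y"
    unfolding Q_def by auto
  define f where "f n x = (\<Prod>i\<in>F. complex_of_real (p i n (sin ((X i x - u i) / real (Suc n)))))" for n x
  have ft: "f n \<in> trig_polys X" for n
    unfolding f_def
  proof (rule trig_polys_prod, rule trig_polys_polynomial[OF p])
    fix i
    have "sin (1 / real (Suc n) * X i x + - u i / real (Suc n)) = sin ((X i x - u i) / real (Suc n))" for x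
      by (simp add: diff_divide_distrib del: of_nat_Suc)
    then show "(\<lambda>x. complex_of_real (sin ((X i x - u i) / real (Suc n)))) \<in> trig_polys X"
      using trig_polys_sin[of "1 / real (Suc n)" X i "- u i / real (Suc n)"] by simp
  qed
  note X_measurable[measurable]
  show ?thesis
  proof (rule lim_in)
    show "f n \<in> V" "f n \<in> borel_measurable M" for n
      by (rule trig_in[OF ft], rule trig_measurable[OF ft])
    show "(\<lambda>x. indicator {x \<in> space M. \<forall>i\<in>F. u i < X i x} x) \<in> borel_measurable M"
      using assms by (intro borel_measurable_indicator sets.sets_Collect_finite_All) measurable
    show "cmod (f n x) \<le> 2 ^ card F" for n x
    proof -
      have "cmod (f n x) = (\<Prod>i\<in>F. \<bar>p i n (sin ((X i x - u i) / real (Suc n)))\<bar>)"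
        unfolding f_def by (simp only: prod_norm[symmetric] norm_of_real)
      also have "\<dots> \<le> (\<Prod>i\<in>F. 2)"
        by (intro prod_mono conjI abs_ge_zero pb)
      finally show ?thesis by simp
    qed
    show "(\<lambda>n. f n x) \<longlonglongrightarrow> indicator {x \<in> space M. \<forall>i\<in>F. u i < X i x} x" if "x \<in> space M" for x
    proof -
      have "(\<lambda>n. f n x) \<longlonglongrightarrow> (\<Prod>i\<in>F. complex_of_real (indicator {u i<..} (X i x)))"
        unfolding f_def by (intro tendsto_prod tendsto_of_real pl)
      moreover have "(\<Prod>i\<in>F. complex_of_real (indicator {u i<..} (X i x)))
          = indicator {x \<in> space M. \<forall>i\<in>F. u i < X i x} x"
      proof (cases "\<forall>i\<in>F. u i < X i x")
        case True
        then show ?thesis using that by simp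
      next
        case False
        then obtain i where "i \<in> F" "\<not> u i < X i x" by blast
        then have "(\<Prod>i\<in>F. complex_of_real (indicator {u i<..} (X i x))) = 0"
          by (intro prod_zero[OF assms] bexI[of _ i]) auto
        then show ?thesis using False by simp
      qed
      ultimately show ?thesis by simp
    qed
  qed
qed

lemma one_in: "(\<lambda>x. 1) \<in> V"
  using cis_in[of "{}"] by simp

text \<open>Dynkin's theorem for the cylinders cut out by strict lower bounds; they are stable under
  intersection because two bounds on one coordinate merge to their maximum.\<close>

lemma indicator_in:
  assumes "A \<in> sets M"
  shows "(\<lambda>x. indicator A x) \<in> V"
proof -
  define P where "P = {{x \<in> space M. \<forall>i\<in>F. u i < X i x} | F u. finite F}"
  note X_measurable[measurable]
  have PM: "P \<subseteq> sets M"
    unfolding P_def by (auto intro!: sets.sets_Collect_finite_All)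
  have gen': "sigma_sets (space M) P = sets M"
  proof
    show "sigma_sets (space M) P \<subseteq> sets M" using PM by (rule sets.sigma_sets_subset)
    have "X i -` {u<..} \<inter> space M \<in> P" for i u
      unfolding P_def by (auto intro!: exI[of _ "{i}"] exI[of _ "\<lambda>_. u"])
    then have "{X i -` {u<..} \<inter> space M | i u. True} \<subseteq> P" by auto
    then show "sets M \<subseteq> sigma_sets (space M) P"
      unfolding gen by (rule sigma_sets_mono')
  qed
  have "Int_stable P"
  proof (rule Int_stableI)
    fix A B assume "A \<in> P" "B \<in> P"
    then obtain F u G v where A: "A = {x \<in> space M. \<forall>i\<in>F. u i < X i x}" "finite F"
      and B: "B = {x \<in> space M. \<forall>i\<in>G. v i < X i x}" "finite G" unfolding P_def by auto
    define w where "w i = (if i \<in> F then (if i \<in> G then max (u i) (v i) else u i) else v i)" for i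
    have "A \<inter> B = {x \<in> space M. \<forall>i\<in>F\<union>G. w i < X i x}"
      unfolding A B w_def by (auto split: if_splits)
    then show "A \<inter> B \<in> P" unfolding P_def using A B by auto
  qed
  have "P \<subseteq> Pow (space M)" by (auto simp: P_def)
  have "A \<in> sigma_sets (space M) P" using assms gen' by simp
  then show ?thesis
  proof (induct rule: sigma_sets_induct_disjoint[OF \<open>Int_stable P\<close> \<open>P \<subseteq> Pow (space M)\<close>, consumes 1, case_names basic empty compl union])
    case (basic A)
    then obtain F u where "A = {x \<in> space M. \<forall>i\<in>F. u i < X i x}" "finite F"
      unfolding P_def by blast
    then show ?case using cylinder_in[of F u] by blast
  next
    case empty
    show ?case using scale_in[OF one_in, of 0] by (simp add: indicator_def)
  next
    case (compl A)
    have V: "(\<lambda>x. 1 + (- 1) * indicator A x) \<in> V"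
      by (rule add_in[OF one_in scale_in[OF compl(2)]])
    have A: "A \<in> sets M" using compl(1) gen' by simp
    show ?case
    \<comment> \<open>A constant sequence: the two functions differ outside \<open>space M\<close>,
      and closure under limits looks at the space only.\<close>
    proof (rule lim_in[of "\<lambda>_ x. 1 + (- 1) * indicator A x" _ 1, OF V])
      show "(\<lambda>x. 1 + (- 1) * indicator A x :: complex) \<in> borel_measurable M"
        using A by (intro borel_measurable_add borel_measurable_times borel_measurable_const borel_measurable_indicator)
      show "indicator (space M - A) \<in> borel_measurable M" using A by simp
    qed (auto split: split_indicator)
  next
    case (union A)
    have AM: "A i \<in> sets M" for i using union(2) gen' by auto
    have fin: "(\<lambda>x. \<Sum>i<n. indicator (A i) x) \<in> V" for n
    proof (induction n)
      case 0
      then show ?case using scale_in[OF one_in, of 0] by simp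
    next
      case (Suc n)
      then show ?case using add_in[OF Suc union(3)[of n]] by simp
    qed
    have ind: "(\<Sum>i<n. indicator (A i) x :: complex) = indicator (\<Union>i<n. A i) x" for n x
      by (rule indicator_UN_disjoint[symmetric])
        (use union(1) in \<open>auto simp: disjoint_family_on_def\<close>)
    show ?case
    proof (rule lim_in[OF fin, where B = 1])
      fix x
      show "(\<lambda>n. \<Sum>i<n. indicator (A i) x) \<longlonglongrightarrow> (indicator (\<Union> (range A)) x :: complex)"
        unfolding ind by (rule LIMSEQ_indicator_UN)
    qed (use AM in \<open>auto simp: ind split: split_indicator\<close>)
  qed
qed

lemma bounded_in:
  assumes g: "g \<in> borel_measurable M" and b: "\<And>x. x \<in> space M \<Longrightarrow> cmod (g x) \<le> B"
  shows "g \<in> V"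
proof -
  obtain s where s: "\<And>i. simple_function M (s i)"
    and lim: "\<And>x. x \<in> space M \<Longrightarrow> (\<lambda>i. s i x) \<longlonglongrightarrow> g x"
    and bd: "\<And>i x. x \<in> space M \<Longrightarrow> dist (s i x) 0 \<le> 2 * dist (g x) 0"
    using borel_measurable_implies_sequence_metric[OF g, of 0] by blast
  have sum_in: "(\<lambda>x. \<Sum>y\<in>F. y * indicator (s i -` {y} \<inter> space M) x) \<in> V" if "finite F" for F i
    using that
  proof induction
    case empty
    then show ?case using scale_in[OF one_in, of 0] by simp
  next
    case (insert y F)
    have "(\<lambda>x. y * indicator (s i -` {y} \<inter> space M) x
        + (\<Sum>y\<in>F. y * indicator (s i -` {y} \<inter> space M) x)) \<in> V"
      by (intro add_in scale_in indicator_in simple_functionD(2)[OF s] insert.IH)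
    then show ?case
      by (subst sum.insert[OF insert.hyps])
  qed
  \<comment> \<open>Equal to \<open>s i\<close> on the space, but written as an explicit combination
    of indicators and thus in \<open>V\<close> as a function on the whole type.\<close>
  define t where "t i x = (\<Sum>y\<in>s i ` space M. y * indicator (s i -` {y} \<inter> space M) x)" for i x
  have ts: "t i x = s i x" if "x \<in> space M" for i x
  proof -
    have "t i x = (\<Sum>y\<in>s i ` space M. if y = s i x then y else 0)"
      unfolding t_def using that by (intro sum.cong) (auto split: split_indicator)
    then show ?thesis using that simple_functionD(1)[OF s[of i]] by simp
  qed
  show ?thesis
  proof (rule lim_in[of t g "2 * B"])
    show "t i \<in> V" for i unfolding t_def using sum_in[OF simple_functionD(1)[OF s]] .
    show "t i \<in> borel_measurable M" for i
      using borel_measurable_simple_function[OF s[of i]]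
      by (subst measurable_cong[OF ts])
    show "cmod (t i x) \<le> 2 * B" if "x \<in> space M" for i x
      using bd[OF that, of i] b[OF that] ts[OF that] by (simp add: dist_norm)
    show "(\<lambda>i. t i x) \<longlonglongrightarrow> g x" if "x \<in> space M" for x
      using lim[OF that] ts[OF that] by simp
  qed (rule g)
qed

end

section \<open>Square-integrable functions\<close>

definition L2 :: "'a measure \<Rightarrow> ('a \<Rightarrow> 'b::euclidean_space) \<Rightarrow> bool" where
  "L2 M f \<longleftrightarrow> f \<in> borel_measurable M \<and> integrable M (\<lambda>x. (norm (f x))\<^sup>2)"

definition nsq :: "'a measure \<Rightarrow> ('a \<Rightarrow> 'b::euclidean_space) \<Rightarrow> real" where
  "nsq M f = (\<integral>x. (norm (f x))\<^sup>2 \<partial>M)"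

lemma L2_measurable[measurable_dest]: "L2 M f \<Longrightarrow> f \<in> borel_measurable M"
  and L2_integrable: "L2 M f \<Longrightarrow> integrable M (\<lambda>x. (norm (f x))\<^sup>2)"
  by (auto simp: L2_def)

lemma nsq_nonneg: "0 \<le> nsq M f"
  by (auto simp: nsq_def)

lemma norm_add_sq_le:
  fixes x y :: "'b::real_normed_vector"
  shows "(norm (x + y))\<^sup>2 \<le> 2 * (norm x)\<^sup>2 + 2 * (norm y)\<^sup>2"
proof -
  have "(norm (x + y))\<^sup>2 \<le> (norm x + norm y)\<^sup>2"
    by (intro power_mono norm_triangle_ineq) auto
  also have "\<dots> \<le> 2 * (norm x)\<^sup>2 + 2 * (norm y)\<^sup>2"
    using sum_squares_bound[of "norm x" "norm y"] by (simp add: power2_sum)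
  finally show ?thesis .
qed

text \<open>Young's inequality with a free weight. The factor \<open>1 + e\<close> can be brought
  near 1, which is what convergence of norms requires.\<close>

lemma norm_add_sq_le_eps:
  fixes x y :: "'b::real_normed_vector"
  assumes "0 < e"
  shows "(norm (x + y))\<^sup>2 \<le> (1 + e) * (norm x)\<^sup>2 + (1 + 1 / e) * (norm y)\<^sup>2"
proof -
  have "(norm (x + y))\<^sup>2 \<le> (norm x + norm y)\<^sup>2"
    by (intro power_mono norm_triangle_ineq) auto
  moreover have "0 \<le> (sqrt e * norm x - norm y / sqrt e)\<^sup>2" by simp
  then have "2 * norm x * norm y \<le> e * (norm x)\<^sup>2 + (norm y)\<^sup>2 / e"
    using assms by (simp add: power2_diff power_mult_distrib power_divide)
  ultimately show ?thesis
    by (simp add: power2_sum algebra_simps)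
qed

lemma L2_add:
  assumes "L2 M f" "L2 M g" shows "L2 M (\<lambda>x. f x + g x)"
proof -
  have [measurable]: "f \<in> borel_measurable M" "g \<in> borel_measurable M"
    using assms by (auto simp: L2_def)
  have "integrable M (\<lambda>x. 2 * (norm (f x))\<^sup>2 + 2 * (norm (g x))\<^sup>2)"
    using assms by (auto simp: L2_def)
  then have "integrable M (\<lambda>x. (norm (f x + g x))\<^sup>2)"
    by (rule Bochner_Integration.integrable_bound) (auto intro: order_trans[OF norm_add_sq_le])
  then show ?thesis by (simp add: L2_def)
qed

lemma L2_scaleR: "L2 M f \<Longrightarrow> L2 M (\<lambda>x. c *\<^sub>R f x)"
  by (auto simp: L2_def power_mult_distrib)

lemma L2_cmult: "L2 M f \<Longrightarrow> L2 M (\<lambda>x. (c :: complex) * f x)"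
  by (auto simp: L2_def power_mult_distrib norm_mult)

lemma L2_rmult: "L2 M f \<Longrightarrow> L2 M (\<lambda>x. (c :: real) * f x)"
  using L2_scaleR[of M f c] by simp

lemma L2_minus: "L2 M f \<Longrightarrow> L2 M (\<lambda>x. - f x)"
  by (auto simp: L2_def)

lemma L2_diff: "L2 M f \<Longrightarrow> L2 M g \<Longrightarrow> L2 M (\<lambda>x. f x - g x)"
  using L2_add[OF _ L2_minus, of M f g] by simp

lemma L2_zero: "L2 M (\<lambda>x. 0)"
  by (simp add: L2_def)

lemma L2_sum: "(\<And>i. i \<in> I \<Longrightarrow> L2 M (f i)) \<Longrightarrow> L2 M (\<lambda>x. \<Sum>i\<in>I. f i x)"
  by (induction I rule: infinite_finite_induct) (auto intro: L2_zero L2_add)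

lemma (in finite_measure) L2_bounded:
  assumes "f \<in> borel_measurable M" "\<And>x. x \<in> space M \<Longrightarrow> norm (f x) \<le> B"
  shows "L2 M f"
  unfolding L2_def
proof (intro conjI assms(1) integrable_const_bound[of _ "B\<^sup>2"])
  show "AE x in M. norm ((norm (f x))\<^sup>2) \<le> B\<^sup>2"
    using assms(2) by (intro AE_I2) (auto intro!: power_mono)
qed (use assms(1) in measurable)

lemma L2_bound:
  fixes f :: "'a \<Rightarrow> 'b::euclidean_space" and g :: "'a \<Rightarrow> 'c::euclidean_space"
  assumes "L2 M g" "f \<in> borel_measurable M" "\<And>x. x \<in> space M \<Longrightarrow> norm (f x) \<le> norm (g x)"
  shows "L2 M f"
  unfolding L2_def
proof (intro conjI assms(2) Bochner_Integration.integrable_bound[OF L2_integrable[OF assms(1)]])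
  show "AE x in M. norm ((norm (f x))\<^sup>2) \<le> norm ((norm (g x))\<^sup>2)"
    using assms(3) by (intro AE_I2) (auto intro!: power_mono)
qed (use assms(2) in measurable)

lemma nsq_add_le:
  assumes "L2 M f" "L2 M g"
  shows "nsq M (\<lambda>x. f x + g x) \<le> 2 * nsq M f + 2 * nsq M g"
proof -
  have "nsq M (\<lambda>x. f x + g x) \<le> (\<integral>x. 2 * (norm (f x))\<^sup>2 + 2 * (norm (g x))\<^sup>2 \<partial>M)"
    unfolding nsq_def using assms L2_add[OF assms]
    by (intro integral_mono norm_add_sq_le) (auto simp: L2_def)
  also have "\<dots> = 2 * nsq M f + 2 * nsq M g"
    using assms by (simp add: nsq_def L2_def)
  finally show ?thesis .
qed

lemma nsq_minus_commute: "nsq M (\<lambda>x. f x - g x) = nsq M (\<lambda>x. g x - f x)"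
  by (simp add: nsq_def norm_minus_commute)

lemma nsq_scaleR: "nsq M (\<lambda>x. c *\<^sub>R f x) = c\<^sup>2 * nsq M f"
  by (simp add: nsq_def power_mult_distrib)

lemma nsq_diff_triangle:
  assumes "L2 M f" "L2 M g" "L2 M h"
  shows "nsq M (\<lambda>x. f x - h x) \<le> 2 * nsq M (\<lambda>x. f x - g x) + 2 * nsq M (\<lambda>x. g x - h x)"
  using nsq_add_le[OF L2_diff[OF assms(1,2)] L2_diff[OF assms(2,3)]] by simp

lemma nsq_add_le_eps:
  assumes "L2 M f" "L2 M g" "0 < e"
  shows "nsq M (\<lambda>x. f x + g x) \<le> (1 + e) * nsq M f + (1 + 1 / e) * nsq M g"
proof -
  have "nsq M (\<lambda>x. f x + g x) \<le> (\<integral>x. (1 + e) * (norm (f x))\<^sup>2 + (1 + 1 / e) * (norm (g x))\<^sup>2 \<partial>M)"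
    unfolding nsq_def using assms L2_add[OF assms(1,2)]
    by (intro integral_mono norm_add_sq_le_eps) (auto simp: L2_def)
  also have "\<dots> = (1 + e) * nsq M f + (1 + 1 / e) * nsq M g"
    using assms by (simp add: nsq_def L2_def)
  finally show ?thesis .
qed

lemma nsq_tendsto:
  assumes f: "\<And>n. L2 M (f n)" and g: "L2 M g" and lim: "(\<lambda>n. nsq M (\<lambda>x. f n x - g x)) \<longlonglongrightarrow> 0"
  shows "(\<lambda>n. nsq M (f n)) \<longlonglongrightarrow> nsq M g"
proof (rule order_tendstoI)
  let ?d = "\<lambda>n. nsq M (\<lambda>x. f n x - g x)"
  fix a assume a: "nsq M g < a"
  \<comment> \<open>Chosen so that \<open>(1 + e) * nsq M g\<close> uses up at most half of the gap
    between \<open>nsq M g\<close> and \<open>a\<close>.\<close>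
  define e where "e = (a - nsq M g) / (2 * (nsq M g + 1))"
  have e: "0 < e" using a nsq_nonneg[of M g] by (simp add: e_def)
  have "e * nsq M g \<le> (a - nsq M g) / 2"
    using a nsq_nonneg[of M g] by (simp add: e_def field_simps)
  then have 1: "(1 + e) * nsq M g + (1 + 1 / e) * 0 < a" using a by (simp add: algebra_simps)
  have "(\<lambda>n. (1 + e) * nsq M g + (1 + 1 / e) * ?d n) \<longlonglongrightarrow> (1 + e) * nsq M g + (1 + 1 / e) * 0"
    by (intro tendsto_intros lim)
  from order_tendstoD(2)[OF this 1]
  show "eventually (\<lambda>n. nsq M (f n) < a) sequentially"
  proof eventually_elim
    case (elim n)
    have "nsq M (\<lambda>x. g x + (f n x - g x)) \<le> (1 + e) * nsq M g + (1 + 1 / e) * ?d n"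
      by (rule nsq_add_le_eps[OF g L2_diff[OF f g] e])
    then show ?case using elim by simp
  qed
next
  let ?d = "\<lambda>n. nsq M (\<lambda>x. f n x - g x)"
  fix a assume a: "a < nsq M g"
  \<comment> \<open>Chosen so that \<open>(1 + e) * a\<close> still lies below
    \<open>nsq M g\<close>; cancelling \<open>1 + e\<close> at the end gives the lower
    bound.\<close>
  define e where "e = (nsq M g - a) / (2 * (\<bar>a\<bar> + 1))"
  have e: "0 < e" using a by (simp add: e_def)
  have "(1 + e) * a \<le> a + e * \<bar>a\<bar>" using e by (simp add: algebra_simps)
  moreover have "e * \<bar>a\<bar> \<le> (nsq M g - a) / 2"
    using a by (simp add: e_def field_simps)
  moreover have "x < G" if "x \<le> b + c" "c \<le> (G - b) / 2" "b < G" for x b c G :: real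
  proof -
    have "2 * c \<le> G - b" using that(2) by simp
    then show ?thesis using that(1,3) by linarith
  qed
  ultimately have "(1 + e) * a < nsq M g" using a by blast
  then have 1: "(1 + 1 / e) * 0 < nsq M g - (1 + e) * a" by simp
  have "(\<lambda>n. (1 + 1 / e) * ?d n) \<longlonglongrightarrow> (1 + 1 / e) * 0"
    by (intro tendsto_intros lim)
  from order_tendstoD(2)[OF this 1]
  show "eventually (\<lambda>n. a < nsq M (f n)) sequentially"
  proof eventually_elim
    case (elim n)
    have "nsq M (\<lambda>x. f n x + (g x - f n x)) \<le> (1 + e) * nsq M (f n) + (1 + 1 / e) * ?d n"
      using nsq_add_le_eps[OF f[of n] L2_diff[OF g f[of n]] e] by (simp add: nsq_minus_commute[of M "f n"])
    with elim have "(1 + e) * a < (1 + e) * nsq M (f n)" by simp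
    then show ?case using e by simp
  qed
qed

lemma nsq_eq_0D:
  assumes "L2 M f" "nsq M f = 0" shows "AE x in M. f x = 0"
  using assms integral_nonneg_eq_0_iff_AE[of M "\<lambda>x. (norm (f x))\<^sup>2"]
  by (auto simp: L2_def nsq_def)

lemma nsq_cong_AE:
  assumes "f \<in> borel_measurable M" "g \<in> borel_measurable M" "AE x in M. f x = g x"
  shows "nsq M f = nsq M g"
  unfolding nsq_def by (rule integral_cong_AE) (use assms in auto)

lemma (in finite_measure) L2_integrable1:
  assumes "L2 M f" shows "integrable M (\<lambda>x. norm (f x))" "integrable M f"
proof -
  have "integrable M (\<lambda>x. 1 + (norm (f x))\<^sup>2)" using assms by (simp add: L2_def)
  then show 1: "integrable M f"
  proof (rule Bochner_Integration.integrable_bound)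
    have "norm y \<le> 1 + (norm y)\<^sup>2" for y :: 'b
    proof -
      have "2 * norm y \<le> 1 + norm y * norm y" "0 \<le> norm y"
        using sum_squares_bound[of 1 "norm y"] by (simp_all add: power2_eq_square)
      then show ?thesis unfolding power2_eq_square by linarith
    qed
    then show "AE x in M. norm (f x) \<le> norm (1 + (norm (f x))\<^sup>2)"
      by (intro AE_I2) (simp add: abs_of_nonneg add_nonneg_nonneg)
  qed (use assms in \<open>auto simp: L2_def\<close>)
  then show "integrable M (\<lambda>x. norm (f x))" by simp
qed

text \<open>Pointwise, \<open>norm y\<close> is at most \<open>d + (norm y)^2 / d\<close>. With
  \<open>d\<close> free this stands in for the Cauchy-Schwarz inequality: fix a small
  \<open>d\<close>, then let \<open>nsq\<close> tend to 0.\<close>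

lemma (in finite_measure) integral_norm_le_nsq:
  assumes "L2 M f" "0 < d"
  shows "(\<integral>x. norm (f x) \<partial>M) \<le> d * measure M (space M) + nsq M f / d"
proof -
  have "norm y \<le> d + (norm y)\<^sup>2 / d" for y :: 'b
  proof -
    have "norm y * d \<le> d * d + norm y * norm y"
    proof -
      have "2 * (norm y * d) \<le> d * d + norm y * norm y" "0 \<le> norm y * d"
        using sum_squares_bound[of d "norm y"] assms(2) by (simp_all add: power2_eq_square mult_ac)
      then show ?thesis by linarith
    qed
    then show ?thesis using assms(2) by (simp add: field_simps power2_eq_square)
  qed
  then have "(\<integral>x. norm (f x) \<partial>M) \<le> (\<integral>x. d + (norm (f x))\<^sup>2 / d \<partial>M)"
    using L2_integrable1[OF assms(1)] L2_integrable[OF assms(1)]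
    by (intro integral_mono) auto
  also have "\<dots> = d * measure M (space M) + nsq M f / d"
    using L2_integrable[OF assms(1)] by (simp add: nsq_def)
  finally show ?thesis .
qed

lemma (in finite_measure) L1_tendsto:
  assumes f: "\<And>n. L2 M (f n)" and lim: "(\<lambda>n. nsq M (f n)) \<longlonglongrightarrow> 0"
  shows "(\<lambda>n. \<integral>x. norm (f n x) \<partial>M) \<longlonglongrightarrow> 0"
proof (rule order_tendstoI)
  fix a :: real assume "a < 0"
  moreover have "0 \<le> (\<integral>x. norm (f n x) \<partial>M)" for n by simp
  ultimately show "eventually (\<lambda>n. a < (\<integral>x. norm (f n x) \<partial>M)) sequentially"
    by (intro always_eventually allI) (metis less_le_trans)
next
  fix a :: real assume a: "0 < a"
  define d where "d = a / (2 * (measure M (space M) + 1))"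
  have d: "0 < d" using a by (simp add: d_def add_nonneg_pos)
  have "d * (measure M (space M) + 1) = a / 2"
  proof -
    have "measure M (space M) + 1 \<noteq> 0"
      using measure_nonneg[of M "space M"] by linarith
    then show ?thesis by (simp add: d_def divide_simps)
  qed
  then have 1: "d * measure M (space M) + 0 / d < a" using a d by (simp add: algebra_simps)
  have "(\<lambda>n. d * measure M (space M) + nsq M (f n) / d) \<longlonglongrightarrow> d * measure M (space M) + 0 / d"
    using d by (intro tendsto_intros lim) auto
  from order_tendstoD(2)[OF this 1]
  show "eventually (\<lambda>n. (\<integral>x. norm (f n x) \<partial>M) < a) sequentially"
    by eventually_elim (use integral_norm_le_nsq[OF f d] in \<open>auto intro: le_less_trans\<close>)
qed

text \<open>Fatou's lemma in \<open>j\<close> with \<open>k\<close> fixed. As pointwise convergence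
  is assumed, the limit is identified with a function known in advance, for instance the sum of a
  Taylor series in \<open>rep_series\<close>.\<close>

lemma L2_limit:
  fixes f :: "nat \<Rightarrow> 'a \<Rightarrow> 'b::euclidean_space"
  assumes f: "\<And>n. L2 M (f n)" and g: "g \<in> borel_measurable M"
    and lim: "AE x in M. (\<lambda>n. f n x) \<longlonglongrightarrow> g x"
    and e: "\<And>k j. nsq M (\<lambda>x. f j x - f k x) \<le> e j + e k" and e_lim: "e \<longlonglongrightarrow> 0"
  shows "L2 M g" "nsq M (\<lambda>x. f k x - g x) \<le> e k"
proof -
  have [measurable]: "\<And>n. f n \<in> borel_measurable M" "g \<in> borel_measurable M"
    using f g by (auto simp: L2_def)
  have e0: "0 \<le> e k" for k using e[of k k] nsq_nonneg[of M "\<lambda>x. f k x - f k x"] by simp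
  have nn: "(\<integral>\<^sup>+x. ennreal ((norm (g x - f k x))\<^sup>2) \<partial>M) \<le> ennreal (e k)" for k
  proof -
    have "(\<integral>\<^sup>+x. ennreal ((norm (g x - f k x))\<^sup>2) \<partial>M)
        = (\<integral>\<^sup>+x. liminf (\<lambda>j. ennreal ((norm (f j x - f k x))\<^sup>2)) \<partial>M)"
    proof (rule nn_integral_cong_AE, use lim in eventually_elim)
      case (elim x)
      have "(\<lambda>j. ennreal ((norm (f j x - f k x))\<^sup>2)) \<longlonglongrightarrow> ennreal ((norm (g x - f k x))\<^sup>2)"
        by (intro tendsto_intros elim)
      then show ?case using lim_imp_Liminf[OF trivial_limit_sequentially] by metis
    qed
    also have "\<dots> \<le> liminf (\<lambda>j. \<integral>\<^sup>+x. ennreal ((norm (f j x - f k x))\<^sup>2) \<partial>M)"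
      by (rule nn_integral_liminf) measurable
    also have "\<dots> = liminf (\<lambda>j. ennreal (nsq M (\<lambda>x. f j x - f k x)))"
      unfolding nsq_def using L2_integrable[OF L2_diff[OF f f]]
      by (subst nn_integral_eq_integral) auto
    also have "\<dots> \<le> liminf (\<lambda>j. ennreal (e j + e k))"
      by (intro Liminf_mono always_eventually allI ennreal_leI e)
    also have "\<dots> = ennreal (e k)"
    proof (rule lim_imp_Liminf)
      have "(\<lambda>j. e j + e k) \<longlonglongrightarrow> 0 + e k" by (intro tendsto_add e_lim tendsto_const)
      then show "(\<lambda>j. ennreal (e j + e k)) \<longlonglongrightarrow> ennreal (e k)" by (intro tendsto_ennrealI) simp
    qed simp
    finally show ?thesis .
  qed
  have d: "L2 M (\<lambda>x. g x - f k x)" for k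
    unfolding L2_def using nn[of k]
    by (auto intro!: integrableI_nonneg simp: ennreal_less_top[THEN le_less_trans[rotated]] top_unique le_less_trans)
  from L2_add[OF this[of 0] f[of 0]] show "L2 M g" by simp
  have "ennreal (nsq M (\<lambda>x. g x - f k x)) \<le> ennreal (e k)"
    using nn[of k] L2_integrable[OF d[of k]] unfolding nsq_def
    by (subst (asm) nn_integral_eq_integral) auto
  then show "nsq M (\<lambda>x. f k x - g x) \<le> e k"
    using e0 by (simp add: nsq_minus_commute[of M "f k"] ennreal_le_iff)
qed

text \<open>Riesz-Fischer. At the Cauchy rate \<open>1 / 4 ^ k\<close> for \<open>nsq\<close>, the
  weight \<open>d = (1/2) ^ k\<close> in \<open>integral_norm_le_nsq\<close> makes both terms for
  the increments of order \<open>(1/2) ^ k\<close>, so the increments are absolutely summable almost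
  everywhere.\<close>

lemma (in finite_measure) L2_complete:
  fixes f :: "nat \<Rightarrow> 'a \<Rightarrow> real"
  assumes f: "\<And>n. L2 M (f n)" and e: "\<And>k j. nsq M (\<lambda>x. f j x - f k x) \<le> C / 4 ^ j + C / 4 ^ k"
  obtains g where "L2 M g" "\<And>k. nsq M (\<lambda>x. f k x - g x) \<le> C / 4 ^ k"
proof -
  have [measurable]: "\<And>n. f n \<in> borel_measurable M"
    using f by (auto simp: L2_def)
  define D where "D = measure M (space M) + 2 * C"
  have C: "0 \<le> C" using e[of 0 0] nsq_nonneg[of M "\<lambda>x. f 0 x - f 0 x"] by simp
  have int: "(\<integral>\<^sup>+x. ennreal (norm (f (Suc k) x - f k x)) \<partial>M) \<le> ennreal (D * (1/2) ^ k)" for k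
  proof -
    have "(\<integral>x. norm (f (Suc k) x - f k x) \<partial>M)
        \<le> (1/2)^k * measure M (space M) + nsq M (\<lambda>x. f (Suc k) x - f k x) / (1/2)^k"
      by (rule integral_norm_le_nsq[OF L2_diff[OF f f]]) simp
    also have "\<dots> \<le> (1/2)^k * measure M (space M) + (2 * C / 4 ^ k) / (1/2)^k"
    proof (intro add_left_mono divide_right_mono)
      have "C / 4 ^ Suc k \<le> C / 4 ^ k" using C by (intro divide_left_mono) auto
      then show "nsq M (\<lambda>x. f (Suc k) x - f k x) \<le> 2 * C / 4 ^ k"
        using e[of "Suc k" k] by simp
    qed auto
    also have "(4::real) ^ k = 2 ^ k * 2 ^ k" by (simp add: power_mult_distrib[symmetric])
    then have "(1/2)^k * measure M (space M) + (2 * C / 4 ^ k) / (1/2)^k = D * (1/2) ^ k"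
      by (simp add: D_def field_simps power_divide)
    finally show ?thesis
      using L2_integrable1(1)[OF L2_diff[OF f f]]
      by (subst nn_integral_eq_integral) (auto intro!: ennreal_leI)
  qed
  have "(\<integral>\<^sup>+x. (\<Sum>k. ennreal (norm (f (Suc k) x - f k x))) \<partial>M)
      = (\<Sum>k. \<integral>\<^sup>+x. ennreal (norm (f (Suc k) x - f k x)) \<partial>M)"
    by (rule nn_integral_suminf) measurable
  also have "\<dots> \<le> (\<Sum>k. ennreal (D * (1/2) ^ k))"
    by (intro suminf_le int) auto
  also have "\<dots> = ennreal (\<Sum>k. D * (1/2) ^ k)"
    using C by (intro suminf_ennreal2 summable_mult summable_geometric) (auto simp: D_def)
  also have "\<dots> < \<infinity>" by simp
  finally have "(\<integral>\<^sup>+x. (\<Sum>k. ennreal (norm (f (Suc k) x - f k x))) \<partial>M) \<noteq> \<infinity>" by simp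
  then have "AE x in M. (\<Sum>k. ennreal (norm (f (Suc k) x - f k x))) \<noteq> \<infinity>"
    by (intro nn_integral_PInf_AE) measurable
  then have conv: "AE x in M. convergent (\<lambda>n. f n x)"
  proof eventually_elim
    case (elim x)
    then have "summable (\<lambda>k. norm (f (Suc k) x - f k x))"
      by (intro summable_suminf_not_top) auto
    then have "summable (\<lambda>k. f (Suc k) x - f k x)" by (rule summable_norm_cancel)
    then have "convergent (\<lambda>n. \<Sum>k<n. f (Suc k) x - f k x)"
      by (simp add: summable_iff_convergent)
    then have "convergent (\<lambda>n. f n x - f 0 x)"
      unfolding sum_lessThan_telescope[of "\<lambda>n. f n x"] .
    then show ?case using convergent_diff_const_right_iff by blast
  qed
  define g where "g x = lim (\<lambda>n. f n x)" for x
  have g: "g \<in> borel_measurable M" unfolding g_def by (rule borel_measurable_lim_metric) simp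
  have gl: "AE x in M. (\<lambda>n. f n x) \<longlonglongrightarrow> g x"
    using conv by eventually_elim (simp add: g_def convergent_LIMSEQ_iff)
  have lim: "(\<lambda>k. C / 4 ^ k) \<longlonglongrightarrow> 0" by (rule LIMSEQ_divide_realpow_zero) simp
  show ?thesis
    by (rule that[OF L2_limit[where e = "\<lambda>k. C / 4 ^ k", OF f g gl e lim]])
qed

lemma nsq_dominated:
  fixes f :: "nat \<Rightarrow> 'a \<Rightarrow> 'b::euclidean_space"
  assumes f: "\<And>n. f n \<in> borel_measurable M" and g: "g \<in> borel_measurable M" and w: "L2 M (w :: 'a \<Rightarrow> real)"
    and lim: "AE x in M. (\<lambda>n. f n x) \<longlonglongrightarrow> g x"
    and fw: "\<And>n x. x \<in> space M \<Longrightarrow> norm (f n x) \<le> w x" and gw: "\<And>x. x \<in> space M \<Longrightarrow> norm (g x) \<le> w x"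
  shows "(\<lambda>n. nsq M (\<lambda>x. f n x - g x)) \<longlonglongrightarrow> 0"
proof -
  have "(\<lambda>n. \<integral>x. (norm (f n x - g x))\<^sup>2 \<partial>M) \<longlonglongrightarrow> (\<integral>x. 0 \<partial>M)"
  proof (rule integral_dominated_convergence)
    show "integrable M (\<lambda>x. 4 * (norm (w x))\<^sup>2)" using w by (simp add: L2_def)
    show "AE x in M. (\<lambda>n. (norm (f n x - g x))\<^sup>2) \<longlonglongrightarrow> 0"
      using lim
    proof eventually_elim
      case (elim x)
      then have "(\<lambda>n. (norm (f n x - g x))\<^sup>2) \<longlonglongrightarrow> (norm (g x - g x))\<^sup>2" by (intro tendsto_intros)
      then show ?case by simp
    qed
    show "AE x in M. norm ((norm (f n x - g x))\<^sup>2) \<le> 4 * (norm (w x))\<^sup>2" for n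
    proof (rule AE_I2)
      fix x assume x: "x \<in> space M"
      have "norm (f n x - g x) \<le> 2 * w x"
        using norm_triangle_ineq4[of "f n x" "g x"] fw[OF x, of n] gw[OF x] by simp
      then have "(norm (f n x - g x))\<^sup>2 \<le> (2 * w x)\<^sup>2" by (intro power_mono) auto
      then show "norm ((norm (f n x - g x))\<^sup>2) \<le> 4 * (norm (w x))\<^sup>2" by (simp add: power_mult_distrib)
    qed
  qed (use f g in measurable)
  then show ?thesis by (simp add: nsq_def)
qed

section \<open>Gaussian random variables and sequences\<close>

lemma char_eq_normal:
  assumes "0 < s"
  shows "char (density lborel (normal_density 0 s)) u = exp (- u\<^sup>2 * s\<^sup>2 / 2)"
proof -
  interpret S: real_distribution std_normal_distribution by (rule real_dist_normal_dist)
  have "distributed std_normal_distribution lborel (\<lambda>x. x) std_normal_density"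
    unfolding distributed_def by (simp add: distr_id2)
  from S.normal_density_affine[OF this, of s 0] assms
  have "distributed std_normal_distribution lborel (\<lambda>x. s * x) (normal_density 0 s)" by simp
  then have "density lborel (normal_density 0 s) = distr std_normal_distribution borel (\<lambda>x. s * x)"
    unfolding distributed_def by (metis distr_cong sets_lborel)
  then have "char (density lborel (normal_density 0 s)) u = char std_normal_distribution (u * s)"
    by (simp add: char_def integral_distr mult.assoc)
  then show ?thesis by (simp add: char_std_normal_distribution power_mult_distrib)
qed

text \<open>Levy's uniqueness theorem. The case \<open>v = 0\<close> is compared with a point mass
  at 0, because a degenerate Gaussian variable has no density.\<close>

lemma (in prob_space) gaussian_char:
  assumes X[measurable]: "X \<in> borel_measurable M" and v: "0 \<le> v"
    and ch: "\<And>u. (\<integral>x. cis (u * X x) \<partial>M) = exp (- u\<^sup>2 * v / 2)"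
  shows "centered_gaussian M X" "L2 M X" "nsq M X = v"
    and "0 < v \<Longrightarrow> distributed M lborel X (normal_density 0 (sqrt v))"
proof -
  let ?D = "distr M borel X"
  interpret D: real_distribution ?D by (rule real_distribution_distr) simp
  have chD: "char ?D u = exp (- u\<^sup>2 * v / 2)" for u
    using ch[of u] unfolding char_def by (subst integral_distr) (simp_all add: cis_conv_exp)
  have "(v = 0 \<longrightarrow> (AE x in M. X x = 0)) \<and> (0 < v \<longrightarrow> distributed M lborel X (normal_density 0 (sqrt v)))"
  proof (intro conjI impI)
    assume "v = 0"
    interpret R: prob_space "return borel (0::real)" by (rule prob_space_return) simp
    have R: "real_distribution (return borel (0::real))" by unfold_locales auto
    have "char ?D = char (return borel 0)"
      by (rule ext) (simp add: chD \<open>v = 0\<close>, simp add: char_def integral_return)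
    then have "?D = return borel 0" using Levy_uniqueness[OF D.real_distribution_axioms R] by simp
    moreover have "AE x in return borel (0::real). x = 0" by (subst AE_return) auto
    ultimately have "AE x in ?D. x = 0" by metis
    then show "AE x in M. X x = 0" by (subst (asm) AE_distr_iff) auto
  next
    assume v: "0 < v"
    interpret N: prob_space "density lborel (normal_density 0 (sqrt v))"
      by (rule prob_space_normal_density) (use v in simp)
    have N: "real_distribution (density lborel (normal_density 0 (sqrt v)))"
      by unfold_locales auto
    have "char ?D = char (density lborel (normal_density 0 (sqrt v)))"
      by (rule ext) (use v in \<open>simp add: chD char_eq_normal\<close>)
    then have "?D = density lborel (normal_density 0 (sqrt v))"
      using Levy_uniqueness[OF D.real_distribution_axioms N] by simp
    moreover have "distr M lborel X = ?D" by (rule distr_cong) auto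
    ultimately show "distributed M lborel X (normal_density 0 (sqrt v))"
      unfolding distributed_def by simp
  qed
  then have zero: "v = 0 \<Longrightarrow> AE x in M. X x = 0"
    and pos: "0 < v \<Longrightarrow> distributed M lborel X (normal_density 0 (sqrt v))" by auto
  show "0 < v \<Longrightarrow> distributed M lborel X (normal_density 0 (sqrt v))" by (rule pos)
  show "centered_gaussian M X"
    unfolding centered_gaussian_def using zero pos v
    by (cases "v = 0") (auto intro!: exI[of _ "sqrt v"])
  have "L2 M X \<and> nsq M X = v"
  proof (cases "v = 0")
    case True
    have 1: "AE x in M. (norm (X x))\<^sup>2 = 0" using zero[OF True] by auto
    then have "integrable M (\<lambda>x. (norm (X x))\<^sup>2)"
      by (subst integrable_cong_AE[OF _ _ 1]) auto
    moreover have "nsq M X = 0" unfolding nsq_def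
      by (subst integral_cong_AE[OF _ _ 1]) auto
    ultimately show ?thesis using True by (simp add: L2_def)
  next
    case False
    then have v: "0 < v" using \<open>0 \<le> v\<close> by simp
    note d = pos[OF v]
    have "integrable lborel (\<lambda>x. normal_density 0 (sqrt v) x * (x - 0)\<^sup>2)"
      by (rule integrable_normal_moment) (use v in simp)
    then have "integrable M (\<lambda>x. (X x)\<^sup>2)"
      by (subst distributed_integrable[OF d, symmetric]) auto
    moreover have "variance X = v" "expectation X = 0"
      using normal_distributed_variance[OF _ d] normal_distributed_expectation[OF _ d] v by auto
    ultimately show ?thesis by (simp add: L2_def nsq_def)
  qed
  then show "L2 M X" "nsq M X = v" by auto
qed

text \<open>\<open>cis\<close> is 1-Lipschitz, so mean square convergence, and with it convergence
  in mean, passes to the characteristic integrals.\<close>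

lemma (in prob_space) cis_integral_tendsto:
  assumes X: "\<And>n. L2 M (X n)" and Y: "L2 M Y" and lim: "(\<lambda>n. nsq M (\<lambda>x. X n x - Y x)) \<longlonglongrightarrow> 0"
  shows "(\<lambda>n. \<integral>x. cis (X n x) \<partial>M) \<longlonglongrightarrow> (\<integral>x. cis (Y x) \<partial>M)"
proof -
  have [measurable]: "\<And>n. X n \<in> borel_measurable M" "Y \<in> borel_measurable M"
    using X Y by (auto simp: L2_def)
  have b: "cmod (cis a - cis b) \<le> \<bar>a - b\<bar>" for a b :: real
  proof -
    have "cis a - cis b = cis b * (cis (a - b) - 1)" by (simp add: algebra_simps cis_mult)
    then have "cmod (cis a - cis b) = cmod (cis (a - b) - 1)" by (simp add: norm_mult)
    also have "\<dots> \<le> \<bar>a - b\<bar>" using iexp_approx1[of "a - b" 0] by (simp add: cis_conv_exp)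
    finally show ?thesis .
  qed
  have i: "integrable M (\<lambda>x. cis (Z x))" if [measurable]: "Z \<in> borel_measurable M" for Z :: "'a \<Rightarrow> real"
    by (rule integrable_const_bound[of _ 1]) (auto simp: cis_conv_exp)
  have "(\<lambda>n. (\<integral>x. cis (X n x) \<partial>M) - (\<integral>x. cis (Y x) \<partial>M)) \<longlonglongrightarrow> 0"
  proof (rule Lim_null_comparison[OF _ L1_tendsto[OF L2_diff[OF X Y] lim]], rule always_eventually, rule allI)
    fix n
    have "cmod ((\<integral>x. cis (X n x) \<partial>M) - (\<integral>x. cis (Y x) \<partial>M)) = cmod (\<integral>x. cis (X n x) - cis (Y x) \<partial>M)"
      by (subst Bochner_Integration.integral_diff) (auto intro!: i)
    also have "\<dots> \<le> (\<integral>x. cmod (cis (X n x) - cis (Y x)) \<partial>M)" by (rule integral_norm_bound)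
    also have "\<dots> \<le> (\<integral>x. norm (X n x - Y x) \<partial>M)"
      by (rule integral_mono[OF integrable_norm[OF Bochner_Integration.integrable_diff[OF i i]]
            L2_integrable1(1)[OF L2_diff[OF X Y]]]) (use b in auto)
    finally show "cmod ((\<integral>x. cis (X n x) \<partial>M) - (\<integral>x. cis (Y x) \<partial>M)) \<le> (\<integral>x. norm (X n x - Y x) \<partial>M)" .
  qed
  from tendsto_add[OF this tendsto_const[of "\<integral>x. cis (Y x) \<partial>M"]] show ?thesis by simp
qed

section \<open>Orthogonalisation for a semidefinite form, and Gaussian sequences with given
  covariance\<close>

function gram_schmidt :: "(real poly \<Rightarrow> real poly \<Rightarrow> real) \<Rightarrow> (nat \<Rightarrow> real poly) \<Rightarrow> nat \<Rightarrow> real poly" where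
  "gram_schmidt B f n = (let w = f n - (\<Sum>j<n. smult (B (f n) (gram_schmidt B f j)) (gram_schmidt B f j))
     in smult (1 / sqrt (B w w)) w)"
  by pat_completeness auto
termination by (relation "Wellfounded.measure (\<lambda>(B, f, n). n)") auto

declare gram_schmidt.simps[simp del]

locale psd_form =
  fixes B :: "real poly \<Rightarrow> real poly \<Rightarrow> real"
  assumes add_l: "\<And>x y z. B (x + y) z = B x z + B y z"
    and scale_l: "\<And>c x z. B (smult c x) z = c * B x z"
    and sym: "\<And>x y. B x y = B y x" and nonneg: "\<And>x. 0 \<le> B x x"
begin

lemma diff_l: "B (x - y) z = B x z - B y z"
  using add_l[of x "smult (-1) y" z] scale_l[of "-1" y z] by simp
lemma zero_l: "B 0 z = 0"
  using scale_l[of 0 0 z] by simp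
lemma sum_l: "B (\<Sum>i\<in>I. x i) z = (\<Sum>i\<in>I. B (x i) z)"
  by (induction I rule: infinite_finite_induct) (auto simp: zero_l add_l)
lemma add_r: "B z (x + y) = B z x + B z y"
  by (subst (1 2 3) sym) (rule add_l)
lemma scale_r: "B z (smult c x) = c * B z x"
  by (subst (1 2) sym) (rule scale_l)
lemma sum_r: "B z (\<Sum>i\<in>I. g i) = (\<Sum>i\<in>I. B z (g i))"
  by (subst (1 2) sym) (rule sum_l)

text \<open>Along the line \<open>y + t w\<close> the form is affine in \<open>t\<close>, so
  nonnegativity forces slope 0. Hence a vector of length 0 contributes nothing and can be replaced
  by 0 in the orthogonalisation.\<close>

lemma null: assumes "B w w = 0" shows "B w y = 0"
proof (rule ccontr)
  assume "B w y \<noteq> 0"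
  \<comment> \<open>The value of \<open>t\<close> at which the affine function equals -1.\<close>
  define t where "t = - (B y y + 1) / (2 * B w y)"
  have "0 \<le> B (y + smult t w) (y + smult t w)" by (rule nonneg)
  also have "\<dots> = B y y + 2 * t * B w y"
    using assms by (simp add: add_l add_r scale_l scale_r sym[of y w])
  also have "\<dots> = -1" using \<open>B w y \<noteq> 0\<close> by (simp add: t_def field_simps)
  finally show False by simp
qed

context
  fixes f :: "nat \<Rightarrow> real poly"
begin

abbreviation (input) "u \<equiv> gram_schmidt B f"
definition w where "w n = f n - (\<Sum>j<n. smult (B (f n) (u j)) (u j))"

lemma u_eq: "u n = smult (1 / sqrt (B (w n) (w n))) (w n)"
  by (subst gram_schmidt.simps) (simp add: w_def Let_def)

text \<open>When \<open>w n\<close> has length 0, the convention \<open>1 / sqrt 0 = 0\<close> turns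
  \<open>u n\<close> into the zero vector; this default takes care of degenerate forms.\<close>

lemma u_norm: "B (w n) (w n) = 0 \<and> u n = 0 \<or> B (w n) (w n) > 0 \<and> B (u n) (u n) = 1"
proof (cases "B (w n) (w n) = 0")
  case True
  then show ?thesis by (simp add: u_eq)
next
  case False
  then have "B (w n) (w n) > 0" using nonneg[of "w n"] by simp
  then show ?thesis by (simp add: u_eq scale_l scale_r)
qed

lemma orth: "k < n \<Longrightarrow> B (u n) (u k) = 0"
proof (induction n arbitrary: k rule: less_induct)
  case (less n)
  have o: "B (u j) (u k) = 0" if "j < n" "j \<noteq> k" for j
  proof (cases "k < j")
    case True
    then show ?thesis using less.IH[of j k] that by simp
  next
    case False
    then have "B (u k) (u j) = 0" using less.IH[of k j] that less.prems by simp
    then show ?thesis by (subst sym)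
  qed
  have "B (w n) (u k) = B (f n) (u k) - (\<Sum>j<n. B (f n) (u j) * B (u j) (u k))"
    by (simp add: w_def diff_l sum_l scale_l)
  also have "(\<Sum>j<n. B (f n) (u j) * B (u j) (u k)) = (\<Sum>j<n. if j = k then B (f n) (u k) * B (u k) (u k) else 0)"
    by (rule sum.cong) (auto simp: o)
  also have "\<dots> = B (f n) (u k) * B (u k) (u k)" using less.prems by simp
  also have "B (f n) (u k) - B (f n) (u k) * B (u k) (u k) = 0"
    using u_norm[of k] zero_l sym[of "f n" 0] by auto
  finally show ?case by (simp add: u_eq[of n] scale_l)
qed

lemma expand: "B (f n) y = (\<Sum>j\<le>n. B (f n) (u j) * B (u j) y)"
proof -
  have "f n = (\<Sum>j<n. smult (B (f n) (u j)) (u j)) + w n" by (simp add: w_def)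
  then have "B (f n) z = B ((\<Sum>j<n. smult (B (f n) (u j)) (u j)) + w n) z" for z by simp
  then have 1: "B (f n) z = (\<Sum>j<n. B (f n) (u j) * B (u j) z) + B (w n) z" for z
    unfolding add_l sum_l scale_l .
  have "B (w n) y = B (f n) (u n) * B (u n) y"
  proof (cases "B (w n) (w n) = 0")
    case True
    then show ?thesis using null[OF True] u_norm[of n] zero_l[of y] by auto
  next
    case False
    then have p: "B (w n) (w n) > 0" using nonneg[of "w n"] by simp
    have "B (f n) (u n) = B (w n) (u n)"
    proof -
      have "B (u j) (u n) = 0" if "j < n" for j
        using orth[OF that] by (subst sym)
      then show ?thesis unfolding 1[of "u n"] by simp
    qed
    also have "\<dots> = sqrt (B (w n) (w n))"
      using p by (simp add: u_eq scale_r real_div_sqrt)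
    finally show ?thesis using p by (simp add: u_eq scale_l)
  qed
  then show ?thesis by (simp add: 1[of y] lessThan_Suc_atMost[symmetric])
qed

text \<open>The entries are \<open>L n j = B (f n) (u j)\<close>. The triangular shape keeps every
  row finite, so the associated linear map of sequences is given coordinatewise by finite
  sums.\<close>

lemma cholesky: "\<exists>L. (\<forall>n m. B (f n) (f m) = (\<Sum>j\<le>n. L n j * L m j)) \<and> (\<forall>n j. n < j \<longrightarrow> L n j = 0)"
proof (intro exI[of _ "\<lambda>n j. B (f n) (u j)"] conjI allI impI)
  show "B (f n) (f m) = (\<Sum>j\<le>n. B (f n) (u j) * B (f m) (u j))" for n m
    using expand[of n "f m"] by (simp add: sym[of "f m"])
  show "B (f n) (u j) = 0" if "n < j" for n j
  proof -
    have "B (u i) (u j) = 0" if "i \<le> n" for i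
      using orth[of i j] that \<open>n < j\<close> by (subst sym) simp
    then show ?thesis unfolding expand[of n "u j"] by simp
  qed
qed

end

end

definition gaussian_noise :: "(nat \<Rightarrow> real) measure" where
  "gaussian_noise = (\<Pi>\<^sub>M i\<in>UNIV. std_normal_distribution)"

interpretation gaussian_noise: product_prob_space "\<lambda>_::nat. std_normal_distribution" UNIV
proof -
  interpret real_distribution std_normal_distribution by (rule real_dist_normal_dist)
  show "product_prob_space (\<lambda>_::nat. std_normal_distribution)"
    by (intro product_prob_spaceI prob_space_axioms)
qed

lemma prob_space_gaussian_noise: "prob_space gaussian_noise"
  unfolding gaussian_noise_def by (rule gaussian_noise.prob_space_axioms)

lemma space_gaussian_noise[simp]: "space gaussian_noise = UNIV"
  by (simp add: gaussian_noise_def space_PiM)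

lemma sets_gaussian_noise[measurable_cong]: "sets gaussian_noise = sets (\<Pi>\<^sub>M i\<in>UNIV. borel)"
  by (auto simp: gaussian_noise_def intro!: sets_PiM_cong)

lemma gaussian_noise_char:
  assumes "finite F"
  shows "(\<integral>g. cis (\<Sum>j\<in>F. v j * g j) \<partial>gaussian_noise) = exp (- (\<Sum>j\<in>F. (v j)\<^sup>2) / 2)"
proof -
  interpret G: prob_space gaussian_noise by (rule prob_space_gaussian_noise)
  have comp: "distr gaussian_noise borel (\<lambda>g. g j) = std_normal_distribution" for j
  proof -
    have "distr gaussian_noise borel (\<lambda>g. g j) = distr gaussian_noise std_normal_distribution (\<lambda>g. g j)"
      by (rule distr_cong) auto
    then show ?thesis
      unfolding gaussian_noise_def using gaussian_noise.PiM_component[of j] by simp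
  qed
  have "G.indep_vars (\<lambda>_. borel) (\<lambda>j g. g j) UNIV"
    by (subst G.indep_vars_iff_distr_eq_PiM')
      (auto simp: comp distr_id2 sets_gaussian_noise restrict_UNIV gaussian_noise_def[symmetric])
  then have "G.indep_vars (\<lambda>_. borel) (\<lambda>j g. g j) F"
    by (rule G.indep_vars_subset) simp
  then have "G.indep_vars (\<lambda>_. borel) (\<lambda>j g. v j * g j) F"
    by (rule G.indep_vars_compose2) simp
  from G.char_distr_sum[OF this, of 1]
  have "char (distr gaussian_noise borel (\<lambda>g. \<Sum>j\<in>F. v j * g j)) 1
      = (\<Prod>j\<in>F. char (distr gaussian_noise borel (\<lambda>g. v j * g j)) 1)" .
  moreover have "char (distr gaussian_noise borel (\<lambda>g. \<Sum>j\<in>F. v j * g j)) 1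
      = (\<integral>g. cis (\<Sum>j\<in>F. v j * g j) \<partial>gaussian_noise)"
    unfolding char_def by (subst integral_distr) (simp_all add: cis_conv_exp)
  moreover have "char (distr gaussian_noise borel (\<lambda>g. v j * g j)) 1 = exp (- (v j)\<^sup>2 / 2)" for j
  proof -
    have "char (distr gaussian_noise borel (\<lambda>g. v j * g j)) 1 = char (distr gaussian_noise borel (\<lambda>g. g j)) (v j)"
      unfolding char_def by (subst (1 2) integral_distr) simp_all
    then show ?thesis by (simp add: comp char_std_normal_distribution)
  qed
  ultimately have "(\<integral>g. cis (\<Sum>j\<in>F. v j * g j) \<partial>gaussian_noise) = (\<Prod>j\<in>F. complex_of_real (exp (- (v j)\<^sup>2 / 2)))"
    by simp
  also have "\<dots> = exp (- (\<Sum>j\<in>F. (v j)\<^sup>2) / 2)"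
    using assms by (simp add: of_real_prod[symmetric] exp_sum[symmetric] sum_divide_distrib[symmetric] sum_negf
        del: of_real_prod)
  finally show ?thesis .
qed

text \<open>The Cholesky factor is applied to independent standard normal variables; its finite rows
  make the map defined and measurable on the whole sequence space.\<close>

lemma gaussian_sequence_exists:
  assumes "psd_form B"
  obtains Q :: "(nat \<Rightarrow> real) measure" where "prob_space Q" "sets Q = sets (\<Pi>\<^sub>M i\<in>UNIV. borel)"
    "\<And>F u. finite F \<Longrightarrow> (\<integral>a. cis (\<Sum>n\<in>F. u n * a n) \<partial>Q)
      = exp (- B (\<Sum>n\<in>F. smult (u n) (f n)) (\<Sum>n\<in>F. smult (u n) (f n)) / 2)"
proof -
  interpret psd_form B by fact
  obtain L where L: "\<And>n m. B (f n) (f m) = (\<Sum>j\<le>n. L n j * L m j)" and L0: "\<And>n j. n < j \<Longrightarrow> L n j = 0"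
    using cholesky[of f] by auto
  define R where "R g n = (\<Sum>j\<le>n. L n j * g j)" for g :: "nat \<Rightarrow> real" and n
  have R[measurable]: "R \<in> gaussian_noise \<rightarrow>\<^sub>M (\<Pi>\<^sub>M i\<in>UNIV. borel)"
    by (rule measurable_PiM_single') (auto simp: R_def[abs_def])
  interpret G: prob_space gaussian_noise by (rule prob_space_gaussian_noise)
  show thesis
  proof (rule that)
    show "prob_space (distr gaussian_noise (\<Pi>\<^sub>M i\<in>UNIV. borel) R)" by (rule G.prob_space_distr) simp
    show "sets (distr gaussian_noise (\<Pi>\<^sub>M i\<in>UNIV. borel) R) = sets (\<Pi>\<^sub>M i\<in>UNIV. borel)" by simp
    fix F :: "nat set" and u :: "nat \<Rightarrow> real" assume F: "finite F"
    define N where "N = Max (insert 0 F)"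
    have N: "n \<le> N" if "n \<in> F" for n using that F by (simp add: N_def)
    define v where "v j = (\<Sum>n\<in>F. u n * L n j)" for j
    have ext: "(\<Sum>j\<le>n. L n j * c j) = (\<Sum>j\<le>N. L n j * c j)" if "n \<in> F" for n and c :: "nat \<Rightarrow> real"
      by (rule sum.mono_neutral_left) (use N[OF that] L0 in auto)
    have "(\<Sum>n\<in>F. u n * R g n) = (\<Sum>j\<le>N. v j * g j)" for g
    proof -
      have "(\<Sum>n\<in>F. u n * R g n) = (\<Sum>n\<in>F. \<Sum>j\<le>N. u n * L n j * g j)"
        by (rule sum.cong) (auto simp: R_def ext sum_distrib_left mult.assoc)
      also have "\<dots> = (\<Sum>j\<le>N. v j * g j)"
        unfolding v_def sum_distrib_right by (rule sum.swap)
      finally show ?thesis .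
    qed
    moreover have "B (\<Sum>n\<in>F. smult (u n) (f n)) (\<Sum>n\<in>F. smult (u n) (f n)) = (\<Sum>j\<le>N. (v j)\<^sup>2)"
    proof -
      have "B (\<Sum>n\<in>F. smult (u n) (f n)) (\<Sum>n\<in>F. smult (u n) (f n)) = (\<Sum>n\<in>F. \<Sum>m\<in>F. u n * (u m * B (f n) (f m)))"
        unfolding sum_l sum_r scale_l scale_r sum_distrib_left
        by (intro sum.cong refl) (simp add: sym)
      also have "\<dots> = (\<Sum>n\<in>F. \<Sum>m\<in>F. \<Sum>j\<le>N. (u n * L n j) * (u m * L m j))"
        by (intro sum.cong refl) (auto simp: L ext sum_distrib_left mult_ac)
      also have "\<dots> = (\<Sum>n\<in>F. \<Sum>j\<le>N. \<Sum>m\<in>F. (u n * L n j) * (u m * L m j))"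
        by (intro sum.cong refl sum.swap)
      also have "\<dots> = (\<Sum>j\<le>N. \<Sum>n\<in>F. \<Sum>m\<in>F. (u n * L n j) * (u m * L m j))"
        by (rule sum.swap)
      also have "\<dots> = (\<Sum>j\<le>N. (v j)\<^sup>2)"
        by (simp add: v_def power2_eq_square sum_product)
      finally show ?thesis .
    qed
    moreover have "(\<integral>a. cis (\<Sum>n\<in>F. u n * a n) \<partial>distr gaussian_noise (\<Pi>\<^sub>M i\<in>UNIV. borel) R)
        = (\<integral>g. cis (\<Sum>n\<in>F. u n * R g n) \<partial>gaussian_noise)"
      unfolding cis_conv_exp by (subst integral_distr) auto
    ultimately show "(\<integral>a. cis (\<Sum>n\<in>F. u n * a n) \<partial>distr gaussian_noise (\<Pi>\<^sub>M i\<in>UNIV. borel) R)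
        = exp (- B (\<Sum>n\<in>F. smult (u n) (f n)) (\<Sum>n\<in>F. smult (u n) (f n)) / 2)"
      using gaussian_noise_char[of "{..N}" v] by simp
  qed
qed

section \<open>A space of entire sample paths\<close>

definition growth_bound :: "nat \<Rightarrow> (nat \<Rightarrow> real) \<Rightarrow> bool" where
  "growth_bound C a \<longleftrightarrow> (\<forall>n. \<bar>a n\<bar> \<le> real C ^ Suc n * sqrt (fact n))"

definition growth :: "(nat \<Rightarrow> real) \<Rightarrow> bool" where
  "growth a \<longleftrightarrow> (\<exists>C. growth_bound C a)"

definition exp_series :: "(nat \<Rightarrow> real) \<Rightarrow> real \<Rightarrow> real" where
  "exp_series a t = (\<Sum>n. a n / fact n * t ^ n)"

definition coef :: "(real \<Rightarrow> real) \<Rightarrow> nat \<Rightarrow> real" where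
  "coef f n = (deriv ^^ n) f 0"

definition paths :: "path set" where
  "paths = exp_series ` Collect growth"

definition path_algebra :: "path measure" where
  "path_algebra = vimage_algebra paths coef (\<Pi>\<^sub>M i\<in>UNIV. borel)"

definition translate :: "real \<Rightarrow> path \<Rightarrow> path" where
  "translate t f = (\<lambda>u. f (t + u))"

lemma summable_power_div_sqrt_fact: "summable (\<lambda>k. z ^ k / sqrt (fact k))" for z :: real
proof (rule summable_ratio_test[where c = "1/2" and N = "nat \<lceil>4 * z\<^sup>2\<rceil>"])
  fix n assume "nat \<lceil>4 * z\<^sup>2\<rceil> \<le> n"
  then have "4 * z\<^sup>2 \<le> real (Suc n)" by linarith
  then have "(2 * \<bar>z\<bar>)\<^sup>2 \<le> real (Suc n)" by (simp add: power_mult_distrib)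
  then have "2 * \<bar>z\<bar> \<le> sqrt (real (Suc n))" by (rule real_le_rsqrt)
  then have "\<bar>z\<bar> / sqrt (real (Suc n)) \<le> 1/2" by (simp add: field_simps)
  then have "\<bar>z\<bar> / sqrt (real (Suc n)) * (\<bar>z\<bar> ^ n / sqrt (fact n)) \<le> 1/2 * (\<bar>z\<bar> ^ n / sqrt (fact n))"
    by (rule mult_right_mono) simp
  moreover have "norm (z ^ Suc n / sqrt (fact (Suc n))) = \<bar>z\<bar> / sqrt (real (Suc n)) * (\<bar>z\<bar> ^ n / sqrt (fact n))"
    by (simp add: abs_mult power_abs real_sqrt_mult del: of_nat_Suc)
  moreover have "norm (z ^ n / sqrt (fact n)) = \<bar>z\<bar> ^ n / sqrt (fact n)"
    by (simp add: power_abs)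
  ultimately show "norm (z ^ Suc n / sqrt (fact (Suc n))) \<le> 1/2 * norm (z ^ n / sqrt (fact n))"
    by simp
qed simp

lemma fact_add_le: "fact (n + k) \<le> (2 ^ (n + k) * fact n * fact k :: real)"
proof -
  have "fact k * fact (n + k - k) * (n + k choose k) = (fact (n + k) :: nat)"
    by (rule binomial_fact_lemma) simp
  then have "(fact (n + k) :: nat) \<le> fact k * fact n * 2 ^ (n + k)"
    using mult_left_mono[OF binomial_le_pow2[of "n + k" k], of "fact k * fact n"] by simp
  then have "real (fact (n + k)) \<le> real (fact k * fact n * 2 ^ (n + k))"
    by (rule of_nat_mono)
  then show ?thesis by (simp add: mult_ac)
qed

lemma growth_shift_sum:
  assumes a: "growth a" and r: "0 \<le> r"
  shows "\<And>n. summable (\<lambda>k. \<bar>a (n + k)\<bar> / fact k * r ^ k)"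
    and "\<exists>D. \<forall>n. (\<Sum>k. \<bar>a (n + k)\<bar> / fact k * r ^ k) \<le> real D ^ Suc n * sqrt (fact n)"
proof -
  obtain C where C: "\<And>n. \<bar>a n\<bar> \<le> real C ^ Suc n * sqrt (fact n)"
    using a by (auto simp: growth_def growth_bound_def)
  define z where "z = 2 * real C * r"
  define S where "S = (\<Sum>k. z ^ k / sqrt (fact k))"
  have sz: "summable (\<lambda>k. z ^ k / sqrt (fact k))" by (rule summable_power_div_sqrt_fact)
  have bound: "\<bar>a (n + k)\<bar> / fact k * r ^ k \<le> (real C * (2 * real C) ^ n * sqrt (fact n)) * (z ^ k / sqrt (fact k))" for n k
  proof -
    have "sqrt (fact (n + k)) \<le> sqrt ((2 ^ (n + k))\<^sup>2 * (fact n * fact k))"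
    proof (rule real_sqrt_le_mono)
      have "(2::real) ^ (n + k) * (fact n * fact k) \<le> (2 ^ (n + k))\<^sup>2 * (fact n * fact k)"
        by (intro mult_right_mono) (auto simp: power2_eq_square)
      moreover have "(fact (n + k) :: real) \<le> 2 ^ (n + k) * (fact n * fact k)"
        using fact_add_le[of n k] by (simp only: mult.assoc)
      ultimately show "(fact (n + k) :: real) \<le> (2 ^ (n + k))\<^sup>2 * (fact n * fact k)"
        by (rule order_trans[rotated])
    qed
    also have "\<dots> = 2 ^ (n + k) * (sqrt (fact n) * sqrt (fact k))"
      by (simp only: real_sqrt_mult real_sqrt_abs) simp
    finally have s: "sqrt (fact (n + k)) \<le> 2 ^ (n + k) * (sqrt (fact n) * sqrt (fact k))" .
    have "\<bar>a (n + k)\<bar> \<le> real C ^ Suc (n + k) * (2 ^ (n + k) * (sqrt (fact n) * sqrt (fact k)))"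
      by (rule order_trans[OF C mult_left_mono[OF s]]) simp
    then have "\<bar>a (n + k)\<bar> / fact k * r ^ k
        \<le> real C ^ Suc (n + k) * (2 ^ (n + k) * (sqrt (fact n) * sqrt (fact k))) / fact k * r ^ k"
      using r by (intro mult_right_mono divide_right_mono) auto
    also have "\<dots> = (real C * (2 * real C) ^ n * sqrt (fact n)) * (z ^ k * (sqrt (fact k) / fact k))"
      by (simp add: z_def power_mult_distrib power_add)
    also have "sqrt (fact k) / fact k = 1 / sqrt (fact k :: real)"
      by (simp add: sqrt_divide_self_eq inverse_eq_divide)
    finally show ?thesis by simp
  qed
  show sm: "summable (\<lambda>k. \<bar>a (n + k)\<bar> / fact k * r ^ k)" for n
    by (rule summable_comparison_test'[OF summable_mult[OF sz], where N = 0])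
      (use bound r in \<open>auto simp: abs_mult\<close>)
  \<comment> \<open>The first summand dominates the constant in front, the second the base
    \<open>2 * C\<close> of the power.\<close>
  define D where "D = nat \<lceil>real C * S\<rceil> + 2 * C"
  have "(\<Sum>k. \<bar>a (n + k)\<bar> / fact k * r ^ k) \<le> real D ^ Suc n * sqrt (fact n)" for n
  proof -
    have "(\<Sum>k. \<bar>a (n + k)\<bar> / fact k * r ^ k) \<le> (\<Sum>k. (real C * (2 * real C) ^ n * sqrt (fact n)) * (z ^ k / sqrt (fact k)))"
      by (intro suminf_le bound sm summable_mult sz)
    also have "\<dots> = (real C * S) * (2 * real C) ^ n * sqrt (fact n)"
      unfolding S_def by (subst suminf_mult[OF sz]) simp
    also have "\<dots> \<le> real D * real D ^ n * sqrt (fact n)"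
    proof (intro mult_right_mono mult_mono power_mono)
      show "real C * S \<le> real D" unfolding D_def by linarith
      show "2 * real C \<le> real D" unfolding D_def by simp
    qed auto
    finally show ?thesis by simp
  qed
  then show "\<exists>D. \<forall>n. (\<Sum>k. \<bar>a (n + k)\<bar> / fact k * r ^ k) \<le> real D ^ Suc n * sqrt (fact n)" by blast
qed

lemma growth_summable:
  assumes "growth a"
  shows "summable (\<lambda>k. a (n + k) / fact k * t ^ k)"
    "\<bar>\<Sum>k. a (n + k) / fact k * t ^ k\<bar> \<le> (\<Sum>k. \<bar>a (n + k)\<bar> / fact k * \<bar>t\<bar> ^ k)"
proof -
  have 1: "summable (\<lambda>k. norm (a (n + k) / fact k * t ^ k))"
    using growth_shift_sum(1)[OF assms, of "\<bar>t\<bar>" n] by (simp add: abs_mult power_abs)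
  then show "summable (\<lambda>k. a (n + k) / fact k * t ^ k)" by (rule summable_norm_cancel)
  show "\<bar>\<Sum>k. a (n + k) / fact k * t ^ k\<bar> \<le> (\<Sum>k. \<bar>a (n + k)\<bar> / fact k * \<bar>t\<bar> ^ k)"
    using summable_norm[OF 1] by (simp add: abs_mult power_abs)
qed

lemma growth_translate:
  assumes "growth a" shows "growth (\<lambda>n. exp_series (\<lambda>k. a (n + k)) t)"
proof -
  obtain D where "\<And>n. (\<Sum>k. \<bar>a (n + k)\<bar> / fact k * \<bar>t\<bar> ^ k) \<le> real D ^ Suc n * sqrt (fact n)"
    using growth_shift_sum(2)[OF assms, of "\<bar>t\<bar>"] by auto
  then have "growth_bound D (\<lambda>n. exp_series (\<lambda>k. a (n + k)) t)"
    unfolding growth_bound_def exp_series_def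
    using growth_summable(2)[OF assms] order_trans by blast
  then show ?thesis by (auto simp: growth_def)
qed

lemma deriv_exp_series:
  assumes "growth a"
  shows "(exp_series (\<lambda>k. a (n + k)) has_real_derivative exp_series (\<lambda>k. a (Suc n + k)) t) (at t)"
proof -
  have "((\<lambda>x. \<Sum>k. a (n + k) / fact k * x ^ k) has_field_derivative
      (\<Sum>k. diffs (\<lambda>k. a (n + k) / fact k) k * t ^ k)) (at t)"
    by (rule termdiffs_strong_converges_everywhere) (rule growth_summable(1)[OF assms])
  moreover have "diffs (\<lambda>k. a (n + k) / fact k) k = a (Suc n + k) / fact k" for k
    by (simp add: diffs_def field_simps del: of_nat_Suc)
  ultimately show ?thesis by (simp add: exp_series_def[abs_def])
qed

lemma deriv_iter_exp_series:
  assumes "growth a"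
  shows "(deriv ^^ n) (exp_series a) = exp_series (\<lambda>k. a (n + k))"
proof (induction n)
  case (Suc n)
  then show ?case
    using deriv_exp_series[OF assms, of n] by (auto intro!: ext DERIV_imp_deriv)
qed simp

lemma coef_exp_series: "growth a \<Longrightarrow> coef (exp_series a) = a"
proof (rule ext)
  fix n assume "growth a"
  then show "coef (exp_series a) n = a n"
    using powser_zero[of "\<lambda>k. a (n + k) / fact k"] by (simp add: coef_def deriv_iter_exp_series exp_series_def)
qed

lemma paths_coef:
  assumes "f \<in> paths"
  shows "growth (coef f)" "exp_series (coef f) = f"
  using assms by (auto simp: paths_def coef_exp_series)

lemma exp_series_in_paths: "growth a \<Longrightarrow> exp_series a \<in> paths"
  by (auto simp: paths_def)

lemma paths_eqI: "f \<in> paths \<Longrightarrow> g \<in> paths \<Longrightarrow> (\<And>n. coef f n = coef g n) \<Longrightarrow> f = g"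
  by (metis ext paths_coef(2))

lemma path_sums:
  assumes "f \<in> paths"
  shows "(\<lambda>k. coef f (n + k) / fact k * t ^ k) sums exp_series (\<lambda>k. coef f (n + k)) t"
  unfolding exp_series_def by (intro summable_sums growth_summable paths_coef assms)

text \<open>The Lagrange remainder of the Maclaurin formula is at most
  \<open>D ^ Suc n * sqrt (fact n) * \<bar>u\<bar> ^ n / fact n\<close> and tends to 0. So the
  translated function is the sum of its own Taylor series, and no double series has to be
  rearranged.\<close>

lemma translate_path:
  assumes f: "f \<in> paths"
  shows "translate t f \<in> paths" "coef (translate t f) n = exp_series (\<lambda>k. coef f (n + k)) t"
proof -
  note gf = paths_coef(1)[OF f]
  define b where "b n = exp_series (\<lambda>k. coef f (n + k)) t" for n
  have gb: "growth b" unfolding b_def by (rule growth_translate[OF gf])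
  have "translate t f u = exp_series b u" for u
  proof -
    define df where "df m x = exp_series (\<lambda>k. coef f (m + k)) (t + x)" for m x
    have "DERIV (df m) x :> df (Suc m) x" for m x
      unfolding df_def using DERIV_shift[of "exp_series (\<lambda>k. coef f (m + k))" _ x t]
        deriv_exp_series[OF gf, of m "t + x"] by (simp add: add.commute)
    moreover have df0: "df 0 = translate t f"
      by (rule ext) (simp add: df_def translate_def paths_coef(2)[OF f])
    ultimately have M: "\<exists>x. \<bar>x\<bar> \<le> \<bar>u\<bar> \<and> translate t f u = (\<Sum>m<n. df m 0 / fact m * u ^ m) + df n x / fact n * u ^ n" for n
      by (intro Maclaurin_all_le) auto
    define r where "r = \<bar>t\<bar> + \<bar>u\<bar>"
    have r: "0 \<le> r" by (simp add: r_def)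
    obtain D where D: "\<And>n. (\<Sum>k. \<bar>coef f (n + k)\<bar> / fact k * r ^ k) \<le> real D ^ Suc n * sqrt (fact n)"
      using growth_shift_sum(2)[OF gf r] by auto
    have "(\<lambda>n. translate t f u - (\<Sum>m<n. b m / fact m * u ^ m)) \<longlonglongrightarrow> 0"
    proof (rule Lim_null_comparison[OF always_eventually], rule allI)
      fix n
      obtain x where x: "\<bar>x\<bar> \<le> \<bar>u\<bar>"
        and e: "translate t f u = (\<Sum>m<n. df m 0 / fact m * u ^ m) + df n x / fact n * u ^ n"
        using M[of n] by blast
      have "\<bar>df n x\<bar> \<le> (\<Sum>k. \<bar>coef f (n + k)\<bar> / fact k * \<bar>t + x\<bar> ^ k)"
        unfolding df_def exp_series_def by (rule growth_summable(2)[OF gf])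
      also have "\<dots> \<le> (\<Sum>k. \<bar>coef f (n + k)\<bar> / fact k * r ^ k)"
        using x by (intro suminf_le growth_shift_sum(1)[OF gf] mult_left_mono power_mono) (auto simp: r_def)
      also note D
      finally have d: "\<bar>df n x\<bar> \<le> real D ^ Suc n * sqrt (fact n)" .
      have "norm (translate t f u - (\<Sum>m<n. b m / fact m * u ^ m)) = \<bar>df n x\<bar> * \<bar>u\<bar> ^ n / fact n"
        unfolding e by (simp add: b_def df_def abs_mult power_abs)
      also have "\<dots> \<le> real D ^ Suc n * sqrt (fact n) * \<bar>u\<bar> ^ n / fact n"
        by (intro divide_right_mono mult_right_mono d) auto
      also have "\<dots> = real D * ((real D * \<bar>u\<bar>) ^ n * (sqrt (fact n) / fact n))"
        by (simp add: power_mult_distrib)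
      also have "sqrt (fact n) / fact n = 1 / sqrt (fact n :: real)"
        by (simp add: sqrt_divide_self_eq inverse_eq_divide)
      finally show "norm (translate t f u - (\<Sum>m<n. b m / fact m * u ^ m)) \<le> real D * ((real D * \<bar>u\<bar>) ^ n / sqrt (fact n))"
        by simp
    next
      show "(\<lambda>n. real D * ((real D * \<bar>u\<bar>) ^ n / sqrt (fact n))) \<longlonglongrightarrow> 0"
        using tendsto_mult_right_zero[OF summable_LIMSEQ_zero[OF summable_power_div_sqrt_fact]] .
    qed
    then have "(\<lambda>n. \<Sum>m<n. b m / fact m * u ^ m) \<longlonglongrightarrow> translate t f u"
      using tendsto_diff[OF tendsto_const[of "translate t f u"]] by fastforce
    then have "(\<lambda>m. b m / fact m * u ^ m) sums translate t f u" by (simp add: sums_def)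
    then show ?thesis by (simp add: exp_series_def sums_iff)
  qed
  then have eq: "translate t f = exp_series b" by auto
  show "translate t f \<in> paths" unfolding eq by (rule exp_series_in_paths[OF gb])
  show "coef (translate t f) n = exp_series (\<lambda>k. coef f (n + k)) t"
    unfolding eq coef_exp_series[OF gb] by (simp add: b_def)
qed

lemma translate_0: "translate 0 f = f" and translate_add: "translate (s + t) f = translate s (translate t f)"
  by (auto simp: translate_def add_ac)

lemma path_deriv:
  assumes "f \<in> paths"
  shows "((\<lambda>t. coef (translate t f) n) has_real_derivative coef (translate t f) (Suc n)) (at t)"
  unfolding translate_path(2)[OF assms] by (rule deriv_exp_series[OF paths_coef(1)[OF assms]])

section \<open>Measurable structure of the path space\<close>

lemma space_path_algebra[simp]: "space path_algebra = paths"
  by (simp add: path_algebra_def)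

lemma measurable_coef_all: "coef \<in> path_algebra \<rightarrow>\<^sub>M (\<Pi>\<^sub>M i\<in>UNIV. borel)"
  unfolding path_algebra_def by (rule measurable_vimage_algebra1) (auto simp: space_PiM)

lemma measurable_coef: "(\<lambda>f. coef f n) \<in> borel_measurable path_algebra"
  using measurable_compose[OF measurable_coef_all measurable_component_singleton[of n]] by simp

lemma measurable_into_path_algebra:
  assumes "\<And>x. x \<in> space M \<Longrightarrow> g x \<in> paths" "\<And>n. (\<lambda>x. coef (g x) n) \<in> borel_measurable M"
  shows "g \<in> M \<rightarrow>\<^sub>M path_algebra"
  unfolding path_algebra_def
proof (rule measurable_vimage_algebra2)
  show "(\<lambda>x. coef (g x)) \<in> M \<rightarrow>\<^sub>M (\<Pi>\<^sub>M i\<in>UNIV. borel)"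
    by (rule measurable_PiM_single') (use assms(2) in auto)
qed (use assms(1) in auto)

lemma measurable_growth: "Measurable.pred (\<Pi>\<^sub>M i\<in>UNIV. borel) growth"
  unfolding growth_def[abs_def] growth_bound_def by measurable

text \<open>The zero path is the default for sequences that grow too fast, which will form null
  sets; it makes the map total and measurable.\<close>

definition to_path :: "(nat \<Rightarrow> real) \<Rightarrow> path" where
  "to_path a = (if growth a then exp_series a else (\<lambda>_. 0))"

lemma zero_in_paths: "(\<lambda>_. 0) \<in> paths" "coef (\<lambda>_. 0) n = 0"
proof -
  have g: "growth (\<lambda>_. 0)" by (auto simp: growth_def growth_bound_def)
  have z: "exp_series (\<lambda>_. 0) = (\<lambda>_. 0)" by (auto simp: exp_series_def)
  show "(\<lambda>_. 0) \<in> paths" using exp_series_in_paths[OF g] z by simp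
  show "coef (\<lambda>_. 0) n = 0" using coef_exp_series[OF g] z by simp
qed

lemma coef_to_path: "coef (to_path a) n = (if growth a then a n else 0)"
  by (simp add: to_path_def coef_exp_series zero_in_paths)

lemma to_path_in_paths: "to_path a \<in> paths"
  by (simp add: to_path_def zero_in_paths exp_series_in_paths)

lemma measurable_to_path: "to_path \<in> (\<Pi>\<^sub>M i\<in>UNIV. borel) \<rightarrow>\<^sub>M path_algebra"
proof (rule measurable_into_path_algebra[OF to_path_in_paths])
  note measurable_growth[measurable]
  show "(\<lambda>x. coef (to_path x) n) \<in> borel_measurable (\<Pi>\<^sub>M i\<in>UNIV. borel)" for n
    unfolding coef_to_path by measurable
qed

lemma measurable_translate: "(\<lambda>(t, f). translate t f) \<in> borel \<Otimes>\<^sub>M path_algebra \<rightarrow>\<^sub>M path_algebra"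
proof (rule measurable_into_path_algebra)
  note measurable_coef[measurable]
  have "(\<lambda>x. exp_series (\<lambda>k. coef (snd x) (n + k)) (fst x)) \<in> borel_measurable (borel \<Otimes>\<^sub>M path_algebra)" for n
    unfolding exp_series_def by measurable
  then show "(\<lambda>x. coef (case x of (t, f) \<Rightarrow> translate t f) n) \<in> borel_measurable (borel \<Otimes>\<^sub>M path_algebra)" for n
    by (rule measurable_cong[THEN iffD1, rotated]) (auto simp: space_pair_measure translate_path)
qed (auto simp: space_pair_measure translate_path)

lemma sets_path_algebra_generator:
  "sets path_algebra = sigma_sets paths {(\<lambda>f. coef f i) -` {u<..} \<inter> paths | i u. True}" (is "_ = sigma_sets _ ?G")
proof
  show "sigma_sets paths ?G \<subseteq> sets path_algebra"
  proof -
    have "?G \<subseteq> sets path_algebra"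
      using measurable_sets[OF measurable_coef] by auto
    then show ?thesis using sets.sigma_sets_subset[of ?G path_algebra] by simp
  qed
  define N where "N = sigma paths ?G"
  have sN: "sets N = sigma_sets paths ?G" "space N = paths"
    unfolding N_def by (intro sets_measure_of space_measure_of, blast)+
  have "(\<lambda>f. coef f i) \<in> borel_measurable N" for i
  proof (rule borel_measurableI_greater)
    fix u
    have "{f \<in> space N. u < coef f i} = (\<lambda>f. coef f i) -` {u<..} \<inter> paths" by (auto simp: sN(2))
    then show "{f \<in> space N. u < coef f i} \<in> sets N"
      unfolding sN(1) by (auto intro: sigma_sets.Basic)
  qed
  then have "(\<lambda>f. f) \<in> N \<rightarrow>\<^sub>M path_algebra"
    by (intro measurable_into_path_algebra) (auto simp: sN)
  show "sets path_algebra \<subseteq> sigma_sets paths ?G"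
  proof
    fix A assume A: "A \<in> sets path_algebra"
    then have "A \<subseteq> paths" using sets.sets_into_space by fastforce
    then show "A \<in> sigma_sets paths ?G"
      using measurable_sets[OF \<open>(\<lambda>f. f) \<in> N \<rightarrow>\<^sub>M path_algebra\<close> A] by (simp add: sN Int_absorb2)
  qed
qed

text \<open>Taylor coefficients at any time \<open>t\<close> are limits of difference quotients of
  those one order lower, along the steps \<open>1 / Suc j\<close>; the induction starts from the
  evaluations. This is why the process generates the sigma-algebra.\<close>

lemma sets_path_algebra_evaluations:
  "sets path_algebra \<subseteq> sigma_sets paths {(\<lambda>f. translate t f 0) -` C \<inter> paths | t C. C \<in> sets borel}" (is "_ \<subseteq> sigma_sets _ ?G")
proof -
  define N where "N = sigma paths ?G"
  have sN: "sets N = sigma_sets paths ?G" "space N = paths"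
    unfolding N_def by (intro sets_measure_of space_measure_of, blast)+
  have m: "(\<lambda>f. coef (translate t f) n) \<in> borel_measurable N" for t n
  proof (induction n arbitrary: t)
    case 0
    have "(\<lambda>f. translate t f 0) \<in> borel_measurable N"
      by (rule measurableI) (auto simp: sN intro!: sigma_sets.Basic)
    then show ?case by (simp add: coef_def)
  next
    case (Suc n)
    let ?q = "\<lambda>j f. (coef (translate (t + inverse (real (Suc j))) f) n - coef (translate t f) n) / inverse (real (Suc j))"
    show ?case
    proof (rule borel_measurable_LIMSEQ_real)
      show "?q j \<in> borel_measurable N" for j
        using Suc.IH by (intro borel_measurable_divide borel_measurable_diff) auto
      fix f assume "f \<in> space N"
      then have "((\<lambda>h. (coef (translate (t + h) f) n - coef (translate t f) n) / h) \<longlongrightarrow> coef (translate t f) (Suc n)) (at 0)"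
        using path_deriv[of f n t] by (simp add: sN DERIV_def)
      then show "(\<lambda>j. ?q j f) \<longlonglongrightarrow> coef (translate t f) (Suc n)"
        by (rule filterlim_compose) (auto simp: filterlim_at simp del: of_nat_Suc intro!: LIMSEQ_inverse_real_of_nat always_eventually)
    qed
  qed
  have "(\<lambda>f. f) \<in> N \<rightarrow>\<^sub>M path_algebra"
    using m[of 0] by (intro measurable_into_path_algebra) (auto simp: sN translate_0)
  show ?thesis
  proof
    fix A assume A: "A \<in> sets path_algebra"
    then have "A \<subseteq> paths" using sets.sets_into_space by fastforce
    then show "A \<in> sigma_sets paths ?G"
      using measurable_sets[OF \<open>(\<lambda>f. f) \<in> N \<rightarrow>\<^sub>M path_algebra\<close> A] by (simp add: sN Int_absorb2)
  qed
qed

text \<open>The growth conditions with a fixed constant are closed, so the coefficients together with the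
  least admissible constant embed the space onto the intersection of a closed and an open set.\<close>

lemma standard_path_space:
  assumes "sets M = sets path_algebra"
  shows "standard_borel_space M"
proof -
  have sp: "space M = paths" using sets_eq_imp_space_eq[OF assms] by simp
  define least where "least f = (LEAST C. growth_bound C (coef f))" for f
  define \<Phi> where "\<Phi> f = case_nat (real (least f)) (coef f)" for f
  define Cl where "Cl = {c :: nat \<Rightarrow> real. c 0 \<in> \<nat> \<and> (\<forall>n. \<bar>c (Suc n)\<bar> \<le> c 0 ^ Suc n * sqrt (fact n))}"
  \<comment> \<open>The constant \<open>c 0\<close> is minimal when \<open>c 0 - 1\<close> violates
    some bound, an open condition. For \<open>c 0 = 0\<close> it holds automatically, since the
    right side at \<open>n = 0\<close> is -1.\<close>
  define Op where "Op = {c :: nat \<Rightarrow> real. \<exists>n. \<bar>c (Suc n)\<bar> > (c 0 - 1) ^ Suc n * sqrt (fact n)}"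
  have cont: "continuous_on UNIV (\<lambda>c :: nat \<Rightarrow> real. c n)" for n
    by (rule continuous_on_product_coordinates)
  have "Cl = (\<lambda>c. c 0) -` \<nat> \<inter> (\<Inter>n. {c. \<bar>c (Suc n)\<bar> \<le> c 0 ^ Suc n * sqrt (fact n)})"
    unfolding Cl_def by auto
  also have "closed \<dots>"
    by (intro closed_Int closed_INT ballI closed_vimage closed_Nats cont closed_Collect_le continuous_intros)
  finally have Cl: "closed Cl" .
  have "Op = (\<Union>n. {c. \<bar>c (Suc n)\<bar> > (c 0 - 1) ^ Suc n * sqrt (fact n)})"
    unfolding Op_def by auto
  also have "open \<dots>"
    by (intro open_UN ballI open_Collect_less cont continuous_intros)
  finally have Op: "open Op" .
  have mono: "growth_bound C a" if "growth_bound j a" "j \<le> C" for j C a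
    unfolding growth_bound_def
  proof
    fix n
    have "real j ^ Suc n * sqrt (fact n) \<le> real C ^ Suc n * sqrt (fact n)"
      using that(2) by (intro mult_right_mono power_mono) auto
    then show "\<bar>a n\<bar> \<le> real C ^ Suc n * sqrt (fact n)"
      using that(1) unfolding growth_bound_def by (blast intro: order_trans)
  qed
  have img: "\<Phi> ` paths = Cl \<inter> Op"
  proof
    show "\<Phi> ` paths \<subseteq> Cl \<inter> Op"
    proof safe
      fix f assume f: "f \<in> paths"
      then obtain C where "growth_bound C (coef f)" using paths_coef(1) by (auto simp: growth_def)
      then have 1: "growth_bound (least f) (coef f)" unfolding least_def by (rule LeastI)
      then show "\<Phi> f \<in> Cl" by (auto simp: \<Phi>_def Cl_def growth_bound_def)
      have "\<exists>n. \<bar>coef f n\<bar> > (real (least f) - 1) ^ Suc n * sqrt (fact n)"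
      proof (cases "least f")
        case 0
        then show ?thesis by (intro exI[of _ 0]) simp
      next
        case (Suc j)
        then have "\<not> growth_bound j (coef f)" unfolding least_def using not_less_Least by (metis lessI)
        then show ?thesis using Suc by (auto simp: growth_bound_def not_le)
      qed
      then show "\<Phi> f \<in> Op" by (auto simp: \<Phi>_def Op_def)
    qed
    show "Cl \<inter> Op \<subseteq> \<Phi> ` paths"
    proof safe
      fix c assume c: "c \<in> Cl" "c \<in> Op"
      then obtain C where C: "c 0 = real C" unfolding Cl_def by (auto elim: Nats_cases)
      define a where "a n = c (Suc n)" for n
      have b: "growth_bound C a" using c(1) unfolding Cl_def growth_bound_def a_def C[symmetric] by blast
      then have g: "growth a" by (auto simp: growth_def)
      have nb: "\<not> growth_bound j a" if "j < C" for j
      proof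
        assume "growth_bound j a"
        then have "growth_bound (C - 1) a" by (rule mono) (use that in simp)
        moreover have "real (C - 1) = real C - 1" using that by simp
        ultimately have "\<bar>c (Suc n)\<bar> \<le> (real C - 1) ^ Suc n * sqrt (fact n)" for n
          unfolding growth_bound_def a_def by metis
        moreover obtain n where "(real C - 1) ^ Suc n * sqrt (fact n) < \<bar>c (Suc n)\<bar>"
          using c(2) unfolding Op_def C[symmetric] by blast
        ultimately show False by (metis not_le)
      qed
      have "least (exp_series a) = C"
        unfolding least_def coef_exp_series[OF g]
      proof (rule Least_equality[of "\<lambda>C. growth_bound C a", OF b])
        show "C \<le> j" if "growth_bound j a" for j using nb[of j] that by (cases "C \<le> j") auto
      qed
      then have "\<Phi> (exp_series a) n = c n" for n
        by (cases n) (simp_all add: \<Phi>_def coef_exp_series[OF g] C, simp add: a_def)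
      then have "\<Phi> (exp_series a) = c" by (rule ext)
      then show "c \<in> \<Phi> ` paths" using exp_series_in_paths[OF g] by blast
    qed
  qed
  have inj: "inj_on \<Phi> paths"
  proof (rule inj_onI)
    fix f g assume "f \<in> paths" "g \<in> paths" "\<Phi> f = \<Phi> g"
    moreover have "\<Phi> h (Suc n) = coef h n" for h n by (simp add: \<Phi>_def)
    ultimately show "f = g" by (metis paths_eqI)
  qed
  define X where "X = pullback_topology paths \<Phi> euclidean"
  have tX: "topspace X = paths" by (simp add: X_def topspace_pullback_topology)
  have oX: "openin X U \<longleftrightarrow> (\<exists>V. open V \<and> U = \<Phi> -` V \<inter> paths)" for U
    by (simp add: X_def openin_pullback_topology)
  have hom: "homeomorphic_map X (top_of_set (Cl \<inter> Op)) \<Phi>"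
  proof (rule bijective_open_imp_homeomorphic_map)
    show "continuous_map X (top_of_set (Cl \<inter> Op)) \<Phi>"
      unfolding continuous_map_in_subtopology
    proof
      show "continuous_map X euclidean \<Phi>"
        unfolding continuous_map_def
      proof (intro conjI allI impI)
        fix U :: "(nat \<Rightarrow> real) set" assume "openin euclidean U"
        moreover have "{x \<in> topspace X. \<Phi> x \<in> U} = \<Phi> -` U \<inter> paths" by (auto simp: tX)
        ultimately show "openin X {x \<in> topspace X. \<Phi> x \<in> U}" unfolding oX by auto
      qed simp
      show "\<Phi> \<in> topspace X \<rightarrow> Cl \<inter> Op" using img tX by auto
    qed
    show "open_map X (top_of_set (Cl \<inter> Op)) \<Phi>"
      unfolding open_map_def
    proof (intro allI impI)
      fix U assume "openin X U"
      then obtain V where V: "open V" "U = \<Phi> -` V \<inter> paths" using oX by auto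
      then have "\<Phi> ` U = V \<inter> (Cl \<inter> Op)" unfolding img[symmetric] by auto
      then show "openin (top_of_set (Cl \<inter> Op)) (\<Phi> ` U)" using V by (auto simp: openin_open)
    qed
    show "\<Phi> ` topspace X = topspace (top_of_set (Cl \<inter> Op))" using img tX by simp
    show "inj_on \<Phi> (topspace X)" using inj tX by simp
  qed
  then have hs: "X homeomorphic_space top_of_set (Cl \<inter> Op)"
    by (rule homeomorphic_map_imp_homeomorphic_space)
  have "completely_metrizable_space (top_of_set Op)"
    using completely_metrizable_space_openin[OF completely_metrizable_space_euclidean, of Op] Op by simp
  then have "completely_metrizable_space (subtopology (top_of_set Op) (Op \<inter> Cl))"
    by (rule completely_metrizable_space_closedin) (use Cl in \<open>auto simp: closedin_closed\<close>)
  then have cm: "completely_metrizable_space X"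
    using homeomorphic_completely_metrizable_space[OF hs] by (simp add: subtopology_subtopology Int_ac)
  have "second_countable (euclidean :: (nat \<Rightarrow> real) topology)"
  proof -
    obtain \<B> :: "(nat \<Rightarrow> real) set set" where "countable \<B>" "\<And>C. C \<in> \<B> \<Longrightarrow> open C"
      and U: "\<And>S. open S \<Longrightarrow> \<exists>U. U \<subseteq> \<B> \<and> S = \<Union>U"
      using univ_second_countable by blast
    moreover have "\<exists>V\<in>\<B>. x \<in> V \<and> V \<subseteq> S" if "open S" "x \<in> S" for S x
      using U[OF that(1)] that(2) by blast
    ultimately show ?thesis unfolding second_countable_def by (intro exI[of _ \<B>]) auto
  qed
  then have sc: "second_countable X"
    using homeomorphic_space_second_countability[OF hs] second_countable_subtopology by auto
  have "sets M = sigma_sets paths {U. openin X U}"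
  proof
    have gen: "{(\<lambda>f. coef f i) -` {u<..} \<inter> paths | i u. True} \<subseteq> {U. openin X U}"
    proof safe
      fix i u
      have "open {c :: nat \<Rightarrow> real. u < c (Suc i)}"
        by (intro open_Collect_less cont continuous_intros)
      moreover have "(\<lambda>f. coef f i) -` {u<..} \<inter> paths = \<Phi> -` {c. u < c (Suc i)} \<inter> paths"
        by (auto simp: \<Phi>_def)
      ultimately show "openin X ((\<lambda>f. coef f i) -` {u<..} \<inter> paths)" unfolding oX by blast
    qed
    show "sets M \<subseteq> sigma_sets paths {U. openin X U}"
      unfolding assms sets_path_algebra_generator by (rule sigma_sets_mono'[OF gen])
    note measurable_coef[measurable]
    have "least \<in> path_algebra \<rightarrow>\<^sub>M count_space UNIV"
      unfolding least_def[abs_def] growth_bound_def by measurable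
    then have [measurable]: "(\<lambda>f. real (least f)) \<in> borel_measurable path_algebra" by measurable
    have "\<Phi> \<in> path_algebra \<rightarrow>\<^sub>M (\<Pi>\<^sub>M i\<in>UNIV. borel)"
      by (rule measurable_PiM_single') (auto simp: \<Phi>_def split: nat.split)
    then have "\<Phi> \<in> path_algebra \<rightarrow>\<^sub>M borel"
      by (simp add: measurable_cong_sets[OF refl sets_PiM_equal_borel])
    then have "{U. openin X U} \<subseteq> sets M"
      using measurable_sets[of \<Phi> path_algebra borel] by (auto simp: oX assms)
    then show "sigma_sets paths {U. openin X U} \<subseteq> sets M"
      using sets.sigma_sets_subset[of _ M] sp by simp
  qed
  then show ?thesis
    unfolding standard_borel_space_def sp using tX cm sc by blast
qed

section \<open>Polynomials as finite linear combinations\<close>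

text \<open>A real polynomial serves as a name for a finite real linear combination. The same name
  is read in two spaces, by \<open>ev\<close> as a function of the spectral variable and by
  \<open>lin\<close> as a functional of the path, so an isometry between the spaces becomes a
  statement about a single \<open>p\<close>.\<close>

definition lift_poly :: "real poly \<Rightarrow> (nat \<Rightarrow> 'v::real_vector) \<Rightarrow> 'v" where
  "lift_poly p X = (\<Sum>k\<le>degree p. coeff p k *\<^sub>R X k)"

lemma lift_poly_eq: "degree p \<le> N \<Longrightarrow> lift_poly p X = (\<Sum>k\<le>N. coeff p k *\<^sub>R X k)"
  unfolding lift_poly_def by (rule sum.mono_neutral_left) (auto simp: coeff_eq_0)

lemma lift_poly_add: "lift_poly (p + q) X = lift_poly p X + lift_poly q X"
proof -
  define N where "N = max (degree p) (degree q)"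
  have N: "degree (p + q) \<le> N" "degree p \<le> N" "degree q \<le> N"
    using degree_add_le_max[of p q] by (auto simp: N_def)
  show ?thesis
    unfolding lift_poly_eq[OF N(1)] lift_poly_eq[OF N(2)] lift_poly_eq[OF N(3)]
    by (simp add: scaleR_add_left sum.distrib)
qed

lemma lift_poly_smult: "lift_poly (smult c p) X = c *\<^sub>R lift_poly p X"
  using lift_poly_eq[OF degree_smult_le[of c p]] by (simp add: lift_poly_def scaleR_sum_right)

lemma lift_poly_minus: "lift_poly (- p) X = - lift_poly p X"
  using lift_poly_smult[of "-1" p X] by simp

lemma lift_poly_diff: "lift_poly (p - q) X = lift_poly p X - lift_poly q X"
  using lift_poly_add[of p "- q" X] by (simp add: lift_poly_minus)

lemma lift_poly_monom: "lift_poly (monom c n) X = c *\<^sub>R X n"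
  using lift_poly_eq[OF degree_monom_le[of c n], of X]
  by (simp add: if_distrib[of "\<lambda>c. c *\<^sub>R _"] cong: if_cong)

lemma lift_poly_0: "lift_poly 0 X = 0"
  by (simp add: lift_poly_def)

lemma lift_poly_sum: "lift_poly (\<Sum>i\<in>I. p i) X = (\<Sum>i\<in>I. lift_poly (p i) X)"
  by (induction I rule: infinite_finite_induct) (auto simp: lift_poly_add lift_poly_0)

definition ev :: "real poly \<Rightarrow> real \<Rightarrow> complex" where
  "ev p x = lift_poly p (\<lambda>k. (\<i> * x) ^ k)"

definition lin :: "real poly \<Rightarrow> path \<Rightarrow> real" where
  "lin p f = lift_poly p (coef f)"

lemmas ev_simps = ev_def lift_poly_add lift_poly_diff lift_poly_minus lift_poly_smult lift_poly_monom lift_poly_0 lift_poly_sum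
lemmas lin_simps = lin_def lift_poly_add lift_poly_diff lift_poly_minus lift_poly_smult lift_poly_monom lift_poly_0 lift_poly_sum

lemma ev_measurable[measurable]: "ev p \<in> borel_measurable borel"
  unfolding ev_def[abs_def] lift_poly_def by measurable

lemma lin_measurable: "lin p \<in> borel_measurable path_algebra"
proof -
  note measurable_coef[measurable]
  show ?thesis unfolding lin_def[abs_def] lift_poly_def by measurable
qed

section \<open>Spectral measures\<close>

text \<open>The two moment conditions serve different ends. \<open>exp_moment\<close> dominates the
  Taylor series of the characters in L2 and so makes polynomials dense; \<open>moment\<close> bounds
  the variances of the Taylor coefficients and so makes the sample paths entire.\<close>

locale spectral_measure =
  fixes \<sigma> :: "real measure"
  assumes finite_symmetric: "finite_symmetric_borel_measure \<sigma>"
    and exp_moment: "\<And>r. integrable \<sigma> (\<lambda>x. exp (r * \<bar>x\<bar>))"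
    and moment: "\<exists>K. \<forall>n. (\<integral>x. x ^ (2 * n) \<partial>\<sigma>) \<le> K * fact n"
begin

sublocale finite_measure \<sigma>
  using finite_symmetric by (simp add: finite_symmetric_borel_measure_def)

lemma sets_eq[simp, measurable_cong]: "sets \<sigma> = sets borel"
  using finite_symmetric by (simp add: finite_symmetric_borel_measure_def)

lemma space_eq[simp]: "space \<sigma> = UNIV"
  using sets_eq_imp_space_eq[OF sets_eq] by simp

lemma integral_reflect:
  fixes g :: "real \<Rightarrow> 'b::{banach, second_countable_topology}"
  assumes [measurable]: "g \<in> borel_measurable borel"
  shows "(\<integral>x. g (- x) \<partial>\<sigma>) = (\<integral>x. g x \<partial>\<sigma>)"
proof -
  have "(\<integral>x. g x \<partial>\<sigma>) = (\<integral>x. g x \<partial>distr \<sigma> borel uminus)"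
    using finite_symmetric by (simp add: finite_symmetric_borel_measure_def)
  then show ?thesis by (simp add: integral_distr)
qed

lemma L2_exp: "L2 \<sigma> (\<lambda>x. exp (r * \<bar>x\<bar>))"
proof -
  have "(exp (r * \<bar>x\<bar>))\<^sup>2 = exp (2 * r * \<bar>x\<bar>)" for x by (simp add: exp_double[symmetric] mult.assoc)
  then show ?thesis using exp_moment[of "2 * r"] by (simp add: L2_def)
qed

lemma power_le_exp: "\<bar>x\<bar> ^ n \<le> fact n * exp \<bar>x\<bar>" for x :: real
proof -
  have "(\<Sum>k\<in>{n}. \<bar>x\<bar> ^ k /\<^sub>R fact k) \<le> exp \<bar>x\<bar>"
    unfolding exp_def by (rule sum_le_suminf[OF summable_exp_generic]) auto
  then show ?thesis by (simp add: field_simps divideR_right)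
qed

lemma L2_power_exp: "L2 \<sigma> (\<lambda>x. \<bar>x\<bar> ^ n * exp (r * \<bar>x\<bar>))"
proof (rule L2_bound[OF L2_rmult[OF L2_exp[of "r + 1"], of "fact n"]])
  fix x :: real
  have "\<bar>x\<bar> ^ n * exp (r * \<bar>x\<bar>) \<le> fact n * exp \<bar>x\<bar> * exp (r * \<bar>x\<bar>)"
    by (intro mult_right_mono power_le_exp) auto
  then show "norm (\<bar>x\<bar> ^ n * exp (r * \<bar>x\<bar>)) \<le> norm (fact n * exp ((r + 1) * \<bar>x\<bar>))"
    by (simp add: abs_mult distrib_right exp_add mult.assoc mult.commute[of "exp (r * \<bar>x\<bar>)"])
qed measurable

lemma L2_power: "L2 \<sigma> (\<lambda>x. (\<i> * complex_of_real x) ^ n)"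
  by (rule L2_bound[OF L2_power_exp[of n 0]]) (auto simp: norm_power norm_mult power_abs)

lemma L2_ev: "L2 \<sigma> (ev p)"
  unfolding ev_def[abs_def] lift_poly_def by (intro L2_sum L2_scaleR L2_power)

lemma taylor_bound: "norm (\<Sum>k<N. (\<i> * complex_of_real y) ^ k /\<^sub>R fact k) \<le> exp \<bar>y\<bar>"
proof -
  have "norm (\<Sum>k<N. (\<i> * complex_of_real y) ^ k /\<^sub>R fact k) \<le> (\<Sum>k<N. \<bar>y\<bar> ^ k /\<^sub>R fact k)"
    by (rule order_trans[OF norm_sum]) (simp add: norm_power norm_mult)
  also have "\<dots> \<le> exp \<bar>y\<bar>"
    unfolding exp_def by (rule sum_le_suminf[OF summable_exp_generic]) auto
  finally show ?thesis .
qed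

lemma taylor_lim: "(\<lambda>N. \<Sum>k<N. (\<i> * complex_of_real y) ^ k /\<^sub>R fact k) \<longlonglongrightarrow> cis y"
  using exp_converges[of "\<i> * complex_of_real y"] by (simp add: sums_def cis_conv_exp)

text \<open>Read by \<open>ev\<close>, this is \<open>(\<i> * x) ^ n\<close> times a Taylor
  polynomial of \<open>cis (t * x)\<close>; read by \<open>lin\<close>, it is a partial sum of the
  Taylor series at 0 of the \<open>n\<close>-th derivative of the path, evaluated at
  \<open>t\<close>.\<close>

definition taylor_poly :: "real \<Rightarrow> nat \<Rightarrow> nat \<Rightarrow> real poly" where
  "taylor_poly t n N = (\<Sum>k<N. monom (t ^ k / fact k) (n + k))"

lemma ev_taylor_poly: "ev (taylor_poly t n N) x
    = (\<i> * x) ^ n * (\<Sum>k<N. (\<i> * complex_of_real (t * x)) ^ k /\<^sub>R fact k)"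
  unfolding taylor_poly_def ev_simps sum_distrib_left
  by (intro sum.cong refl) (simp add: power_add power_mult_distrib scaleR_conv_of_real field_simps)

lemma L2_exp_character: "L2 \<sigma> (\<lambda>x. (\<i> * complex_of_real x) ^ n * cis (t * x))"
  by (rule L2_bound[OF L2_power]) (auto simp: norm_mult cis_conv_exp)

lemma taylor_tendsto:
  "(\<lambda>N. nsq \<sigma> (\<lambda>x. ev (taylor_poly t n N) x - (\<i> * complex_of_real x) ^ n * cis (t * x))) \<longlonglongrightarrow> 0"
proof (rule nsq_dominated[where w = "\<lambda>x. \<bar>x\<bar> ^ n * exp (\<bar>t\<bar> * \<bar>x\<bar>)"])
  show "L2 \<sigma> (\<lambda>x. \<bar>x\<bar> ^ n * exp (\<bar>t\<bar> * \<bar>x\<bar>))" by (rule L2_power_exp)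
  show "AE x in \<sigma>. (\<lambda>N. ev (taylor_poly t n N) x) \<longlonglongrightarrow> (\<i> * complex_of_real x) ^ n * cis (t * x)"
    unfolding ev_taylor_poly by (intro AE_I2 tendsto_mult tendsto_const taylor_lim)
  show "norm (ev (taylor_poly t n N) x) \<le> \<bar>x\<bar> ^ n * exp (\<bar>t\<bar> * \<bar>x\<bar>)" for N x
    unfolding ev_taylor_poly norm_mult norm_power
    using mult_left_mono[OF taylor_bound[of "t * x" N], of "\<bar>x\<bar> ^ n"] by (simp add: abs_mult)
  show "norm ((\<i> * complex_of_real x) ^ n * cis (t * x)) \<le> \<bar>x\<bar> ^ n * exp (\<bar>t\<bar> * \<bar>x\<bar>)" for x
    by (simp add: norm_mult norm_power mult_le_cancel_left1)
  show "(\<lambda>x. (\<i> * complex_of_real x) ^ n * cis (t * x)) \<in> borel_measurable \<sigma>"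
    using L2_exp_character by (simp add: L2_def)
qed (use L2_ev in \<open>simp add: L2_def\<close>)

section \<open>Density of the polynomials in L2 of the spectral measure\<close>

definition approximable :: "(real \<Rightarrow> complex) \<Rightarrow> bool" where
  "approximable g \<longleftrightarrow> L2 \<sigma> g \<and> (\<forall>e>0. \<exists>N c. nsq \<sigma> (\<lambda>x. (\<Sum>k<N. c k * complex_of_real x ^ k) - g x) < e)"

lemma L2_cpoly: "L2 \<sigma> (\<lambda>x. \<Sum>k<N. c k * complex_of_real x ^ k)"
  by (intro L2_sum L2_cmult L2_bound[OF L2_power_exp[of _ 0]]) (auto simp: norm_power)

lemma approximable_limit:
  assumes g: "L2 \<sigma> g" and "\<And>e. e > 0 \<Longrightarrow> \<exists>g'. approximable g' \<and> nsq \<sigma> (\<lambda>x. g' x - g x) < e"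
  shows "approximable g"
  unfolding approximable_def
proof (intro conjI allI impI g)
  fix e :: real assume "e > 0"
  then obtain g' where g': "approximable g'" "nsq \<sigma> (\<lambda>x. g' x - g x) < e / 4"
    using assms(2)[of "e / 4"] by auto
  then obtain N c where "nsq \<sigma> (\<lambda>x. (\<Sum>k<N. c k * complex_of_real x ^ k) - g' x) < e / 4"
    using \<open>e > 0\<close> unfolding approximable_def by (metis divide_pos_pos zero_less_numeral)
  moreover have "nsq \<sigma> (\<lambda>x. (\<Sum>k<N. c k * complex_of_real x ^ k) - g x) \<le>
      2 * nsq \<sigma> (\<lambda>x. (\<Sum>k<N. c k * complex_of_real x ^ k) - g' x) + 2 * nsq \<sigma> (\<lambda>x. g' x - g x)"
    by (rule nsq_diff_triangle) (use g' g L2_cpoly in \<open>auto simp: approximable_def\<close>)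
  ultimately have "nsq \<sigma> (\<lambda>x. (\<Sum>k<N. c k * complex_of_real x ^ k) - g x) < e"
    using g'(2) by simp
  then show "\<exists>N c. nsq \<sigma> (\<lambda>x. (\<Sum>k<N. c k * complex_of_real x ^ k) - g x) < e" by blast
qed

lemma approximable_cis: "approximable (\<lambda>x. cis (t * x))"
  unfolding approximable_def
proof (intro conjI allI impI)
  show L: "L2 \<sigma> (\<lambda>x. cis (t * x))" using L2_exp_character[of 0 t] by simp
  fix e :: real assume "e > 0"
  with taylor_tendsto[of t 0] have "eventually (\<lambda>N. nsq \<sigma> (\<lambda>x. ev (taylor_poly t 0 N) x - cis (t * x)) < e) sequentially"
    by (simp add: order_tendsto_iff)
  then obtain N where "nsq \<sigma> (\<lambda>x. ev (taylor_poly t 0 N) x - cis (t * x)) < e"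
    by (auto simp: eventually_sequentially)
  moreover have "ev (taylor_poly t 0 N) x = (\<Sum>k<N. ((\<i> * t) ^ k / fact k) * complex_of_real x ^ k)" for x
    unfolding ev_taylor_poly by (simp add: scaleR_conv_of_real field_simps power_mult_distrib)
  ultimately show "\<exists>N c. nsq \<sigma> (\<lambda>x. (\<Sum>k<N. c k * complex_of_real x ^ k) - cis (t * x)) < e"
    by (intro exI[of _ N] exI[of _ "\<lambda>k. (\<i> * t) ^ k / fact k"]) simp
qed

lemma approximable_add:
  assumes f: "approximable f" and g: "approximable g"
  shows "approximable (\<lambda>x. f x + g x)"
  unfolding approximable_def
proof (intro conjI allI impI)
  have L: "L2 \<sigma> f" "L2 \<sigma> g" using f g by (auto simp: approximable_def)
  then show "L2 \<sigma> (\<lambda>x. f x + g x)" by (rule L2_add)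
  fix e :: real assume "e > 0"
  then have "e / 4 > 0" by simp
  then obtain N c where N: "nsq \<sigma> (\<lambda>x. (\<Sum>k<N. c k * complex_of_real x ^ k) - f x) < e / 4"
    using f unfolding approximable_def by meson
  obtain N' c' where N': "nsq \<sigma> (\<lambda>x. (\<Sum>k<N'. c' k * complex_of_real x ^ k) - g x) < e / 4"
    using g \<open>e / 4 > 0\<close> unfolding approximable_def by meson
  define d where "d k = (if k < N then c k else 0) + (if k < N' then c' k else 0)" for k
  have "(\<Sum>k<N. c k * complex_of_real x ^ k) = (\<Sum>k<max N N'. (if k < N then c k else 0) * complex_of_real x ^ k)" for x
    by (rule sum.mono_neutral_cong_left) auto
  moreover have "(\<Sum>k<N'. c' k * complex_of_real x ^ k) = (\<Sum>k<max N N'. (if k < N' then c' k else 0) * complex_of_real x ^ k)" for x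
    by (rule sum.mono_neutral_cong_left) auto
  ultimately have eq: "(\<Sum>k<max N N'. d k * complex_of_real x ^ k) - (f x + g x)
      = ((\<Sum>k<N. c k * complex_of_real x ^ k) - f x) + ((\<Sum>k<N'. c' k * complex_of_real x ^ k) - g x)" for x
    by (simp add: d_def distrib_right sum.distrib)
  have "nsq \<sigma> (\<lambda>x. (\<Sum>k<max N N'. d k * complex_of_real x ^ k) - (f x + g x)) < e"
    unfolding eq using nsq_add_le[OF L2_diff[OF L2_cpoly[of c N] L(1)] L2_diff[OF L2_cpoly[of c' N'] L(2)]] N N' by linarith
  then show "\<exists>N c. nsq \<sigma> (\<lambda>x. (\<Sum>k<N. c k * complex_of_real x ^ k) - (f x + g x)) < e" by blast
qed

lemma approximable_scale:
  assumes f: "approximable f" shows "approximable (\<lambda>x. c * f x)"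
  unfolding approximable_def
proof (intro conjI allI impI)
  have L: "L2 \<sigma> f" using f by (auto simp: approximable_def)
  then show "L2 \<sigma> (\<lambda>x. c * f x)" by (rule L2_cmult)
  fix e :: real assume e: "e > 0"
  have c: "(cmod c)\<^sup>2 + 1 > 0" by (simp add: add_nonneg_pos)
  then obtain N d where N: "nsq \<sigma> (\<lambda>x. (\<Sum>k<N. d k * complex_of_real x ^ k) - f x) < e / ((cmod c)\<^sup>2 + 1)"
    using f e unfolding approximable_def by (meson divide_pos_pos)
  have "(\<Sum>k<N. (c * d k) * complex_of_real x ^ k) - c * f x = c * ((\<Sum>k<N. d k * complex_of_real x ^ k) - f x)" for x
    by (simp add: right_diff_distrib sum_distrib_left mult.assoc)
  then have "nsq \<sigma> (\<lambda>x. (\<Sum>k<N. (c * d k) * complex_of_real x ^ k) - c * f x)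
      = (cmod c)\<^sup>2 * nsq \<sigma> (\<lambda>x. (\<Sum>k<N. d k * complex_of_real x ^ k) - f x)"
    by (simp add: nsq_def norm_mult power_mult_distrib)
  also have "\<dots> \<le> ((cmod c)\<^sup>2 + 1) * nsq \<sigma> (\<lambda>x. (\<Sum>k<N. d k * complex_of_real x ^ k) - f x)"
    by (intro mult_right_mono nsq_nonneg) simp
  also have "\<dots> < e" using N c by (simp add: field_simps)
  finally show "\<exists>N d. nsq \<sigma> (\<lambda>x. (\<Sum>k<N. d k * complex_of_real x ^ k) - c * f x) < e"
    by (intro exI[of _ N] exI[of _ "\<lambda>k. c * d k"])
qed

lemma approximable_bounded_limit:
  assumes f: "\<And>n. approximable (f n)" and g: "g \<in> borel_measurable \<sigma>"
    and b: "\<And>n x. cmod (f n x) \<le> B" and lim: "\<And>x. (\<lambda>n. f n x) \<longlonglongrightarrow> g x"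
  shows "approximable g"
proof (rule approximable_limit)
  have gb: "cmod (g x) \<le> B" for x
    by (rule LIMSEQ_le_const2[OF tendsto_norm[OF lim]]) (use b in auto)
  show "L2 \<sigma> g" by (rule L2_bounded[OF g gb])
  have "(\<lambda>n. nsq \<sigma> (\<lambda>x. f n x - g x)) \<longlonglongrightarrow> 0"
    by (rule nsq_dominated[where w = "\<lambda>_. B", OF _ g])
      (use f b gb lim in \<open>auto simp: approximable_def L2_def\<close>)
  then show "\<exists>g'. approximable g' \<and> nsq \<sigma> (\<lambda>x. g' x - g x) < e" if "e > 0" for e
    using that f by (auto simp: order_tendsto_iff eventually_sequentially) blast
qed

lemma approximable_bounded:
  assumes "g \<in> borel_measurable \<sigma>" "\<And>x. cmod (g x) \<le> B"
  shows "approximable g"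
proof -
  interpret multiplicative_class \<sigma> "\<lambda>_::unit. \<lambda>x. x" "Collect approximable"
  proof
    show "sets \<sigma> = sigma_sets (space \<sigma>) {(\<lambda>x. x) -` {u<..} \<inter> space \<sigma> | (i::unit) (u::real). True}"
    proof -
      have "{(\<lambda>x. x) -` {u<..} \<inter> space \<sigma> | (i::unit) (u::real). True} = range greaterThan"
        by auto
      then show ?thesis
        using arg_cong[OF borel_Ioi[where 'a = real], of sets] by simp
    qed
    show "(\<lambda>x. cis (\<Sum>i\<in>F. u i * x)) \<in> Collect approximable" for F :: "unit set" and u
      using approximable_cis[of "\<Sum>i\<in>F. u i"] by (simp add: sum_distrib_right)
    show "\<And>f g. f \<in> Collect approximable \<Longrightarrow> g \<in> Collect approximable \<Longrightarrow> (\<lambda>x. f x + g x) \<in> Collect approximable"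
      using approximable_add by simp
    show "\<And>f c. f \<in> Collect approximable \<Longrightarrow> (\<lambda>x. c * f x) \<in> Collect approximable"
      using approximable_scale by simp
    show "g \<in> Collect approximable" if "\<And>n. f n \<in> Collect approximable" "g \<in> borel_measurable \<sigma>"
      "\<And>n x. x \<in> space \<sigma> \<Longrightarrow> cmod (f n x) \<le> B" "\<And>x. x \<in> space \<sigma> \<Longrightarrow> (\<lambda>n. f n x) \<longlonglongrightarrow> g x" for f g B
      using approximable_bounded_limit[of f g B] that by simp
  qed simp
  show ?thesis using bounded_in[of g B] assms by simp
qed

text \<open>Exponential moments make the characters limits of polynomials, the multiplicative class
  extends this to bounded functions, and truncation of the values to all of L2. For a general
  measure with finite moments polynomials can fail to be dense.\<close>

lemma approximable_L2:
  assumes g: "L2 \<sigma> g" shows "approximable g"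
proof (rule approximable_limit[OF g])
  have [measurable]: "g \<in> borel_measurable \<sigma>" using g by (simp add: L2_def)
  define f where "f n x = (if cmod (g x) \<le> real n then g x else 0)" for n x
  have fm[measurable]: "f n \<in> borel_measurable \<sigma>" for n unfolding f_def[abs_def] by measurable
  have fa: "approximable (f n)" for n
    by (rule approximable_bounded[OF fm, of _ "real n"]) (simp add: f_def)
  have "(\<lambda>n. nsq \<sigma> (\<lambda>x. f n x - g x)) \<longlonglongrightarrow> 0"
  proof (rule nsq_dominated[where w = "\<lambda>x. cmod (g x)"])
    show "L2 \<sigma> (\<lambda>x. cmod (g x))" using g by (simp add: L2_def)
    have "eventually (\<lambda>n. f n x = g x) sequentially" for x
      using eventually_ge_at_top[of "nat \<lceil>cmod (g x)\<rceil>"]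
    proof eventually_elim
      case (elim n)
      then have "cmod (g x) \<le> real n" by linarith
      then show ?case by (simp add: f_def)
    qed
    then show "AE x in \<sigma>. (\<lambda>n. f n x) \<longlonglongrightarrow> g x" by (intro AE_I2 tendsto_eventually)
  qed (auto simp: f_def)
  then show "\<exists>g'. approximable g' \<and> nsq \<sigma> (\<lambda>x. g' x - g x) < e" if "e > 0" for e
    using that fa by (auto simp: order_tendsto_iff eventually_sequentially) blast
qed

text \<open>The real space that corresponds to real random variables: every \<open>ev p\<close> with
  a real polynomial \<open>p\<close> belongs to it.\<close>

definition hermitian :: "(real \<Rightarrow> complex) \<Rightarrow> bool" where
  "hermitian h \<longleftrightarrow> (\<forall>x. h (- x) = cnj (h x))"

text \<open>Averaging an approximating polynomial \<open>q x\<close> with the conjugate of \<open>q (- x)\<close> makes it a real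
  polynomial in \<open>i x\<close>.\<close>

lemma ev_dense:
  assumes h: "L2 \<sigma> h" "hermitian h" and e: "e > 0"
  shows "\<exists>p. nsq \<sigma> (\<lambda>x. ev p x - h x) < e"
proof -
  obtain N c where N: "nsq \<sigma> (\<lambda>x. (\<Sum>k<N. c k * complex_of_real x ^ k) - h x) < e"
    using approximable_L2[OF h(1)] e unfolding approximable_def by blast
  define q where "q x = (\<Sum>k<N. c k * complex_of_real x ^ k)" for x
  have L: "L2 \<sigma> q" unfolding q_def[abs_def] by (rule L2_cpoly)
  have [measurable]: "h \<in> borel_measurable borel" "q \<in> borel_measurable borel"
    using h(1) L by (auto simp: L2_def)
  have [measurable]: "cnj \<in> borel_measurable borel"
    by (intro borel_measurable_continuous_onI continuous_intros)
  define q' where "q' x = cnj (q (- x))" for x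
  define p where "p = (\<Sum>k<N. monom (Re (c k / \<i> ^ k)) k)"
  have ev: "ev p x = (q x + q' x) / 2" for x
  proof -
    have "complex_of_real (Re (c k / \<i> ^ k)) * (\<i> * x) ^ k = (c k * of_real x ^ k + cnj (c k) * of_real (- x) ^ k) / 2" for k
    proof -
      have "complex_of_real (Re (c k / \<i> ^ k)) = (c k / \<i> ^ k + cnj (c k) / (- \<i>) ^ k) / 2"
        using complex_add_cnj[of "c k / \<i> ^ k"] by simp
      then have "complex_of_real (Re (c k / \<i> ^ k)) * (\<i> * x) ^ k
          = (c k * ((\<i> * x) ^ k / \<i> ^ k) + cnj (c k) * ((\<i> * x) ^ k / (- \<i>) ^ k)) / 2"
        by (simp add: distrib_right add_divide_distrib)
      also have "(\<i> * x) ^ k / \<i> ^ k = of_real x ^ k" by (simp add: power_divide[symmetric])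
      also have "(\<i> * x) ^ k / (- \<i>) ^ k = of_real (- x) ^ k" by (simp add: power_divide[symmetric])
      finally show ?thesis .
    qed
    then have "(\<Sum>k<N. complex_of_real (Re (c k / \<i> ^ k)) * (\<i> * x) ^ k)
        = (\<Sum>k<N. (c k * of_real x ^ k + cnj (c k) * of_real (- x) ^ k) / 2)"
      by (intro sum.cong refl)
    also have "\<dots> = (q x + q' x) / 2"
      by (simp add: q_def q'_def sum.distrib flip: sum_divide_distrib)
    finally show ?thesis
      by (simp add: p_def ev_simps scaleR_conv_of_real)
  qed
  have L': "L2 \<sigma> (\<lambda>x. q' x - h x)" and eq: "nsq \<sigma> (\<lambda>x. q' x - h x) = nsq \<sigma> (\<lambda>x. q x - h x)"
  proof -
    have n: "cmod (q' x - h x) = cmod (q (- x) - h (- x))" for x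
    proof -
      have "cmod (cnj z - w) = cmod (z - cnj w)" for z w
        using complex_mod_cnj[of "z - cnj w"] by simp
      then show ?thesis using h(2) by (simp add: q'_def hermitian_def)
    qed
    have "integrable (distr \<sigma> borel uminus) (\<lambda>x. (cmod (q x - h x))\<^sup>2)"
      using L2_diff[OF L h(1)] finite_symmetric by (simp add: L2_def finite_symmetric_borel_measure_def)
    then have "integrable \<sigma> (\<lambda>x. (cmod (q (- x) - h (- x)))\<^sup>2)"
      by (subst (asm) integrable_distr_eq) auto
    then show "L2 \<sigma> (\<lambda>x. q' x - h x)" unfolding L2_def n by (simp add: q'_def)
    show "nsq \<sigma> (\<lambda>x. q' x - h x) = nsq \<sigma> (\<lambda>x. q x - h x)"
      unfolding nsq_def n by (rule integral_reflect) simp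
  qed
  have "nsq \<sigma> (\<lambda>x. ev p x - h x) = nsq \<sigma> (\<lambda>x. (1/2) *\<^sub>R ((q x - h x) + (q' x - h x)))"
    unfolding ev by (intro arg_cong[of _ _ "nsq \<sigma>"] ext) (simp add: scaleR_conv_of_real field_simps)
  also have "\<dots> = (1/2)\<^sup>2 * nsq \<sigma> (\<lambda>x. (q x - h x) + (q' x - h x))" by (rule nsq_scaleR)
  also have "\<dots> \<le> (1/2)\<^sup>2 * (2 * nsq \<sigma> (\<lambda>x. q x - h x) + 2 * nsq \<sigma> (\<lambda>x. q' x - h x))"
    by (intro mult_left_mono nsq_add_le L2_diff L h L') auto
  also have "\<dots> = nsq \<sigma> (\<lambda>x. q x - h x)" by (simp add: eq power2_eq_square)
  finally show ?thesis using N by (intro exI[of _ p]) (simp add: q_def)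
qed

end

section \<open>From the moments to a law on entire paths\<close>

lemma L2_mult_integrable:
  fixes f g :: "'a \<Rightarrow> complex"
  assumes "L2 M f" "L2 M g" shows "integrable M (\<lambda>x. f x * g x)"
proof (rule Bochner_Integration.integrable_bound)
  show "integrable M (\<lambda>x. (norm (f x))\<^sup>2 + (norm (g x))\<^sup>2)"
    using assms by (simp add: L2_def)
  show "(\<lambda>x. f x * g x) \<in> borel_measurable M" using assms by (auto simp: L2_def intro: borel_measurable_times)
  show "AE x in M. norm (f x * g x) \<le> norm ((norm (f x))\<^sup>2 + (norm (g x))\<^sup>2)"
  proof (rule AE_I2)
    fix x
    have "2 * (norm (f x) * norm (g x)) \<le> (norm (f x))\<^sup>2 + (norm (g x))\<^sup>2" "0 \<le> norm (f x) * norm (g x)"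
      using sum_squares_bound[of "norm (f x)" "norm (g x)"] by simp_all
    then show "norm (f x * g x) \<le> norm ((norm (f x))\<^sup>2 + (norm (g x))\<^sup>2)"
    proof -
      have "norm (f x) * norm (g x) \<le> (norm (f x))\<^sup>2 + (norm (g x))\<^sup>2"
        using \<open>2 * (norm (f x) * norm (g x)) \<le> _\<close> \<open>0 \<le> norm (f x) * norm (g x)\<close> by linarith
      then show ?thesis by (simp add: norm_mult)
    qed
  qed
qed

lemma abs_power_squared: "(\<bar>x\<bar> ^ n)\<^sup>2 = x ^ (2 * n)" for x :: real
  by (metis power2_abs power_mult mult.commute)

lemma L2_cnj: "L2 M f \<Longrightarrow> L2 M (\<lambda>x. cnj (f x))"
proof -
  have [measurable]: "cnj \<in> borel_measurable borel"
    by (intro borel_measurable_continuous_onI continuous_intros)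
  show "L2 M f \<Longrightarrow> L2 M (\<lambda>x. cnj (f x))" by (auto simp: L2_def)
qed

text \<open>The series of the terms \<open>(X n)\<^sup>2 / (4 ^ n * fact n)\<close> has finite
  expectation, so almost surely its terms are bounded.\<close>

lemma (in prob_space) AE_growth:
  assumes L: "\<And>n. L2 M (X n)" and b: "\<And>n. nsq M (X n) \<le> K0 * fact n"
  shows "AE w in M. growth (\<lambda>n. X n w)"
proof -
  have [measurable]: "X n \<in> borel_measurable M" for n using L by (simp add: L2_def)
  have K00: "0 \<le> K0" using b[of 0] nsq_nonneg[of M "X 0"] by simp
  have "(\<integral>\<^sup>+w. (\<Sum>n. ennreal ((X n w)\<^sup>2 / (4 ^ n * fact n))) \<partial>M) = (\<Sum>n. \<integral>\<^sup>+w. ennreal ((X n w)\<^sup>2 / (4 ^ n * fact n)) \<partial>M)"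
    by (rule nn_integral_suminf) measurable
  also have "\<dots> \<le> (\<Sum>n. ennreal (K0 * (1/4) ^ n))"
  proof (intro suminf_le allI)
    fix n
    have "(\<integral>\<^sup>+w. ennreal ((X n w)\<^sup>2 / (4 ^ n * fact n)) \<partial>M) = ennreal (nsq M (X n) / (4 ^ n * fact n))"
      using L2_integrable[OF L] by (subst nn_integral_eq_integral) (auto simp: nsq_def)
    also have "\<dots> \<le> ennreal (K0 * (1/4) ^ n)"
      using b[of n] by (intro ennreal_leI) (simp add: field_simps power_divide)
    finally show "(\<integral>\<^sup>+w. ennreal ((X n w)\<^sup>2 / (4 ^ n * fact n)) \<partial>M) \<le> ennreal (K0 * (1/4) ^ n)" .
  qed auto
  also have "\<dots> = ennreal (\<Sum>n. K0 * (1/4) ^ n)"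
    using K00 by (intro suminf_ennreal2 summable_mult summable_geometric) auto
  also have "\<dots> < \<infinity>" by simp
  finally have "(\<integral>\<^sup>+w. (\<Sum>n. ennreal ((X n w)\<^sup>2 / (4 ^ n * fact n))) \<partial>M) \<noteq> \<infinity>" by simp
  then have "AE w in M. (\<Sum>n. ennreal ((X n w)\<^sup>2 / (4 ^ n * fact n))) \<noteq> \<infinity>"
    by (intro nn_integral_PInf_AE) measurable
  then show ?thesis
  proof eventually_elim
    case (elim w)
    then have "summable (\<lambda>n. (X n w)\<^sup>2 / (4 ^ n * fact n))"
      by (intro summable_suminf_not_top) auto
    then have "Bseq (\<lambda>n. (X n w)\<^sup>2 / (4 ^ n * fact n))"
      by (rule summable_imp_Bseq)
    then obtain B where B: "B > 0" "\<And>n. norm ((X n w)\<^sup>2 / (4 ^ n * fact n)) \<le> B"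
      by (auto simp: Bseq_def)
    \<comment> \<open>\<open>sqrt B\<close> pays for the extra factor in \<open>C ^ Suc n\<close>,
      the summand 2 for \<open>2 ^ n = sqrt (4 ^ n)\<close>.\<close>
    define C where "C = nat \<lceil>sqrt B\<rceil> + 2"
    have C: "sqrt B \<le> real C" "2 \<le> real C" unfolding C_def by linarith+
    have "\<bar>X n w\<bar> \<le> real C ^ Suc n * sqrt (fact n)" for n
    proof -
      have "(X n w)\<^sup>2 \<le> B * (4 ^ n * fact n)"
        using B(2)[of n] by (simp add: field_simps)
      then have "\<bar>X n w\<bar> \<le> sqrt (B * (4 ^ n * fact n))"
        by (rule real_le_rsqrt[of "\<bar>X n w\<bar>", simplified])
      also have "\<dots> = sqrt B * (2 ^ n * sqrt (fact n))"
      proof -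
        have "(4::real) ^ n = (2 ^ n)\<^sup>2" by (simp add: power2_eq_square flip: power_mult_distrib)
        then show ?thesis by (simp add: real_sqrt_mult)
      qed
      also have "\<dots> \<le> real C * (real C ^ n * sqrt (fact n))"
        using C by (intro mult_mono power_mono) auto
      finally show ?thesis by simp
    qed
    then show ?case by (auto simp: growth_def growth_bound_def)
  qed
qed

context spectral_measure
begin

text \<open>The Taylor coefficients are made Gaussian with covariance
  \<open>Re (\<integral>x. ev p x * cnj (ev q x) \<partial>\<sigma>)\<close>, as the
  \<open>n\<close>-th derivative of the process at 0 corresponds to \<open>(\<i> * x) ^ n\<close>.
  Their variances are the even moments of \<open>\<sigma>\<close>, whose growth makes almost every
  coefficient sequence that of a path.\<close>

lemma path_law_exists:
  "\<exists>M. prob_space M \<and> sets M = sets path_algebra \<and>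
    (\<forall>p. (\<integral>f. cis (lin p f) \<partial>M) = exp (- nsq \<sigma> (ev p) / 2))"
proof -
  define B where "B p q = (\<integral>x. Re (ev p x * cnj (ev q x)) \<partial>\<sigma>)" for p q
  have int: "integrable \<sigma> (\<lambda>x. Re (ev p x * cnj (ev q x)))" for p q
    by (intro integrable_Re L2_mult_integrable L2_ev L2_cnj)
  have B_diag: "B p p = nsq \<sigma> (ev p)" for p
  proof -
    have "Re (z * cnj z) = (norm z)\<^sup>2" for z by (simp add: complex_mult_cnj cmod_power2)
    then show ?thesis unfolding B_def nsq_def by presburger
  qed
  have "psd_form B"
  proof (rule psd_form.intro)
    show "B (p + q) r = B p r + B q r" for p q r
      unfolding B_def by (subst Bochner_Integration.integral_add[OF int int, symmetric])
        (simp add: ev_simps algebra_simps)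
    show "B (smult c p) r = c * B p r" for c p r
      unfolding B_def by (subst integral_mult_right_zero[symmetric])
        (simp add: ev_simps algebra_simps)
    show "B p q = B q p" for p q
      unfolding B_def by (simp add: mult.commute)
    show "0 \<le> B p p" for p
      unfolding B_diag by (rule nsq_nonneg)
  qed
  from gaussian_sequence_exists[OF this, of "monom 1"]
  obtain Q :: "(nat \<Rightarrow> real) measure" where Q: "prob_space Q" "sets Q = sets (\<Pi>\<^sub>M i\<in>UNIV. borel)"
    and "\<And>F u. finite F \<Longrightarrow> (\<integral>a. cis (\<Sum>n\<in>F. u n * a n) \<partial>Q)
      = exp (- B (\<Sum>n\<in>F. smult (u n) (monom 1 n)) (\<Sum>n\<in>F. smult (u n) (monom 1 n)) / 2)"
    by blast
  then have ch: "finite F \<Longrightarrow> (\<integral>a. cis (\<Sum>n\<in>F. u n * a n) \<partial>Q)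
      = exp (- nsq \<sigma> (ev (\<Sum>n\<in>F. monom (u n) n)) / 2)" for F u
    by (simp add: B_diag smult_monom)
  interpret Q: prob_space Q by fact
  note Q(2)[measurable_cong]
  obtain K0 where K0: "\<And>n. (\<integral>x. x ^ (2 * n) \<partial>\<sigma>) \<le> K0 * fact n" using moment by auto
  have a2: "L2 Q (\<lambda>a. a n)" "nsq Q (\<lambda>a. a n) \<le> K0 * fact n" for n
  proof -
    have "nsq \<sigma> (ev (monom u n)) = u\<^sup>2 * (\<integral>x. x ^ (2 * n) \<partial>\<sigma>)" for u
    proof -
      have "(norm (ev (monom u n) x))\<^sup>2 = u\<^sup>2 * x ^ (2 * n)" for x
      proof -
        show ?thesis
          by (simp add: ev_simps norm_power norm_mult power_mult_distrib abs_power_squared)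
      qed
      then show ?thesis by (simp add: nsq_def)
    qed
    then have 2: "(\<integral>a. cis (u * a n) \<partial>Q) = exp (- u\<^sup>2 * (\<integral>x. x ^ (2 * n) \<partial>\<sigma>) / 2)" for u
      using ch[of "{n}" "\<lambda>_. u"] by simp
    have 1: "0 \<le> (\<integral>x. x ^ (2 * n) \<partial>\<sigma>)" by simp
    have 3: "(\<lambda>a. a n) \<in> borel_measurable Q" by measurable
    show "L2 Q (\<lambda>a. a n)" "nsq Q (\<lambda>a. a n) \<le> K0 * fact n"
      by (rule Q.gaussian_char(2)[OF 3 1 2], use Q.gaussian_char(3)[OF 3 1 2] K0 in simp)
  qed
  have AE_growth: "AE a in Q. growth a"
    using Q.AE_growth[of "\<lambda>n a. a n" K0] a2 by simp
  have tp[measurable]: "to_path \<in> Q \<rightarrow>\<^sub>M path_algebra"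
    using measurable_to_path by (simp add: measurable_cong_sets[OF Q(2) refl])
  have "(\<integral>f. cis (lin p f) \<partial>distr Q path_algebra to_path) = exp (- nsq \<sigma> (ev p) / 2)" for p
  proof -
    note lin_measurable[measurable]
    have "(\<integral>f. cis (lin p f) \<partial>distr Q path_algebra to_path) = (\<integral>a. cis (lin p (to_path a)) \<partial>Q)"
      unfolding cis_conv_exp by (rule integral_distr) measurable
    also have "\<dots> = (\<integral>a. cis (\<Sum>n\<le>degree p. coeff p n * a n) \<partial>Q)"
    proof (rule integral_cong_AE)
      show "AE a in Q. cis (lin p (to_path a)) = cis (\<Sum>n\<le>degree p. coeff p n * a n)"
        using AE_growth by eventually_elim (simp add: lin_def lift_poly_def coef_to_path)
    qed (unfold cis_conv_exp, measurable)
    also have "\<dots> = exp (- nsq \<sigma> (ev p) / 2)"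
      unfolding ch[OF finite_atMost] poly_as_sum_of_monoms ..
    finally show ?thesis .
  qed
  then show ?thesis
    using Q.prob_space_distr[OF tp] by (intro exI[of _ "distr Q path_algebra to_path"]) simp
qed

end

section \<open>The Gaussian space of the path law\<close>

locale gaussian_paths = spectral_measure +
  fixes M :: "path measure"
  assumes prob_M: "prob_space M" and sets_M: "sets M = sets path_algebra"
    and char_lin: "\<And>p. (\<integral>f. cis (lin p f) \<partial>M) = exp (- nsq \<sigma> (ev p) / 2)"
begin

sublocale M: prob_space M by (rule prob_M)

lemma sets_M_eq[measurable_cong]: "sets M = sets path_algebra" by (rule sets_M)

lemma space_M[simp]: "space M = paths"
  using sets_eq_imp_space_eq[OF sets_M] by simp

lemma coef_M[measurable]: "(\<lambda>f. coef f n) \<in> borel_measurable M"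
  using measurable_coef by (simp add: measurable_cong_sets[OF sets_M refl])

lemma lin_M[measurable]: "lin p \<in> borel_measurable M"
  using lin_measurable by (simp add: measurable_cong_sets[OF sets_M refl])

lemma lin_L2: "L2 M (lin p)" and nsq_lin: "nsq M (lin p) = nsq \<sigma> (ev p)"
proof -
  have "(\<integral>f. cis (u * lin p f) \<partial>M) = exp (- u\<^sup>2 * nsq \<sigma> (ev p) / 2)" for u
  proof -
    have "(\<integral>f. cis (u * lin p f) \<partial>M) = (\<integral>f. cis (lin (smult u p) f) \<partial>M)"
      by (simp add: lin_simps)
    also have "nsq \<sigma> (ev (smult u p)) = u\<^sup>2 * nsq \<sigma> (ev p)"
      using nsq_scaleR[of \<sigma> u "ev p"] by (simp add: ev_simps[abs_def])
    then have "(\<integral>f. cis (lin (smult u p) f) \<partial>M) = exp (- u\<^sup>2 * nsq \<sigma> (ev p) / 2)"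
      by (simp add: char_lin)
    finally show ?thesis .
  qed
  from M.gaussian_char[OF lin_M nsq_nonneg this]
  show "L2 M (lin p)" "nsq M (lin p) = nsq \<sigma> (ev p)" by auto
qed

text \<open>\<open>rep h g\<close> says that \<open>g\<close> is the value at \<open>h\<close> of the isometry from the Hermitian functions in
  \<open>L\<^sup>2(\<sigma>)\<close> onto the Gaussian space that maps \<open>(i x)\<^sup>n\<close> to the \<open>n\<close>-th Taylor coefficient of the path.\<close>

definition rep :: "(real \<Rightarrow> complex) \<Rightarrow> (path \<Rightarrow> real) \<Rightarrow> bool" where
  "rep h g \<longleftrightarrow> L2 \<sigma> h \<and> L2 M g \<and>
    (\<forall>e>0. \<exists>p. nsq \<sigma> (\<lambda>x. ev p x - h x) < e \<and> nsq M (\<lambda>f. lin p f - g f) < e)"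

lemma rep_L2: "rep h g \<Longrightarrow> L2 \<sigma> h" "rep h g \<Longrightarrow> L2 M g"
  by (auto simp: rep_def)

lemma rep_lin: "rep (ev p) (lin p)"
  unfolding rep_def by (auto intro!: L2_ev lin_L2 exI[of _ p] simp: nsq_def)

lemma rep_add:
  assumes "rep h g" "rep h' g'" shows "rep (\<lambda>x. h x + h' x) (\<lambda>f. g f + g' f)"
  unfolding rep_def
proof (intro conjI allI impI)
  have L: "L2 \<sigma> h" "L2 M g" "L2 \<sigma> h'" "L2 M g'" using assms by (auto simp: rep_def)
  then show "L2 \<sigma> (\<lambda>x. h x + h' x)" "L2 M (\<lambda>f. g f + g' f)" by (auto intro: L2_add)
  fix e :: real assume "e > 0"
  then have e: "e / 4 > 0" by simp
  obtain p where p: "nsq \<sigma> (\<lambda>x. ev p x - h x) < e / 4" "nsq M (\<lambda>f. lin p f - g f) < e / 4"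
    using assms(1) e unfolding rep_def by meson
  obtain p' where p': "nsq \<sigma> (\<lambda>x. ev p' x - h' x) < e / 4" "nsq M (\<lambda>f. lin p' f - g' f) < e / 4"
    using assms(2) e unfolding rep_def by meson
  have 1: "ev (p + p') x - (h x + h' x) = (ev p x - h x) + (ev p' x - h' x)" for x
    by (simp add: ev_simps)
  have 2: "lin (p + p') f - (g f + g' f) = (lin p f - g f) + (lin p' f - g' f)" for f
    by (simp add: lin_simps)
  have "nsq \<sigma> (\<lambda>x. ev (p + p') x - (h x + h' x)) < e"
    unfolding 1 using nsq_add_le[OF L2_diff[OF L2_ev[of p] L(1)] L2_diff[OF L2_ev[of p'] L(3)]] p p' by linarith
  moreover have "nsq M (\<lambda>f. lin (p + p') f - (g f + g' f)) < e"
    unfolding 2 using nsq_add_le[OF L2_diff[OF lin_L2[of p] L(2)] L2_diff[OF lin_L2[of p'] L(4)]] p p' by linarith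
  ultimately show "\<exists>p. nsq \<sigma> (\<lambda>x. ev p x - (h x + h' x)) < e \<and> nsq M (\<lambda>f. lin p f - (g f + g' f)) < e"
    by blast
qed

lemma rep_scale:
  assumes "rep h g" shows "rep (\<lambda>x. c *\<^sub>R h x) (\<lambda>f. c * g f)"
  unfolding rep_def
proof (intro conjI allI impI)
  have L: "L2 \<sigma> h" "L2 M g" using assms by (auto simp: rep_def)
  then show "L2 \<sigma> (\<lambda>x. c *\<^sub>R h x)" "L2 M (\<lambda>f. c * g f)" by (auto intro: L2_scaleR L2_rmult)
  fix e :: real assume e: "e > 0"
  have c: "c\<^sup>2 + 1 > 0" by (simp add: add_nonneg_pos)
  then obtain p where p: "nsq \<sigma> (\<lambda>x. ev p x - h x) < e / (c\<^sup>2 + 1)" "nsq M (\<lambda>f. lin p f - g f) < e / (c\<^sup>2 + 1)"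
    using assms e unfolding rep_def by (meson divide_pos_pos)
  have b: "c\<^sup>2 * y < e" if "y < e / (c\<^sup>2 + 1)" "0 \<le> y" for y
  proof -
    have "c\<^sup>2 * y \<le> (c\<^sup>2 + 1) * y" using that(2) by (intro mult_right_mono) auto
    also have "\<dots> < e" using that(1) c by (simp add: field_simps)
    finally show ?thesis .
  qed
  have 1: "ev (smult c p) x - c *\<^sub>R h x = c *\<^sub>R (ev p x - h x)" for x
    by (simp add: ev_simps scaleR_diff_right)
  have 2: "lin (smult c p) f - c * g f = c *\<^sub>R (lin p f - g f)" for f
    by (simp add: lin_simps right_diff_distrib)
  have "nsq \<sigma> (\<lambda>x. ev (smult c p) x - c *\<^sub>R h x) < e" "nsq M (\<lambda>f. lin (smult c p) f - c * g f) < e"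
    unfolding 1 2 nsq_scaleR by (intro b p nsq_nonneg)+
  then show "\<exists>p. nsq \<sigma> (\<lambda>x. ev p x - c *\<^sub>R h x) < e \<and> nsq M (\<lambda>f. lin p f - c * g f) < e" by blast
qed

lemma rep_diff:
  assumes "rep h g" "rep h' g'" shows "rep (\<lambda>x. h x - h' x) (\<lambda>f. g f - g' f)"
  using rep_add[OF assms(1) rep_scale[OF assms(2), of "-1"]] by simp

lemma rep_zero: "rep (\<lambda>x. 0) (\<lambda>f. 0)"
  using rep_lin[of 0] by (simp add: ev_simps[abs_def] lin_simps[abs_def])

lemma rep_sum:
  assumes "\<And>i. i \<in> I \<Longrightarrow> rep (h i) (g i)"
  shows "rep (\<lambda>x. \<Sum>i\<in>I. c i *\<^sub>R h i x) (\<lambda>f. \<Sum>i\<in>I. c i * g i f)"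
  using assms
proof (induction I rule: infinite_finite_induct)
  case (insert i I)
  have "rep (\<lambda>x. c i *\<^sub>R h i x + (\<Sum>j\<in>I. c j *\<^sub>R h j x)) (\<lambda>f. c i * g i f + (\<Sum>j\<in>I. c j * g j f))"
    by (intro rep_add rep_scale insert.IH insert.prems) auto
  then show ?case using insert.hyps by simp
qed (auto intro: rep_zero)

lemma rep_limit:
  assumes L: "L2 \<sigma> h" "L2 M g"
    and lim: "\<And>e. e > 0 \<Longrightarrow> \<exists>h' g'. rep h' g' \<and> nsq \<sigma> (\<lambda>x. h' x - h x) < e \<and> nsq M (\<lambda>f. g' f - g f) < e"
  shows "rep h g"
  unfolding rep_def
proof (intro conjI allI impI L)
  fix e :: real assume "e > 0"
  then have e: "e / 4 > 0" by simp
  obtain h' g' where r: "rep h' g'" and 1: "nsq \<sigma> (\<lambda>x. h' x - h x) < e / 4" "nsq M (\<lambda>f. g' f - g f) < e / 4"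
    using lim[OF e] by blast
  obtain p where p: "nsq \<sigma> (\<lambda>x. ev p x - h' x) < e / 4" "nsq M (\<lambda>f. lin p f - g' f) < e / 4"
    using r e unfolding rep_def by meson
  have "nsq \<sigma> (\<lambda>x. ev p x - h x) < e"
    using nsq_diff_triangle[OF L2_ev[of p] rep_L2(1)[OF r] L(1)] 1 p by linarith
  moreover have "nsq M (\<lambda>f. lin p f - g f) < e"
    using nsq_diff_triangle[OF lin_L2[of p] rep_L2(2)[OF r] L(2)] 1 p by linarith
  ultimately show "\<exists>p. nsq \<sigma> (\<lambda>x. ev p x - h x) < e \<and> nsq M (\<lambda>f. lin p f - g f) < e" by blast
qed

lemma rep_limit_seq:
  assumes r: "\<And>n. rep (h n) (g n)" and L: "L2 \<sigma> h'" "L2 M g'"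
    and "(\<lambda>n. nsq \<sigma> (\<lambda>x. h n x - h' x)) \<longlonglongrightarrow> 0" "(\<lambda>n. nsq M (\<lambda>f. g n f - g' f)) \<longlonglongrightarrow> 0"
  shows "rep h' g'"
proof (rule rep_limit[OF L])
  fix e :: real assume "e > 0"
  then have "eventually (\<lambda>n. nsq \<sigma> (\<lambda>x. h n x - h' x) < e \<and> nsq M (\<lambda>f. g n f - g' f) < e) sequentially"
    using assms(4,5) by (intro eventually_conj) (auto simp: order_tendsto_iff)
  then obtain n where "nsq \<sigma> (\<lambda>x. h n x - h' x) < e \<and> nsq M (\<lambda>f. g n f - g' f) < e"
    by (auto simp: eventually_sequentially)
  with r[of n] show "\<exists>h'' g''. rep h'' g'' \<and> nsq \<sigma> (\<lambda>x. h'' x - h' x) < e \<and> nsq M (\<lambda>f. g'' f - g' f) < e"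
    by blast
qed

lemma rep_seq:
  assumes "rep h g"
  obtains p where "(\<lambda>n. nsq \<sigma> (\<lambda>x. ev (p n) x - h x)) \<longlonglongrightarrow> 0" "(\<lambda>n. nsq M (\<lambda>f. lin (p n) f - g f)) \<longlonglongrightarrow> 0"
proof -
  have "\<exists>p. nsq \<sigma> (\<lambda>x. ev p x - h x) < inverse (real (Suc n)) \<and> nsq M (\<lambda>f. lin p f - g f) < inverse (real (Suc n))" for n
  proof -
    have "0 < inverse (real (Suc n))" by simp
    then show ?thesis using assms unfolding rep_def by blast
  qed
  then have "\<exists>p. \<forall>n. nsq \<sigma> (\<lambda>x. ev (p n) x - h x) < inverse (real (Suc n)) \<and> nsq M (\<lambda>f. lin (p n) f - g f) < inverse (real (Suc n))"
    by (intro choice allI)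
  then obtain p where p: "\<And>n. nsq \<sigma> (\<lambda>x. ev (p n) x - h x) < inverse (real (Suc n))"
    "\<And>n. nsq M (\<lambda>f. lin (p n) f - g f) < inverse (real (Suc n))" by blast
  show thesis
  proof (rule that[of p])
    show "(\<lambda>n. nsq \<sigma> (\<lambda>x. ev (p n) x - h x)) \<longlonglongrightarrow> 0"
      by (rule tendsto_sandwich[OF _ _ tendsto_const LIMSEQ_inverse_real_of_nat])
        (auto intro!: always_eventually nsq_nonneg less_imp_le[OF p(1)] simp del: of_nat_Suc)
    show "(\<lambda>n. nsq M (\<lambda>f. lin (p n) f - g f)) \<longlonglongrightarrow> 0"
      by (rule tendsto_sandwich[OF _ _ tendsto_const LIMSEQ_inverse_real_of_nat])
        (auto intro!: always_eventually nsq_nonneg less_imp_le[OF p(2)] simp del: of_nat_Suc)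
  qed
qed

text \<open>Both sides are continuous in L2, and for polynomials they agree by
  \<open>char_lin\<close>.\<close>

lemma rep_char:
  assumes "rep h g" shows "(\<integral>f. cis (g f) \<partial>M) = exp (- nsq \<sigma> h / 2)"
proof -
  obtain p where p: "(\<lambda>n. nsq \<sigma> (\<lambda>x. ev (p n) x - h x)) \<longlonglongrightarrow> 0" "(\<lambda>n. nsq M (\<lambda>f. lin (p n) f - g f)) \<longlonglongrightarrow> 0"
    using rep_seq[OF assms] .
  have "(\<lambda>n. \<integral>f. cis (lin (p n) f) \<partial>M) \<longlonglongrightarrow> (\<integral>f. cis (g f) \<partial>M)"
    by (rule M.cis_integral_tendsto[OF lin_L2 rep_L2(2)[OF assms] p(2)])
  moreover have "(\<lambda>n. nsq \<sigma> (ev (p n))) \<longlonglongrightarrow> nsq \<sigma> h"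
    by (rule nsq_tendsto[OF L2_ev rep_L2(1)[OF assms] p(1)])
  then have "(\<lambda>n. complex_of_real (exp (- nsq \<sigma> (ev (p n)) / 2))) \<longlonglongrightarrow> exp (- nsq \<sigma> h / 2)"
    by (intro tendsto_of_real tendsto_exp tendsto_divide tendsto_minus tendsto_const) auto
  ultimately show ?thesis
    unfolding char_lin using LIMSEQ_unique by blast
qed

lemma rep_gaussian:
  assumes "rep h g"
  shows "centered_gaussian M g" "nsq M g = nsq \<sigma> h"
    and "0 < nsq \<sigma> h \<Longrightarrow> distributed M lborel g (normal_density 0 (sqrt (nsq \<sigma> h)))"
proof -
  have m: "g \<in> borel_measurable M" using rep_L2(2)[OF assms] by (simp add: L2_def)
  have "(\<integral>f. cis (u * g f) \<partial>M) = exp (- u\<^sup>2 * nsq \<sigma> h / 2)" for u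
    using rep_char[OF rep_scale[OF assms, of u]] by (simp add: nsq_scaleR)
  from M.gaussian_char[OF m nsq_nonneg this]
  show "centered_gaussian M g" "nsq M g = nsq \<sigma> h"
    "0 < nsq \<sigma> h \<Longrightarrow> distributed M lborel g (normal_density 0 (sqrt (nsq \<sigma> h)))" by auto
qed

text \<open>The isometry sends the difference to a variable of norm 0. The almost sure identities
  between paths in \<open>self_similarity\<close> are obtained in this way, coefficient by
  coefficient, from almost everywhere identities between functions of the spectral variable.\<close>

lemma rep_unique:
  assumes "rep h g" "rep h' g'" "AE x in \<sigma>. h x = h' x"
  shows "AE f in M. g f = g' f"
proof -
  note d = rep_diff[OF assms(1,2)]
  have "nsq M (\<lambda>f. g f - g' f) = nsq \<sigma> (\<lambda>x. h x - h' x)" by (rule rep_gaussian(2)[OF d])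
  also have "\<dots> = nsq \<sigma> (\<lambda>x. 0 :: complex)"
    by (rule nsq_cong_AE) (use assms(3) rep_L2(1)[OF d] in \<open>auto simp: L2_def\<close>)
  finally have "nsq M (\<lambda>f. g f - g' f) = 0" by (simp add: nsq_def)
  from nsq_eq_0D[OF rep_L2(2)[OF d] this] show ?thesis by auto
qed

lemma rep_cong:
  assumes "rep h g" "\<And>x. h x = h' x" "AE f in M. g f = g' f" "g' \<in> borel_measurable M"
  shows "rep h' g'"
proof -
  have h: "h' = h" using assms(2) by auto
  have [measurable]: "g \<in> borel_measurable M" "g' \<in> borel_measurable M"
    using rep_L2(2)[OF assms(1)] assms(4) by (auto simp: L2_def)
  have "integrable M (\<lambda>f. (norm (g' f))\<^sup>2)"
    by (rule integrable_cong_AE_imp[OF L2_integrable[OF rep_L2(2)[OF assms(1)]]]) (use assms(3) in auto)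
  then have "L2 M g'" by (simp add: L2_def)
  moreover have "nsq M (\<lambda>f. lin p f - g' f) = nsq M (\<lambda>f. lin p f - g f)" for p
    by (rule nsq_cong_AE) (use assms(3) in auto)
  ultimately show ?thesis using assms(1) unfolding rep_def h by auto
qed

text \<open>Hermitian functions are those that the real polynomials \<open>ev p\<close> approximate.
  The rate \<open>1 / 4 ^ n\<close> is the one that \<open>L2_complete\<close> asks for.\<close>

lemma rep_exists:
  assumes h: "L2 \<sigma> h" "hermitian h" obtains g where "rep h g"
proof -
  have "\<exists>p. nsq \<sigma> (\<lambda>x. ev p x - h x) < 1 / 4 ^ n" for n :: nat
    by (rule ev_dense[OF h]) simp
  then have "\<exists>p. \<forall>n. nsq \<sigma> (\<lambda>x. ev (p n) x - h x) < 1 / 4 ^ n" by (intro choice allI)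
  then obtain p where p: "\<And>n. nsq \<sigma> (\<lambda>x. ev (p n) x - h x) < 1 / 4 ^ n" by blast
  have "nsq M (\<lambda>f. lin (p j) f - lin (p k) f) \<le> 2 / 4 ^ j + 2 / 4 ^ k" for j k
  proof -
    have "nsq M (\<lambda>f. lin (p j) f - lin (p k) f) = nsq \<sigma> (\<lambda>x. ev (p j) x - ev (p k) x)"
      using nsq_lin[of "p j - p k"] by (simp add: lin_simps[abs_def] ev_simps[abs_def])
    also have "\<dots> \<le> 2 * nsq \<sigma> (\<lambda>x. ev (p j) x - h x) + 2 * nsq \<sigma> (\<lambda>x. ev (p k) x - h x)"
      using nsq_diff_triangle[OF L2_ev[of "p j"] h(1) L2_ev[of "p k"]]
      by (simp add: nsq_minus_commute[of \<sigma> h])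
    also have "\<dots> \<le> 2 / 4 ^ j + 2 / 4 ^ k"
      using p[of j] p[of k] by simp
    finally show ?thesis .
  qed
  then obtain g where g: "L2 M g" "\<And>k. nsq M (\<lambda>f. lin (p k) f - g f) \<le> 2 / 4 ^ k"
    by (rule M.L2_complete[of "\<lambda>k. lin (p k)" 2, OF lin_L2]) blast
  have "rep h g"
  proof (rule rep_limit_seq[OF rep_lin h(1) g(1)])
    have z: "(\<lambda>k. c / 4 ^ k) \<longlonglongrightarrow> 0" for c :: real by (rule LIMSEQ_divide_realpow_zero) simp
    show "(\<lambda>n. nsq \<sigma> (\<lambda>x. ev (p n) x - h x)) \<longlonglongrightarrow> 0"
      by (rule tendsto_sandwich[OF _ _ tendsto_const z[of 1]])
        (auto intro!: always_eventually nsq_nonneg less_imp_le[OF p])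
    show "(\<lambda>n. nsq M (\<lambda>f. lin (p n) f - g f)) \<longlonglongrightarrow> 0"
      by (rule tendsto_sandwich[OF _ _ tendsto_const z[of 2]])
        (auto intro!: always_eventually nsq_nonneg g(2))
  qed
  then show thesis by (rule that)
qed

text \<open>By the isometry the functionals \<open>lin (p n)\<close> are Cauchy at the rate of the
  spectral convergence, and \<open>L2_limit\<close> identifies their limit with the pointwise one.
  This applies to translations, whose coefficients are given by a series on every single
  path.\<close>

lemma rep_series:
  assumes g: "g \<in> borel_measurable M" and lim: "AE f in M. (\<lambda>n. lin (p n) f) \<longlonglongrightarrow> g f"
    and h: "L2 \<sigma> h" "(\<lambda>n. nsq \<sigma> (\<lambda>x. ev (p n) x - h x)) \<longlonglongrightarrow> 0"
  shows "rep h g"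
proof -
  define e where "e n = 2 * nsq \<sigma> (\<lambda>x. ev (p n) x - h x)" for n
  have e0: "e \<longlonglongrightarrow> 0" unfolding e_def[abs_def] using tendsto_mult_right_zero[OF h(2)] .
  have "nsq M (\<lambda>f. lin (p j) f - lin (p k) f) \<le> e j + e k" for j k
  proof -
    have "nsq M (\<lambda>f. lin (p j) f - lin (p k) f) = nsq \<sigma> (\<lambda>x. ev (p j) x - ev (p k) x)"
      using nsq_lin[of "p j - p k"] by (simp add: lin_simps[abs_def] ev_simps[abs_def])
    also have "\<dots> \<le> 2 * nsq \<sigma> (\<lambda>x. ev (p j) x - h x) + 2 * nsq \<sigma> (\<lambda>x. ev (p k) x - h x)"
      using nsq_diff_triangle[OF L2_ev[of "p j"] h(1) L2_ev[of "p k"]]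
      by (simp add: nsq_minus_commute[of \<sigma> h])
    finally show ?thesis by (simp add: e_def)
  qed
  note lim' = L2_limit[of M "\<lambda>n. lin (p n)" g e, OF lin_L2 g lim this e0]
  show ?thesis
  proof (rule rep_limit_seq[OF rep_lin h(1) lim'(1) h(2)])
    show "(\<lambda>n. nsq M (\<lambda>f. lin (p n) f - g f)) \<longlonglongrightarrow> 0"
      by (rule tendsto_sandwich[OF _ _ tendsto_const e0])
        (auto intro!: always_eventually nsq_nonneg lim'(2))
  qed
qed

lemma translate_coef_measurable[measurable]: "(\<lambda>f. coef (translate t f) n) \<in> borel_measurable M"
proof -
  have "(\<lambda>f. translate t f) \<in> path_algebra \<rightarrow>\<^sub>M path_algebra"
    using measurable_compose[OF measurable_Pair1'[of t borel] measurable_translate] by simp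
  from measurable_compose[OF this measurable_coef]
  show ?thesis by (simp add: measurable_cong_sets[OF sets_M refl])
qed

lemma rep_translate: "rep (\<lambda>x. (\<i> * complex_of_real x) ^ n * cis (t * x)) (\<lambda>f. coef (translate t f) n)"
proof (rule rep_series[OF translate_coef_measurable _ L2_exp_character taylor_tendsto])
  show "AE f in M. (\<lambda>N. lin (taylor_poly t n N) f) \<longlonglongrightarrow> coef (translate t f) n"
  proof (rule AE_I2)
    fix f assume "f \<in> space M"
    then have f: "f \<in> paths" by simp
    have "lin (taylor_poly t n N) f = (\<Sum>k<N. coef f (n + k) / fact k * t ^ k)" for N
      unfolding taylor_poly_def lin_simps by (simp add: mult_ac)
    then show "(\<lambda>N. lin (taylor_poly t n N) f) \<longlonglongrightarrow> coef (translate t f) n"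
      using path_sums[OF f, of n t] by (simp add: translate_path(2)[OF f] sums_def)
  qed
qed

end

section \<open>Translations and rescalings of paths\<close>

text \<open>Two maps that are inverse to each other almost everywhere restrict to a bijection
  between the sets where \<open>R' (R f) = f\<close> and where \<open>R (R' f) = f\<close>. These
  sets are measurable because equality of paths is tested on countably many coefficients.\<close>

lemma isomorphic_flowsI:
  assumes M: "prob_space M" "sets M = sets path_algebra"
    and R: "R \<in> M \<rightarrow>\<^sub>M M" "R' \<in> M \<rightarrow>\<^sub>M M" and mp: "distr M M R = M" "distr M M R' = M"
    and inv: "AE f in M. R' (R f) = f" "AE f in M. R (R' f) = f"
    and eqv: "\<And>t. AE f in M. R (T t f) = S t (R f)"
    and T: "\<And>t. T t \<in> M \<rightarrow>\<^sub>M M" and S: "\<And>t. S t \<in> M \<rightarrow>\<^sub>M M"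
  shows "isomorphic_flows M T M S"
proof -
  interpret prob_space M by fact
  note [measurable] = R T S and M(2)[measurable_cong]
  have sp: "space M = paths" using sets_eq_imp_space_eq[OF M(2)] by simp
  have cm[measurable]: "(\<lambda>f. coef f n) \<in> borel_measurable M" for n
    using measurable_coef by (simp add: measurable_cong_sets[OF M(2) refl])
  have eqm: "Measurable.pred M (\<lambda>f. g f = f)" if [measurable]: "g \<in> M \<rightarrow>\<^sub>M M" for g
  proof -
    have "(\<forall>n. coef (g f) n = coef f n) \<longleftrightarrow> g f = f" if "f \<in> space M" for f
      using measurable_space[OF \<open>g \<in> M \<rightarrow>\<^sub>M M\<close> that] that paths_eqI sp by metis
    moreover have "Measurable.pred M (\<lambda>f. coef (g f) n = coef f n)" for n
      using borel_measurable_eq[OF measurable_compose[OF that cm] cm, of n n] by (simp add: pred_def)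
    then have "Measurable.pred M (\<lambda>f. \<forall>n. coef (g f) n = coef f n)" by (rule pred_intros_countable)
    ultimately show ?thesis by (simp cong: measurable_cong)
  qed
  define X where "X = {f \<in> space M. R' (R f) = f}"
  define Y where "Y = {f \<in> space M. R (R' f) = f}"
  have X[measurable]: "X \<in> sets M" unfolding X_def using eqm[of "\<lambda>f. R' (R f)"] by simp
  have Y[measurable]: "Y \<in> sets M" unfolding Y_def using eqm[of "\<lambda>f. R (R' f)"] by simp
  have AEX: "AE f in M. f \<in> X" using inv(1) AE_space by eventually_elim (simp add: X_def)
  have AEY: "AE f in M. f \<in> Y" using inv(2) AE_space by eventually_elim (simp add: Y_def)
  have RXY: "R f \<in> Y" if "f \<in> X" for f
    using that measurable_space[OF R(1)] by (auto simp: X_def Y_def)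
  have RYX: "R' f \<in> X" if "f \<in> Y" for f
    using that measurable_space[OF R(2)] by (auto simp: X_def Y_def)
  have inj: "inj_on R X" by (rule inj_on_inverseI[of _ R']) (simp add: X_def)
  have bij: "bij_betw R X Y"
    by (rule bij_betwI[of _ _ _ R']) (auto simp: RXY RYX, auto simp: X_def Y_def)
  have the_inv: "the_inv_into X R y = R' y" if "y \<in> Y" for y
    by (rule the_inv_into_f_eq[OF inj _ RYX[OF that]]) (use that in \<open>simp add: Y_def\<close>)
  have Rm: "R \<in> restrict_space M X \<rightarrow>\<^sub>M restrict_space M Y"
    by (rule measurable_restrict_space3) (use RXY in auto)
  have R'm: "R' \<in> restrict_space M Y \<rightarrow>\<^sub>M restrict_space M X"
    by (rule measurable_restrict_space3) (use RYX in auto)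
  have spY: "space (restrict_space M Y) = Y" using sets.sets_into_space[OF Y] by (auto simp: space_restrict_space)
  have spX: "space (restrict_space M X) = X" using sets.sets_into_space[OF X] by (auto simp: space_restrict_space)
  show ?thesis
    unfolding isomorphic_flows_def
  proof (rule bexI[OF _ X], rule bexI[OF _ Y], rule exI[of _ R], intro conjI allI)
    show "emeasure M (space M - X) = 0" "emeasure M (space M - Y) = 0"
      using AEX AEY by (auto simp: AE_iff_measurable[OF _ refl] set_diff_eq)
    show "bij_betw R X Y" by (rule bij)
    show "R \<in> restrict_space M X \<rightarrow>\<^sub>M restrict_space M Y" by (rule Rm)
    show "the_inv_into X R \<in> restrict_space M Y \<rightarrow>\<^sub>M restrict_space M X"
      using R'm by (subst measurable_cong[of _ _ R']) (auto simp: spY the_inv)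
    show "distr (restrict_space M X) (restrict_space M Y) R = restrict_space M Y"
    proof (rule measure_eqI)
      fix A assume "A \<in> sets (distr (restrict_space M X) (restrict_space M Y) R)"
      then have A': "A \<in> sets (restrict_space M Y)" by simp
      then have A: "A \<in> sets M" "A \<subseteq> Y" using sets.sets_into_space[OF A'] by (auto simp: sets_restrict_space_iff spY)
      have "emeasure (distr (restrict_space M X) (restrict_space M Y) R) A = emeasure (restrict_space M X) (R -` A \<inter> X)"
        by (simp add: emeasure_distr[OF Rm A'] spX)
      also have "\<dots> = emeasure M (R -` A \<inter> X)"
        by (rule emeasure_restrict_space) auto
      also have "\<dots> = emeasure M (R -` A \<inter> space M)"
      proof (rule emeasure_eq_AE)
        show "AE f in M. f \<in> R -` A \<inter> X \<longleftrightarrow> f \<in> R -` A \<inter> space M"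
          using AEX by eventually_elim (simp add: X_def)
        show "R -` A \<inter> space M \<in> sets M" by (rule measurable_sets[OF R(1) A(1)])
        then have "(R -` A \<inter> space M) \<inter> X \<in> sets M" by (rule sets.Int[OF _ X])
        moreover have "(R -` A \<inter> space M) \<inter> X = R -` A \<inter> X" by (auto simp: X_def)
        ultimately show "R -` A \<inter> X \<in> sets M" by simp
      qed
      also have "\<dots> = emeasure (distr M M R) A" using A by (simp add: emeasure_distr)
      also have "\<dots> = emeasure (restrict_space M Y) A" using A by (simp add: mp emeasure_restrict_space)
      finally show "emeasure (distr (restrict_space M X) (restrict_space M Y) R) A = emeasure (restrict_space M Y) A" .
    qed simp
    fix t
    \<comment> \<open>The intertwining relation is needed at the point \<open>R' f\<close>; it holds
      there almost surely because \<open>R'\<close> preserves the measure.\<close>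
    have "AE f in distr M M R'. R (T t f) = S t (R f)" unfolding mp by (rule eqv)
    then have "AE f in M. R (T t (R' f)) = S t (R (R' f))" by (rule AE_distrD[OF R(2)])
    then show "AE y in M. R (T t (the_inv_into X R y)) = S t y"
      using AEY by eventually_elim (simp add: the_inv, simp add: Y_def)
  qed
qed

context gaussian_paths
begin

lemma coef_generates: "sets M = sigma_sets (space M) {(\<lambda>f. coef f i) -` {u<..} \<inter> space M | i u. True}"
  unfolding sets_M sets_path_algebra_generator by simp

lemma sum_coef_eq_lin: "finite F \<Longrightarrow> (\<Sum>i\<in>F. u i * coef f i) = lin (\<Sum>i\<in>F. monom (u i) i) f"
  by (simp add: lin_simps)

text \<open>The hypothesis says that multiplication by \<open>s\<close> carries the measure with
  density \<open>(cmod (h x))\<^sup>2\<close> to \<open>\<sigma>\<close>. So \<open>h\<close> is the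
  multiplier that makes composition with this multiplication isometric.\<close>

lemma nsq_scale:
  fixes h k :: "real \<Rightarrow> complex"
  assumes [measurable]: "h \<in> borel_measurable borel" "k \<in> borel_measurable borel"
    and sc: "\<And>g. g \<in> borel_measurable borel \<Longrightarrow>
      (\<integral>\<^sup>+x. g (s * x) * ennreal ((cmod (h x))\<^sup>2) \<partial>\<sigma>) = (\<integral>\<^sup>+x. g x \<partial>\<sigma>)"
  shows "nsq \<sigma> (\<lambda>x. h x * k (s * x)) = nsq \<sigma> k"
    and "L2 \<sigma> k \<Longrightarrow> L2 \<sigma> (\<lambda>x. h x * k (s * x))"
proof -
  have eq: "(\<integral>\<^sup>+x. ennreal ((cmod (h x * k (s * x)))\<^sup>2) \<partial>\<sigma>) = (\<integral>\<^sup>+x. ennreal ((cmod (k x))\<^sup>2) \<partial>\<sigma>)"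
    using sc[of "\<lambda>x. ennreal ((cmod (k x))\<^sup>2)"]
    by (simp add: norm_mult power_mult_distrib ennreal_mult' mult.commute)
  show "nsq \<sigma> (\<lambda>x. h x * k (s * x)) = nsq \<sigma> k"
    unfolding nsq_def by (subst (1 2) integral_eq_nn_integral) (auto simp: eq)
  assume "L2 \<sigma> k"
  then have "(\<integral>\<^sup>+x. ennreal ((cmod (k x))\<^sup>2) \<partial>\<sigma>) < \<infinity>"
    by (subst nn_integral_eq_integral) (auto simp: L2_def)
  then show "L2 \<sigma> (\<lambda>x. h x * k (s * x))"
    unfolding L2_def by (auto intro!: integrableI_nonneg simp: eq)
qed

text \<open>By the isometry the functionals \<open>lin p (R f)\<close> have the same characteristic
  integrals as \<open>lin p f\<close>, and the multiplicative class turns this into invariance of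
  the law. Translations, with \<open>s = 1\<close> and \<open>h x = cis (t * x)\<close>, and
  rescalings are both instances.\<close>

lemma transport:
  assumes R: "R \<in> M \<rightarrow>\<^sub>M path_algebra" and h[measurable]: "h \<in> borel_measurable borel"
    and rep: "\<And>m. rep (\<lambda>x. h x * (\<i> * complex_of_real (s * x)) ^ m) (\<lambda>f. coef (R f) m)"
    and sc: "\<And>g. g \<in> borel_measurable borel \<Longrightarrow>
      (\<integral>\<^sup>+x. g (s * x) * ennreal ((cmod (h x))\<^sup>2) \<partial>\<sigma>) = (\<integral>\<^sup>+x. g x \<partial>\<sigma>)"
  shows "distr M M R = M" and "\<And>k g. rep k g \<Longrightarrow> rep (\<lambda>x. h x * k (s * x)) (\<lambda>f. g (R f))"
proof -
  have RM[measurable]: "R \<in> M \<rightarrow>\<^sub>M M" using R by (simp add: measurable_cong_sets[OF refl sets_M])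
  have rl: "rep (\<lambda>x. h x * ev p (s * x)) (\<lambda>f. lin p (R f))" for p
  proof (rule rep_cong[OF rep_sum[of "{..degree p}", OF rep]])
    show "(\<Sum>i\<in>{..degree p}. coeff p i *\<^sub>R (h x * (\<i> * complex_of_real (s * x)) ^ i)) = h x * ev p (s * x)" for x
      by (simp add: ev_def lift_poly_def sum_distrib_left)
    show "AE f in M. (\<Sum>i\<in>{..degree p}. coeff p i * coef (R f) i) = lin p (R f)"
      by (simp add: lin_def lift_poly_def)
  qed measurable
  have ch: "(\<integral>f. cis (lin p (R f)) \<partial>M) = (\<integral>f. cis (lin p f) \<partial>M)" for p
    unfolding rep_char[OF rl] char_lin using nsq_scale(1)[OF h ev_measurable sc] by simp
  show mp: "distr M M R = M"
  proof (rule measure_eqI)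
    define V where "V = {g :: path \<Rightarrow> complex. integrable M g \<and> integrable M (\<lambda>f. g (R f)) \<and>
      (\<integral>f. g (R f) \<partial>M) = (\<integral>f. g f \<partial>M)}"
    interpret multiplicative_class M "\<lambda>i f. coef f i" V
    proof
      show "(\<lambda>f. coef f i) \<in> borel_measurable M" for i by measurable
      show "sets M = sigma_sets (space M) {(\<lambda>f. coef f i) -` {u<..} \<inter> space M |i u. True}"
        by (rule coef_generates)
      show "(\<lambda>f. cis (\<Sum>i\<in>F. u i * coef f i)) \<in> V" if "finite F" for F u
      proof -
        have i: "integrable M (\<lambda>f. cis (lin p f))" "integrable M (\<lambda>f. cis (lin p (R f)))" for p
          unfolding cis_conv_exp by (rule M.integrable_const_bound[of _ 1]; simp)+
        then show ?thesis unfolding V_def by (simp add: sum_coef_eq_lin[OF that] ch)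
      qed
      show "(\<lambda>x. f x + g x) \<in> V" if "f \<in> V" "g \<in> V" for f g
        using that by (auto simp: V_def)
      show "(\<lambda>x. c * f x) \<in> V" if "f \<in> V" for f c
        using that by (auto simp: V_def)
      show "g \<in> V" if f: "\<And>n. f n \<in> V" "\<And>n. f n \<in> borel_measurable M" "g \<in> borel_measurable M"
        and b: "\<And>n x. x \<in> space M \<Longrightarrow> cmod (f n x) \<le> B"
        and lim: "\<And>x. x \<in> space M \<Longrightarrow> (\<lambda>n. f n x) \<longlonglongrightarrow> g x" for f g B
      proof -
        have [measurable]: "\<And>n. f n \<in> borel_measurable M" "g \<in> borel_measurable M" using f by auto
        have RS: "R x \<in> space M" if "x \<in> space M" for x using measurable_space[OF RM that] .
        have 1: "integrable M g" "(\<lambda>n. \<integral>x. f n x \<partial>M) \<longlonglongrightarrow> (\<integral>x. g x \<partial>M)"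
          by (rule integrable_dominated_convergence[where w = "\<lambda>_. B" and s = f]
              integral_dominated_convergence[where w = "\<lambda>_. B" and s = f]; use b lim in auto)+
        have 2: "integrable M (\<lambda>x. g (R x))" "(\<lambda>n. \<integral>x. f n (R x) \<partial>M) \<longlonglongrightarrow> (\<integral>x. g (R x) \<partial>M)"
          by (rule integrable_dominated_convergence[where w = "\<lambda>_. B" and s = "\<lambda>n x. f n (R x)"]
              integral_dominated_convergence[where w = "\<lambda>_. B" and s = "\<lambda>n x. f n (R x)"];
              use b lim RS in auto)+
        have "(\<integral>x. f n (R x) \<partial>M) = (\<integral>x. f n x \<partial>M)" for n using f(1)[of n] by (simp add: V_def)
        then have "(\<integral>x. g (R x) \<partial>M) = (\<integral>x. g x \<partial>M)" using LIMSEQ_unique 1(2) 2(2) by simp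
        then show ?thesis using 1 2 by (simp add: V_def)
      qed
    qed
    fix A assume "A \<in> sets (distr M M R)"
    then have A[measurable]: "A \<in> sets M" by simp
    have "(\<integral>f. indicator A (R f) \<partial>M) = (\<integral>f. indicator A f \<partial>M :: complex)"
      using indicator_in[OF A] by (simp add: V_def)
    moreover have "(\<integral>f. indicator A (R f) \<partial>M) = complex_of_real (measure M (R -` A \<inter> space M))"
    proof -
      have "(\<integral>f. indicator A (R f) \<partial>M) = (\<integral>f. complex_of_real (indicator (R -` A \<inter> space M) f) \<partial>M)"
        by (rule Bochner_Integration.integral_cong) (auto split: split_indicator)
      then show ?thesis by simp
    qed
    moreover have "(\<integral>f. indicator A f \<partial>M) = complex_of_real (measure M A)"
    proof -
      have "(\<integral>f. indicator A f \<partial>M) = (\<integral>f. complex_of_real (indicator A f) \<partial>M)"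
        by (rule Bochner_Integration.integral_cong) (auto split: split_indicator)
      then show ?thesis using sets.sets_into_space[OF A] by (simp add: Int_absorb2)
    qed
    ultimately have "measure M (R -` A \<inter> space M) = measure M A" by simp
    then show "emeasure (distr M M R) A = emeasure M A"
      by (simp add: emeasure_distr M.emeasure_eq_measure)
  qed simp
  fix k g assume kg: "rep k g"
  have [measurable]: "k \<in> borel_measurable borel" "g \<in> borel_measurable M"
    using rep_L2[OF kg] by (auto simp: L2_def)
  have mpi: "nsq M (\<lambda>f. g' (R f)) = nsq M g'" and mpL: "L2 M g' \<Longrightarrow> L2 M (\<lambda>f. g' (R f))"
    if [measurable]: "g' \<in> borel_measurable M" for g' :: "path \<Rightarrow> real"
  proof -
    have "nsq M g' = nsq (distr M M R) g'" by (simp add: mp)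
    then show "nsq M (\<lambda>f. g' (R f)) = nsq M g'" unfolding nsq_def by (simp add: integral_distr)
    assume "L2 M g'"
    then have "integrable (distr M M R) (\<lambda>f. (norm (g' f))\<^sup>2)" by (simp add: mp L2_def)
    then show "L2 M (\<lambda>f. g' (R f))" by (simp add: L2_def integrable_distr_eq)
  qed
  show "rep (\<lambda>x. h x * k (s * x)) (\<lambda>f. g (R f))"
  proof (rule rep_limit)
    show "L2 \<sigma> (\<lambda>x. h x * k (s * x))" by (rule nsq_scale(2)[OF h _ sc rep_L2(1)[OF kg]]) simp
    show "L2 M (\<lambda>f. g (R f))" by (rule mpL[OF _ rep_L2(2)[OF kg]]) simp
    fix e :: real assume "e > 0"
    then obtain p where p: "nsq \<sigma> (\<lambda>x. ev p x - k x) < e" "nsq M (\<lambda>f. lin p f - g f) < e"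
      using kg unfolding rep_def by blast
    have "nsq \<sigma> (\<lambda>x. h x * ev p (s * x) - h x * k (s * x)) = nsq \<sigma> (\<lambda>x. ev p x - k x)"
      using nsq_scale(1)[OF h _ sc, of "\<lambda>x. ev p x - k x"] by (simp add: right_diff_distrib)
    moreover have "nsq M (\<lambda>f. lin p (R f) - g (R f)) = nsq M (\<lambda>f. lin p f - g f)"
      using mpi[of "\<lambda>f. lin p f - g f"] by simp
    ultimately show "\<exists>h' g'. rep h' g' \<and> nsq \<sigma> (\<lambda>x. h' x - h x * k (s * x)) < e \<and> nsq M (\<lambda>f. g' f - g (R f)) < e"
      using p rl[of p] by (intro exI[of _ "\<lambda>x. h x * ev p (s * x)"] exI[of _ "\<lambda>f. lin p (R f)"]) simp
  qed
qed

lemma translate_measurable: "translate t \<in> M \<rightarrow>\<^sub>M path_algebra"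
proof -
  have "(\<lambda>f. translate t f) \<in> path_algebra \<rightarrow>\<^sub>M path_algebra"
    using measurable_compose[OF measurable_Pair1'[of t borel] measurable_translate] by simp
  then show ?thesis by (simp add: measurable_cong_sets[OF sets_M refl])
qed

lemma translate_M[measurable]: "translate t \<in> M \<rightarrow>\<^sub>M M"
  using translate_measurable by (simp add: measurable_cong_sets[OF refl sets_M])

lemma translate_mp: "distr M M (translate t) = M"
  and rep_translate_comp: "rep k g \<Longrightarrow> rep (\<lambda>x. cis (t * x) * k x) (\<lambda>f. g (translate t f))"
proof -
  have cm: "(\<lambda>x. cis (t * x)) \<in> borel_measurable borel"
    unfolding cis_conv_exp by measurable
  have r: "rep (\<lambda>x. cis (t * x) * (\<i> * complex_of_real (1 * x)) ^ m) (\<lambda>f. coef (translate t f) m)" for m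
    using rep_translate[of m t] by (simp add: mult.commute)
  have sc: "(\<integral>\<^sup>+x. g (1 * x) * ennreal ((cmod (cis (t * x)))\<^sup>2) \<partial>\<sigma>) = (\<integral>\<^sup>+x. g x \<partial>\<sigma>)" for g
    by simp
  note tr = transport[OF translate_measurable cm r sc]
  show "distr M M (translate t) = M" by (rule tr(1))
  show "rep k g \<Longrightarrow> rep (\<lambda>x. cis (t * x) * k x) (\<lambda>f. g (translate t f))"
    using tr(2)[of k g] by simp
qed

section \<open>The translation flow is a nonatomic Gaussian flow\<close>

lemma coef_0: "coef f 0 = f 0"
  by (simp add: coef_def)

lemma rep_eval: "rep (\<lambda>x. cis (t * x)) (\<lambda>f. translate t f 0)"
  using rep_translate[of 0 t] by (simp add: coef_0)

lemma rep_eval_0: "rep (\<lambda>x. 1) (\<lambda>f. f 0)"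
  using rep_eval[of 0] by (simp add: translate_0)

text \<open>Polarisation expresses the covariance through norms, which the isometry moves to the
  spectral side. The imaginary part vanishes by the symmetry of \<open>\<sigma>\<close>.\<close>

lemma evaluation_covariance:
  "complex_of_real (\<integral>f. translate t f 0 * f 0 \<partial>M) = (\<integral>u. cis (t * u) \<partial>\<sigma>)"
proof -
  let ?X = "\<lambda>f. translate t f 0" and ?Y = "\<lambda>f. f 0 :: real"
  have L: "L2 M ?X" "L2 M ?Y" using rep_L2(2)[OF rep_eval] rep_L2(2)[OF rep_eval_0] by auto
  have "2 * (\<integral>f. ?X f * ?Y f \<partial>M) = nsq M (\<lambda>f. ?X f + ?Y f) - nsq M ?X - nsq M ?Y"
  proof -
    have "2 * (\<integral>f. ?X f * ?Y f \<partial>M) = (\<integral>f. (norm (?X f + ?Y f))\<^sup>2 - (norm (?X f))\<^sup>2 - (norm (?Y f))\<^sup>2 \<partial>M)"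
      unfolding integral_mult_right_zero[symmetric]
      by (rule Bochner_Integration.integral_cong) (auto simp: power2_sum)
    also have "\<dots> = nsq M (\<lambda>f. ?X f + ?Y f) - nsq M ?X - nsq M ?Y"
      unfolding nsq_def using L2_integrable[OF L2_add[OF L]] L2_integrable[OF L(1)] L2_integrable[OF L(2)]
      by (subst Bochner_Integration.integral_diff; (subst Bochner_Integration.integral_diff)?) auto
    finally show ?thesis .
  qed
  also have "\<dots> = nsq \<sigma> (\<lambda>x. cis (t * x) + 1) - nsq \<sigma> (\<lambda>x. cis (t * x)) - nsq \<sigma> (\<lambda>x. 1 :: complex)"
    using rep_gaussian(2)[OF rep_add[OF rep_eval rep_eval_0]] rep_gaussian(2)[OF rep_eval]
      rep_gaussian(2)[OF rep_eval_0] by simp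
  also have "\<dots> = (\<integral>x. (norm (cis (t * x) + 1))\<^sup>2 - (norm (cis (t * x)))\<^sup>2 - (norm (1 :: complex))\<^sup>2 \<partial>\<sigma>)"
    unfolding nsq_def
    using L2_integrable[OF rep_L2(1)[OF rep_add[OF rep_eval[of t] rep_eval_0]]]
    by (subst Bochner_Integration.integral_diff; (subst Bochner_Integration.integral_diff)?) auto
  also have "\<dots> = (\<integral>x. 2 * cos (t * x) \<partial>\<sigma>)"
    by (rule Bochner_Integration.integral_cong) (auto simp: cmod_power2 power2_sum algebra_simps)
  finally have 1: "(\<integral>f. ?X f * ?Y f \<partial>M) = (\<integral>x. cos (t * x) \<partial>\<sigma>)" by simp
  have ic: "integrable \<sigma> (\<lambda>x. cis (t * x))"
    unfolding cis_conv_exp by (rule integrable_const_bound[of _ 1]) auto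
  have "Im (\<integral>x. cis (t * x) \<partial>\<sigma>) = (\<integral>x. sin (t * x) \<partial>\<sigma>)"
    using integral_Im[OF ic] by simp
  also have "\<dots> = - (\<integral>x. sin (t * x) \<partial>\<sigma>)"
    using integral_reflect[of "\<lambda>x. sin (t * x)"] by simp
  finally have "Im (\<integral>x. cis (t * x) \<partial>\<sigma>) = 0"
    using integral_Im[OF ic] by simp
  then show ?thesis using integral_Re[OF ic] 1 by (simp add: complex_eq_iff)
qed

text \<open>On an atom the variable \<open>f 0\<close> would be almost surely constant, since each
  rational threshold leaves one side of the atom null. But a nondegenerate Gaussian variable has
  null level sets.\<close>

lemma nonatomic_M:
  assumes pos: "0 < measure \<sigma> UNIV"
  shows "nonatomic M"
  unfolding nonatomic_def
proof (rule notI, elim bexE conjE)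
  fix A assume A[measurable]: "A \<in> sets M" and A0: "0 < emeasure M A"
    and atom: "\<forall>B\<in>sets M. B \<subseteq> A \<longrightarrow> emeasure M B = 0 \<or> emeasure M B = emeasure M A"
  define X where "X f = f 0" for f :: path
  have X[measurable]: "X \<in> borel_measurable M"
    unfolding X_def using rep_L2(2)[OF rep_eval_0] by (simp add: L2_def)
  have "nsq \<sigma> (\<lambda>x. 1 :: complex) = measure \<sigma> UNIV" by (simp add: nsq_def)
  then obtain v where d: "distributed M lborel X (normal_density 0 v)"
    using rep_gaussian(3)[OF rep_eval_0] pos unfolding X_def by auto
  have null: "emeasure M {f \<in> space M. X f = c} = 0" for c
  proof -
    have "emeasure M (X -` {c} \<inter> space M) = (\<integral>\<^sup>+x. ennreal (normal_density 0 v x) * indicator {c} x \<partial>lborel)"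
      by (rule distributed_emeasure[OF d]) simp
    also have "\<dots> = (\<integral>\<^sup>+(x::real). 0 \<partial>lborel)"
    proof (rule nn_integral_cong_AE)
      show "AE x in lborel. ennreal (normal_density 0 v x) * indicator {c} x = 0"
        using AE_lborel_singleton[of c] by eventually_elim simp
    qed
    finally have "emeasure M (X -` {c} \<inter> space M) = 0" by simp
    moreover have "X -` {c} \<inter> space M = {f \<in> space M. X f = c}" by auto
    ultimately show ?thesis by simp
  qed
  have half: "emeasure M (A \<inter> {f \<in> space M. X f \<le> q}) = 0 \<or> emeasure M (A \<inter> {f \<in> space M. \<not> X f \<le> q}) = 0" for q
  proof (rule ccontr)
    let ?B = "A \<inter> {f \<in> space M. X f \<le> q}" and ?C = "A \<inter> {f \<in> space M. \<not> X f \<le> q}"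
    assume n: "\<not> (emeasure M ?B = 0 \<or> emeasure M ?C = 0)"
    have BC: "?B \<in> sets M" "?C \<in> sets M" by measurable
    have "emeasure M ?B = 0 \<or> emeasure M ?B = emeasure M A" "emeasure M ?C = 0 \<or> emeasure M ?C = emeasure M A"
      by (rule atom[rule_format, OF BC(1)], blast) (rule atom[rule_format, OF BC(2)], blast)
    then have "emeasure M ?B = emeasure M A" "emeasure M ?C = emeasure M A"
      using n by metis+
    moreover have "emeasure M A = emeasure M ?B + emeasure M ?C"
      using sets.sets_into_space[OF A] by (subst plus_emeasure[OF BC]) (auto intro!: arg_cong[of _ _ "emeasure M"])
    ultimately have "emeasure M A = emeasure M A + emeasure M A" by simp
    then have "measure M A = 0" by (simp add: M.emeasure_eq_measure flip: ennreal_plus)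
    then show False using A0 by (simp add: M.emeasure_eq_measure)
  qed
  define N where "N q = (if emeasure M (A \<inter> {f \<in> space M. X f \<le> q}) = 0
    then A \<inter> {f \<in> space M. X f \<le> q} else A \<inter> {f \<in> space M. \<not> X f \<le> q})" for q
  have N: "N q \<in> null_sets M" for q
  proof -
    have "A \<inter> {f \<in> space M. X f \<le> q} \<in> sets M" "A \<inter> {f \<in> space M. \<not> X f \<le> q} \<in> sets M"
      by measurable
    then show ?thesis using half[of q] unfolding N_def by (auto intro!: null_setsI simp del: space_M)
  qed
  have N2: "A \<inter> {f \<in> space M. X f \<le> q} \<subseteq> N q \<or> A \<inter> {f \<in> space M. \<not> X f \<le> q} \<subseteq> N q" for q
    unfolding N_def by auto
  have U: "(\<Union>q\<in>\<rat>. N q) \<in> null_sets M"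
    by (rule null_sets_UN') (use N countable_rat in auto)
  have "A - (\<Union>q\<in>\<rat>. N q) \<noteq> {}"
  proof
    assume "A - (\<Union>q\<in>\<rat>. N q) = {}"
    then have "A \<subseteq> (\<Union>q\<in>\<rat>. N q)" by auto
    then have "A \<in> null_sets M" by (rule null_sets_subset[OF U A])
    then show False using A0 by (simp add: null_sets_def)
  qed
  then obtain f0 where f0: "f0 \<in> A" "f0 \<notin> (\<Union>q\<in>\<rat>. N q)" by auto
  have "f \<in> {f \<in> space M. X f = X f0}" if f: "f \<in> A" "f \<notin> (\<Union>q\<in>\<rat>. N q)" for f
  proof -
    have False if gg: "g \<in> A" "g' \<in> A" "g \<notin> (\<Union>q\<in>\<rat>. N q)" "g' \<notin> (\<Union>q\<in>\<rat>. N q)" "X g < X g'" for g g'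
    proof -
      obtain q where "q \<in> \<rat>" "X g < q" "q < X g'" using Rats_dense_in_real[OF gg(5)] by auto
      moreover have "g \<in> A \<inter> {f \<in> space M. X f \<le> q}" "g' \<in> A \<inter> {f \<in> space M. \<not> X f \<le> q}"
        using gg calculation sets.sets_into_space[OF A] by auto
      ultimately show False using N2[of q] gg(3,4) by blast
    qed
    then have "X f = X f0" using f f0 by (metis linorder_neqE_linordered_idom)
    then show ?thesis using f sets.sets_into_space[OF A] by auto
  qed
  then have "A \<subseteq> {f \<in> space M. X f = X f0} \<union> (\<Union>q\<in>\<rat>. N q)" by auto
  moreover have "{f \<in> space M. X f = X f0} \<union> (\<Union>q\<in>\<rat>. N q) \<in> null_sets M"
  proof (rule null_sets.Un[OF _ U])
    have "{f \<in> space M. X f = X f0} \<in> sets M" by measurable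
    then show "{f \<in> space M. X f = X f0} \<in> null_sets M" using null[of "X f0"] by (rule null_setsI[rotated])
  qed
  ultimately have "A \<in> null_sets M" using null_sets_subset[OF _ A] by blast
  then show False using A0 by (simp add: null_sets_def)
qed

lemma flow_translate:
  assumes "0 < measure \<sigma> UNIV"
  shows "flow M translate"
  unfolding flow_def
proof (intro conjI ballI allI)
  show "prob_space M" by (rule prob_M)
  show "standard_borel_space M" by (rule standard_path_space[OF sets_M])
  show "nonatomic M" by (rule nonatomic_M[OF assms])
  have "sets (borel \<Otimes>\<^sub>M M) = sets (borel \<Otimes>\<^sub>M path_algebra :: (real \<times> path) measure)"
    by (rule sets_pair_measure_cong) (auto simp: sets_M)
  then show "(\<lambda>(t, x). translate t x) \<in> borel \<Otimes>\<^sub>M M \<rightarrow>\<^sub>M M"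
    using measurable_translate by (simp add: measurable_cong_sets[OF _ sets_M])
qed (simp_all add: translate_0 translate_add translate_mp)

lemma gaussian_flow_translate:
  assumes "0 < measure \<sigma> UNIV"
  shows "gaussian_flow M translate"
  unfolding gaussian_flow_def
proof (intro conjI exI)
  show "flow M translate" by (rule flow_translate[OF assms])
  show "finite_symmetric_borel_measure \<sigma>" by (rule finite_symmetric)
  show "gaussian_shift_flow \<sigma> M translate"
    unfolding gaussian_shift_flow_def
  proof (intro conjI exI allI)
    show "flow M translate" by (rule flow_translate[OF assms])
    show "centered_gaussian M (\<lambda>f. f 0)" by (rule rep_gaussian(1)[OF rep_eval_0])
    show "centered_gaussian_process M (\<lambda>t x. translate t x 0)"
      unfolding centered_gaussian_process_def
    proof (intro allI impI)
      fix F :: "real set" and c :: "real \<Rightarrow> real"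
      have "rep (\<lambda>x. \<Sum>t\<in>F. c t *\<^sub>R cis (t * x)) (\<lambda>f. \<Sum>t\<in>F. c t * translate t f 0)"
        by (rule rep_sum) (rule rep_eval)
      then show "centered_gaussian M (\<lambda>x. \<Sum>t\<in>F. c t * translate t x 0)" by (rule rep_gaussian(1))
    qed
    show "complex_of_real (\<integral>x. translate t x 0 * x 0 \<partial>M) = (\<integral>u. cis (t * u) \<partial>\<sigma>)" for t
      by (rule evaluation_covariance)
    show "generates_mod_null M (\<lambda>t x. translate t x 0)"
      unfolding generates_mod_null_def
      using sets_path_algebra_evaluations by (auto simp: sets_M)
  qed
  show "isomorphic_flows M translate M translate"
    by (rule isomorphic_flowsI[of M "\<lambda>f. f" "\<lambda>f. f"]) (auto simp: prob_M sets_M distr_id2)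
qed

text \<open>The image path is prescribed by its Taylor coefficients: the \<open>m\<close>-th one
  represents \<open>\<phi> x * (\<i> * (s * x)) ^ m\<close>, which is Hermitian because
  \<open>\<phi>\<close> is even. The isometry gives it the variance of the original coefficient, so
  almost surely the sequence grows slowly enough to be that of a path.\<close>

lemma rescaling_map:
  assumes \<phi>[measurable]: "\<phi> \<in> borel_measurable borel" and even: "\<And>x. \<phi> (- x) = \<phi> x"
    and sc: "\<And>g. g \<in> borel_measurable borel \<Longrightarrow>
      (\<integral>\<^sup>+x. g (s * x) * ennreal ((\<phi> x)\<^sup>2) \<partial>\<sigma>) = (\<integral>\<^sup>+x. g x \<partial>\<sigma>)"
  obtains R where "R \<in> M \<rightarrow>\<^sub>M path_algebra" "distr M M R = M"
    "\<And>k g. rep k g \<Longrightarrow> rep (\<lambda>x. complex_of_real (\<phi> x) * k (s * x)) (\<lambda>f. g (R f))"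
proof -
  have sc': "(\<integral>\<^sup>+x. g (s * x) * ennreal ((cmod (complex_of_real (\<phi> x)))\<^sup>2) \<partial>\<sigma>) = (\<integral>\<^sup>+x. g x \<partial>\<sigma>)"
    if "g \<in> borel_measurable borel" for g
    using sc[OF that] by simp
  have hm: "(\<lambda>x. complex_of_real (\<phi> x)) \<in> borel_measurable borel" by measurable
  have pm: "(\<lambda>x. (\<i> * complex_of_real x) ^ m) \<in> borel_measurable borel" for m by measurable
  have "\<exists>b. rep (\<lambda>x. complex_of_real (\<phi> x) * (\<i> * complex_of_real (s * x)) ^ m) b" for m
  proof (rule rep_exists)
    show "L2 \<sigma> (\<lambda>x. complex_of_real (\<phi> x) * (\<i> * complex_of_real (s * x)) ^ m)"
      by (rule nsq_scale(2)[OF hm pm sc' L2_power])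
    show "hermitian (\<lambda>x. complex_of_real (\<phi> x) * (\<i> * complex_of_real (s * x)) ^ m)"
      unfolding hermitian_def by (simp add: even)
  qed blast
  then have "\<exists>b. \<forall>m. rep (\<lambda>x. complex_of_real (\<phi> x) * (\<i> * complex_of_real (s * x)) ^ m) (b m)"
    by (intro choice allI)
  then obtain b where b: "\<And>m. rep (\<lambda>x. complex_of_real (\<phi> x) * (\<i> * complex_of_real (s * x)) ^ m) (b m)"
    by blast
  have bm[measurable]: "b m \<in> borel_measurable M" for m using rep_L2(2)[OF b] by (simp add: L2_def)
  obtain K0 where K0: "\<And>n. (\<integral>x. x ^ (2 * n) \<partial>\<sigma>) \<le> K0 * fact n" using moment by auto
  have "nsq M (b m) \<le> K0 * fact m" for m
  proof -
    have "nsq M (b m) = nsq \<sigma> (\<lambda>x. (\<i> * complex_of_real x) ^ m)"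
      unfolding rep_gaussian(2)[OF b] by (rule nsq_scale(1)[OF hm pm sc'])
    also have "(norm ((\<i> * complex_of_real x) ^ m))\<^sup>2 = x ^ (2 * m)" for x
      by (simp add: norm_power norm_mult abs_power_squared)
    then have "nsq \<sigma> (\<lambda>x. (\<i> * complex_of_real x) ^ m) = (\<integral>x. x ^ (2 * m) \<partial>\<sigma>)" by (simp add: nsq_def)
    finally show ?thesis using K0[of m] by simp
  qed
  from M.AE_growth[OF rep_L2(2)[OF b] this] have gr: "AE f in M. growth (\<lambda>m. b m f)" .
  define R where "R f = to_path (\<lambda>m. b m f)" for f
  have R: "R \<in> M \<rightarrow>\<^sub>M path_algebra"
    unfolding R_def by (rule measurable_compose[OF _ measurable_to_path]) (rule measurable_PiM_single'; simp)
  have "rep (\<lambda>x. complex_of_real (\<phi> x) * (\<i> * complex_of_real (s * x)) ^ m) (\<lambda>f. coef (R f) m)" for m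
    by (rule rep_cong[OF b refl _ measurable_compose[OF R measurable_coef]])
      (use gr in eventually_elim, simp add: R_def coef_to_path)
  from transport[OF R hm this sc'] that[OF R] show thesis by blast
qed

text \<open>The multiplier \<open>\<phi>\<close> at scale \<open>s\<close> and its inverse at scale
  \<open>1 / s\<close> give two rescaling maps. That these are inverse to each other and intertwine
  the flows reduces to identities between spectral functions.\<close>

lemma self_similarity:
  assumes s: "s \<noteq> 0" and \<phi>[measurable]: "\<phi> \<in> borel_measurable borel" and even: "\<And>x. \<phi> (- x) = \<phi> x"
    and nz: "AE x in \<sigma>. \<phi> x \<noteq> 0"
    and sc: "\<And>g. g \<in> borel_measurable borel \<Longrightarrow>
      (\<integral>\<^sup>+x. g (s * x) * ennreal ((\<phi> x)\<^sup>2) \<partial>\<sigma>) = (\<integral>\<^sup>+x. g x \<partial>\<sigma>)"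
  shows "s \<in> self_similarities M translate"
proof -
  \<comment> \<open>The multiplier that undoes \<open>\<phi>\<close> after the substitution
    \<open>y = s * x\<close>.\<close>
  define \<psi> where "\<psi> y = 1 / \<phi> (y / s)" for y
  have \<psi>[measurable]: "\<psi> \<in> borel_measurable borel" unfolding \<psi>_def[abs_def] by measurable
  have even': "\<psi> (- x) = \<psi> x" for x by (simp add: \<psi>_def even)
  have sc': "(\<integral>\<^sup>+x. g (1 / s * x) * ennreal ((\<psi> x)\<^sup>2) \<partial>\<sigma>) = (\<integral>\<^sup>+x. g x \<partial>\<sigma>)"
    if [measurable]: "g \<in> borel_measurable borel" for g
  proof -
    have "(\<integral>\<^sup>+x. g (1 / s * x) * ennreal ((\<psi> x)\<^sup>2) \<partial>\<sigma>)
        = (\<integral>\<^sup>+x. g (1 / s * (s * x)) * ennreal ((\<psi> (s * x))\<^sup>2) * ennreal ((\<phi> x)\<^sup>2) \<partial>\<sigma>)"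
      by (rule sc[symmetric]) measurable
    also have "\<dots> = (\<integral>\<^sup>+x. g x \<partial>\<sigma>)"
    proof (rule nn_integral_cong_AE, use nz in eventually_elim)
      case (elim x)
      then have "ennreal ((\<psi> (s * x))\<^sup>2) * ennreal ((\<phi> x)\<^sup>2) = 1"
        using s by (simp add: \<psi>_def power_divide flip: ennreal_mult)
      then show ?case using s by (simp add: mult.assoc)
    qed
    finally show ?thesis .
  qed
  obtain R where R: "R \<in> M \<rightarrow>\<^sub>M path_algebra" "distr M M R = M"
    and rR: "\<And>k g. rep k g \<Longrightarrow> rep (\<lambda>x. complex_of_real (\<phi> x) * k (s * x)) (\<lambda>f. g (R f))"
    using rescaling_map[OF \<phi> even sc] by blast
  obtain R' where R': "R' \<in> M \<rightarrow>\<^sub>M path_algebra" "distr M M R' = M"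
    and rR': "\<And>k g. rep k g \<Longrightarrow> rep (\<lambda>x. complex_of_real (\<psi> x) * k (1 / s * x)) (\<lambda>f. g (R' f))"
    by (rule rescaling_map[OF \<psi> even' sc']) blast+
  have Rp: "R f \<in> paths" "R' f \<in> paths" if "f \<in> space M" for f
    using measurable_space[OF R(1) that] measurable_space[OF R'(1) that] by auto
  have base: "rep (\<lambda>x. (\<i> * complex_of_real x) ^ n) (\<lambda>f. coef f n)" for n
    using rep_translate[of n 0] by (simp add: translate_0)
  \<comment> \<open>In \<open>R (R' f)\<close> the multiplier is evaluated at \<open>x / s\<close>.
    The set where it vanishes there is null by \<open>sc\<close> applied to its indicator, because
    the transformed integrand contains the factor \<open>\<phi> x = 0\<close>.\<close>
  have nz': "AE x in \<sigma>. \<phi> (x / s) \<noteq> 0"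
  proof -
    have "(\<integral>\<^sup>+x. indicator {y. \<phi> (y / s) = 0} x \<partial>\<sigma>)
        = (\<integral>\<^sup>+x. indicator {y. \<phi> (y / s) = 0} (s * x) * ennreal ((\<phi> x)\<^sup>2) \<partial>\<sigma>)"
      by (rule sc[symmetric]) measurable
    also have "\<dots> = (\<integral>\<^sup>+x. 0 \<partial>\<sigma>)"
      by (rule nn_integral_cong) (use s in \<open>auto split: split_indicator\<close>)
    finally have "emeasure \<sigma> {y. \<phi> (y / s) = 0} = 0" by simp
    then show ?thesis by (subst AE_iff_measurable[OF _ refl]) auto
  qed
  have inv1: "AE f in M. R' (R f) = f"
  proof -
    have "AE f in M. coef (R' (R f)) n = coef f n" for n
    proof (rule rep_unique[OF rR[OF rR'[OF base]] base])
      show "AE x in \<sigma>. complex_of_real (\<phi> x) * (complex_of_real (\<psi> (s * x)) * (\<i> * complex_of_real (1 / s * (s * x))) ^ n)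
          = (\<i> * complex_of_real x) ^ n"
        using nz by eventually_elim (use s in \<open>simp add: \<psi>_def\<close>)
    qed
    then have "AE f in M. \<forall>n. coef (R' (R f)) n = coef f n" by (simp add: AE_all_countable)
    then show ?thesis using AE_space
    proof eventually_elim
      case (elim f)
      have "R f \<in> space M" using Rp(1)[OF elim(2)] by simp
      then show ?case using elim Rp(2)[of "R f"] by (intro paths_eqI) auto
    qed
  qed
  have inv2: "AE f in M. R (R' f) = f"
  proof -
    have "AE f in M. coef (R (R' f)) n = coef f n" for n
    proof (rule rep_unique[OF rR'[OF rR[OF base]] base])
      show "AE x in \<sigma>. complex_of_real (\<psi> x) * (complex_of_real (\<phi> (1 / s * x)) * (\<i> * complex_of_real (s * (1 / s * x))) ^ n)
          = (\<i> * complex_of_real x) ^ n"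
        using nz' by eventually_elim (use s in \<open>simp add: \<psi>_def\<close>)
    qed
    then have "AE f in M. \<forall>n. coef (R (R' f)) n = coef f n" by (simp add: AE_all_countable)
    then show ?thesis using AE_space
    proof eventually_elim
      case (elim f)
      have "R' f \<in> space M" using Rp(2)[OF elim(2)] by simp
      then show ?case using elim Rp(1)[of "R' f"] by (intro paths_eqI) auto
    qed
  qed
  have eqv: "AE f in M. R (translate (s * t) f) = translate t (R f)" for t
  proof -
    have "AE f in M. coef (R (translate (s * t) f)) n = coef (translate t (R f)) n" for n
    proof (rule rep_unique[OF rep_translate_comp[OF rR[OF base]] rR[OF rep_translate]])
      show "AE x in \<sigma>. cis (s * t * x) * (complex_of_real (\<phi> x) * (\<i> * complex_of_real (s * x)) ^ n)
          = complex_of_real (\<phi> x) * ((\<i> * complex_of_real (s * x)) ^ n * cis (t * (s * x)))"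
        by (intro AE_I2) (simp add: mult_ac)
    qed
    then have "AE f in M. \<forall>n. coef (R (translate (s * t) f)) n = coef (translate t (R f)) n" by (simp add: AE_all_countable)
    then show ?thesis using AE_space
    proof eventually_elim
      case (elim f)
      have "translate (s * t) f \<in> space M" using elim(2) by (simp add: translate_path)
      then show ?case using elim Rp(1) by (intro paths_eqI) (auto simp: translate_path(1))
    qed
  qed
  have "isomorphic_flows M (\<lambda>t. translate (s * t)) M translate"
    by (rule isomorphic_flowsI[OF prob_M sets_M _ _ R(2) R'(2) inv1 inv2 eqv])
      (use R(1) R'(1) translate_measurable in \<open>simp_all add: measurable_cong_sets[OF refl sets_M]\<close>)
  then show ?thesis using s by (simp add: self_similarities_def)
qed

end

section \<open>Averages of oscillating integrals\<close>

lemma integral_cos_interval: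
  fixes a b c :: real
  assumes "a \<le> b" "c \<noteq> 0"
  shows "(\<integral>s. indicator {a..b} s * cos (s * c) \<partial>lborel) = (sin (b * c) - sin (a * c)) / c"
proof -
  have "(\<integral>s. indicator {a..b} s *\<^sub>R cos (s * c) \<partial>lborel) = sin (b * c) / c - sin (a * c) / c"
  proof (rule integral_FTC_atLeastAtMost[OF assms(1)])
    show "((\<lambda>s. sin (s * c) / c) has_vector_derivative cos (x * c)) (at x within {a..b})" for x
      using assms(2) unfolding has_real_derivative_iff_has_vector_derivative[symmetric]
      by (auto intro!: derivative_eq_intros)
  qed (intro continuous_intros)
  then show ?thesis by (simp add: diff_divide_distrib)
qed

text \<open>By Fubini the average over \<open>s\<close> can be taken inside, where the integral of
  \<open>cos (s * c)\<close> over an interval is at most \<open>2 / \<bar>c\<bar>\<close>. With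
  \<open>D x = x\<close> this yields meagerness, with \<open>D (x, y) = x - y\<close> on the product
  space it yields weak mixing.\<close>

lemma oscillating_average_tendsto_0:
  fixes N :: "'z measure" and w D :: "'z \<Rightarrow> real"
  assumes fin: "finite_measure N" and ab: "a \<le> b" and w: "integrable N w"
    and D[measurable]: "D \<in> borel_measurable N" and D0: "AE z in N. D z \<noteq> 0"
    and t: "filterlim t at_top sequentially"
  shows "(\<lambda>n. \<integral>s. indicator {a..b} s * (\<integral>z. w z * cos (s * t n * D z) \<partial>N) \<partial>lborel) \<longlonglongrightarrow> 0"
proof -
  interpret N: finite_measure N by fact
  interpret P: pair_sigma_finite lborel N
    by (intro pair_sigma_finite.intro sigma_finite_lborel N.sigma_finite_measure)
  have [measurable]: "w \<in> borel_measurable N" using w by auto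
  define c where "c n z = (\<integral>s. indicator {a..b} s * cos (s * (t n * D z)) \<partial>lborel)" for n z
  have ii: "integrable lborel (\<lambda>s. indicator {a..b} s :: real)"
    by (intro integrable_real_indicator) (auto simp: emeasure_lborel_Icc_eq)
  have fub: "(\<integral>s. indicator {a..b} s * (\<integral>z. w z * cos (s * t n * D z) \<partial>N) \<partial>lborel) = (\<integral>z. w z * c n z \<partial>N)" for n
  proof -
    let ?f = "\<lambda>s z. indicator {a..b} s * (w z * cos (s * t n * D z))"
    have "integrable (lborel \<Otimes>\<^sub>M N) (case_prod ?f)"
    proof (rule P.Fubini_integrable)
      show "case_prod ?f \<in> borel_measurable (lborel \<Otimes>\<^sub>M N)" by measurable
      have wi: "integrable N (\<lambda>z. w z * cos (s * t n * D z))" for s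
        by (rule Bochner_Integration.integrable_bound[OF w]) (auto simp: abs_mult mult_left_le)
      then show "AE s in lborel. integrable N (\<lambda>z. case (s, z) of (s, z) \<Rightarrow> ?f s z)" by simp
      show "integrable lborel (\<lambda>s. \<integral>z. norm (case (s, z) of (s, z) \<Rightarrow> ?f s z) \<partial>N)"
      proof (rule Bochner_Integration.integrable_bound)
        show "integrable lborel (\<lambda>s. indicator {a..b} s * (\<integral>z. \<bar>w z\<bar> \<partial>N))" using ii by simp
        show "AE s in lborel. norm (\<integral>z. norm (case (s, z) of (s, z) \<Rightarrow> ?f s z) \<partial>N) \<le> norm (indicator {a..b} s * (\<integral>z. \<bar>w z\<bar> \<partial>N))"
        proof (rule AE_I2)
          fix s
          have "(\<integral>z. norm (?f s z) \<partial>N) \<le> (\<integral>z. indicator {a..b} s * \<bar>w z\<bar> \<partial>N)"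
            by (rule integral_mono) (use integrable_norm[OF wi[of s]] w in \<open>auto simp: abs_mult mult_left_le split: split_indicator\<close>)
          then show "norm (\<integral>z. norm (case (s, z) of (s, z) \<Rightarrow> ?f s z) \<partial>N) \<le> norm (indicator {a..b} s * (\<integral>z. \<bar>w z\<bar> \<partial>N))"
            by simp
        qed
        show "(\<lambda>s. \<integral>z. norm (case (s, z) of (s, z) \<Rightarrow> ?f s z) \<partial>N) \<in> borel_measurable lborel" by measurable
      qed
    qed
    from P.Fubini_integral[OF this]
    have "(\<integral>s. (\<integral>z. ?f s z \<partial>N) \<partial>lborel) = (\<integral>z. (\<integral>s. ?f s z \<partial>lborel) \<partial>N)" by simp
    moreover have "(\<integral>s. ?f s z \<partial>lborel) = w z * c n z" for z
    proof -
      have "(\<integral>s. ?f s z \<partial>lborel) = (\<integral>s. w z * (indicator {a..b} s * cos (s * (t n * D z))) \<partial>lborel)"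
        by (rule Bochner_Integration.integral_cong) (auto simp: mult_ac)
      then show ?thesis by (simp add: c_def)
    qed
    ultimately show ?thesis by simp
  qed
  have "(\<lambda>n. \<integral>z. w z * c n z \<partial>N) \<longlonglongrightarrow> (\<integral>z. 0 \<partial>N)"
  proof (rule integral_dominated_convergence)
    show "integrable N (\<lambda>z. \<bar>w z\<bar> * (b - a))" using w by simp
    show "(\<lambda>z. w z * c n z) \<in> borel_measurable N" for n unfolding c_def by measurable
    have cb: "\<bar>c n z\<bar> \<le> b - a" for n z
    proof -
      have "\<bar>c n z\<bar> \<le> (\<integral>s. norm (indicator {a..b} s * cos (s * (t n * D z))) \<partial>lborel)"
        unfolding c_def real_norm_def[symmetric] by (rule integral_norm_bound)
      also have "\<dots> \<le> (\<integral>s. indicator {a..b} s \<partial>lborel)"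
        by (rule integral_mono'[OF ii]) (auto split: split_indicator)
      also have "\<dots> = b - a" using ab by simp
      finally show ?thesis .
    qed
    show "AE z in N. norm (w z * c n z) \<le> \<bar>w z\<bar> * (b - a)" for n
      using cb by (auto simp: abs_mult intro!: mult_left_mono)
    show "AE z in N. (\<lambda>n. w z * c n z) \<longlonglongrightarrow> 0"
      using D0
    proof eventually_elim
      case (elim z)
      have "(\<lambda>n. 2 / \<bar>D z\<bar> * inverse (t n)) \<longlonglongrightarrow> 2 / \<bar>D z\<bar> * 0"
        by (intro tendsto_mult tendsto_const tendsto_inverse_0_at_top t)
      then have "(\<lambda>n. 2 / \<bar>D z\<bar> * inverse (t n)) \<longlonglongrightarrow> 0" by simp
      moreover have "eventually (\<lambda>n. norm (c n z) \<le> 2 / \<bar>D z\<bar> * inverse (t n)) sequentially"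
        using t[unfolded filterlim_at_top_dense, rule_format, of 0]
      proof eventually_elim
        case (elim n)
        have "\<bar>sin (b * (t n * D z)) - sin (a * (t n * D z))\<bar> \<le> 2"
          using abs_sin_le_one[of "b * (t n * D z)"] abs_sin_le_one[of "a * (t n * D z)"] by linarith
        then have "\<bar>c n z\<bar> \<le> 2 / \<bar>t n * D z\<bar>"
          unfolding c_def using \<open>D z \<noteq> 0\<close> elim
          by (subst integral_cos_interval[OF ab]) (auto intro!: divide_right_mono)
        then show ?case using elim by (simp add: abs_mult field_simps)
      qed
      ultimately have "(\<lambda>n. c n z) \<longlonglongrightarrow> 0" by (rule Lim_null_comparison[rotated])
      then show ?case using tendsto_mult_right_zero by blast
    qed
  qed simp
  then show ?thesis by (simp add: fub)
qed

lemma LIMSEQ_approximate: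
  fixes a :: "nat \<Rightarrow> 'b::real_normed_vector"
  assumes "\<And>e. e > 0 \<Longrightarrow> \<exists>b l. b \<longlonglongrightarrow> l \<and> norm (l - L) \<le> e \<and> (\<forall>n. norm (a n - b n) \<le> e)"
  shows "a \<longlonglongrightarrow> L"
proof (rule LIMSEQ_I)
  fix r :: real assume "0 < r"
  then obtain b l where b: "b \<longlonglongrightarrow> l" "norm (l - L) \<le> r / 4" "\<And>n. norm (a n - b n) \<le> r / 4"
    using assms[of "r / 4"] by auto
  obtain N where N: "\<And>n. n \<ge> N \<Longrightarrow> norm (b n - l) < r / 4"
    using LIMSEQ_D[OF b(1), of "r / 4"] \<open>0 < r\<close> by auto
  have "norm (a n - L) < r" if "n \<ge> N" for n
  proof -
    have "norm ((a n - b n) + (b n - l) + (l - L)) \<le> norm ((a n - b n) + (b n - l)) + norm (l - L)"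
      "norm ((a n - b n) + (b n - l)) \<le> norm (a n - b n) + norm (b n - l)"
      by (rule norm_triangle_ineq)+
    then show ?thesis using b(2) b(3)[of n] N[OF that] \<open>0 < r\<close> by simp
  qed
  then show "\<exists>N. \<forall>n\<ge>N. norm (a n - L) < r" by blast
qed

section \<open>Measure preserving images of an isomorphism\<close>

text \<open>The inverse of the isomorphism is extended from \<open>Y\<close> by a constant value, so
  that it is defined everywhere. Cancelling \<open>R\<close> in the intertwining clause requires
  \<open>T t (Q y) \<in> X\<close>, which holds almost everywhere because \<open>T t\<close> and
  \<open>Q\<close> preserve the measures.\<close>

lemma isomorphic_flows_inverse:
  assumes iso: "isomorphic_flows M T N S" and M: "prob_space M" and N: "prob_space N"
    and T: "\<And>t. T t \<in> M \<rightarrow>\<^sub>M M" "\<And>t. distr M M (T t) = M"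
  obtains Q where "Q \<in> N \<rightarrow>\<^sub>M M" "distr N M Q = M" "\<And>t. AE y in N. Q (S t y) = T t (Q y)"
proof -
  interpret M: prob_space M by fact
  interpret N: prob_space N by fact
  obtain X Y R where X: "X \<in> sets M" and Y: "Y \<in> sets N"
    and X0: "emeasure M (space M - X) = 0" and Y0: "emeasure N (space N - Y) = 0"
    and bij: "bij_betw R X Y"
    and R: "R \<in> restrict_space M X \<rightarrow>\<^sub>M restrict_space N Y"
    and R': "the_inv_into X R \<in> restrict_space N Y \<rightarrow>\<^sub>M restrict_space M X"
    and mp: "distr (restrict_space M X) (restrict_space N Y) R = restrict_space N Y"
    and eqv: "\<And>t. AE y in N. R (T t (the_inv_into X R y)) = S t y"
    using iso unfolding isomorphic_flows_def by blast
  have AEX: "AE x in M. x \<in> X" using X0 X by (subst AE_iff_measurable[OF _ refl]) (auto simp: set_diff_eq)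
  have AEY: "AE x in N. x \<in> Y" using Y0 Y by (subst AE_iff_measurable[OF _ refl]) (auto simp: set_diff_eq)
  have XS: "X \<subseteq> space M" "Y \<subseteq> space N" using sets.sets_into_space X Y by auto
  obtain x0 where x0: "x0 \<in> space M" using M.not_empty by blast
  define Q where "Q y = (if y \<in> Y then the_inv_into X R y else x0)" for y
  have inj: "inj_on R X" using bij by (simp add: bij_betw_def)
  have QR: "Q (R x) = x" if "x \<in> X" for x
    using that bij the_inv_into_f_f[OF inj that] by (auto simp: Q_def bij_betw_def)
  have QX: "Q y \<in> X" if "y \<in> Y" for y
    using that the_inv_into_into[OF inj, of y X] bij by (auto simp: Q_def bij_betw_def)
  have "the_inv_into X R \<in> restrict_space N Y \<rightarrow>\<^sub>M M"
    using measurable_restrict_space2_iff[of "the_inv_into X R" "restrict_space N Y" M X] R' by auto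
  then have Qm[measurable]: "Q \<in> N \<rightarrow>\<^sub>M M"
    unfolding Q_def using Y x0 by (intro measurable_restrict_space_iff[THEN iffD1]) auto
  have Qmp: "distr N M Q = M"
  proof (rule measure_eqI)
    fix A assume "A \<in> sets (distr N M Q)"
    then have A: "A \<in> sets M" by simp
    have B: "Q -` A \<inter> Y \<in> sets N"
    proof -
      have "Q -` A \<inter> space N \<inter> Y \<in> sets N" using measurable_sets[OF Qm A] Y by (rule sets.Int)
      moreover have "Q -` A \<inter> space N \<inter> Y = Q -` A \<inter> Y" using XS by auto
      ultimately show ?thesis by simp
    qed
    then have B': "Q -` A \<inter> Y \<in> sets (restrict_space N Y)" by (subst sets_restrict_space_iff) (use Y in auto)
    have "emeasure (distr N M Q) A = emeasure N (Q -` A \<inter> space N)" using A by (simp add: emeasure_distr)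
    also have "\<dots> = emeasure N (Q -` A \<inter> Y)"
      by (rule emeasure_eq_AE) (use AEY XS B measurable_sets[OF Qm A] in \<open>auto elim!: eventually_mono\<close>)
    also have "\<dots> = emeasure (restrict_space N Y) (Q -` A \<inter> Y)"
      using Y by (subst emeasure_restrict_space) auto
    also have "\<dots> = emeasure (distr (restrict_space M X) (restrict_space N Y) R) (Q -` A \<inter> Y)" by (simp add: mp)
    also have "\<dots> = emeasure (restrict_space M X) (R -` (Q -` A \<inter> Y) \<inter> space (restrict_space M X))"
      by (rule emeasure_distr[OF R B'])
    also have "R -` (Q -` A \<inter> Y) \<inter> space (restrict_space M X) = A \<inter> X"
    proof -
      have "R x \<in> Y" if "x \<in> X" for x using that bij by (auto simp: bij_betw_def)
      then show ?thesis using XS(1) QR by (auto simp: space_restrict_space)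
    qed
    also have "emeasure (restrict_space M X) (A \<inter> X) = emeasure M (A \<inter> X)"
      using X by (subst emeasure_restrict_space) auto
    also have "\<dots> = emeasure M A"
      by (rule emeasure_eq_AE) (use AEX A X in \<open>auto elim!: eventually_mono\<close>)
    finally show "emeasure (distr N M Q) A = emeasure M A" .
  qed simp
  have "AE y in N. Q (S t y) = T t (Q y)" for t
  proof -
    have "AE x in distr M M (T t). x \<in> X" unfolding T(2) by (rule AEX)
    then have "AE x in M. T t x \<in> X" by (rule AE_distrD[OF T(1)])
    then have "AE x in distr N M Q. T t x \<in> X" unfolding Qmp .
    then have "AE y in N. T t (Q y) \<in> X" by (rule AE_distrD[OF Qm])
    then show ?thesis using AEY eqv[of t]
    proof eventually_elim
      case (elim y)
      then have "R (T t (Q y)) = S t y" by (simp add: Q_def)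
      then show ?case using QR[OF elim(1)] by simp
    qed
  qed
  then show thesis using that Qm Qmp by blast
qed

section \<open>Bounded functions on the path space\<close>

context gaussian_paths
begin

definition bdd :: "(path \<Rightarrow> complex) \<Rightarrow> bool" where
  "bdd g \<longleftrightarrow> g \<in> borel_measurable M \<and> (\<exists>B. \<forall>f\<in>space M. cmod (g f) \<le> B)"

lemma bddI: "g \<in> borel_measurable M \<Longrightarrow> (\<And>f. f \<in> space M \<Longrightarrow> cmod (g f) \<le> B) \<Longrightarrow> bdd g"
  unfolding bdd_def by blast

lemma bddE:
  assumes "bdd g" obtains B where "g \<in> borel_measurable M" "\<And>f. f \<in> space M \<Longrightarrow> cmod (g f) \<le> B"
  using assms unfolding bdd_def by blast

lemma bdd_measurable: "bdd g \<Longrightarrow> g \<in> borel_measurable M"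
  unfolding bdd_def by blast

lemma bdd_integrable: assumes "bdd g" shows "integrable M g"
proof -
  obtain B where "g \<in> borel_measurable M" "\<And>f. f \<in> space M \<Longrightarrow> cmod (g f) \<le> B"
    using assms by (rule bddE) blast
  then show ?thesis by (intro M.integrable_const_bound[of _ B] AE_I2)
qed

lemma bdd_add: assumes "bdd g" "bdd h" shows "bdd (\<lambda>f. g f + h f)"
proof -
  obtain B where B: "g \<in> borel_measurable M" "\<And>f. f \<in> space M \<Longrightarrow> cmod (g f) \<le> B"
    using assms(1) by (rule bddE) blast
  obtain C where C: "h \<in> borel_measurable M" "\<And>f. f \<in> space M \<Longrightarrow> cmod (h f) \<le> C"
    using assms(2) by (rule bddE) blast
  show ?thesis
    by (rule bddI[of _ "B + C"], rule borel_measurable_add[OF B(1) C(1)], rule norm_triangle_mono[OF B(2) C(2)])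
qed

lemma bdd_mult: assumes "bdd g" "bdd h" shows "bdd (\<lambda>f. g f * h f)"
proof -
  obtain B where B: "g \<in> borel_measurable M" "\<And>f. f \<in> space M \<Longrightarrow> cmod (g f) \<le> B"
    using assms(1) by (rule bddE) blast
  obtain C where C: "h \<in> borel_measurable M" "\<And>f. f \<in> space M \<Longrightarrow> cmod (h f) \<le> C"
    using assms(2) by (rule bddE) blast
  show ?thesis
  proof (rule bddI[of _ "B * C"], rule borel_measurable_times[OF B(1) C(1)])
    fix f assume f: "f \<in> space M"
    show "cmod (g f * h f) \<le> B * C"
      unfolding norm_mult using order_trans[OF norm_ge_zero B(2)[OF f]]
      by (intro mult_mono B(2)[OF f] C(2)[OF f] norm_ge_zero)
  qed
qed

lemma bdd_const: "bdd (\<lambda>f. c)"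
  by (rule bddI[of _ "cmod c"]) auto

lemma bdd_diff: "bdd g \<Longrightarrow> bdd h \<Longrightarrow> bdd (\<lambda>f. g f - h f)"
  using bdd_add[of g "\<lambda>f. - 1 * h f"] bdd_mult[OF bdd_const[of "-1"], of h] by simp

lemma bdd_cis: "g \<in> borel_measurable M \<Longrightarrow> bdd (\<lambda>f. cis (g f))"
  by (rule bddI[of _ 1]) (simp_all add: cis_conv_exp)

lemma bdd_comp: assumes "bdd g" "R \<in> M \<rightarrow>\<^sub>M M" shows "bdd (\<lambda>f. g (R f))"
proof -
  obtain B where B: "g \<in> borel_measurable M" "\<And>f. f \<in> space M \<Longrightarrow> cmod (g f) \<le> B"
    using assms(1) by (rule bddE) blast
  show ?thesis
    by (rule bddI[of _ B], rule measurable_compose[OF assms(2) B(1)], rule B(2), rule measurable_space[OF assms(2)])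
qed

lemma bdd_limit:
  assumes "g \<in> borel_measurable M" "\<And>n f. f \<in> space M \<Longrightarrow> cmod (gn n f) \<le> B"
    "\<And>f. f \<in> space M \<Longrightarrow> (\<lambda>n. gn n f) \<longlonglongrightarrow> g f"
  shows "bdd g"
proof (rule bddI[OF assms(1), of B])
  fix f assume f: "f \<in> space M"
  show "cmod (g f) \<le> B"
    by (rule LIMSEQ_le_const2[OF tendsto_norm[OF assms(3)[OF f]]]) (use assms(2)[OF f] in blast)
qed

lemma bounded_limit_L1:
  assumes "\<And>n. gn n \<in> borel_measurable M" "g \<in> borel_measurable M"
    and "\<And>n f. f \<in> space M \<Longrightarrow> cmod (gn n f) \<le> B" "\<And>f. f \<in> space M \<Longrightarrow> (\<lambda>n. gn n f) \<longlonglongrightarrow> g f"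
  shows "(\<lambda>n. \<integral>f. cmod (gn n f - g f) \<partial>M) \<longlonglongrightarrow> 0"
proof -
  have "(\<lambda>n. \<integral>f. cmod (gn n f - g f) \<partial>M) \<longlonglongrightarrow> (\<integral>f. 0 \<partial>M)"
  proof (rule integral_dominated_convergence[where w = "\<lambda>_. 2 * B"])
    show "AE f in M. (\<lambda>n. cmod (gn n f - g f)) \<longlonglongrightarrow> 0"
      using assms(4) by (intro AE_I2 tendsto_norm_zero) (simp add: LIM_zero)
    show "AE f in M. norm (cmod (gn n f - g f)) \<le> 2 * B" for n
    proof (rule AE_I2)
      fix f assume f: "f \<in> space M"
      have "cmod (g f) \<le> B" by (rule LIMSEQ_le_const2[OF tendsto_norm[OF assms(4)[OF f]]]) (use assms(3) f in auto)
      then show "norm (cmod (gn n f - g f)) \<le> 2 * B"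
        using norm_triangle_ineq4[of "gn n f" "g f"] assms(3)[OF f, of n] by simp
    qed
  qed (use assms(1,2) in measurable)
  then show ?thesis by simp
qed

lemma mp_integral:
  fixes g :: "path \<Rightarrow> 'b::{banach, second_countable_topology}"
  assumes "R \<in> M \<rightarrow>\<^sub>M M" "distr M M R = M" "g \<in> borel_measurable M"
  shows "(\<integral>f. g (R f) \<partial>M) = (\<integral>f. g f \<partial>M)"
  using integral_distr[OF assms(1,3)] assms(2) by simp

text \<open>Properties of bounded functions that are stable under linear combinations and bounded limits
  need only be checked for the characters of the Gaussian space.\<close>

lemma bounded_class_induct:
  assumes g: "bdd g"
    and cis: "\<And>p. P (\<lambda>f. cis (lin p f))"
    and add: "\<And>g h. bdd g \<Longrightarrow> bdd h \<Longrightarrow> P g \<Longrightarrow> P h \<Longrightarrow> P (\<lambda>f. g f + h f)"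
    and scale: "\<And>c g. bdd g \<Longrightarrow> P g \<Longrightarrow> P (\<lambda>f. c * g f)"
    and lim: "\<And>gn g. (\<And>n. bdd (gn n)) \<Longrightarrow> (\<And>n. P (gn n)) \<Longrightarrow> bdd g \<Longrightarrow>
      (\<lambda>n. \<integral>f. cmod (gn n f - g f) \<partial>M) \<longlonglongrightarrow> 0 \<Longrightarrow> P g"
  shows "P g"
proof -
  interpret multiplicative_class M "\<lambda>i f. coef f i" "{g. bdd g \<and> P g}"
  proof
    show "(\<lambda>f. coef f i) \<in> borel_measurable M" for i by measurable
    show "sets M = sigma_sets (space M) {(\<lambda>f. coef f i) -` {u<..} \<inter> space M |i u. True}"
      by (rule coef_generates)
    show "(\<lambda>f. cis (\<Sum>i\<in>F. u i * coef f i)) \<in> {g. bdd g \<and> P g}" if "finite F" for F u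
      unfolding sum_coef_eq_lin[OF that] using cis bdd_cis[OF lin_M] by simp
    show "(\<lambda>x. f x + g x) \<in> {g. bdd g \<and> P g}" if "f \<in> {g. bdd g \<and> P g}" "g \<in> {g. bdd g \<and> P g}" for f g
      using that add bdd_add by simp
    show "(\<lambda>x. c * f x) \<in> {g. bdd g \<and> P g}" if "f \<in> {g. bdd g \<and> P g}" for f c
      using that scale bdd_mult[OF bdd_const] by simp
    show "g \<in> {g. bdd g \<and> P g}" if f: "\<And>n. f n \<in> {g. bdd g \<and> P g}" "\<And>n. f n \<in> borel_measurable M" "g \<in> borel_measurable M"
      and b: "\<And>n x. x \<in> space M \<Longrightarrow> cmod (f n x) \<le> B"
      and l: "\<And>x. x \<in> space M \<Longrightarrow> (\<lambda>n. f n x) \<longlonglongrightarrow> g x" for f g B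
    proof -
      have "bdd g" by (rule bdd_limit[OF f(3) b l])
      moreover have "P g"
        by (rule lim[of f, OF _ _ \<open>bdd g\<close> bounded_limit_L1[OF f(2,3) b l]]) (use f(1) in auto)
      ultimately show ?thesis by simp
    qed
  qed
  show ?thesis using bounded_in[of g] g unfolding bdd_def by blast
qed

section \<open>Rigidity\<close>

text \<open>By the isometry this is the mean square of the increment \<open>f t - f 0\<close> of the
  process.\<close>

definition rigidity_defect :: "real \<Rightarrow> real" where
  "rigidity_defect t = nsq \<sigma> (\<lambda>x. cis (t * x) - 1)"

text \<open>For characters of the Gaussian space this holds because \<open>cis\<close> is Lipschitz;
  limits are handled uniformly in \<open>n\<close> since translations preserve the measure. The
  extension to bounded functions is made because an isomorphism can carry the process out of the
  Gaussian space.\<close>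

lemma rigid_bounded:
  assumes rig: "AE x in \<sigma>. (\<lambda>n. cis (t n * x)) \<longlonglongrightarrow> 1" and g: "bdd g"
  shows "(\<lambda>n. \<integral>f. cmod (g (translate (t n) f) - g f) \<partial>M) \<longlonglongrightarrow> 0"
  using g
proof (rule bounded_class_induct)
  fix p
  define d where "d n f = lin p (translate (t n) f) - lin p f" for n f
  have rd: "rep (\<lambda>x. cis (t n * x) * ev p x - ev p x) (d n)" for n
    unfolding d_def by (rule rep_diff[OF rep_translate_comp[OF rep_lin] rep_lin])
  have "(\<lambda>n. nsq \<sigma> (\<lambda>x. cis (t n * x) * ev p x - ev p x)) \<longlonglongrightarrow> 0"
  proof (rule nsq_dominated[where w = "\<lambda>x. cmod (ev p x)"])
    show "L2 \<sigma> (\<lambda>x. cmod (ev p x))" using L2_ev[of p] by (simp add: L2_def)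
    show "AE x in \<sigma>. (\<lambda>n. cis (t n * x) * ev p x) \<longlonglongrightarrow> ev p x"
      using rig
    proof eventually_elim
      case (elim x)
      from tendsto_mult[OF elim tendsto_const[of "ev p x"]] show ?case by simp
    qed
  qed (auto simp: norm_mult cis_conv_exp)
  then have "(\<lambda>n. nsq M (d n)) \<longlonglongrightarrow> 0" using rep_gaussian(2)[OF rd] by simp
  from M.L1_tendsto[OF rep_L2(2)[OF rd] this]
  have "(\<lambda>n. \<integral>f. norm (d n f) \<partial>M) \<longlonglongrightarrow> 0" .
  then show "(\<lambda>n. \<integral>f. cmod (cis (lin p (translate (t n) f)) - cis (lin p f)) \<partial>M) \<longlonglongrightarrow> 0"
  proof (rule Lim_null_comparison[rotated], intro always_eventually allI)
    fix n
    have b: "cmod (cis a - cis b) \<le> \<bar>a - b\<bar>" for a b :: real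
    proof -
      have "cis a - cis b = cis b * (cis (a - b) - 1)" by (simp add: algebra_simps cis_mult)
      then have "cmod (cis a - cis b) = cmod (cis (a - b) - 1)" by (simp add: norm_mult)
      also have "\<dots> \<le> \<bar>a - b\<bar>" using iexp_approx1[of "a - b" 0] by (simp add: cis_conv_exp)
      finally show ?thesis .
    qed
    have "(\<integral>f. cmod (cis (lin p (translate (t n) f)) - cis (lin p f)) \<partial>M) \<le> (\<integral>f. norm (d n f) \<partial>M)"
    proof (rule integral_mono')
      show "integrable M (\<lambda>f. norm (d n f))" by (rule M.L2_integrable1(1)[OF rep_L2(2)[OF rd]])
    qed (auto simp: d_def b)
    then show "norm (\<integral>f. cmod (cis (lin p (translate (t n) f)) - cis (lin p f)) \<partial>M) \<le> (\<integral>f. norm (d n f) \<partial>M)"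
      by simp
  qed
next
  fix g h assume gh: "bdd g" "bdd h"
    and l: "(\<lambda>n. \<integral>f. cmod (g (translate (t n) f) - g f) \<partial>M) \<longlonglongrightarrow> 0"
    "(\<lambda>n. \<integral>f. cmod (h (translate (t n) f) - h f) \<partial>M) \<longlonglongrightarrow> 0"
  have i: "integrable M (\<lambda>f. cmod (g (translate (t n) f) - g f))" if "bdd g" for g n
    by (rule integrable_norm[OF bdd_integrable[OF bdd_diff[OF bdd_comp[OF that translate_M] that]]])
  have "(\<lambda>n. (\<integral>f. cmod (g (translate (t n) f) - g f) \<partial>M) + (\<integral>f. cmod (h (translate (t n) f) - h f) \<partial>M)) \<longlonglongrightarrow> 0"
    using tendsto_add[OF l] by simp
  then show "(\<lambda>n. \<integral>f. cmod (g (translate (t n) f) + h (translate (t n) f) - (g f + h f)) \<partial>M) \<longlonglongrightarrow> 0"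
  proof (rule Lim_null_comparison[rotated], intro always_eventually allI)
    fix n
    have "(\<integral>f. cmod (g (translate (t n) f) + h (translate (t n) f) - (g f + h f)) \<partial>M)
        \<le> (\<integral>f. cmod (g (translate (t n) f) - g f) + cmod (h (translate (t n) f) - h f) \<partial>M)"
    proof (rule integral_mono')
      show "integrable M (\<lambda>f. cmod (g (translate (t n) f) - g f) + cmod (h (translate (t n) f) - h f))"
        by (intro Bochner_Integration.integrable_add i gh)
    qed (auto simp: norm_diff_triangle_ineq)
    then show "norm (\<integral>f. cmod (g (translate (t n) f) + h (translate (t n) f) - (g f + h f)) \<partial>M)
        \<le> (\<integral>f. cmod (g (translate (t n) f) - g f) \<partial>M) + (\<integral>f. cmod (h (translate (t n) f) - h f) \<partial>M)"
      by (simp add: Bochner_Integration.integral_add[OF i[OF gh(1)] i[OF gh(2)]])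
  qed
next
  fix c g assume "(\<lambda>n. \<integral>f. cmod (g (translate (t n) f) - g f) \<partial>M) \<longlonglongrightarrow> 0"
  from tendsto_mult_right_zero[OF this, of "cmod c"]
  show "(\<lambda>n. \<integral>f. cmod (c * g (translate (t n) f) - c * g f) \<partial>M) \<longlonglongrightarrow> 0"
    by (simp add: norm_mult flip: right_diff_distrib)
next
  fix gn g assume b: "\<And>k. bdd (gn k)" "bdd g" and l: "\<And>k. (\<lambda>n. \<integral>f. cmod (gn k (translate (t n) f) - gn k f) \<partial>M) \<longlonglongrightarrow> 0"
    and lim: "(\<lambda>k. \<integral>f. cmod (gn k f - g f) \<partial>M) \<longlonglongrightarrow> 0"
  have i1: "integrable M (\<lambda>f. cmod (g1 f - g2 f))" if "bdd g1" "bdd g2" for g1 g2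
    by (rule integrable_norm[OF bdd_integrable[OF bdd_diff[OF that]]])
  show "(\<lambda>n. \<integral>f. cmod (g (translate (t n) f) - g f) \<partial>M) \<longlonglongrightarrow> 0"
  proof (rule LIMSEQ_approximate)
    fix e :: real assume "e > 0"
    then obtain k where k: "(\<integral>f. cmod (gn k f - g f) \<partial>M) < e / 2"
      using order_tendstoD(2)[OF lim, of "e / 2"] by (auto simp: eventually_sequentially)
    have "norm ((\<integral>f. cmod (g (translate (t n) f) - g f) \<partial>M) - (\<integral>f. cmod (gn k (translate (t n) f) - gn k f) \<partial>M)) \<le> e" for n
    proof -
      let ?T = "translate (t n)"
      note gT = bdd_comp[OF b(2) translate_M, of "t n"] and gkT = bdd_comp[OF b(1)[of k] translate_M, of "t n"]
      have "norm ((\<integral>f. cmod (g (?T f) - g f) \<partial>M) - (\<integral>f. cmod (gn k (?T f) - gn k f) \<partial>M))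
          = norm (\<integral>f. cmod (g (?T f) - g f) - cmod (gn k (?T f) - gn k f) \<partial>M)"
        by (subst Bochner_Integration.integral_diff[OF i1[OF gT b(2)] i1[OF gkT b(1)[of k]]]) simp
      also have "\<dots> \<le> (\<integral>f. norm (cmod (g (?T f) - g f) - cmod (gn k (?T f) - gn k f)) \<partial>M)"
        by (rule integral_norm_bound)
      also have "\<dots> \<le> (\<integral>f. cmod (gn k (?T f) - g (?T f)) + cmod (gn k f - g f) \<partial>M)"
      proof (rule integral_mono')
        show "integrable M (\<lambda>f. cmod (gn k (?T f) - g (?T f)) + cmod (gn k f - g f))"
          by (intro Bochner_Integration.integrable_add i1 b gT gkT)
        show "norm (cmod (g (?T f) - g f) - cmod (gn k (?T f) - gn k f)) \<le> cmod (gn k (?T f) - g (?T f)) + cmod (gn k f - g f)" for f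
        proof -
          have "norm (cmod (g (?T f) - g f) - cmod (gn k (?T f) - gn k f)) \<le> cmod ((g (?T f) - g f) - (gn k (?T f) - gn k f))"
            using norm_triangle_ineq3[of "g (?T f) - g f" "gn k (?T f) - gn k f"] by simp
          also have "\<dots> = cmod ((gn k f - g f) - (gn k (?T f) - g (?T f)))" by (simp add: algebra_simps)
          also have "\<dots> \<le> cmod (gn k f - g f) + cmod (gn k (?T f) - g (?T f))" by (rule norm_triangle_ineq4)
          finally show ?thesis by simp
        qed
      qed simp
      also have "\<dots> = (\<integral>f. cmod (gn k (?T f) - g (?T f)) \<partial>M) + (\<integral>f. cmod (gn k f - g f) \<partial>M)"
        by (rule Bochner_Integration.integral_add[OF i1[OF gkT gT] i1[OF b(1)[of k] b(2)]])
      also have "(\<integral>f. cmod (gn k (?T f) - g (?T f)) \<partial>M) = (\<integral>f. cmod (gn k f - g f) \<partial>M)"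
      proof -
        have "gn k \<in> borel_measurable M" "g \<in> borel_measurable M" using b unfolding bdd_def by auto
        then have "(\<lambda>f. cmod (gn k f - g f)) \<in> borel_measurable M" by measurable
        from mp_integral[OF translate_M translate_mp this] show ?thesis .
      qed
      finally show ?thesis using k by simp
    qed
    then show "\<exists>b l'. b \<longlonglongrightarrow> l' \<and> norm (l' - 0) \<le> e \<and> (\<forall>n. norm ((\<integral>f. cmod (g (translate (t n) f) - g f) \<partial>M) - b n) \<le> e)"
      using l[of k] \<open>e > 0\<close> by (intro exI[of _ "\<lambda>n. \<integral>f. cmod (gn k (translate (t n) f) - gn k f) \<partial>M"] exI[of _ 0]) auto
  qed
qed

text \<open>The bounded function \<open>cis (\<xi> 0 (Q f))\<close> is rigid along
  \<open>t n\<close>; through the intertwining map \<open>Q\<close> this becomes convergence in mean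
  of \<open>cis (\<xi> (s * t n) f)\<close> to \<open>cis (\<xi> 0 f)\<close>. The defect is then
  recovered from the characteristic integral
  \<open>exp (- rigidity_defect (s * t n) / 2)\<close>.\<close>

lemma self_similarity_rigid:
  assumes rig: "AE x in \<sigma>. (\<lambda>n. cis (t n * x)) \<longlonglongrightarrow> 1" and s: "s \<in> self_similarities M translate"
  shows "(\<lambda>n. rigidity_defect (s * t n)) \<longlonglongrightarrow> 0"
proof -
  have "isomorphic_flows M (\<lambda>t. translate (s * t)) M translate"
    using s by (simp add: self_similarities_def)
  then obtain Q where Q: "Q \<in> M \<rightarrow>\<^sub>M M" "distr M M Q = M"
    and eqv: "\<And>t. AE y in M. Q (translate t y) = translate (s * t) (Q y)"
    by (rule isomorphic_flows_inverse[OF _ prob_M prob_M]) (auto simp: translate_mp)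
  define \<xi> where "\<xi> u f = translate u f 0" for u f
  have r: "rep (\<lambda>x. cis (u * x)) (\<xi> u)" for u unfolding \<xi>_def by (rule rep_eval)
  have [measurable]: "\<xi> u \<in> borel_measurable M" for u using rep_L2(2)[OF r] by (simp add: L2_def)
  note Q(1)[measurable]
  have "bdd (\<lambda>f. cis (\<xi> 0 (Q f)))" by (rule bdd_cis) measurable
  from rigid_bounded[OF rig this]
  have "(\<lambda>n. \<integral>f. cmod (cis (\<xi> 0 (Q (translate (t n) f))) - cis (\<xi> 0 (Q f))) \<partial>M) \<longlonglongrightarrow> 0" .
  moreover have "(\<integral>f. cmod (cis (\<xi> 0 (Q (translate (t n) f))) - cis (\<xi> 0 (Q f))) \<partial>M)
      = (\<integral>f. cmod (cis (\<xi> (s * t n) f) - cis (\<xi> 0 f)) \<partial>M)" for n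
  proof -
    have "(\<integral>f. cmod (cis (\<xi> 0 (Q (translate (t n) f))) - cis (\<xi> 0 (Q f))) \<partial>M)
        = (\<integral>f. cmod (cis (\<xi> (s * t n) (Q f)) - cis (\<xi> 0 (Q f))) \<partial>M)"
    proof (rule integral_cong_AE)
      show "AE f in M. cmod (cis (\<xi> 0 (Q (translate (t n) f))) - cis (\<xi> 0 (Q f)))
          = cmod (cis (\<xi> (s * t n) (Q f)) - cis (\<xi> 0 (Q f)))"
        using eqv[of "t n"] by eventually_elim (simp add: \<xi>_def translate_def)
    qed (unfold cis_conv_exp, measurable)
    also have "\<dots> = (\<integral>f. cmod (cis (\<xi> (s * t n) f) - cis (\<xi> 0 f)) \<partial>M)"
      by (rule mp_integral[OF Q, of "\<lambda>f. cmod (cis (\<xi> (s * t n) f) - cis (\<xi> 0 f))"])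
        (unfold cis_conv_exp, measurable)
    finally show ?thesis .
  qed
  ultimately have l1: "(\<lambda>n. \<integral>f. cmod (cis (\<xi> (s * t n) f) - cis (\<xi> 0 f)) \<partial>M) \<longlonglongrightarrow> 0" by simp
  have rd: "rep (\<lambda>x. cis (u * x) - 1) (\<lambda>f. \<xi> u f - \<xi> 0 f)" for u
    using rep_diff[OF r[of u] r[of 0]] by simp
  have "(\<lambda>n. complex_of_real (exp (- rigidity_defect (s * t n) / 2)) - 1) \<longlonglongrightarrow> 0"
  proof (rule Lim_null_comparison[OF _ l1], intro always_eventually allI)
    fix n
    have ic: "integrable M (\<lambda>f. cis (\<xi> (s * t n) f - \<xi> 0 f))"
      by (rule bdd_integrable[OF bdd_cis]) measurable
    have c: "norm (cis (a - b) - 1) = norm (cis a - cis b)" for a b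
    proof -
      have "cis a - cis b = cis b * (cis (a - b) - 1)" by (simp add: algebra_simps cis_mult)
      then show ?thesis by (simp add: norm_mult)
    qed
    have "complex_of_real (exp (- rigidity_defect (s * t n) / 2)) - 1 = (\<integral>f. cis (\<xi> (s * t n) f - \<xi> 0 f) - 1 \<partial>M)"
      using rep_char[OF rd[of "s * t n"]] ic M.prob_space by (simp add: rigidity_defect_def)
    also have "norm \<dots> \<le> (\<integral>f. norm (cis (\<xi> (s * t n) f - \<xi> 0 f) - 1) \<partial>M)"
      by (rule integral_norm_bound)
    also have "(\<integral>f. norm (cis (\<xi> (s * t n) f - \<xi> 0 f) - 1) \<partial>M) = (\<integral>f. cmod (cis (\<xi> (s * t n) f) - cis (\<xi> 0 f)) \<partial>M)"
      by (simp only: c)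
    finally show "norm (complex_of_real (exp (- rigidity_defect (s * t n) / 2)) - 1)
        \<le> (\<integral>f. cmod (cis (\<xi> (s * t n) f) - cis (\<xi> 0 f)) \<partial>M)" .
  qed
  then have "(\<lambda>n. complex_of_real (exp (- rigidity_defect (s * t n) / 2))) \<longlonglongrightarrow> of_real 1"
    using LIM_zero_cancel by fastforce
  then have "(\<lambda>n. exp (- rigidity_defect (s * t n) / 2)) \<longlonglongrightarrow> 1"
    unfolding tendsto_of_real_iff .
  from tendsto_ln[OF this] have "(\<lambda>n. - rigidity_defect (s * t n) / 2) \<longlonglongrightarrow> 0" by simp
  from tendsto_mult[OF tendsto_const[of "-2"] this] show ?thesis by simp
qed

lemma rigidity_defect_eq: "rigidity_defect t = 2 * measure \<sigma> UNIV - 2 * (\<integral>x. cos (t * x) \<partial>\<sigma>)"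
proof -
  have ic: "integrable \<sigma> (\<lambda>x. cos (t * x))" by (rule integrable_const_bound[of _ 1]) auto
  have "(norm (cis (t * x) - 1))\<^sup>2 = 2 - 2 * cos (t * x)" for x
    using sin_cos_squared_add[of "t * x"] by (simp add: cmod_power2 power2_diff)
  then have "rigidity_defect t = (\<integral>x. 2 - 2 * cos (t * x) \<partial>\<sigma>)" by (simp add: rigidity_defect_def nsq_def)
  then show ?thesis using ic by simp
qed

lemma continuous_rigidity_defect: "continuous_on UNIV rigidity_defect"
proof -
  have "isCont (\<lambda>t. \<integral>x. cos (t * x) \<partial>\<sigma>) t" for t
    unfolding continuous_at_sequentially
  proof (intro allI impI, unfold o_def)
    fix u :: "nat \<Rightarrow> real" assume "u \<longlonglongrightarrow> t"
    then show "(\<lambda>n. \<integral>x. cos (u n * x) \<partial>\<sigma>) \<longlonglongrightarrow> (\<integral>x. cos (t * x) \<partial>\<sigma>)"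
      by (intro integral_dominated_convergence[where w = "\<lambda>_. 1"]) (auto intro!: tendsto_intros)
  qed
  then have "continuous_on UNIV (\<lambda>t. \<integral>x. cos (t * x) \<partial>\<sigma>)" by (simp add: continuous_at_imp_continuous_on)
  then show ?thesis unfolding rigidity_defect_eq[abs_def] by (intro continuous_intros)
qed

text \<open>Scales with small defect along a tail of \<open>t\<close> cannot fill an interval: there
  the integrals of \<open>cos (s * t n * x)\<close> would stay bounded below, while their averages
  over \<open>s\<close> tend to 0.\<close>

lemma meager_self_similarities:
  assumes rig: "AE x in \<sigma>. (\<lambda>n. cis (t n * x)) \<longlonglongrightarrow> 1" and t: "filterlim t at_top sequentially"
    and pos: "0 < measure \<sigma> UNIV" and zero: "emeasure \<sigma> {0} = 0"
  shows "meager_in (top_of_set (UNIV - {0 :: real})) (self_similarities M translate)"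
proof -
  define m where "m = measure \<sigma> UNIV"
  \<comment> \<open>The defect is \<open>2 * m\<close> minus twice the integral of the cosine, so
    the threshold \<open>m\<close> bounds that integral below by \<open>m / 2\<close>.\<close>
  define C where "C N = {s. \<forall>n\<ge>N. rigidity_defect (s * t n) \<le> m}" for N
  \<comment> \<open>Intersected with the group, as \<open>meager_in\<close> asks for a set equal to
    a union of nowhere dense sets.\<close>
  define A where "A N = C N \<inter> self_similarities M translate" for N
  have "C N = (\<Inter>n\<in>{N..}. {s. rigidity_defect (s * t n) \<le> m})" for N unfolding C_def by auto
  moreover have "closed {s. rigidity_defect (s * t n) \<le> m}" for n
  proof (rule closed_Collect_le)
    have "continuous_on UNIV (\<lambda>s. s * t n)" by (intro continuous_intros)
    then show "continuous_on UNIV (\<lambda>s. rigidity_defect (s * t n))"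
      by (rule continuous_on_compose2[OF continuous_rigidity_defect]) auto
  qed simp
  ultimately have closed: "closed (C N)" for N by auto
  have Iint: "interior (C N) = {}" for N
  proof (rule ccontr)
    assume "interior (C N) \<noteq> {}"
    then obtain s0 e where "e > 0" "cball s0 e \<subseteq> C N" by (metis all_not_in_conv mem_interior_cball)
    then have ab: "{s0 - e..s0 + e} \<subseteq> C N" by (simp add: cball_eq_atLeastAtMost)
    define a b where "a = s0 - e" and "b = s0 + e"
    have ab': "a < b" using \<open>e > 0\<close> by (simp add: a_def b_def)
    have D0: "AE x in \<sigma>. x \<noteq> 0" using zero by (subst AE_iff_measurable[OF _ refl]) auto
    have "(\<lambda>n. \<integral>s. indicator {a..b} s * (\<integral>x. 1 * cos (s * t n * x) \<partial>\<sigma>) \<partial>lborel) \<longlonglongrightarrow> 0"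
      by (rule oscillating_average_tendsto_0[OF finite_measure_axioms less_imp_le[OF ab'] _ _ D0 t]) simp_all
    moreover have "0 < m * (b - a) / 2" using pos ab' by (simp add: m_def)
    ultimately have "eventually (\<lambda>n. (\<integral>s. indicator {a..b} s * (\<integral>x. 1 * cos (s * t n * x) \<partial>\<sigma>) \<partial>lborel) < m * (b - a) / 2) sequentially"
      by (rule order_tendstoD)
    then obtain n where n: "n \<ge> N" "(\<integral>s. indicator {a..b} s * (\<integral>x. 1 * cos (s * t n * x) \<partial>\<sigma>) \<partial>lborel) < m * (b - a) / 2"
    proof -
      assume "eventually (\<lambda>n. (\<integral>s. indicator {a..b} s * (\<integral>x. 1 * cos (s * t n * x) \<partial>\<sigma>) \<partial>lborel) < m * (b - a) / 2) sequentially"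
        and th: "\<And>n. N \<le> n \<Longrightarrow> (\<integral>s. indicator {a..b} s * (\<integral>x. 1 * cos (s * t n * x) \<partial>\<sigma>) \<partial>lborel) < m * (b - a) / 2 \<Longrightarrow> thesis"
      from eventually_conj[OF eventually_ge_at_top[of N] this(1)] show thesis
        using th unfolding eventually_sequentially by blast
    qed
    have ge: "m / 2 \<le> (\<integral>x. cos (s * t n * x) \<partial>\<sigma>)" if "s \<in> {a..b}" for s
    proof -
      have "s \<in> C N" using that ab by (auto simp: a_def b_def)
      then have "rigidity_defect (s * t n) \<le> m" using n(1) by (simp add: C_def)
      then show ?thesis by (simp add: rigidity_defect_eq m_def)
    qed
    have le: "\<bar>\<integral>x. cos (s * t n * x) \<partial>\<sigma>\<bar> \<le> m" for s
    proof -
      have "\<bar>\<integral>x. cos (s * t n * x) \<partial>\<sigma>\<bar> \<le> (\<integral>x. norm (cos (s * t n * x)) \<partial>\<sigma>)"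
        unfolding real_norm_def[symmetric] by (rule integral_norm_bound)
      also have "\<dots> \<le> (\<integral>x. 1 \<partial>\<sigma>)" by (rule integral_mono') auto
      finally show ?thesis by (simp add: m_def)
    qed
    have ii: "integrable lborel (\<lambda>s. indicator {a..b} s :: real)"
    by (intro integrable_real_indicator) (auto simp: emeasure_lborel_Icc_eq)
    have "m * (b - a) / 2 = (\<integral>s. indicator {a..b} s * (m / 2) \<partial>lborel)" using ab' by simp
    also have "\<dots> \<le> (\<integral>s. indicator {a..b} s * (\<integral>x. 1 * cos (s * t n * x) \<partial>\<sigma>) \<partial>lborel)"
    proof (rule integral_mono)
      show "integrable lborel (\<lambda>s. indicator {a..b} s * (m / 2))" using ii by simp
      have "integrable lborel (\<lambda>s. indicator {a..b} s * m)" using ii by simp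
      then show "integrable lborel (\<lambda>s. indicator {a..b} s * (\<integral>x. 1 * cos (s * t n * x) \<partial>\<sigma>))"
        by (rule Bochner_Integration.integrable_bound)
          (auto simp: abs_mult split: split_indicator intro!: order_trans[OF le])
    qed (use ge in \<open>auto split: split_indicator\<close>)
    finally show False using n(2) by simp
  qed
  have nd: "nowhere_dense_in (top_of_set (UNIV - {0})) (A N)" for N
    unfolding nowhere_dense_in_def
  proof
    show "A N \<subseteq> topspace (top_of_set (UNIV - {0}))"
      by (auto simp: A_def self_similarities_def)
    have "top_of_set (UNIV - {0}) closure_of A N \<subseteq> C N"
      unfolding closure_of_subtopology using closure_minimal[OF _ closed[of N], of "(UNIV - {0}) \<inter> A N"]
      by (auto simp: A_def)
    then have "top_of_set (UNIV - {0}) interior_of (top_of_set (UNIV - {0}) closure_of A N)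
        \<subseteq> top_of_set (UNIV - {0}) interior_of C N" by (rule interior_of_mono)
    also have "\<dots> = (UNIV - {0}) \<inter> interior (C N)"
      by (subst interior_of_subtopology_open) auto
    finally show "top_of_set (UNIV - {0}) interior_of (top_of_set (UNIV - {0}) closure_of A N) = {}"
      using Iint by auto
  qed
  have "self_similarities M translate = (\<Union>N. A N)"
  proof
    show "self_similarities M translate \<subseteq> (\<Union>N. A N)"
    proof
      fix s assume s: "s \<in> self_similarities M translate"
      have "eventually (\<lambda>n. rigidity_defect (s * t n) < m) sequentially"
        using order_tendstoD(2)[OF self_similarity_rigid[OF rig s]] pos by (simp add: m_def)
      then obtain N where "\<forall>n\<ge>N. rigidity_defect (s * t n) < m" by (auto simp: eventually_sequentially)
      then have "s \<in> A N" using s by (auto simp: A_def C_def intro: less_imp_le)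
      then show "s \<in> (\<Union>N. A N)" by blast
    qed
  qed (auto simp: A_def)
  then show ?thesis
    unfolding meager_in_def using nd by (intro exI[of _ "range A"]) auto
qed

end

section \<open>Weak mixing\<close>

context spectral_measure
begin

lemma integrable_power: "integrable \<sigma> (\<lambda>x. x ^ k)"
proof -
  have "L2 \<sigma> (\<lambda>x. x ^ k)"
    by (rule L2_bound[OF L2_power_exp[of k 0]]) (auto simp: power_abs)
  then show ?thesis by (rule L2_integrable1)
qed

lemma integrable_power_times:
  assumes [measurable]: "c \<in> borel_measurable borel" and c: "\<And>x. \<bar>c x\<bar> \<le> 1"
  shows "integrable \<sigma> (\<lambda>x. x ^ k * c x :: real)"
  by (rule Bochner_Integration.integrable_bound[OF integrable_power[of k]])
    (auto simp: abs_mult mult_left_le c)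

text \<open>The squared modulus at \<open>t\<close> of the Fourier transform of \<open>x ^ k\<close>
  times \<open>\<sigma>\<close>.\<close>

definition moment_sq :: "nat \<Rightarrow> real \<Rightarrow> real" where
  "moment_sq k t = (\<integral>x. x ^ k * cos (t * x) \<partial>\<sigma>)\<^sup>2 + (\<integral>x. x ^ k * sin (t * x) \<partial>\<sigma>)\<^sup>2"

text \<open>Wiener's argument: \<open>moment_sq k t\<close> is the double integral of
  \<open>(x * y) ^ k * cos (t * (x - y))\<close>, and \<open>x \<noteq> y\<close> almost everywhere
  in the absence of atoms. One sequence serves all powers: the sum over \<open>k \<le> j\<close> has
  averages tending to 0, so at some time it falls below \<open>1 / Suc j\<close>.\<close>

lemma vanishing_sequence:
  assumes atomless: "\<And>a. emeasure \<sigma> {a} = 0"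
  shows "\<exists>\<tau>. \<forall>k. (\<lambda>n. moment_sq k (\<tau> n)) \<longlonglongrightarrow> 0"
proof -
  interpret P: pair_sigma_finite \<sigma> \<sigma>
    by (intro pair_sigma_finite.intro sigma_finite_measure)
  define w where "w k z = (fst z * snd z) ^ k" for k and z :: "real \<times> real"
  define D where "D z = fst z - snd z" for z :: "real \<times> real"
  have wm[measurable]: "w k \<in> borel_measurable (\<sigma> \<Otimes>\<^sub>M \<sigma>)" for k unfolding w_def[abs_def] by measurable
  have Dm[measurable]: "D \<in> borel_measurable (\<sigma> \<Otimes>\<^sub>M \<sigma>)" unfolding D_def[abs_def] by measurable
  have wi: "integrable (\<sigma> \<Otimes>\<^sub>M \<sigma>) (w k)" for k
  proof (rule P.Fubini_integrable)
    show "integrable \<sigma> (\<lambda>x. \<integral>y. norm (w k (x, y)) \<partial>\<sigma>)"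
      using integrable_norm[OF integrable_power[of k]] by (simp add: w_def power_mult_distrib abs_mult)
    show "AE x in \<sigma>. integrable \<sigma> (\<lambda>y. w k (x, y))"
      using integrable_power[of k] by (simp add: w_def power_mult_distrib)
  qed simp
  have D0: "AE z in \<sigma> \<Otimes>\<^sub>M \<sigma>. D z \<noteq> 0"
  proof (rule P.AE_pair_measure)
    show "{z \<in> space (\<sigma> \<Otimes>\<^sub>M \<sigma>). D z \<noteq> 0} \<in> sets (\<sigma> \<Otimes>\<^sub>M \<sigma>)" by measurable
    have "AE y in \<sigma>. x - y \<noteq> 0" for x
      using atomless[of x] by (subst AE_iff_measurable[of "{x}"]) auto
    then show "AE x in \<sigma>. AE y in \<sigma>. D (x, y) \<noteq> 0" by (simp add: D_def)
  qed
  have fin: "finite_measure (\<sigma> \<Otimes>\<^sub>M \<sigma>)"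
    by (rule finite_measure_pair_measure) (rule finite_measure_axioms)+
  define G where "G k n s = (\<integral>z. w k z * cos (s * real n * D z) \<partial>(\<sigma> \<Otimes>\<^sub>M \<sigma>))" for k n s
  have wci: "integrable (\<sigma> \<Otimes>\<^sub>M \<sigma>) (\<lambda>z. w k z * cos (t * D z))" for k t
    by (rule Bochner_Integration.integrable_bound[OF wi[of k]]) (auto simp: abs_mult mult_left_le)
  have G_eq: "G k n s = moment_sq k (s * real n)" for k n s
  proof -
    let ?t = "s * real n"
    let ?C = "\<integral>x. x ^ k * cos (?t * x) \<partial>\<sigma>" and ?S = "\<integral>x. x ^ k * sin (?t * x) \<partial>\<sigma>"
    have ic: "integrable \<sigma> (\<lambda>x. x ^ k * cos (?t * x))" and isn: "integrable \<sigma> (\<lambda>x. x ^ k * sin (?t * x))"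
      by (rule integrable_power_times; simp)+
    have "G k n s = (\<integral>x. (\<integral>y. w k (x, y) * cos (?t * D (x, y)) \<partial>\<sigma>) \<partial>\<sigma>)"
      unfolding G_def using P.integral_fst'[OF wci[of k ?t]] by simp
    also have "\<dots> = (\<integral>x. x ^ k * cos (?t * x) * ?C + x ^ k * sin (?t * x) * ?S \<partial>\<sigma>)"
    proof (rule Bochner_Integration.integral_cong[OF refl])
      fix x
      have "w k (x, y) * cos (?t * D (x, y))
          = x ^ k * cos (?t * x) * (y ^ k * cos (?t * y)) + x ^ k * sin (?t * x) * (y ^ k * sin (?t * y))" for y
        by (simp add: w_def D_def right_diff_distrib cos_diff power_mult_distrib algebra_simps)
      then show "(\<integral>y. w k (x, y) * cos (?t * D (x, y)) \<partial>\<sigma>) = x ^ k * cos (?t * x) * ?C + x ^ k * sin (?t * x) * ?S"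
        using ic isn by simp
    qed
    also have "\<dots> = ?C * ?C + ?S * ?S" using ic isn by simp
    finally show ?thesis by (simp add: moment_sq_def power2_eq_square)
  qed
  have avg: "(\<lambda>n. \<integral>s. indicator {0..1::real} s * G k n s \<partial>lborel) \<longlonglongrightarrow> 0" for k
    unfolding G_def
    by (rule oscillating_average_tendsto_0[OF fin _ wi Dm D0 filterlim_real_sequentially]) simp
  have ii: "integrable lborel (\<lambda>s. indicator {0..1::real} s :: real)"
    by (intro integrable_real_indicator) (auto simp: emeasure_lborel_Icc_eq)
  have Gi: "integrable lborel (\<lambda>s. indicator {0..1::real} s * G k n s)" for k n
  proof (rule Bochner_Integration.integrable_bound)
    show "integrable lborel (\<lambda>s. indicator {0..1::real} s * (\<integral>z. norm (w k z) \<partial>(\<sigma> \<Otimes>\<^sub>M \<sigma>)))" using ii by simp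
    have "\<bar>G k n s\<bar> \<le> (\<integral>z. norm (w k z) \<partial>(\<sigma> \<Otimes>\<^sub>M \<sigma>))" for s
    proof -
      have "\<bar>G k n s\<bar> \<le> (\<integral>z. norm (w k z * cos (s * real n * D z)) \<partial>(\<sigma> \<Otimes>\<^sub>M \<sigma>))"
        unfolding G_def real_norm_def[symmetric] by (rule integral_norm_bound)
      also have "\<dots> \<le> (\<integral>z. norm (w k z) \<partial>(\<sigma> \<Otimes>\<^sub>M \<sigma>))"
        by (rule integral_mono'[OF integrable_norm[OF wi]]) (auto simp: abs_mult mult_left_le)
      finally show ?thesis .
    qed
    then show "AE s in lborel. norm (indicator {0..1::real} s * G k n s) \<le> norm (indicator {0..1::real} s * (\<integral>z. norm (w k z) \<partial>(\<sigma> \<Otimes>\<^sub>M \<sigma>)))"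
      by (auto simp: abs_mult split: split_indicator)
    show "(\<lambda>s. indicator {0..1::real} s * G k n s) \<in> borel_measurable lborel" unfolding G_def by measurable
  qed
  have "\<exists>t. (\<Sum>k\<le>j. moment_sq k t) < inverse (real (Suc j))" for j
  proof -
    have "(\<lambda>n. \<Sum>k\<le>j. \<integral>s. indicator {0..1::real} s * G k n s \<partial>lborel) \<longlonglongrightarrow> (\<Sum>k\<le>j. 0)"
      by (intro tendsto_sum avg)
    then have "eventually (\<lambda>n. (\<Sum>k\<le>j. \<integral>s. indicator {0..1::real} s * G k n s \<partial>lborel) < inverse (real (Suc j))) sequentially"
      by (rule order_tendstoD) simp
    then obtain n where n: "(\<Sum>k\<le>j. \<integral>s. indicator {0..1::real} s * G k n s \<partial>lborel) < inverse (real (Suc j))"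
      by (auto simp: eventually_sequentially)
    have "\<exists>s\<in>{0..1}. (\<Sum>k\<le>j. G k n s) < inverse (real (Suc j))"
    proof (rule ccontr)
      assume "\<not> ?thesis"
      then have ge: "inverse (real (Suc j)) \<le> (\<Sum>k\<le>j. G k n s)" if "s \<in> {0..1}" for s
        using that not_less by blast
      have "inverse (real (Suc j)) = (\<integral>s. indicator {0..1::real} s * inverse (real (Suc j)) \<partial>lborel)" by simp
      also have "\<dots> \<le> (\<integral>s. (\<Sum>k\<le>j. indicator {0..1::real} s * G k n s) \<partial>lborel)"
      proof (rule integral_mono)
        show "integrable lborel (\<lambda>s. indicator {0..1::real} s * inverse (real (Suc j)))" using ii by simp
        show "indicator {0..1::real} s * inverse (real (Suc j)) \<le> (\<Sum>k\<le>j. indicator {0..1::real} s * G k n s)" for s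
          using ge[of s] by (cases "s \<in> {0..1}") (simp_all del: of_nat_Suc)
      qed (intro Bochner_Integration.integrable_sum Gi)
      also have "\<dots> = (\<Sum>k\<le>j. \<integral>s. indicator {0..1::real} s * G k n s \<partial>lborel)"
        by (intro Bochner_Integration.integral_sum Gi)
      finally show False using n by simp
    qed
    then show ?thesis unfolding G_eq by blast
  qed
  then have "\<exists>\<tau>. \<forall>j. (\<Sum>k\<le>j. moment_sq k (\<tau> j)) < inverse (real (Suc j))" by (intro choice allI)
  then obtain \<tau> where \<tau>: "\<And>j. (\<Sum>k\<le>j. moment_sq k (\<tau> j)) < inverse (real (Suc j))" by blast
  have nn: "0 \<le> moment_sq k t" for k t by (simp add: moment_sq_def)
  have "(\<lambda>n. moment_sq k (\<tau> n)) \<longlonglongrightarrow> 0" for k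
  proof (rule tendsto_sandwich[OF _ _ tendsto_const LIMSEQ_inverse_real_of_nat])
    show "eventually (\<lambda>n. 0 \<le> moment_sq k (\<tau> n)) sequentially" using nn by simp
    show "eventually (\<lambda>n. moment_sq k (\<tau> n) \<le> inverse (real (Suc n))) sequentially"
      using eventually_ge_at_top[of k]
    proof eventually_elim
      case (elim n)
      have "moment_sq k (\<tau> n) \<le> (\<Sum>k\<le>n. moment_sq k (\<tau> n))"
        by (rule member_le_sum) (use elim nn in auto)
      then show ?case using \<tau>[of n] by simp
    qed
  qed
  then show ?thesis by blast
qed

lemma cis_power_integral_tendsto:
  assumes "(\<lambda>n. moment_sq k (\<tau> n)) \<longlonglongrightarrow> 0"
  shows "(\<lambda>n. \<integral>x. cis (\<tau> n * x) * complex_of_real x ^ k \<partial>\<sigma>) \<longlonglongrightarrow> 0"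
proof -
  have i: "integrable \<sigma> (\<lambda>x. cis (t * x) * complex_of_real x ^ k)" for t
    by (rule Bochner_Integration.integrable_bound[OF integrable_power[of k]])
      (auto simp: norm_mult norm_power cis_conv_exp power_abs)
  have "(cmod (\<integral>x. cis (t * x) * complex_of_real x ^ k \<partial>\<sigma>))\<^sup>2 = moment_sq k t" for t
  proof -
    have "Re (cis (t * x) * complex_of_real x ^ k) = x ^ k * cos (t * x)" "Im (cis (t * x) * complex_of_real x ^ k) = x ^ k * sin (t * x)" for x
      by (simp_all flip: of_real_power)
    then show ?thesis
      unfolding cmod_power2 moment_sq_def using integral_Re[OF i[of t]] integral_Im[OF i[of t]] by (simp add: mult.commute)
  qed
  then have "(\<lambda>n. (cmod (\<integral>x. cis (\<tau> n * x) * complex_of_real x ^ k \<partial>\<sigma>))\<^sup>2) \<longlonglongrightarrow> 0" using assms by simp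
  from tendsto_real_sqrt[OF this] show ?thesis by (simp add: tendsto_norm_zero_iff)
qed

lemma ev_correlation_tendsto:
  assumes \<tau>: "\<And>k. (\<lambda>n. moment_sq k (\<tau> n)) \<longlonglongrightarrow> 0"
  shows "(\<lambda>n. \<integral>x. cis (\<tau> n * x) * (ev p x * cnj (ev q x)) \<partial>\<sigma>) \<longlonglongrightarrow> 0"
proof -
  have i: "integrable \<sigma> (\<lambda>x. cis (t * x) * complex_of_real x ^ k)" for t k
    by (rule Bochner_Integration.integrable_bound[OF integrable_power[of k]])
      (auto simp: norm_mult norm_power cis_conv_exp power_abs)
  define c where "c j k = complex_of_real (coeff p j) * \<i> ^ j * (complex_of_real (coeff q k) * (- \<i>) ^ k)" for j k
  have "cis t * (ev p x * cnj (ev q x)) = (\<Sum>j\<le>degree p. \<Sum>k\<le>degree q. c j k * (cis t * complex_of_real x ^ (j + k)))" for t x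
  proof -
    have "ev p x * cnj (ev q x) = (\<Sum>j\<le>degree p. \<Sum>k\<le>degree q.
        (coeff p j *\<^sub>R (\<i> * x) ^ j) * (coeff q k *\<^sub>R (- \<i> * x) ^ k))"
      by (simp add: ev_def lift_poly_def sum_product)
    also have "\<dots> = (\<Sum>j\<le>degree p. \<Sum>k\<le>degree q. c j k * complex_of_real x ^ (j + k))"
    proof (intro sum.cong refl)
      fix j k
      have "(- \<i> * complex_of_real x) ^ k = (- \<i>) ^ k * complex_of_real x ^ k" by (rule power_mult_distrib)
      then show "(coeff p j *\<^sub>R (\<i> * x) ^ j) * (coeff q k *\<^sub>R (- \<i> * x) ^ k) = c j k * complex_of_real x ^ (j + k)"
        unfolding c_def scaleR_conv_of_real by (simp only: power_mult_distrib power_add) (simp add: mult_ac)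
    qed
    finally show ?thesis by (simp add: sum_distrib_left mult_ac)
  qed
  then have "(\<integral>x. cis (t * x) * (ev p x * cnj (ev q x)) \<partial>\<sigma>)
      = (\<Sum>j\<le>degree p. \<Sum>k\<le>degree q. c j k * (\<integral>x. cis (t * x) * complex_of_real x ^ (j + k) \<partial>\<sigma>))" for t
    using i by (simp add: Bochner_Integration.integral_sum Bochner_Integration.integrable_sum)
  moreover have "(\<lambda>n. \<Sum>j\<le>degree p. \<Sum>k\<le>degree q. c j k * (\<integral>x. cis (\<tau> n * x) * complex_of_real x ^ (j + k) \<partial>\<sigma>)) \<longlonglongrightarrow> 0"
    by (intro tendsto_null_sum tendsto_mult_right_zero cis_power_integral_tendsto \<tau>)
  ultimately show ?thesis by simp
qed

end

section \<open>Mixing along a sequence of times\<close>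

context gaussian_paths
begin

text \<open>The left side is the characteristic integral of a sum whose variance differs from the
  sum of the two variances by twice the correlation \<open>Re (I n)\<close>, and this correlation
  tends to 0.\<close>

lemma mixing_characters:
  assumes \<tau>: "\<And>k. (\<lambda>n. moment_sq k (\<tau> n)) \<longlonglongrightarrow> 0"
  shows "(\<lambda>n. \<integral>f. cis (lin p (translate (\<tau> n) f)) * cis (lin q f) \<partial>M)
    \<longlonglongrightarrow> (\<integral>f. cis (lin p f) \<partial>M) * (\<integral>f. cis (lin q f) \<partial>M)"
proof -
  define I where "I n = (\<integral>x. cis (\<tau> n * x) * (ev p x * cnj (ev q x)) \<partial>\<sigma>)" for n
  have eq: "(\<integral>f. cis (lin p (translate (\<tau> n) f)) * cis (lin q f) \<partial>M)
      = complex_of_real (exp (- (nsq \<sigma> (ev p) + nsq \<sigma> (ev q) + 2 * Re (I n)) / 2))" for n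
  proof -
    have r: "rep (\<lambda>x. cis (\<tau> n * x) * ev p x + ev q x) (\<lambda>f. lin p (translate (\<tau> n) f) + lin q f)"
      by (rule rep_add[OF rep_translate_comp[OF rep_lin] rep_lin])
    have L: "L2 \<sigma> (\<lambda>x. cis (\<tau> n * x) * ev p x)" using rep_L2(1)[OF rep_translate_comp[OF rep_lin]] .
    have i: "integrable \<sigma> (\<lambda>x. cis (\<tau> n * x) * (ev p x * cnj (ev q x)))"
      using L2_mult_integrable[OF L L2_cnj[OF L2_ev[of q]]] by (simp add: mult.assoc)
    define R where "R x = Re (cis (\<tau> n * x) * (ev p x * cnj (ev q x)))" for x
    have Ri: "integrable \<sigma> R" unfolding R_def by (rule integrable_Re[OF i])
    have "(norm (cis (\<tau> n * x) * ev p x + ev q x))\<^sup>2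
        = (norm (ev p x))\<^sup>2 + (norm (ev q x))\<^sup>2 + 2 * R x" for x
    proof -
      have "(norm (a + b))\<^sup>2 = (norm a)\<^sup>2 + (norm b)\<^sup>2 + 2 * Re (a * cnj b)" for a b :: complex
        by (simp only: cmod_power2 complex_add_cnj) (simp add: power2_eq_square algebra_simps)
      from this[of "cis (\<tau> n * x) * ev p x" "ev q x"] show ?thesis
        by (simp add: R_def norm_mult mult.assoc)
    qed
    then have "nsq \<sigma> (\<lambda>x. cis (\<tau> n * x) * ev p x + ev q x)
        = (\<integral>x. (norm (ev p x))\<^sup>2 + (norm (ev q x))\<^sup>2 + 2 * R x \<partial>\<sigma>)"
      unfolding nsq_def by presburger
    also have "\<dots> = nsq \<sigma> (ev p) + nsq \<sigma> (ev q) + 2 * (\<integral>x. R x \<partial>\<sigma>)"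
      unfolding nsq_def using L2_integrable[OF L2_ev[of p]] L2_integrable[OF L2_ev[of q]] Ri
      by (subst Bochner_Integration.integral_add; (subst Bochner_Integration.integral_add)?) auto
    also have "(\<integral>x. R x \<partial>\<sigma>) = Re (I n)"
      unfolding I_def R_def by (rule integral_Re[OF i])
    finally show ?thesis using rep_char[OF r] by (simp add: cis_mult)
  qed
  have "(\<lambda>n. Re (I n)) \<longlonglongrightarrow> Re 0"
    unfolding I_def by (intro tendsto_Re ev_correlation_tendsto \<tau>)
  then have "(\<lambda>n. complex_of_real (exp (- (nsq \<sigma> (ev p) + nsq \<sigma> (ev q) + 2 * Re (I n)) / 2)))
      \<longlonglongrightarrow> complex_of_real (exp (- (nsq \<sigma> (ev p) + nsq \<sigma> (ev q) + 2 * Re 0) / 2))"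
    by (intro tendsto_of_real tendsto_exp tendsto_divide tendsto_minus tendsto_add tendsto_mult tendsto_const;
        (assumption | simp))
  moreover have "complex_of_real (exp (- (nsq \<sigma> (ev p) + nsq \<sigma> (ev q) + 2 * Re 0) / 2))
      = (\<integral>f. cis (lin p f) \<partial>M) * (\<integral>f. cis (lin q f) \<partial>M)"
    unfolding char_lin by (simp add: exp_add[symmetric] add_divide_distrib flip: of_real_mult)
  ultimately show ?thesis unfolding eq by simp
qed

definition mixes :: "(nat \<Rightarrow> real) \<Rightarrow> (path \<Rightarrow> complex) \<Rightarrow> (path \<Rightarrow> complex) \<Rightarrow> bool" where
  "mixes \<tau> g k \<longleftrightarrow> (\<lambda>n. \<integral>f. g (translate (\<tau> n) f) * k f \<partial>M) \<longlonglongrightarrow> (\<integral>f. g f \<partial>M) * (\<integral>f. k f \<partial>M)"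

lemma norm_integral_mult_le:
  assumes "bdd g" "bdd k" "\<And>f. f \<in> space M \<Longrightarrow> cmod (k f) \<le> B"
  shows "cmod (\<integral>f. g f * k f \<partial>M) \<le> B * (\<integral>f. cmod (g f) \<partial>M)"
proof -
  have "cmod (\<integral>f. g f * k f \<partial>M) \<le> (\<integral>f. cmod (g f * k f) \<partial>M)" by (rule integral_norm_bound)
  also have "\<dots> \<le> (\<integral>f. B * cmod (g f) \<partial>M)"
  proof (rule integral_mono)
    show "integrable M (\<lambda>f. cmod (g f * k f))" by (rule integrable_norm[OF bdd_integrable[OF bdd_mult[OF assms(1,2)]]])
    show "integrable M (\<lambda>f. B * cmod (g f))" using integrable_norm[OF bdd_integrable[OF assms(1)]] by simp
    show "cmod (g f * k f) \<le> B * cmod (g f)" if "f \<in> space M" for f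
      unfolding norm_mult using mult_right_mono[OF assms(3)[OF that] norm_ge_zero[of "g f"]] by (simp add: mult.commute)
  qed
  finally show ?thesis by simp
qed

lemma norm_integral_le: "bdd g \<Longrightarrow> cmod (\<integral>f. g f \<partial>M) \<le> (\<integral>f. cmod (g f) \<partial>M)"
  by (rule integral_norm_bound)

lemma mixes_limit_left:
  assumes b: "\<And>j. bdd (gn j)" "bdd g" "bdd k" and m: "\<And>j. mixes \<tau> (gn j) k"
    and lim: "(\<lambda>j. \<integral>f. cmod (gn j f - g f) \<partial>M) \<longlonglongrightarrow> 0"
  shows "mixes \<tau> g k"
  unfolding mixes_def
proof (rule LIMSEQ_approximate)
  fix e :: real assume e: "e > 0"
  obtain B where B: "\<And>f. f \<in> space M \<Longrightarrow> cmod (k f) \<le> B" using b(3) by (rule bddE) blast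
  define B' where "B' = max B 1"
  have B': "\<And>f. f \<in> space M \<Longrightarrow> cmod (k f) \<le> B'" "B' > 0" using B by (fastforce simp: B'_def)+
  have "eventually (\<lambda>j. (\<integral>f. cmod (gn j f - g f) \<partial>M) < e / B') sequentially"
    using order_tendstoD(2)[OF lim] e B'(2) by simp
  then obtain j where "(\<integral>f. cmod (gn j f - g f) \<partial>M) < e / B'" by (auto simp: eventually_sequentially)
  then have j: "B' * (\<integral>f. cmod (gn j f - g f) \<partial>M) < e" using B'(2) by (simp add: field_simps)
  note bd = bdd_diff[OF b(1)[of j] b(2)]
  show "\<exists>b l. b \<longlonglongrightarrow> l \<and> cmod (l - (\<integral>f. g f \<partial>M) * (\<integral>f. k f \<partial>M)) \<le> e \<and>
      (\<forall>n. cmod ((\<integral>f. g (translate (\<tau> n) f) * k f \<partial>M) - b n) \<le> e)"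
  proof (intro exI conjI allI)
    show "(\<lambda>n. \<integral>f. gn j (translate (\<tau> n) f) * k f \<partial>M) \<longlonglongrightarrow> (\<integral>f. gn j f \<partial>M) * (\<integral>f. k f \<partial>M)"
      using m[of j] by (simp add: mixes_def)
    have "(\<integral>f. gn j f \<partial>M) * (\<integral>f. k f \<partial>M) - (\<integral>f. g f \<partial>M) * (\<integral>f. k f \<partial>M) = (\<integral>f. gn j f - g f \<partial>M) * (\<integral>f. k f \<partial>M)"
      using bdd_integrable[OF b(1)[of j]] bdd_integrable[OF b(2)] by (simp add: left_diff_distrib)
    also have "cmod \<dots> \<le> (\<integral>f. cmod (gn j f - g f) \<partial>M) * B'"
      unfolding norm_mult
    proof (rule mult_mono)
      show "cmod (\<integral>f. k f \<partial>M) \<le> B'"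
      proof -
        have "(\<integral>f. cmod (k f) \<partial>M) \<le> (\<integral>f. B' \<partial>M)"
          by (rule integral_mono) (use B' integrable_norm[OF bdd_integrable[OF b(3)]] in auto)
        also have "\<dots> = B'" using M.prob_space by simp
        finally show ?thesis by (rule order_trans[OF norm_integral_le[OF b(3)]])
      qed
    qed (use norm_integral_le[OF bd] B'(2) in auto)
    finally show "cmod ((\<integral>f. gn j f \<partial>M) * (\<integral>f. k f \<partial>M) - (\<integral>f. g f \<partial>M) * (\<integral>f. k f \<partial>M)) \<le> e"
      using j by (simp add: mult.commute)
    fix n
    let ?T = "translate (\<tau> n)"
    note gT = bdd_comp[OF b(2) translate_M, of "\<tau> n"] and gjT = bdd_comp[OF b(1)[of j] translate_M, of "\<tau> n"]
    have "(\<integral>f. g (?T f) * k f \<partial>M) - (\<integral>f. gn j (?T f) * k f \<partial>M) = - (\<integral>f. (gn j (?T f) - g (?T f)) * k f \<partial>M)"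
      using bdd_integrable[OF bdd_mult[OF gT b(3)]] bdd_integrable[OF bdd_mult[OF gjT b(3)]]
      by (simp add: left_diff_distrib)
    also have "cmod \<dots> = cmod (\<integral>f. (gn j (?T f) - g (?T f)) * k f \<partial>M)" by (rule norm_minus_cancel)
    also have "\<dots> \<le> B' * (\<integral>f. cmod (gn j (?T f) - g (?T f)) \<partial>M)"
      by (rule norm_integral_mult_le[OF bdd_diff[OF gjT gT] b(3) B'(1)])
    also have "(\<integral>f. cmod (gn j (?T f) - g (?T f)) \<partial>M) = (\<integral>f. cmod (gn j f - g f) \<partial>M)"
      using mp_integral[OF translate_M translate_mp, of "\<lambda>f. cmod (gn j f - g f)"] bdd_measurable[OF bd]
      by (simp add: borel_measurable_norm)
    finally show "cmod ((\<integral>f. g (?T f) * k f \<partial>M) - (\<integral>f. gn j (?T f) * k f \<partial>M)) \<le> e" using j by simp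
  qed
qed

lemma mixes_limit_right:
  assumes b: "\<And>j. bdd (kn j)" "bdd k" "bdd g" and m: "\<And>j. mixes \<tau> g (kn j)"
    and lim: "(\<lambda>j. \<integral>f. cmod (kn j f - k f) \<partial>M) \<longlonglongrightarrow> 0"
  shows "mixes \<tau> g k"
  unfolding mixes_def
proof (rule LIMSEQ_approximate)
  fix e :: real assume e: "e > 0"
  obtain B where B: "\<And>f. f \<in> space M \<Longrightarrow> cmod (g f) \<le> B" using b(3) by (rule bddE) blast
  define B' where "B' = max B 1"
  have B': "\<And>f. f \<in> space M \<Longrightarrow> cmod (g f) \<le> B'" "B' > 0" using B by (fastforce simp: B'_def)+
  have "eventually (\<lambda>j. (\<integral>f. cmod (kn j f - k f) \<partial>M) < e / B') sequentially"
    using order_tendstoD(2)[OF lim] e B'(2) by simp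
  then obtain j where "(\<integral>f. cmod (kn j f - k f) \<partial>M) < e / B'" by (auto simp: eventually_sequentially)
  then have j: "B' * (\<integral>f. cmod (kn j f - k f) \<partial>M) < e" using B'(2) by (simp add: field_simps)
  note bd = bdd_diff[OF b(1)[of j] b(2)]
  show "\<exists>b l. b \<longlonglongrightarrow> l \<and> cmod (l - (\<integral>f. g f \<partial>M) * (\<integral>f. k f \<partial>M)) \<le> e \<and>
      (\<forall>n. cmod ((\<integral>f. g (translate (\<tau> n) f) * k f \<partial>M) - b n) \<le> e)"
  proof (intro exI conjI allI)
    show "(\<lambda>n. \<integral>f. g (translate (\<tau> n) f) * kn j f \<partial>M) \<longlonglongrightarrow> (\<integral>f. g f \<partial>M) * (\<integral>f. kn j f \<partial>M)"
      using m[of j] by (simp add: mixes_def)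
    have "(\<integral>f. g f \<partial>M) * (\<integral>f. kn j f \<partial>M) - (\<integral>f. g f \<partial>M) * (\<integral>f. k f \<partial>M) = (\<integral>f. kn j f - k f \<partial>M) * (\<integral>f. g f \<partial>M)"
      using bdd_integrable[OF b(1)[of j]] bdd_integrable[OF b(2)] by (simp add: algebra_simps)
    also have "cmod \<dots> \<le> (\<integral>f. cmod (kn j f - k f) \<partial>M) * B'"
      unfolding norm_mult
    proof (rule mult_mono)
      show "cmod (\<integral>f. g f \<partial>M) \<le> B'"
      proof -
        have "(\<integral>f. cmod (g f) \<partial>M) \<le> (\<integral>f. B' \<partial>M)"
          by (rule integral_mono) (use B' integrable_norm[OF bdd_integrable[OF b(3)]] in auto)
        also have "\<dots> = B'" using M.prob_space by simp
        finally show ?thesis by (rule order_trans[OF norm_integral_le[OF b(3)]])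
      qed
    qed (use norm_integral_le[OF bd] B'(2) in auto)
    finally show "cmod ((\<integral>f. g f \<partial>M) * (\<integral>f. kn j f \<partial>M) - (\<integral>f. g f \<partial>M) * (\<integral>f. k f \<partial>M)) \<le> e"
      using j by (simp add: mult.commute)
    fix n
    let ?T = "translate (\<tau> n)"
    note gT = bdd_comp[OF b(3) translate_M, of "\<tau> n"]
    have T: "?T f \<in> space M" if "f \<in> space M" for f using measurable_space[OF translate_M that] .
    have "(\<integral>f. g (?T f) * k f \<partial>M) - (\<integral>f. g (?T f) * kn j f \<partial>M) = - (\<integral>f. (kn j f - k f) * g (?T f) \<partial>M)"
      using bdd_integrable[OF bdd_mult[OF b(2) gT]] bdd_integrable[OF bdd_mult[OF b(1)[of j] gT]]
      by (simp add: algebra_simps)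
    also have "cmod \<dots> = cmod (\<integral>f. (kn j f - k f) * g (?T f) \<partial>M)" by (rule norm_minus_cancel)
    also have "\<dots> \<le> B' * (\<integral>f. cmod (kn j f - k f) \<partial>M)"
      by (rule norm_integral_mult_le[OF bd gT B'(1)[OF T]])
    finally show "cmod ((\<integral>f. g (?T f) * k f \<partial>M) - (\<integral>f. g (?T f) * kn j f \<partial>M)) \<le> e" using j by simp
  qed
qed

text \<open>The extension from characters is made one argument at a time: bounded \<open>g\<close>
  against a fixed character, then bounded \<open>k\<close> against the fixed
  \<open>g\<close>.\<close>

lemma mixes_bounded:
  assumes \<tau>: "\<And>k. (\<lambda>n. moment_sq k (\<tau> n)) \<longlonglongrightarrow> 0" and g: "bdd g" and k: "bdd k"
  shows "mixes \<tau> g k"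
proof -
  have add_l: "mixes \<tau> (\<lambda>f. g f + h f) k" if "bdd g" "bdd h" "bdd k" "mixes \<tau> g k" "mixes \<tau> h k" for g h k
  proof -
    have i: "integrable M (\<lambda>f. g (translate t f) * k f)" if "bdd g" for g t
      by (rule bdd_integrable[OF bdd_mult[OF bdd_comp[OF that translate_M] \<open>bdd k\<close>]])
    show ?thesis
      using tendsto_add[OF that(4,5)[unfolded mixes_def]] i[OF that(1)] i[OF that(2)]
        bdd_integrable[OF that(1)] bdd_integrable[OF that(2)]
      unfolding mixes_def by (simp add: distrib_right)
  qed
  have add_r: "mixes \<tau> k (\<lambda>f. g f + h f)" if "bdd g" "bdd h" "bdd k" "mixes \<tau> k g" "mixes \<tau> k h" for g h k
  proof -
    have i: "integrable M (\<lambda>f. k (translate t f) * g f)" if "bdd g" for g t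
      by (rule bdd_integrable[OF bdd_mult[OF bdd_comp[OF \<open>bdd k\<close> translate_M] that]])
    show ?thesis
      using tendsto_add[OF that(4,5)[unfolded mixes_def]] i[OF that(1)] i[OF that(2)]
        bdd_integrable[OF that(1)] bdd_integrable[OF that(2)]
      unfolding mixes_def by (simp add: distrib_left)
  qed
  have scale_l: "mixes \<tau> (\<lambda>f. c * g f) k" if "mixes \<tau> g k" for c g k
    using tendsto_mult[OF tendsto_const[of c] that[unfolded mixes_def]]
    unfolding mixes_def by (simp add: mult.assoc)
  have scale_r: "mixes \<tau> k (\<lambda>f. c * g f)" if "mixes \<tau> k g" for c g k
    using tendsto_mult[OF tendsto_const[of c] that[unfolded mixes_def]]
    unfolding mixes_def by (simp add: mult.left_commute)
  have char: "mixes \<tau> g (\<lambda>f. cis (lin q f))" for q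
    using g
  proof (rule bounded_class_induct)
    show "mixes \<tau> (\<lambda>f. cis (lin p f)) (\<lambda>f. cis (lin q f))" for p
      unfolding mixes_def by (rule mixing_characters[OF \<tau>])
    note ck = bdd_cis[OF lin_M[of q]]
    show "mixes \<tau> (\<lambda>f. g f + h f) (\<lambda>f. cis (lin q f))"
      if "bdd g" "bdd h" "mixes \<tau> g (\<lambda>f. cis (lin q f))" "mixes \<tau> h (\<lambda>f. cis (lin q f))" for g h
      by (rule add_l[OF that(1,2) ck that(3,4)])
    show "mixes \<tau> g (\<lambda>f. cis (lin q f))"
      if "\<And>n. bdd (gn n)" "\<And>n. mixes \<tau> (gn n) (\<lambda>f. cis (lin q f))" "bdd g"
        "(\<lambda>n. \<integral>f. cmod (gn n f - g f) \<partial>M) \<longlonglongrightarrow> 0" for gn g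
      by (rule mixes_limit_left[OF that(1,3) ck that(2,4)])
  qed (rule scale_l)
  show ?thesis
    using k
  proof (rule bounded_class_induct)
    show "mixes \<tau> g (\<lambda>f. cis (lin q f))" for q by (rule char)
    show "mixes \<tau> g (\<lambda>f. k f + h f)" if "bdd k" "bdd h" "mixes \<tau> g k" "mixes \<tau> g h" for k h
      by (rule add_r[OF that(1,2) g that(3,4)])
    show "mixes \<tau> g k"
      if "\<And>n. bdd (kn n)" "\<And>n. mixes \<tau> g (kn n)" "bdd k" "(\<lambda>n. \<integral>f. cmod (kn n f - k f) \<partial>M) \<longlonglongrightarrow> 0" for kn k
      by (rule mixes_limit_right[OF that(1,3) g that(2,4)])
  qed (rule scale_r)
qed

text \<open>Mixing is applied to \<open>g\<close> and \<open>cnj g\<close>. The eigenvalue has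
  modulus 1, so in the limit the mean of \<open>(cmod (g f))\<^sup>2\<close> equals the squared
  modulus of the mean of \<open>g\<close>, and the variance vanishes.\<close>

lemma bounded_eigenfunction_const:
  assumes \<tau>: "\<And>k. (\<lambda>n. moment_sq k (\<tau> n)) \<longlonglongrightarrow> 0" and g: "bdd g"
    and eig: "\<And>t. AE f in M. g (translate t f) = cis (\<theta> * t) * g f"
  shows "AE f in M. g f = (\<integral>f. g f \<partial>M)"
proof -
  have cnjm: "cnj \<in> borel_measurable borel"
    by (intro borel_measurable_continuous_onI continuous_intros)
  obtain B where B: "g \<in> borel_measurable M" "\<And>f. f \<in> space M \<Longrightarrow> cmod (g f) \<le> B" using g by (rule bddE) blast
  have k: "bdd (\<lambda>f. cnj (g f))"
    by (rule bddI[OF measurable_compose[OF B(1) cnjm], of B]) (use B(2) in simp)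
  define m where "m = (\<integral>f. g f \<partial>M)"
  have ck: "(\<integral>f. cnj (g f) \<partial>M) = cnj m" unfolding m_def by (rule Bochner_Integration.integral_cnj)
  have sq: "(\<integral>f. g f * cnj (g f) \<partial>M) = complex_of_real (\<integral>f. (cmod (g f))\<^sup>2 \<partial>M)"
    by (simp add: complex_norm_square[symmetric] flip: of_real_power)
  have "(\<lambda>n. \<integral>f. g (translate (\<tau> n) f) * cnj (g f) \<partial>M) \<longlonglongrightarrow> m * cnj m"
    using mixes_bounded[OF \<tau> g k] by (simp add: mixes_def ck m_def)
  moreover have "(\<integral>f. g (translate t f) * cnj (g f) \<partial>M) = cis (\<theta> * t) * (\<integral>f. g f * cnj (g f) \<partial>M)" for t
  proof -
    have "(\<integral>f. g (translate t f) * cnj (g f) \<partial>M) = (\<integral>f. cis (\<theta> * t) * (g f * cnj (g f)) \<partial>M)"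
    proof (rule integral_cong_AE)
      show "AE f in M. g (translate t f) * cnj (g f) = cis (\<theta> * t) * (g f * cnj (g f))"
        using eig[of t] by eventually_elim simp
    qed (rule bdd_measurable[OF bdd_mult[OF bdd_comp[OF g translate_M] k]]
        bdd_measurable[OF bdd_mult[OF bdd_const bdd_mult[OF g k]]])+
    then show ?thesis by simp
  qed
  ultimately have "(\<lambda>n. cis (\<theta> * \<tau> n) * (\<integral>f. g f * cnj (g f) \<partial>M)) \<longlonglongrightarrow> m * cnj m" by simp
  from tendsto_norm[OF this]
  have "(\<lambda>n. cmod (\<integral>f. g f * cnj (g f) \<partial>M)) \<longlonglongrightarrow> cmod (m * cnj m)" by (simp add: norm_mult)
  then have "cmod (\<integral>f. g f * cnj (g f) \<partial>M) = cmod (m * cnj m)" using LIMSEQ_unique tendsto_const by blast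
  then have e2: "(\<integral>f. (cmod (g f))\<^sup>2 \<partial>M) = (cmod m)\<^sup>2"
    unfolding sq by (simp add: norm_mult power2_eq_square)
  have L: "L2 M (\<lambda>f. g f - m)"
    by (rule M.L2_bounded[of _ "B + cmod m"])
      (use B in \<open>auto intro: order_trans[OF norm_triangle_ineq4]\<close>)
  have i2: "integrable M (\<lambda>f. (cmod (g f))\<^sup>2)" using M.L2_bounded[OF B] by (simp add: L2_def)
  define r where "r f = Re (g f * cnj m)" for f
  have ir: "integrable M r"
    unfolding r_def by (intro integrable_Re bdd_integrable bdd_mult g bdd_const)
  have "nsq M (\<lambda>f. g f - m) = (\<integral>f. (cmod (g f))\<^sup>2 + (cmod m)\<^sup>2 - 2 * r f \<partial>M)"
  proof -
    have "(cmod (a - m))\<^sup>2 = (cmod a)\<^sup>2 + (cmod m)\<^sup>2 - 2 * Re (a * cnj m)" for a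
      by (simp only: cmod_power2) (simp add: power2_eq_square algebra_simps)
    then show ?thesis unfolding nsq_def r_def by presburger
  qed
  also have "\<dots> = (cmod m)\<^sup>2 + (cmod m)\<^sup>2 - 2 * (\<integral>f. r f \<partial>M)"
    using i2 ir M.prob_space e2 by simp
  also have "(\<integral>f. r f \<partial>M) = (cmod m)\<^sup>2"
  proof -
    have "(\<integral>f. r f \<partial>M) = Re (\<integral>f. g f * cnj m \<partial>M)"
      unfolding r_def by (rule integral_Re) (intro bdd_integrable bdd_mult g bdd_const)
    also have "(\<integral>f. g f * cnj m \<partial>M) = m * cnj m" by (simp add: m_def)
    finally show ?thesis by (simp add: complex_mult_cnj cmod_power2)
  qed
  finally have "nsq M (\<lambda>f. g f - m) = 0" by simp
  from nsq_eq_0D[OF L this] show ?thesis unfolding m_def by auto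
qed

lemma weakly_mixing_translate:
  assumes atomless: "\<And>a. emeasure \<sigma> {a} = 0"
  shows "weakly_mixing M translate"
  unfolding weakly_mixing_def
proof (intro allI impI)
  fix g :: "path \<Rightarrow> complex" and \<theta> :: real
  assume g[measurable]: "g \<in> borel_measurable M" and "integrable M (\<lambda>x. (cmod (g x))\<^sup>2)"
    and eig: "\<forall>t. AE x in M. g (translate t x) = cis (\<theta> * t) * g x"
  obtain \<tau> where \<tau>: "\<And>k. (\<lambda>n. moment_sq k (\<tau> n)) \<longlonglongrightarrow> 0"
    using vanishing_sequence[OF atomless] by blast
  \<comment> \<open>Truncation by modulus commutes with multiplication by a number of modulus 1, so
    each \<open>h K\<close> is a bounded eigenfunction with the same
    \<open>\<theta>\<close>.\<close>
  define h where "h K f = (if cmod (g f) \<le> real K then g f else 0)" for K f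
  have hm: "h K \<in> borel_measurable M" for K unfolding h_def[abs_def] by measurable
  have hb: "bdd (h K)" for K by (rule bddI[OF hm, of _ "real K"]) (simp add: h_def)
  have "AE f in M. h K (translate t f) = cis (\<theta> * t) * h K f" for K t
    using eig[rule_format, of t] by eventually_elim (simp add: h_def norm_mult)
  then have c: "AE f in M. h K f = (\<integral>f. h K f \<partial>M)" for K
    by (rule bounded_eigenfunction_const[OF \<tau> hb])
  show "\<exists>c. AE x in M. g x = c"
  proof (cases "\<exists>K. (\<integral>f. h K f \<partial>M) \<noteq> 0")
    case True
    then obtain K where K: "(\<integral>f. h K f \<partial>M) \<noteq> 0" by blast
    \<comment> \<open>A nonzero value of \<open>h K\<close> comes from the branch where
      \<open>h K f = g f\<close>.\<close>
    have "AE f in M. g f = (\<integral>f. h K f \<partial>M)"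
      using c[of K] by eventually_elim (use K in \<open>auto simp: h_def split: if_splits\<close>)
    then show ?thesis by blast
  next
    case False
    then have "AE f in M. h K f = 0" for K using c[of K] by simp
    then have "AE f in M. \<forall>K. h K f = 0" by (simp add: AE_all_countable)
    then have "AE f in M. g f = 0"
    proof eventually_elim
      case (elim f)
      have "cmod (g f) \<le> real (nat \<lceil>cmod (g f)\<rceil>)" by linarith
      then show ?case using elim[rule_format, of "nat \<lceil>cmod (g f)\<rceil>"] by (simp add: h_def)
    qed
    then show ?thesis by blast
  qed
qed

end

section \<open>Self-similarities from quasi-invariance\<close>

context gaussian_paths
begin

text \<open>The square root of the symmetrised Radon--Nikodym density is the multiplier that turns the
  Gaussian process at scale \<open>s\<close> into the one at scale 1.\<close>

lemma self_similarity_of_quasi_invariance: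
  assumes s: "s \<noteq> 0"
    and qi: "\<And>A. A \<in> sets borel \<Longrightarrow> emeasure \<sigma> ((\<lambda>x. x / s) -` A) = 0 \<longleftrightarrow> emeasure \<sigma> A = 0"
  shows "s \<in> self_similarities M translate"
proof -
  define \<nu> where "\<nu> = distr \<sigma> \<sigma> (\<lambda>x. x / s)"
  have m: "(\<lambda>x. x / s) \<in> \<sigma> \<rightarrow>\<^sub>M \<sigma>" by measurable
  have e\<nu>: "emeasure \<nu> A = emeasure \<sigma> ((\<lambda>x. x / s) -` A)" if "A \<in> sets borel" for A
    unfolding \<nu>_def using that by (subst emeasure_distr[OF m]) auto
  have "absolutely_continuous \<sigma> \<nu>"
    unfolding absolutely_continuous_def
  proof
    fix A assume A: "A \<in> null_sets \<sigma>"
    then have "A \<in> sets borel" "emeasure \<sigma> A = 0" by (auto simp: null_sets_def)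
    then show "A \<in> null_sets \<nu>" using e\<nu>[of A] qi[of A] by (auto simp: null_sets_def \<nu>_def)
  qed
  from Radon_Nikodym[OF this] obtain D where D[measurable]: "D \<in> borel_measurable borel"
    and dD: "density \<sigma> D = \<nu>" by (auto simp: \<nu>_def measurable_cong_sets[OF sets_eq refl])
  have int_reflect: "(\<integral>\<^sup>+x. g (- x) \<partial>\<sigma>) = (\<integral>\<^sup>+x. g x \<partial>\<sigma>)" if [measurable]: "g \<in> borel_measurable borel" for g
  proof -
    have "(\<integral>\<^sup>+x. g x \<partial>\<sigma>) = (\<integral>\<^sup>+x. g x \<partial>distr \<sigma> borel uminus)"
      using finite_symmetric by (simp add: finite_symmetric_borel_measure_def)
    then show ?thesis by (simp add: nn_integral_distr)
  qed
  have int_D: "(\<integral>\<^sup>+x. g x * D x \<partial>\<sigma>) = (\<integral>\<^sup>+x. g (x / s) \<partial>\<sigma>)" if [measurable]: "g \<in> borel_measurable borel" for g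
  proof -
    have "(\<integral>\<^sup>+x. g x \<partial>\<nu>) = (\<integral>\<^sup>+x. g (x / s) \<partial>\<sigma>)"
      unfolding \<nu>_def by (subst nn_integral_distr[OF m]) auto
    moreover have "(\<integral>\<^sup>+x. g x \<partial>\<nu>) = (\<integral>\<^sup>+x. D x * g x \<partial>\<sigma>)"
      unfolding dD[symmetric] by (rule nn_integral_density) auto
    ultimately show ?thesis by (simp add: mult.commute)
  qed
  \<comment> \<open>Averaging with the reflection makes the multiplier even; by the symmetry of
    \<open>\<sigma>\<close> the integrals of \<open>g * E\<close> and \<open>g * D\<close>
    agree.\<close>
  define E where "E x = (D x + D (- x)) / 2" for x
  have [measurable]: "E \<in> borel_measurable borel" unfolding E_def[abs_def] by measurable
  have int_E: "(\<integral>\<^sup>+x. g x * E x \<partial>\<sigma>) = (\<integral>\<^sup>+x. g (x / s) \<partial>\<sigma>)" if [measurable]: "g \<in> borel_measurable borel" for g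
  proof -
    have "(\<integral>\<^sup>+x. g x * D (- x) \<partial>\<sigma>) = (\<integral>\<^sup>+x. g (- x) * D x \<partial>\<sigma>)"
      using int_reflect[of "\<lambda>x. g (- x) * D x"] by simp
    also have "\<dots> = (\<integral>\<^sup>+x. g (- (x / s)) \<partial>\<sigma>)" by (rule int_D) measurable
    also have "\<dots> = (\<integral>\<^sup>+x. g (x / s) \<partial>\<sigma>)"
      using int_reflect[of "\<lambda>x. g (x / s)"] by simp
    finally have r: "(\<integral>\<^sup>+x. g x * D (- x) \<partial>\<sigma>) = (\<integral>\<^sup>+x. g (x / s) \<partial>\<sigma>)" .
    have "(\<integral>\<^sup>+x. g x * E x \<partial>\<sigma>) = (\<integral>\<^sup>+x. (g x * D x + g x * D (- x)) / 2 \<partial>\<sigma>)"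
      unfolding E_def by (intro nn_integral_cong) (simp add: ennreal_times_divide distrib_left)
    also have "\<dots> = (\<integral>\<^sup>+x. g x * D x + g x * D (- x) \<partial>\<sigma>) / 2"
      by (rule nn_integral_divide) measurable
    also have "(\<integral>\<^sup>+x. g x * D x + g x * D (- x) \<partial>\<sigma>) = (\<integral>\<^sup>+x. g (x / s) \<partial>\<sigma>) + (\<integral>\<^sup>+x. g (x / s) \<partial>\<sigma>)"
      by (subst nn_integral_add) (auto simp: int_D r)
    also have "(\<dots>) / 2 = (\<integral>\<^sup>+x. g (x / s) \<partial>\<sigma>)"
      by (simp add: mult_2[symmetric] ennreal_mult_divide_eq mult.commute[of 2])
    finally show ?thesis .
  qed
  have "(\<integral>\<^sup>+x. E x \<partial>\<sigma>) = (\<integral>\<^sup>+x. 1 \<partial>\<sigma>)" using int_E[of "\<lambda>_. 1"] by simp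
  then have "(\<integral>\<^sup>+x. E x \<partial>\<sigma>) \<noteq> \<infinity>" by (simp add: emeasure_eq_measure)
  then have Efin: "AE x in \<sigma>. E x \<noteq> \<infinity>" by (intro nn_integral_PInf_AE) auto
  \<comment> \<open>Here the other half of quasi-invariance enters: the preimage of the zero set is
    null by the formula for \<open>E\<close>, hence so is the zero set itself.\<close>
  have "emeasure \<sigma> {x. E x = 0} = 0"
  proof -
    have "(\<integral>\<^sup>+x. indicator {x. E x = 0} (x / s) \<partial>\<sigma>) = (\<integral>\<^sup>+x. indicator {x. E x = 0} x * E x \<partial>\<sigma>)"
      by (rule int_E[symmetric]) measurable
    also have "\<dots> = (\<integral>\<^sup>+x. 0 \<partial>\<sigma>)" by (rule nn_integral_cong) (auto split: split_indicator)
    finally have "(\<integral>\<^sup>+x. indicator ((\<lambda>x. x / s) -` {x. E x = 0}) x \<partial>\<sigma>) = 0"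
      by (simp add: indicator_def)
    then have "emeasure \<sigma> ((\<lambda>x. x / s) -` {x. E x = 0}) = 0"
      by (subst (asm) nn_integral_indicator) auto
    then show ?thesis using qi[of "{x. E x = 0}"] by simp
  qed
  then have Enz: "AE x in \<sigma>. E x \<noteq> 0" by (subst AE_iff_measurable[OF _ refl]) auto
  define \<phi> where "\<phi> x = sqrt (enn2real (E x))" for x
  have \<phi>E: "AE x in \<sigma>. ennreal ((\<phi> x)\<^sup>2) = E x"
    using Efin by eventually_elim (simp add: \<phi>_def ennreal_enn2real less_top)
  show ?thesis
  proof (rule self_similarity[OF s, of \<phi>])
    show "\<phi> \<in> borel_measurable borel" unfolding \<phi>_def[abs_def] by measurable
    show "\<phi> (- x) = \<phi> x" for x by (simp add: \<phi>_def E_def add.commute)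
    show "AE x in \<sigma>. \<phi> x \<noteq> 0"
      using \<phi>E Enz by eventually_elim auto
    show "(\<integral>\<^sup>+x. g (s * x) * ennreal ((\<phi> x)\<^sup>2) \<partial>\<sigma>) = (\<integral>\<^sup>+x. g x \<partial>\<sigma>)"
      if [measurable]: "g \<in> borel_measurable borel" for g
    proof -
      have "(\<integral>\<^sup>+x. g (s * x) * ennreal ((\<phi> x)\<^sup>2) \<partial>\<sigma>) = (\<integral>\<^sup>+x. g (s * x) * E x \<partial>\<sigma>)"
        using \<phi>E by (intro nn_integral_cong_AE) (auto elim!: eventually_mono)
      also have "\<dots> = (\<integral>\<^sup>+x. g (s * (x / s)) \<partial>\<sigma>)" by (rule int_E) measurable
      finally show ?thesis using s by simp
    qed
  qed
qed

end

section \<open>Product measures with almost shift-invariant factors\<close>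

locale digit_measure =
  fixes p :: "nat \<Rightarrow> int pmf"
begin

definition \<mu> :: "(nat \<Rightarrow> int) measure" where
  "\<mu> = (\<Pi>\<^sub>M k\<in>UNIV. measure_pmf (p k))"

sublocale P: product_prob_space "\<lambda>k. measure_pmf (p k)" UNIV
  by (intro product_prob_spaceI prob_space_measure_pmf)

lemma prob_space_\<mu>: "prob_space \<mu>"
  unfolding \<mu>_def by (rule P.prob_space_axioms)

sublocale prob_space \<mu> by (rule prob_space_\<mu>)

lemma space_\<mu>[simp]: "space \<mu> = UNIV"
  by (simp add: \<mu>_def space_PiM)

lemma sets_\<mu>[measurable_cong]: "sets \<mu> = sets (\<Pi>\<^sub>M k\<in>UNIV. count_space UNIV)"
  unfolding \<mu>_def by (intro sets_PiM_cong) auto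

lemma coordinate_measurable[measurable]: "(\<lambda>\<omega>. \<omega> k) \<in> \<mu> \<rightarrow>\<^sub>M count_space UNIV"
  by measurable

lemma coordinate_distr: "distr \<mu> (count_space UNIV) (\<lambda>\<omega>. g (\<omega> k)) = measure_pmf (map_pmf g (p k))"
proof -
  have "distr \<mu> (measure_pmf (p k)) (\<lambda>\<omega>. \<omega> k) = measure_pmf (p k)"
    unfolding \<mu>_def by (rule P.PiM_component) simp
  then have "distr (distr \<mu> (measure_pmf (p k)) (\<lambda>\<omega>. \<omega> k)) (count_space UNIV) g = measure_pmf (map_pmf g (p k))"
    by (simp add: map_pmf_rep_eq)
  moreover have "distr (distr \<mu> (measure_pmf (p k)) (\<lambda>\<omega>. \<omega> k)) (count_space UNIV) g
      = distr \<mu> (count_space UNIV) (g \<circ> (\<lambda>\<omega>. \<omega> k))"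
    by (rule distr_distr) auto
  ultimately show ?thesis by (simp add: comp_def)
qed

lemma indep_coordinates: "indep_vars (\<lambda>_. count_space UNIV) (\<lambda>k \<omega>. \<omega> k) UNIV"
proof (subst indep_vars_iff_distr_eq_PiM')
  have "distr \<mu> (\<Pi>\<^sub>M k\<in>UNIV. count_space UNIV) (\<lambda>x. \<lambda>i\<in>UNIV. x i) = \<mu>"
    by (simp add: restrict_UNIV distr_id2 sets_\<mu>)
  also have "\<mu> = (\<Pi>\<^sub>M i\<in>UNIV. distr \<mu> (count_space UNIV) (\<lambda>\<omega>. \<omega> i))"
    using coordinate_distr[of "\<lambda>x. x"] by (simp add: \<mu>_def)
  finally show "distr \<mu> (\<Pi>\<^sub>M k\<in>UNIV. count_space UNIV) (\<lambda>x. \<lambda>i\<in>UNIV. x i)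
      = (\<Pi>\<^sub>M i\<in>UNIV. distr \<mu> (count_space UNIV) (\<lambda>\<omega>. \<omega> i))" .
qed auto

lemma image_product:
  "distr \<mu> (\<Pi>\<^sub>M k\<in>UNIV. count_space UNIV) (\<lambda>\<omega> k. g k (\<omega> k)) = (\<Pi>\<^sub>M k\<in>UNIV. measure_pmf (map_pmf (g k) (p k)))"
proof -
  have "indep_vars (\<lambda>_. count_space UNIV) (\<lambda>k \<omega>. g k (\<omega> k)) UNIV"
    by (rule indep_vars_compose2[OF indep_coordinates]) auto
  then have "distr \<mu> (\<Pi>\<^sub>M k\<in>UNIV. count_space UNIV) (\<lambda>\<omega>. \<lambda>k\<in>UNIV. g k (\<omega> k))
      = (\<Pi>\<^sub>M k\<in>UNIV. distr \<mu> (count_space UNIV) (\<lambda>\<omega>. g k (\<omega> k)))"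
    by (subst (asm) indep_vars_iff_distr_eq_PiM') auto
  then show ?thesis by (simp add: restrict_UNIV coordinate_distr)
qed

text \<open>A bounded instance of Kakutani's criterion with an explicit density. On cylinders the
  partial densities factor by independence, and they are dominated by the constant
  \<open>exp (suminf lam)\<close>.\<close>

lemma product_density:
  fixes q :: "nat \<Rightarrow> int pmf" and h :: "nat \<Rightarrow> int \<Rightarrow> real"
  assumes q: "\<And>k j. pmf (q k) j = exp (h k j) * pmf (p k) j"
    and h: "\<And>k j. \<bar>h k j\<bar> \<le> lam k" and lam: "summable lam"
  shows "(\<Pi>\<^sub>M k\<in>UNIV. measure_pmf (q k)) = density \<mu> (\<lambda>\<omega>. ennreal (exp (\<Sum>k. h k (\<omega> k))))"
proof -
  interpret Q: product_prob_space "\<lambda>k. measure_pmf (q k)" UNIV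
    by (intro product_prob_spaceI prob_space_measure_pmf)
  let ?D = "\<lambda>\<omega>. ennreal (exp (\<Sum>k. h k (\<omega> k)))"
  have sm: "summable (\<lambda>k. h k (\<omega> k))" for \<omega>
    by (rule summable_comparison_test'[OF lam]) (use h in auto)
  have lam0: "0 \<le> lam k" for k using h[of k 0] by simp
  have hm[measurable]: "(\<lambda>\<omega>. h k (\<omega> k)) \<in> borel_measurable \<mu>" for k
    by (rule measurable_compose[OF coordinate_measurable]) simp
  have "density \<mu> ?D = (\<Pi>\<^sub>M k\<in>UNIV. measure_pmf (q k))"
  proof (rule Q.PiM_eq)
    show "sets (density \<mu> ?D) = sets (\<Pi>\<^sub>M k\<in>UNIV. measure_pmf (q k))"
      by (simp add: sets_\<mu>) (intro sets_PiM_cong, auto)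
    fix J :: "nat set" and F :: "nat \<Rightarrow> int set" assume J: "finite J"
    define C where "C = {\<omega> :: nat \<Rightarrow> int. \<forall>j\<in>J. \<omega> j \<in> F j}"
    have emb: "prod_emb UNIV (\<lambda>k. measure_pmf (q k)) J (\<Pi>\<^sub>E j\<in>J. F j) = C"
      by (auto simp: C_def prod_emb_def PiE_def space_PiM Pi_iff)
    have "{\<omega> \<in> space \<mu>. \<omega> j \<in> F j} \<in> sets \<mu>" for j
      by (rule measurable_sets_Collect[OF coordinate_measurable]) simp
    from sets.sets_Collect_finite_All[of J \<mu> "\<lambda>j \<omega>. \<omega> j \<in> F j", OF this J]
    have "{\<omega> \<in> space \<mu>. \<forall>j\<in>J. \<omega> j \<in> F j} \<in> sets \<mu>" .
    then have C[measurable]: "C \<in> sets \<mu>" by (simp add: C_def)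
    \<comment> \<open>Partial density times the indicator of the cylinder, written as a product over
      coordinates so that independence applies; \<open>n\<close> will be large enough for the first
      \<open>n\<close> places to contain \<open>J\<close>.\<close>
    define Dn where "Dn n \<omega> = (\<Prod>k<n. ennreal (exp (h k (\<omega> k)) * indicator (if k \<in> J then F k else UNIV) (\<omega> k)))" for n \<omega>
    have int_n: "(\<integral>\<^sup>+\<omega>. Dn n \<omega> \<partial>\<mu>) = (\<Prod>k\<in>J. emeasure (measure_pmf (q k)) (F k))" if "J \<subseteq> {..<n}" for n
    proof -
      have "(\<integral>\<^sup>+\<omega>. Dn n \<omega> \<partial>\<mu>) = (\<Prod>k<n. \<integral>\<^sup>+\<omega>. ennreal (exp (h k (\<omega> k)) * indicator (if k \<in> J then F k else UNIV) (\<omega> k)) \<partial>\<mu>)"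
        unfolding Dn_def
        by (rule indep_vars_nn_integral)
          (auto intro!: indep_vars_compose2[OF indep_vars_subset[OF indep_coordinates]])
      also have "\<dots> = (\<Prod>k<n. if k \<in> J then emeasure (measure_pmf (q k)) (F k) else 1)"
      proof (rule prod.cong[OF refl])
        fix k
        let ?F = "if k \<in> J then F k else UNIV"
        have "(\<integral>\<^sup>+\<omega>. ennreal (exp (h k (\<omega> k)) * indicator ?F (\<omega> k)) \<partial>\<mu>)
            = (\<integral>\<^sup>+j. ennreal (exp (h k j) * indicator ?F j) \<partial>measure_pmf (p k))"
          using nn_integral_distr[of "\<lambda>\<omega>. \<omega> k" \<mu> "count_space UNIV" "\<lambda>j. ennreal (exp (h k j) * indicator ?F j)"]
            coordinate_distr[of "\<lambda>x. x" k] by simp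
        also have "\<dots> = (\<integral>\<^sup>+j. ennreal (pmf (p k) j) * ennreal (exp (h k j) * indicator ?F j) \<partial>count_space UNIV)"
          by (rule nn_integral_measure_pmf)
        also have "\<dots> = (\<integral>\<^sup>+j. ennreal (pmf (q k) j) * indicator ?F j \<partial>count_space UNIV)"
          by (intro nn_integral_cong) (auto simp: q mult.commute simp flip: ennreal_mult split: split_indicator)
        also have "\<dots> = (\<integral>\<^sup>+j. indicator ?F j \<partial>measure_pmf (q k))"
          by (rule nn_integral_measure_pmf[symmetric])
        also have "\<dots> = (if k \<in> J then emeasure (measure_pmf (q k)) (F k) else 1)"
          using measure_pmf.emeasure_space_1[of "q k"] by simp
        finally show "(\<integral>\<^sup>+\<omega>. ennreal (exp (h k (\<omega> k)) * indicator ?F (\<omega> k)) \<partial>\<mu>)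
            = (if k \<in> J then emeasure (measure_pmf (q k)) (F k) else 1)" .
      qed
      also have "\<dots> = (\<Prod>k\<in>J. emeasure (measure_pmf (q k)) (F k))"
        using that by (intro prod.mono_neutral_cong_right) auto
      finally show ?thesis .
    qed
    have Dn_eq: "Dn n \<omega> = ennreal (exp (\<Sum>k<n. h k (\<omega> k))) * indicator C \<omega>" if "J \<subseteq> {..<n}" for n \<omega>
    proof (cases "\<omega> \<in> C")
      case True
      then show ?thesis
        unfolding Dn_def by (subst prod_ennreal) (auto simp: exp_sum C_def intro!: arg_cong[of _ _ ennreal] prod.cong)
    next
      case False
      then obtain j where "j \<in> J" "\<omega> j \<notin> F j" by (auto simp: C_def)
      then show ?thesis using False that unfolding Dn_def by (auto intro!: prod_zero bexI[of _ j])
    qed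
    obtain n0 where n0: "J \<subseteq> {..<n0}" using finite_nat_bounded[OF J] by auto
    define D' where "D' n \<omega> = ennreal (exp (\<Sum>k<n. h k (\<omega> k))) * indicator C \<omega>" for n \<omega>
    have "(\<lambda>n. \<integral>\<^sup>+\<omega>. D' n \<omega> \<partial>\<mu>) \<longlonglongrightarrow> (\<integral>\<^sup>+\<omega>. ?D \<omega> * indicator C \<omega> \<partial>\<mu>)"
    proof (rule nn_integral_dominated_convergence[where w = "\<lambda>_. ennreal (exp (suminf lam))"])
      show "D' n \<in> borel_measurable \<mu>" for n unfolding D'_def[abs_def] by measurable
      show "(\<integral>\<^sup>+\<omega>. ennreal (exp (suminf lam)) \<partial>\<mu>) < \<infinity>" by (simp add: emeasure_eq_measure ennreal_mult_less_top)
      show "AE \<omega> in \<mu>. D' n \<omega> \<le> ennreal (exp (suminf lam))" for n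
      proof (rule AE_I2)
        fix \<omega>
        have "(\<Sum>k<n. h k (\<omega> k)) \<le> (\<Sum>k<n. lam k)" by (rule sum_mono) (use h in \<open>simp add: abs_le_iff\<close>)
        also have "\<dots> \<le> suminf lam" by (rule sum_le_suminf[OF lam]) (use lam0 in auto)
        finally show "D' n \<omega> \<le> ennreal (exp (suminf lam))"
          unfolding D'_def by (auto split: split_indicator)
      qed
      show "AE \<omega> in \<mu>. (\<lambda>n. D' n \<omega>) \<longlonglongrightarrow> ?D \<omega> * indicator C \<omega>"
      proof (rule AE_I2)
        fix \<omega>
        have "(\<lambda>n. ennreal (exp (\<Sum>k<n. h k (\<omega> k)))) \<longlonglongrightarrow> ?D \<omega>"
          by (intro tendsto_ennrealI tendsto_exp summable_LIMSEQ sm)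
        then show "(\<lambda>n. D' n \<omega>) \<longlonglongrightarrow> ?D \<omega> * indicator C \<omega>"
          unfolding D'_def by (auto split: split_indicator)
      qed
    qed measurable
    moreover have "eventually (\<lambda>n. (\<integral>\<^sup>+\<omega>. D' n \<omega> \<partial>\<mu>) = (\<Prod>k\<in>J. emeasure (measure_pmf (q k)) (F k))) sequentially"
      using eventually_ge_at_top[of n0]
    proof eventually_elim
      case (elim n)
      then have "J \<subseteq> {..<n}" using n0 by auto
      from int_n[OF this] Dn_eq[OF this] show ?case by (simp add: D'_def)
    qed
    ultimately have "(\<integral>\<^sup>+\<omega>. ?D \<omega> * indicator C \<omega> \<partial>\<mu>) = (\<Prod>k\<in>J. emeasure (measure_pmf (q k)) (F k))"
      by (rule LIMSEQ_unique[OF _ tendsto_eventually])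
    then show "emeasure (density \<mu> ?D) (prod_emb UNIV (\<lambda>k. measure_pmf (q k)) J (\<Pi>\<^sub>E j\<in>J. F j)) = (\<Prod>j\<in>J. emeasure (measure_pmf (q j)) (F j))"
      unfolding emb by (subst emeasure_density) auto
  qed
  then show ?thesis by simp
qed

lemma product_density_bounds:
  fixes q :: "nat \<Rightarrow> int pmf" and h :: "nat \<Rightarrow> int \<Rightarrow> real"
  assumes q: "\<And>k j. pmf (q k) j = exp (h k j) * pmf (p k) j"
    and h: "\<And>k j. \<bar>h k j\<bar> \<le> lam k" and lam: "summable lam" and A: "A \<in> sets \<mu>"
  shows "emeasure (\<Pi>\<^sub>M k\<in>UNIV. measure_pmf (q k)) A \<le> ennreal (exp (suminf lam)) * emeasure \<mu> A"
    "ennreal (exp (- suminf lam)) * emeasure \<mu> A \<le> emeasure (\<Pi>\<^sub>M k\<in>UNIV. measure_pmf (q k)) A"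
proof -
  note [measurable] = A
  have hm[measurable]: "(\<lambda>\<omega>. h k (\<omega> k)) \<in> borel_measurable \<mu>" for k
    by (rule measurable_compose[OF coordinate_measurable]) simp
  have b: "\<bar>\<Sum>k. h k (\<omega> k)\<bar> \<le> suminf lam" for \<omega>
  proof -
    have s: "summable (\<lambda>k. norm (h k (\<omega> k)))"
      by (rule summable_comparison_test'[OF lam]) (use h in auto)
    have "\<bar>\<Sum>k. h k (\<omega> k)\<bar> \<le> (\<Sum>k. norm (h k (\<omega> k)))" using summable_norm[OF s] by simp
    also have "\<dots> \<le> suminf lam" by (rule suminf_le[OF _ s lam]) (use h in auto)
    finally show ?thesis .
  qed
  have e: "emeasure (\<Pi>\<^sub>M k\<in>UNIV. measure_pmf (q k)) A = (\<integral>\<^sup>+\<omega>. ennreal (exp (\<Sum>k. h k (\<omega> k))) * indicator A \<omega> \<partial>\<mu>)"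
    unfolding product_density[OF q h lam] by (rule emeasure_density) auto
  have u: "(\<integral>\<^sup>+\<omega>. ennreal c * indicator A \<omega> \<partial>\<mu>) = ennreal c * emeasure \<mu> A" for c
    by (rule nn_integral_cmult_indicator[OF A])
  show "emeasure (\<Pi>\<^sub>M k\<in>UNIV. measure_pmf (q k)) A \<le> ennreal (exp (suminf lam)) * emeasure \<mu> A"
    unfolding e u[symmetric] using b by (intro nn_integral_mono mult_right_mono ennreal_leI) (auto simp: abs_le_iff)
  show "ennreal (exp (- suminf lam)) * emeasure \<mu> A \<le> emeasure (\<Pi>\<^sub>M k\<in>UNIV. measure_pmf (q k)) A"
    unfolding e u[symmetric]
  proof (intro nn_integral_mono mult_right_mono ennreal_leI)
    show "exp (- suminf lam) \<le> exp (\<Sum>k. h k (\<omega> k))" for \<omega> using b[of \<omega>] by (simp add: abs_le_iff)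
  qed auto
qed

end

section \<open>Two-sided geometric digits\<close>

text \<open>The mass is proportional to \<open>r ^ digit_size j\<close>, where
  \<open>digit_size j\<close> is the distance from \<open>j\<close> to the nearer of 0 and -1. The
  centre is -1/2, so the reflection \<open>j \<mapsto> - 1 - j\<close> preserves the law and
  exchanges the two cases of \<open>0 \<le> j\<close>.\<close>

definition two_sided :: "real \<Rightarrow> int pmf" where
  "two_sided r = map_pmf (\<lambda>(b, n). if b then int n else - 1 - int n)
     (pair_pmf (bernoulli_pmf (1/2)) (geometric_pmf (1 - r)))"

definition digit_size :: "int \<Rightarrow> nat" where
  "digit_size j = nat (if 0 \<le> j then j else - 1 - j)"

lemma pmf_two_sided:
  assumes r: "0 < r" "r < 1"
  shows "pmf (two_sided r) j = r ^ digit_size j * (1 - r) / 2"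
proof -
  let ?f = "\<lambda>(b, n). if b then int n else - 1 - int n"
  have inj: "inj ?f" by (auto simp: inj_def split: if_splits)
  have j: "j = ?f (0 \<le> j, digit_size j)" by (auto simp: digit_size_def)
  have "pmf (two_sided r) (?f (0 \<le> j, digit_size j)) = pmf (pair_pmf (bernoulli_pmf (1/2)) (geometric_pmf (1 - r))) (0 \<le> j, digit_size j)"
    unfolding two_sided_def by (rule pmf_map_inj'[OF inj])
  also have "\<dots> = r ^ digit_size j * (1 - r) / 2"
    using r by (cases "0 \<le> j") (simp_all add: pmf_pair)
  finally show ?thesis using j by simp
qed

text \<open>A shift by at most one place changes \<open>digit_size\<close> by at most 1, which
  bounds the logarithm of the ratio of masses by \<open>l\<close>.\<close>

lemma two_sided_shift:
  assumes l: "0 < l" and m: "m \<in> {0, 1}"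
  shows "pmf (map_pmf (\<lambda>j. j + m) (two_sided (exp (- l)))) j
    = exp (l * (real (digit_size j) - real (digit_size (j - m)))) * pmf (two_sided (exp (- l))) j"
    and "\<bar>l * (real (digit_size j) - real (digit_size (j - m)))\<bar> \<le> l"
proof -
  have "inj (\<lambda>j :: int. j + m)" by (simp add: inj_def)
  from pmf_map_inj'[OF this, of "two_sided (exp (- l))" "j - m"]
  have 1: "pmf (map_pmf (\<lambda>j. j + m) (two_sided (exp (- l)))) j = pmf (two_sided (exp (- l))) (j - m)" by simp
  have 2: "exp (- l) ^ n = exp (- l * real n)" for n by (simp add: exp_of_nat_mult[symmetric] mult.commute)
  show "pmf (map_pmf (\<lambda>j. j + m) (two_sided (exp (- l)))) j
    = exp (l * (real (digit_size j) - real (digit_size (j - m)))) * pmf (two_sided (exp (- l))) j"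
    unfolding 1 using l by (subst (1 2) pmf_two_sided) (simp_all add: 2 mult_exp_exp algebra_simps)
  have "\<bar>real (digit_size j) - real (digit_size (j - m))\<bar> \<le> 1"
    using m by (auto simp: digit_size_def)
  then have "l * \<bar>real (digit_size j) - real (digit_size (j - m))\<bar> \<le> l * 1"
    using l by (intro mult_left_mono) auto
  then show "\<bar>l * (real (digit_size j) - real (digit_size (j - m)))\<bar> \<le> l"
    using l by (simp add: abs_mult)
qed

lemma two_sided_reflect:
  assumes r: "0 < r" "r < 1"
  shows "map_pmf (\<lambda>j. - 1 - j) (two_sided r) = two_sided r"
proof (rule pmf_eqI)
  fix j :: int
  have "inj (\<lambda>j :: int. - 1 - j)" by (simp add: inj_def)
  from pmf_map_inj'[OF this, of "two_sided r" "- 1 - j"]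
  show "pmf (map_pmf (\<lambda>j. - 1 - j) (two_sided r)) j = pmf (two_sided r) j"
    using r by (simp add: pmf_two_sided digit_size_def)
qed

text \<open>Typical digits have size about \<open>2 ^ k\<close>, so a shift by 1 costs at most
  \<open>(1/2) ^ k\<close> in the log-density, a summable amount.\<close>

definition digit_pmf :: "nat \<Rightarrow> int pmf" where
  "digit_pmf k = two_sided (exp (- ((1/2) ^ k)))"

lemma digit_tail: "\<exists>N. 1 \<le> N \<and> (\<Sum>j\<le>n. measure (measure_pmf (digit_pmf j)) {i. int N < \<bar>i\<bar>}) \<le> (1/2) ^ n"
proof -
  have "(\<lambda>N. measure (measure_pmf (digit_pmf j)) {i. int N < \<bar>i\<bar>}) \<longlonglongrightarrow> measure (measure_pmf (digit_pmf j)) (\<Inter>N. {i. int N < \<bar>i\<bar>})" for j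
    by (rule measure_pmf.finite_Lim_measure_decseq) (auto simp: decseq_def)
  moreover have "(\<Inter>N. {i. int N < \<bar>i\<bar>}) = {}"
  proof -
    have "\<not> int (nat \<bar>i\<bar>) < \<bar>i\<bar>" for i by simp
    then show ?thesis by blast
  qed
  ultimately have "(\<lambda>N. measure (measure_pmf (digit_pmf j)) {i. int N < \<bar>i\<bar>}) \<longlonglongrightarrow> 0" for j by simp
  then have "(\<lambda>N. \<Sum>j\<le>n. measure (measure_pmf (digit_pmf j)) {i. int N < \<bar>i\<bar>}) \<longlonglongrightarrow> 0"
    by (intro tendsto_null_sum)
  then have "eventually (\<lambda>N. (\<Sum>j\<le>n. measure (measure_pmf (digit_pmf j)) {i. int N < \<bar>i\<bar>}) < (1/2) ^ n) sequentially"
    by (rule order_tendstoD) simp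
  from eventually_conj[OF this eventually_ge_at_top[of 1]]
  obtain N where "(\<Sum>j\<le>n. measure (measure_pmf (digit_pmf j)) {i. int N < \<bar>i\<bar>}) < (1/2) ^ n" "1 \<le> N"
    by (auto simp: eventually_sequentially)
  then show ?thesis by (intro exI[of _ N]) auto
qed

text \<open>One bound for all digits up to place \<open>n\<close>, since a single power of the
  denominator has to clear all of them. The failure probability \<open>(1/2) ^ n\<close> is
  summable, as the Borel-Cantelli lemma requires in \<open>AE_good\<close>.\<close>

definition digit_bound :: "nat \<Rightarrow> nat" where
  "digit_bound n = (SOME N. 1 \<le> N \<and> (\<Sum>j\<le>n. measure (measure_pmf (digit_pmf j)) {i. int N < \<bar>i\<bar>}) \<le> (1/2) ^ n)"

lemma digit_bound: "1 \<le> digit_bound n"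
    "(\<Sum>j\<le>n. measure (measure_pmf (digit_pmf j)) {i. int (digit_bound n) < \<bar>i\<bar>}) \<le> (1/2) ^ n"
  using someI_ex[OF digit_tail[of n]] unfolding digit_bound_def by auto

section \<open>The ratios \<open>1 + 1/A\<^sub>k\<close>\<close>

text \<open>\<open>den n\<close> is a common denominator of products of the first \<open>n\<close> ratios and their inverses, and
  \<open>big n\<close> bounds the integers arising after clearing denominators; each \<open>A\<^sub>k\<close> is chosen large
  compared with all of these numbers at the previous stages.\<close>

fun den_big :: "nat \<Rightarrow> nat \<times> nat" where
  "den_big 0 = (1, 1)"
| "den_big (Suc n) = (let A = 4 ^ Suc n * (digit_bound (Suc n) + 1) * (snd (den_big n) + 1);
      d = fst (den_big n) * (A * (A + 1))
    in (d, snd (den_big n) + d ^ digit_bound (Suc n) * 2 ^ (Suc n * digit_bound (Suc n))))"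

definition den :: "nat \<Rightarrow> nat" where "den n = fst (den_big n)"
definition big :: "nat \<Rightarrow> nat" where "big n = snd (den_big n)"
text \<open>Each factor has its task: \<open>4 ^ k\<close> makes the tails geometric,
  \<open>digit_bound k + 1\<close> absorbs the digit at place \<open>k\<close> together with a shift
  by one, and \<open>big (k - 1) + 1\<close> absorbs the integers produced at earlier
  stages.\<close>

definition Anum :: "nat \<Rightarrow> nat" where
  "Anum k = 4 ^ k * (digit_bound k + 1) * (big (k - 1) + 1)"

lemma den_0: "den 0 = 1" and big_0: "big 0 = 1"
  by (simp_all add: den_def big_def)

lemma den_Suc: "den (Suc n) = den n * (Anum (Suc n) * (Anum (Suc n) + 1))"
  by (simp add: den_def big_def Anum_def Let_def)

lemma big_Suc: "big (Suc n) = big n + den (Suc n) ^ digit_bound (Suc n) * 2 ^ (Suc n * digit_bound (Suc n))"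
  by (simp add: den_def big_def Let_def)

declare den_big.simps[simp del]

lemma Anum_pos: "0 < Anum k"
  by (simp add: Anum_def)

lemma den_pos: "0 < den n"
  by (induction n) (auto simp: den_0 den_Suc Anum_pos)

lemma big_mono: "n \<le> m \<Longrightarrow> big n \<le> big m"
  by (rule lift_Suc_mono_le[of big]) (simp add: big_Suc)

lemma den_le_big: "den n ^ digit_bound n * 2 ^ (n * digit_bound n) \<le> big n"
  by (cases n) (auto simp: den_0 big_0 big_Suc)

lemma Anum_ge: "n < k \<Longrightarrow> 4 ^ k * (digit_bound k + 1) * (big n + 1) \<le> Anum k"
  unfolding Anum_def by (intro mult_left_mono add_right_mono big_mono) auto

lemma den_ge_power: "4 ^ n \<le> den n"
proof (cases n)
  case (Suc m)
  have "4 ^ n * (1 * 1) \<le> 4 ^ n * ((digit_bound n + 1) * (big m + 1))"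
    by (intro mult_left_mono mult_mono) auto
  also have "\<dots> \<le> Anum n" using Anum_ge[of m n] Suc by (simp only: mult.assoc)
  finally have "4 ^ n \<le> Anum n" by simp
  also have "\<dots> \<le> 1 * (Anum n * (Anum n + 1))" by simp
  also have "\<dots> \<le> den m * (Anum n * (Anum n + 1))"
    using den_pos[of m] by (intro mult_right_mono) auto
  finally show ?thesis using Suc by (simp add: den_Suc)
qed (simp add: den_0)

text \<open>Place 0 gets rate 0, because digit 0 decides the sign of the product and must not affect
  its modulus.\<close>

definition rate :: "nat \<Rightarrow> real" where
  "rate k = (if k = 0 then 0 else ln (1 + 1 / real (Anum k)))"

lemma rate_0: "rate 0 = 0" by (simp add: rate_def)

lemma rate_pos: "0 < k \<Longrightarrow> 0 < rate k"
  using Anum_pos[of k] by (simp add: rate_def ln_gt_zero)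

lemma rate_nonneg: "0 \<le> rate k"
  using rate_pos[of k] rate_0 by (cases k) auto

lemma rate_le: "rate k \<le> 1 / real (Anum k)"
  by (simp add: rate_def ln_add_one_self_le_self)

lemma exp_rate: "0 < k \<Longrightarrow> exp (rate k) = 1 + 1 / real (Anum k)"
  using Anum_pos[of k] by (simp add: rate_def add_pos_pos)

lemma digit_rate_le:
  assumes "n < k" shows "real (digit_bound k + 1) * rate k \<le> (1/4) ^ k / real (big n + 1)"
proof -
  have "real (digit_bound k + 1) * rate k \<le> real (digit_bound k + 1) * (1 / real (Anum k))"
    by (intro mult_left_mono rate_le) simp
  also have "\<dots> \<le> real (digit_bound k + 1) * (1 / real (4 ^ k * (digit_bound k + 1) * (big n + 1)))"
    using Anum_ge[OF assms] by (intro mult_left_mono divide_left_mono of_nat_mono mult_pos_pos)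
      (auto simp del: of_nat_mult of_nat_add simp: Anum_pos)
  also have "\<dots> = (1/4) ^ k / real (big n + 1)"
  proof -
    have "c * (1 / (d * c * b)) = (1 / d) / b" if "c \<noteq> 0" for c d b :: real using that by simp
    from this[of "real (digit_bound k + 1)" "4 ^ k" "real (big n + 1)"]
    show ?thesis by (simp only: of_nat_mult of_nat_power of_nat_numeral power_one_over)
  qed
  finally show ?thesis .
qed

text \<open>The geometric series with first term \<open>(1/4) ^ Suc n\<close> sums to
  \<open>(1/4) ^ n / 3\<close>. The divisor \<open>big n + 1\<close> keeps the tail small after
  multiplication by an integer up to \<open>big n\<close>, and small against \<open>rate n\<close>
  when \<open>n\<close> is positive.\<close>

lemma tail_sum:
  fixes w :: "nat \<Rightarrow> real"
  assumes w: "\<And>k. n < k \<Longrightarrow> \<bar>w k\<bar> \<le> real (digit_bound k + 1)"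
  shows "summable (\<lambda>k. w k * rate k)"
    and "\<bar>\<Sum>k. w (k + Suc n) * rate (k + Suc n)\<bar> \<le> (1/4) ^ n / (3 * real (big n + 1))"
proof -
  have b: "\<bar>w (k + Suc n) * rate (k + Suc n)\<bar> \<le> (1/4) ^ Suc n / real (big n + 1) * (1/4) ^ k" for k
  proof -
    have "\<bar>w (k + Suc n) * rate (k + Suc n)\<bar> \<le> real (digit_bound (k + Suc n) + 1) * rate (k + Suc n)"
      unfolding abs_mult abs_of_nonneg[OF rate_nonneg] by (intro mult_right_mono w rate_nonneg) simp
    also have "\<dots> \<le> (1/4) ^ (k + Suc n) / real (big n + 1)" by (rule digit_rate_le) simp
    also have "\<dots> = (1/4) ^ Suc n / real (big n + 1) * (1/4) ^ k" by (simp add: power_add)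
    finally show ?thesis .
  qed
  have g: "summable (\<lambda>k. (1/4) ^ Suc n / real (big n + 1) * (1/4 :: real) ^ k)"
    by (intro summable_mult summable_geometric) simp
  have s: "summable (\<lambda>k. \<bar>w (k + Suc n) * rate (k + Suc n)\<bar>)"
    by (rule summable_comparison_test'[OF g]) (use b in simp)
  then have "summable (\<lambda>k. w (k + Suc n) * rate (k + Suc n))" by (rule summable_rabs_cancel)
  then show "summable (\<lambda>k. w k * rate k)" by (rule summable_iff_shift[THEN iffD1])
  have "\<bar>\<Sum>k. w (k + Suc n) * rate (k + Suc n)\<bar> \<le> (\<Sum>k. \<bar>w (k + Suc n) * rate (k + Suc n)\<bar>)"
    by (rule summable_rabs[OF s])
  also have "\<dots> \<le> (\<Sum>k. (1/4) ^ Suc n / real (big n + 1) * (1/4) ^ k)"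
    by (rule suminf_le[OF b s g])
  also have "\<dots> = (1/4) ^ Suc n / real (big n + 1) * (1 / (1 - 1/4))"
    by (subst suminf_mult) (auto simp: suminf_geometric)
  also have "\<dots> = (1/4) ^ n / (3 * real (big n + 1))"
  proof -
    have "x * (1/4) / b * (1 / (1 - 1/4)) = x / (3 * b)" for x b :: real by simp
    then show ?thesis by (simp only: power_Suc2)
  qed
  finally show "\<bar>\<Sum>k. w (k + Suc n) * rate (k + Suc n)\<bar> \<le> (1/4) ^ n / (3 * real (big n + 1))" .
qed

text \<open>A power of \<open>(A + 1) / A\<close> with exponent between \<open>- M\<close> and
  \<open>M\<close> becomes an integer after multiplication by \<open>(A * (A + 1)) ^ M\<close>, and
  the power is at most \<open>2 ^ M\<close> since \<open>A \<ge> 1\<close>. The factor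
  \<open>2 ^ (n * M)\<close> collects these bounds; for \<open>M = digit_bound n\<close> the result
  is dominated by \<open>big n\<close>.\<close>

lemma clear_denominators:
  assumes "\<And>k. k \<le> n \<Longrightarrow> \<bar>w k\<bar> \<le> int M"
  shows "\<exists>I :: nat. real (den n ^ M) * exp (\<Sum>k\<le>n. real_of_int (w k) * rate k) = real I \<and> I \<le> den n ^ M * 2 ^ (n * M)"
  using assms
proof (induction n)
  case 0
  then show ?case by (intro exI[of _ 1]) (simp add: den_0 rate_0)
next
  case (Suc n)
  then obtain I where I: "real (den n ^ M) * exp (\<Sum>k\<le>n. real_of_int (w k) * rate k) = real I"
    "I \<le> den n ^ M * 2 ^ (n * M)" by force
  define A where "A = Anum (Suc n)"
  have A: "0 < A" by (simp add: A_def Anum_pos)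
  define v where "v = w (Suc n)"
  have v: "\<bar>v\<bar> \<le> int M" using Suc.prems[of "Suc n"] by (simp add: v_def)
  have e: "exp (rate (Suc n)) = (real A + 1) / real A"
    using exp_rate[of "Suc n"] A by (simp add: A_def field_simps)
  have "\<exists>J. real ((A * (A + 1)) ^ M) * exp (real_of_int v * rate (Suc n)) = real J \<and> J \<le> (A * (A + 1)) ^ M * 2 ^ M"
  proof -
    have pw: "((real A + 1) / real A) ^ i \<le> 2 ^ M" if "i \<le> M" for i
    proof -
      have "((real A + 1) / real A) ^ i \<le> 2 ^ i" using A by (intro power_mono) (auto simp: field_simps)
      also have "\<dots> \<le> (2::real) ^ M" using that by (intro power_increasing) auto
      finally show ?thesis .
    qed
    show ?thesis
    proof (cases "0 \<le> v")
      case True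
      define i where "i = nat v"
      have i: "i \<le> M" "real_of_int v = real i" using v True by (auto simp: i_def)
      have x: "exp (real_of_int v * rate (Suc n)) = ((real A + 1) / real A) ^ i"
        unfolding i(2) exp_of_nat_mult e ..
      have "real ((A * (A + 1)) ^ M) * ((real A + 1) / real A) ^ i = real (A ^ (M - i) * (A + 1) ^ (M + i))"
      proof -
        have "real A ^ M = real A ^ (M - i) * real A ^ i" using i(1) by (simp flip: power_add)
        then show ?thesis using A
          by (simp only: of_nat_mult of_nat_power power_mult_distrib power_divide power_add of_nat_add of_nat_1) simp
      qed
      moreover have "real (A ^ (M - i) * (A + 1) ^ (M + i)) \<le> real ((A * (A + 1)) ^ M * 2 ^ M)"
        unfolding calculation[symmetric] of_nat_mult[of _ "2 ^ M"] using pw[OF i(1)] by (intro mult_left_mono) auto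
      ultimately show ?thesis unfolding x by (intro exI[of _ "A ^ (M - i) * (A + 1) ^ (M + i)"]) (simp only: of_nat_le_iff)
    next
      case False
      define i where "i = nat (- v)"
      have i: "i \<le> M" "real_of_int v = - real i" using v False by (auto simp: i_def)
      have x: "exp (real_of_int v * rate (Suc n)) = (real A / (real A + 1)) ^ i"
      proof -
        have "exp (real_of_int v * rate (Suc n)) = inverse (exp (real i * rate (Suc n)))"
          by (simp add: i(2) exp_minus)
        also have "\<dots> = inverse (((real A + 1) / real A) ^ i)" by (simp add: exp_of_nat_mult e)
        finally show ?thesis by (simp add: power_divide)
      qed
      have eq: "real ((A * (A + 1)) ^ M) * (real A / (real A + 1)) ^ i = real (A ^ (M + i) * (A + 1) ^ (M - i))"
      proof -
        have "(real A + 1) ^ M = (real A + 1) ^ (M - i) * (real A + 1) ^ i" using i(1) by (simp flip: power_add)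
        then show ?thesis
          by (simp only: of_nat_mult of_nat_power power_mult_distrib power_divide power_add of_nat_add of_nat_1) simp
      qed
      have "(real A / (real A + 1)) ^ i \<le> 1" by (intro power_le_one) auto
      also have "1 \<le> (2::real) ^ M" by simp
      finally have "real (A ^ (M + i) * (A + 1) ^ (M - i)) \<le> real ((A * (A + 1)) ^ M * 2 ^ M)"
        unfolding eq[symmetric] of_nat_mult[of _ "2 ^ M"] by (intro mult_left_mono) auto
      then show ?thesis unfolding x eq by (intro exI[of _ "A ^ (M + i) * (A + 1) ^ (M - i)"]) (simp only: of_nat_le_iff)
    qed
  qed
  then obtain J where J: "real ((A * (A + 1)) ^ M) * exp (real_of_int v * rate (Suc n)) = real J"
    "J \<le> (A * (A + 1)) ^ M * 2 ^ M" by blast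
  have "real (den (Suc n) ^ M) * exp (\<Sum>k\<le>Suc n. real_of_int (w k) * rate k)
      = (real (den n ^ M) * exp (\<Sum>k\<le>n. real_of_int (w k) * rate k)) * (real ((A * (A + 1)) ^ M) * exp (real_of_int v * rate (Suc n)))"
    unfolding den_Suc A_def[symmetric] v_def by (simp add: power_mult_distrib exp_add)
  also have "\<dots> = real (I * J)" unfolding I J by simp
  finally have "real (den (Suc n) ^ M) * exp (\<Sum>k\<le>Suc n. real_of_int (w k) * rate k) = real (I * J)" .
  moreover have "I * J \<le> (den n ^ M * 2 ^ (n * M)) * ((A * (A + 1)) ^ M * 2 ^ M)"
    by (rule mult_mono[OF I(2) J(2)]) auto
  then have "I * J \<le> den (Suc n) ^ M * 2 ^ (Suc n * M)"
    unfolding den_Suc A_def[symmetric] by (simp add: power_mult_distrib power_add mult_ac)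
  ultimately show ?case by blast
qed

lemma abs_exp_minus_one_le: "\<bar>u\<bar> \<le> 1 \<Longrightarrow> \<bar>exp u - 1\<bar> \<le> 2 * \<bar>u\<bar>" for u :: real
proof (cases "0 \<le> u")
  case True
  assume "\<bar>u\<bar> \<le> 1"
  then have "exp u \<le> 1 + u + u\<^sup>2" using True by (intro exp_bound) auto
  moreover have "u\<^sup>2 \<le> u" using True \<open>\<bar>u\<bar> \<le> 1\<close> by (simp add: power2_eq_square mult_left_le)
  ultimately show ?thesis using True by simp
next
  case False
  then have "exp u \<le> 1" by simp
  moreover have "1 + u \<le> exp u" by (rule exp_ge_add_one_self)
  ultimately show ?thesis using False by linarith
qed

section \<open>The random scale\<close>

interpretation digits: digit_measure digit_pmf .

text \<open>The random product in logarithmic form, with the sign taken from digit 0. On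
  \<open>good\<close> sequences the series converges, so its value there is the intended
  one.\<close>

definition scale_of :: "(nat \<Rightarrow> int) \<Rightarrow> real" where
  "scale_of w = (if 0 \<le> w 0 then 1 else - 1) * exp (\<Sum>k. real_of_int (w k) * rate k)"

definition good :: "(nat \<Rightarrow> int) \<Rightarrow> bool" where
  "good w \<longleftrightarrow> eventually (\<lambda>n. \<forall>j\<le>n. \<bar>w j\<bar> \<le> int (digit_bound n)) sequentially"

lemma scale_of_measurable[measurable]: "scale_of \<in> borel_measurable digits.\<mu>"
proof -
  have [measurable]: "(\<lambda>w. real_of_int (w k)) \<in> borel_measurable digits.\<mu>" for k
    by (rule measurable_compose[OF digits.coordinate_measurable]) simp
  have [measurable]: "Measurable.pred digits.\<mu> (\<lambda>w. 0 \<le> w 0)"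
    by (rule measurable_compose[OF digits.coordinate_measurable]) simp
  show ?thesis unfolding scale_of_def[abs_def] by measurable
qed

lemma AE_good: "AE w in digits.\<mu>. good w"
proof -
  define B where "B n = (\<Union>j\<le>n. {w \<in> space digits.\<mu>. int (digit_bound n) < \<bar>w j\<bar>})" for n
  have Bj: "{w \<in> space digits.\<mu>. int m < \<bar>w j\<bar>} \<in> sets digits.\<mu>" for m j
  proof -
    have "Measurable.pred digits.\<mu> (\<lambda>w. int m < \<bar>w j\<bar>)"
      by (rule measurable_compose[OF digits.coordinate_measurable]) simp
    then show ?thesis by (simp add: pred_def)
  qed
  have B: "B n \<in> sets digits.\<mu>" for n unfolding B_def using Bj by auto
  have mj: "measure digits.\<mu> {w \<in> space digits.\<mu>. int m < \<bar>w j\<bar>} = measure (measure_pmf (digit_pmf j)) {i. int m < \<bar>i\<bar>}" for m j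
  proof -
    have "measure (measure_pmf (digit_pmf j)) {i. int m < \<bar>i\<bar>} = measure (distr digits.\<mu> (count_space UNIV) (\<lambda>w. w j)) {i. int m < \<bar>i\<bar>}"
      using digits.coordinate_distr[of "\<lambda>x. x" j] by simp
    also have "\<dots> = measure digits.\<mu> ((\<lambda>w. w j) -` {i. int m < \<bar>i\<bar>} \<inter> space digits.\<mu>)"
      by (rule measure_distr) auto
    also have "(\<lambda>w. w j) -` {i. int m < \<bar>i\<bar>} \<inter> space digits.\<mu> = {w \<in> space digits.\<mu>. int m < \<bar>w j\<bar>}" by auto
    finally show ?thesis by simp
  qed
  have "measure digits.\<mu> (B n) \<le> (1/2) ^ n" for n
  proof -
    have "measure digits.\<mu> (B n) \<le> (\<Sum>j\<le>n. measure digits.\<mu> {w \<in> space digits.\<mu>. int (digit_bound n) < \<bar>w j\<bar>})"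
      unfolding B_def by (rule digits.finite_measure_subadditive_finite) (use Bj in auto)
    then show ?thesis using digit_bound(2)[of n] by (simp only: mj)
  qed
  then have "summable (\<lambda>n. measure digits.\<mu> (B n))"
    by (intro summable_comparison_test'[OF summable_geometric[of "1/2"]]) auto
  then have "AE w in digits.\<mu>. eventually (\<lambda>n. w \<in> space digits.\<mu> - B n) sequentially"
    by (intro borel_cantelli_AE1 B) (auto simp: digits.emeasure_eq_measure)
  then show ?thesis
    unfolding good_def by eventually_elim (auto simp: B_def not_less elim!: eventually_mono)
qed

lemma good_summable:
  assumes "good w" "\<And>k. \<bar>e k\<bar> \<le> (1 :: real)"
  shows "summable (\<lambda>k. (real_of_int (w k) + e k) * rate k)"
proof -
  obtain n where n: "\<And>k. n \<le> k \<Longrightarrow> \<forall>j\<le>k. \<bar>w j\<bar> \<le> int (digit_bound k)"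
    using assms(1) by (auto simp: good_def eventually_sequentially)
  show ?thesis
  proof (rule tail_sum(1)[of n])
    fix k assume "n < k"
    then have "\<bar>w k\<bar> \<le> int (digit_bound k)" using n[of k] by auto
    then have "\<bar>real_of_int (w k)\<bar> \<le> real (digit_bound k)" by linarith
    then show "\<bar>real_of_int (w k) + e k\<bar> \<le> real (digit_bound k + 1)" using assms(2)[of k] by simp
  qed
qed

definition rigid_time :: "nat \<Rightarrow> real" where
  "rigid_time n = 2 * pi * real (den n ^ digit_bound n)"

lemma rigid_time_at_top: "filterlim rigid_time at_top sequentially"
proof (rule filterlim_at_top_mono[OF filterlim_real_sequentially], intro always_eventually allI)
  fix n
  have "n \<le> 2 ^ n" by (rule less_imp_le[OF less_exp])
  also have "\<dots> \<le> 4 ^ n" by (rule power_mono) auto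
  also have "\<dots> \<le> den n ^ 1" using den_ge_power[of n] by simp
  also have "\<dots> \<le> den n ^ digit_bound n"
    using den_pos[of n] digit_bound(1)[of n] by (intro power_increasing) auto
  finally have "real n \<le> real (den n ^ digit_bound n)" by (rule of_nat_mono)
  also have "\<dots> \<le> rigid_time n"
    unfolding rigid_time_def using pi_gt3 mult_right_mono[of 1 "2 * pi" "real (den n ^ digit_bound n)"] by simp
  finally show "real n \<le> rigid_time n" .
qed

text \<open>For large \<open>n\<close>, \<open>rigid_time n * scale_of w\<close> is up to sign
  \<open>2 * pi * I * exp u\<close> with an integer \<open>I \<le> big n\<close> and a tail
  \<open>u\<close> of size at most \<open>(1/4) ^ n / (3 * (big n + 1))\<close>. So it lies within
  \<open>4 * pi * (1/4) ^ n\<close> of a multiple of \<open>2 * pi\<close>.\<close>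

lemma good_rigid:
  assumes w: "good w"
  shows "(\<lambda>n. cis (rigid_time n * scale_of w)) \<longlonglongrightarrow> 1"
proof -
  define s :: real where "s = (if 0 \<le> w 0 then 1 else - 1)"
  obtain n0 where n0: "\<And>k j. n0 \<le> k \<Longrightarrow> j \<le> k \<Longrightarrow> \<bar>w j\<bar> \<le> int (digit_bound k)"
    using w by (auto simp: good_def eventually_sequentially)
  have sm: "summable (\<lambda>k. real_of_int (w k) * rate k)"
    using good_summable[OF w, of "\<lambda>_. 0"] by simp
  have "eventually (\<lambda>n. norm (cis (rigid_time n * scale_of w) - 1) \<le> 4 * pi * (1/4) ^ n) sequentially"
    using eventually_ge_at_top[of n0]
  proof eventually_elim
    case (elim n)
    define u where "u = (\<Sum>k. real_of_int (w (k + Suc n)) * rate (k + Suc n))"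
    have u: "\<bar>u\<bar> \<le> (1/4) ^ n / (3 * real (big n + 1))"
      unfolding u_def
    proof (rule tail_sum(2)[of n "\<lambda>k. real_of_int (w k)"])
      fix k assume "n < k"
      then have "\<bar>w k\<bar> \<le> int (digit_bound k)" using n0[of k k] elim by simp
      then show "\<bar>real_of_int (w k)\<bar> \<le> real (digit_bound k + 1)" by linarith
    qed
    obtain I where I: "real (den n ^ digit_bound n) * exp (\<Sum>k\<le>n. real_of_int (w k) * rate k) = real I"
      "I \<le> den n ^ digit_bound n * 2 ^ (n * digit_bound n)"
      using clear_denominators[of n w "digit_bound n"] n0[OF elim] by blast
    have Ib: "real I \<le> real (big n)" using I(2) den_le_big[of n] by simp
    have "(\<Sum>k. real_of_int (w k) * rate k) = u + (\<Sum>k<Suc n. real_of_int (w k) * rate k)"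
      unfolding u_def by (rule suminf_split_initial_segment[OF sm])
    then have "scale_of w = s * (exp (\<Sum>k\<le>n. real_of_int (w k) * rate k) * exp u)"
      by (simp add: scale_of_def s_def exp_add lessThan_Suc_atMost mult.commute)
    then have "rigid_time n * scale_of w = s * (2 * pi * (real (den n ^ digit_bound n) * exp (\<Sum>k\<le>n. real_of_int (w k) * rate k)) * exp u)"
      by (simp add: rigid_time_def)
    then have r: "rigid_time n * scale_of w = s * (2 * pi * real I) + s * (2 * pi * real I * (exp u - 1))"
      unfolding I(1) by (simp add: algebra_simps)
    have "cis (s * (2 * pi * real I)) = 1"
      using cis_multiple_2pi[of "s * real I"] by (simp add: s_def mult_ac)
    then have "cis (rigid_time n * scale_of w) = cis (s * (2 * pi * real I * (exp u - 1)))"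
      unfolding r by (simp flip: cis_mult)
    then have "norm (cis (rigid_time n * scale_of w) - 1) \<le> \<bar>s * (2 * pi * real I * (exp u - 1))\<bar>"
      using iexp_approx1[of "s * (2 * pi * real I * (exp u - 1))" 0] by (simp add: cis_conv_exp)
    also have "\<dots> = 2 * pi * real I * \<bar>exp u - 1\<bar>" by (simp add: abs_mult s_def)
    also have "\<dots> \<le> 2 * pi * real (big n) * (2 * \<bar>u\<bar>)"
    proof (intro mult_mono abs_exp_minus_one_le)
      have "(1/4) ^ n / (3 * real (big n + 1)) \<le> 1 / 1"
        by (intro frac_le) (auto intro: power_le_one)
      then show "\<bar>u\<bar> \<le> 1" using u by linarith
    qed (use Ib in auto)
    also have "\<dots> \<le> 2 * pi * real (big n) * (2 * ((1/4) ^ n / (3 * real (big n + 1))))"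
      using u by (intro mult_left_mono) auto
    also have "\<dots> = 4 * pi * (1/4) ^ n * (real (big n) / (3 * real (big n + 1)))" by simp
    also have "\<dots> \<le> 4 * pi * (1/4) ^ n * 1"
      by (intro mult_left_mono) (auto simp: field_simps)
    finally show ?case by simp
  qed
  moreover have "(\<lambda>n. 4 * pi * (1/4 :: real) ^ n) \<longlonglongrightarrow> 0"
    by (intro tendsto_mult_right_zero LIMSEQ_power_zero) simp
  ultimately have "(\<lambda>n. cis (rigid_time n * scale_of w) - 1) \<longlonglongrightarrow> 0" by (rule Lim_null_comparison)
  then show ?thesis by (rule LIM_zero_cancel)
qed

section \<open>The law of the random scale\<close>

definition scale_law :: "real measure" where
  "scale_law = distr digits.\<mu> borel scale_of"

lemma prob_space_scale_law: "prob_space scale_law"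
  unfolding scale_law_def by (rule digits.prob_space_distr) measurable

lemma sets_scale_law[simp, measurable_cong]: "sets scale_law = sets borel"
  by (simp add: scale_law_def)

lemma space_scale_law[simp]: "space scale_law = UNIV"
  by (simp add: scale_law_def)

lemma emeasure_scale_law: "B \<in> sets borel \<Longrightarrow> emeasure scale_law B = emeasure digits.\<mu> {w. scale_of w \<in> B}"
  unfolding scale_law_def by (subst emeasure_distr) (auto simp: vimage_def)

lemma move_digits_measurable: "(\<lambda>w k. g k (w k)) \<in> digits.\<mu> \<rightarrow>\<^sub>M (\<Pi>\<^sub>M k\<in>UNIV. count_space (UNIV :: int set))"
proof (rule measurable_PiM_single')
  show "(\<lambda>w. g k (w k)) \<in> digits.\<mu> \<rightarrow>\<^sub>M count_space UNIV" for k
    by (rule measurable_compose[OF digits.coordinate_measurable]) simp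
qed auto

lemma scale_of_measurable'[measurable]: "scale_of \<in> borel_measurable (\<Pi>\<^sub>M k\<in>UNIV. count_space (UNIV :: int set))"
  using scale_of_measurable by (simp add: measurable_cong_sets[OF digits.sets_\<mu> refl])

definition shift_scale :: "(nat \<Rightarrow> bool) \<Rightarrow> real" where
  "shift_scale m = exp (\<Sum>k. of_bool (m k) * rate k)"

lemma summable_bool_rate: "summable (\<lambda>k. of_bool (m k) * rate k)"
  by (rule tail_sum(1)[of 0]) auto

lemma scale_of_shift:
  assumes "good w" "\<not> m 0"
  shows "scale_of (\<lambda>k. w k + of_bool (m k)) = shift_scale m * scale_of w"
proof -
  have "summable (\<lambda>k. real_of_int (w k) * rate k)"
    using good_summable[OF assms(1), of "\<lambda>_. 0"] by simp
  from suminf_add[OF this summable_bool_rate[of m]]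
  have "(\<Sum>k. real_of_int (w k + of_bool (m k)) * rate k) = (\<Sum>k. real_of_int (w k) * rate k) + (\<Sum>k. of_bool (m k) * rate k)"
    by (simp add: distrib_right)
  then show ?thesis using assms(2) by (simp add: scale_of_def shift_scale_def exp_add)
qed

text \<open>On good sequences, adding \<open>m\<close> to the digits multiplies the scale by
  \<open>shift_scale m\<close>; the sign survives because \<open>\<not> m 0\<close>. On the digit
  side the change of law has a density between \<open>inverse C\<close> and \<open>C\<close>, with
  \<open>C\<close> the same for all \<open>m\<close>.\<close>

lemma scale_law_shift:
  assumes m: "\<not> m 0" and B: "B \<in> sets borel"
  defines "C \<equiv> exp (\<Sum>k. (1/2 :: real) ^ k)"
  shows "emeasure scale_law ((\<lambda>y. shift_scale m * y) -` B) \<le> ennreal C * emeasure scale_law B"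
    and "ennreal (inverse C) * emeasure scale_law B \<le> emeasure scale_law ((\<lambda>y. shift_scale m * y) -` B)"
proof -
  let ?N = "\<Pi>\<^sub>M k\<in>UNIV. count_space (UNIV :: int set)"
  define g where "g k = (\<lambda>j. j + of_bool (m k) :: int)" for k
  define q where "q k = map_pmf (g k) (digit_pmf k)" for k
  define h where "h k j = (1/2) ^ k * (real (digit_size j) - real (digit_size (j - of_bool (m k))))" for k j
  define A where "A = {w. scale_of w \<in> B}"
  note [measurable] = B
  have sB[measurable]: "(\<lambda>y. shift_scale m * y) -` B \<in> sets borel"
    using measurable_sets_borel[of "\<lambda>y. shift_scale m * y" borel B] B by simp
  have AN: "A \<in> sets ?N"
    using measurable_sets[OF scale_of_measurable' B] by (simp add: A_def vimage_def space_PiM)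
  then have A: "A \<in> sets digits.\<mu>" by (simp add: digits.sets_\<mu>)
  have F: "(\<lambda>w k. g k (w k)) \<in> digits.\<mu> \<rightarrow>\<^sub>M ?N" by (rule move_digits_measurable)
  have "emeasure scale_law ((\<lambda>y. shift_scale m * y) -` B) = emeasure digits.\<mu> {w \<in> space digits.\<mu>. shift_scale m * scale_of w \<in> B}"
    by (subst emeasure_scale_law) auto
  also have "\<dots> = emeasure digits.\<mu> ((\<lambda>w k. g k (w k)) -` A \<inter> space digits.\<mu>)"
  proof (rule emeasure_eq_AE)
    show "AE w in digits.\<mu>. w \<in> {w \<in> space digits.\<mu>. shift_scale m * scale_of w \<in> B} \<longleftrightarrow> w \<in> (\<lambda>w k. g k (w k)) -` A \<inter> space digits.\<mu>"
      using AE_good by eventually_elim (simp add: A_def g_def scale_of_shift[where m = m, OF _ m])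
    show "(\<lambda>w k. g k (w k)) -` A \<inter> space digits.\<mu> \<in> sets digits.\<mu>" by (rule measurable_sets[OF F AN])
    show "{w \<in> space digits.\<mu>. shift_scale m * scale_of w \<in> B} \<in> sets digits.\<mu>" by measurable
  qed
  also have "\<dots> = emeasure (distr digits.\<mu> ?N (\<lambda>w k. g k (w k))) A"
    by (rule emeasure_distr[OF F AN, symmetric])
  also have "\<dots> = emeasure (\<Pi>\<^sub>M k\<in>UNIV. measure_pmf (q k)) A"
    by (simp add: digits.image_product q_def)
  finally have e: "emeasure scale_law ((\<lambda>y. shift_scale m * y) -` B) = emeasure (\<Pi>\<^sub>M k\<in>UNIV. measure_pmf (q k)) A" .
  have b: "emeasure scale_law B = emeasure digits.\<mu> A" by (simp add: emeasure_scale_law A_def)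
  have q: "pmf (q k) j = exp (h k j) * pmf (digit_pmf k) j" for k j
    unfolding q_def g_def h_def digit_pmf_def by (rule two_sided_shift(1)) auto
  have h: "\<bar>h k j\<bar> \<le> (1/2) ^ k" for k j
    unfolding h_def by (rule two_sided_shift(2)) auto
  have l: "summable (\<lambda>k. (1/2 :: real) ^ k)" by (intro summable_geometric) simp
  show "emeasure scale_law ((\<lambda>y. shift_scale m * y) -` B) \<le> ennreal C * emeasure scale_law B"
    unfolding e b C_def by (rule digits.product_density_bounds(1)[OF q h l A])
  show "ennreal (inverse C) * emeasure scale_law B \<le> emeasure scale_law ((\<lambda>y. shift_scale m * y) -` B)"
    unfolding e b C_def exp_minus[symmetric] by (rule digits.product_density_bounds(2)[OF q h l A])
qed

text \<open>Reflecting digit 0 flips the sign and keeps the modulus, as \<open>rate 0 = 0\<close>,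
  and the law of the digit is invariant under the reflection.\<close>

lemma scale_law_symmetric: "distr scale_law borel uminus = scale_law"
proof -
  let ?N = "\<Pi>\<^sub>M k\<in>UNIV. count_space (UNIV :: int set)"
  define g :: "nat \<Rightarrow> int \<Rightarrow> int" where "g k = (if k = 0 then (\<lambda>j. - 1 - j) else (\<lambda>j. j))" for k
  have q: "map_pmf (g k) (digit_pmf k) = digit_pmf k" for k
    by (simp add: g_def digit_pmf_def two_sided_reflect)
  have F: "(\<lambda>w k. g k (w k)) \<in> digits.\<mu> \<rightarrow>\<^sub>M ?N" by (rule move_digits_measurable)
  have sc: "scale_of (\<lambda>k. g k (w k)) = - scale_of w" for w
  proof -
    have "(\<lambda>k. real_of_int (g k (w k)) * rate k) = (\<lambda>k. real_of_int (w k) * rate k)"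
      by (auto simp: g_def rate_0)
    then show ?thesis by (simp add: scale_of_def g_def)
  qed
  have "distr scale_law borel uminus = distr digits.\<mu> borel (uminus \<circ> scale_of)"
    unfolding scale_law_def by (rule distr_distr) measurable
  also have "\<dots> = distr digits.\<mu> borel (scale_of \<circ> (\<lambda>w k. g k (w k)))"
    by (simp add: comp_def sc)
  also have "\<dots> = distr (distr digits.\<mu> ?N (\<lambda>w k. g k (w k))) borel scale_of"
    by (rule distr_distr[symmetric]) (auto intro: F)
  also have "\<dots> = distr digits.\<mu> borel scale_of"
    unfolding digits.image_product q by (simp only: digits.\<mu>_def)
  finally show ?thesis by (simp add: scale_law_def)
qed

lemma Anum_le_big: "0 < n \<Longrightarrow> Anum n \<le> big n"
proof (cases n)
  case (Suc m)
  have "1 * Anum n * 1 \<le> den m * Anum n * (Anum n + 1)"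
    using den_pos[of m] by (intro mult_mono) auto
  also have "\<dots> = den n ^ 1 * 1" using Suc by (simp add: den_Suc algebra_simps)
  also have "\<dots> \<le> den n ^ digit_bound n * 2 ^ (n * digit_bound n)"
    using den_pos[of n] digit_bound(1)[of n] by (intro mult_mono power_increasing) auto
  also have "\<dots> \<le> big n" by (rule den_le_big)
  finally show ?thesis by simp
qed simp

lemma Anum_less:
  assumes "0 < n" "n < k"
  shows "Anum n < Anum k"
proof -
  have "Anum n < 1 * 1 * (big n + 1)" using Anum_le_big[OF assms(1)] by simp
  also have "\<dots> \<le> 4 ^ k * (digit_bound k + 1) * (big n + 1)" by (intro mult_mono) auto
  also have "\<dots> \<le> Anum k" by (rule Anum_ge[OF assms(2)])
  finally show ?thesis .
qed

text \<open>An atom at \<open>a \<noteq> 0\<close> would force at least \<open>1 / C\<close> times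
  its mass at each of the infinitely many distinct points \<open>s k * a\<close>, where
  \<open>C\<close> does not depend on \<open>k\<close>. At 0 there is no mass because the scale
  never vanishes.\<close>

lemma scale_law_atomless: "emeasure scale_law {a} = 0"
proof -
  interpret L: prob_space scale_law by (rule prob_space_scale_law)
  define C where "C = exp (\<Sum>k. (1/2 :: real) ^ k)"
  show ?thesis
  proof (cases "a = 0")
    case True
    then show ?thesis by (simp add: emeasure_scale_law scale_of_def)
  next
    case False
    define s where "s k = exp (rate (Suc k))" for k
    have s: "shift_scale (\<lambda>i. i = Suc k) = s k" for k
    proof -
      have "(\<Sum>i. of_bool (i = Suc k) * rate i) = (\<Sum>i\<in>{Suc k}. of_bool (i = Suc k) * rate i)"
        by (rule suminf_finite) auto
      then show ?thesis by (simp add: shift_scale_def s_def)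
    qed
    have inj: "s k \<noteq> s l" if "k < l" for k l
      using Anum_less[of "Suc k" "Suc l"] that by (simp add: s_def exp_rate del: exp_inj_iff)
    have "disjoint_family (\<lambda>k. {s k * a})"
      unfolding disjoint_family_on_def using inj False by (auto simp: neq_iff)
    then have "(\<lambda>k. measure scale_law {s k * a}) sums measure scale_law (\<Union>k. {s k * a})"
      by (intro L.finite_measure_UNION) auto
    then have "(\<lambda>k. C * measure scale_law {s k * a}) \<longlonglongrightarrow> C * 0"
      by (intro tendsto_intros summable_LIMSEQ_zero sums_summable)
    moreover have "measure scale_law {a} \<le> C * measure scale_law {s k * a}" for k
    proof -
      have "(\<lambda>y. shift_scale (\<lambda>i. i = Suc k) * y) -` {s k * a} = {a}"
        unfolding s by (auto simp: s_def)
      then have "emeasure scale_law {a} \<le> ennreal C * emeasure scale_law {s k * a}"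
        using scale_law_shift(1)[of "\<lambda>i. i = Suc k" "{s k * a}"] by (simp add: C_def)
      then show ?thesis
        by (simp add: L.emeasure_eq_measure C_def flip: ennreal_mult)
    qed
    ultimately have "measure scale_law {a} \<le> C * 0"
      by (intro LIMSEQ_le_const) auto
    then have "measure scale_law {a} = 0" using measure_nonneg[of scale_law "{a}"] by simp
    then show ?thesis by (simp add: L.emeasure_eq_measure)
  qed
qed

text \<open>The first place \<open>k\<close> where \<open>m\<close> and \<open>m'\<close> differ
  decides the order: \<open>rate k\<close> is at least \<open>1 / (Anum k + 1)\<close>, while all
  later places together contribute at most a third of that.\<close>

lemma inj_shift_scale: "inj_on shift_scale {m. \<not> m 0}"
proof -
  have less: "(\<Sum>i. of_bool (m' i) * rate i) < (\<Sum>i. of_bool (m i) * rate i)"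
    if k: "0 < k" "m k" "\<not> m' k" "\<And>i. i < k \<Longrightarrow> m i = m' i" for m m' k
  proof -
    let ?e = "\<lambda>i. of_bool (m i) - of_bool (m' i) :: real"
    have sd: "summable (\<lambda>i. ?e i * rate i)"
      using summable_diff[OF summable_bool_rate[of m] summable_bool_rate[of m']] by (simp add: left_diff_distrib)
    have "(\<Sum>i. of_bool (m i) * rate i) - (\<Sum>i. of_bool (m' i) * rate i) = (\<Sum>i. ?e i * rate i)"
      using suminf_diff[OF summable_bool_rate[of m] summable_bool_rate[of m']] by (simp add: left_diff_distrib)
    also have "\<dots> = (\<Sum>i. ?e (i + Suc k) * rate (i + Suc k)) + (\<Sum>i<Suc k. ?e i * rate i)"
      by (rule suminf_split_initial_segment[OF sd])
    also have "(\<Sum>i<Suc k. ?e i * rate i) = rate k"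
    proof -
      have "(\<Sum>i<k. ?e i * rate i) = 0" by (rule sum.neutral) (use k in auto)
      then show ?thesis using k by simp
    qed
    finally have d: "(\<Sum>i. of_bool (m i) * rate i) - (\<Sum>i. of_bool (m' i) * rate i)
        = (\<Sum>i. ?e (i + Suc k) * rate (i + Suc k)) + rate k" .
    define A where "A = real (Anum k)"
    have A: "0 < A" using Anum_pos[of k] by (simp add: A_def)
    have "\<bar>\<Sum>i. ?e (i + Suc k) * rate (i + Suc k)\<bar> \<le> (1/4) ^ k / (3 * real (big k + 1))"
      by (rule tail_sum(2)) auto
    also have "\<dots> \<le> 1 / (3 * (A + 1))"
      using Anum_le_big[OF k(1)] A by (intro frac_le) (auto simp: A_def intro: power_le_one)
    also have "\<dots> < 1 / (A + 1)" using A by (intro divide_strict_left_mono) auto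
    also have "\<dots> \<le> rate k"
    proof -
      \<comment> \<open>\<open>ln x \<le> x - 1\<close> at the reciprocal of
        \<open>1 + 1 / A\<close> gives the lower bound \<open>1 / (A + 1)\<close> for
        \<open>ln (1 + 1 / A)\<close>.\<close>
      have "ln (1 / (1 + 1 / A)) \<le> 1 / (1 + 1 / A) - 1" using A by (intro ln_le_minus_one) (auto simp: add_pos_pos)
      moreover have "ln (1 / (1 + 1 / A)) = - rate k" using A k(1) by (simp add: rate_def ln_div A_def add_pos_pos)
      moreover have "1 / (1 + 1 / A) - 1 = - (1 / (A + 1))" using A by (simp add: field_simps)
      ultimately show ?thesis by simp
    qed
    finally show ?thesis using d by linarith
  qed
  show ?thesis
  proof (rule inj_onI, rule ccontr)
    fix m m' assume z: "m \<in> {m. \<not> m 0}" "m' \<in> {m. \<not> m 0}" and eq: "shift_scale m = shift_scale m'" and ne: "m \<noteq> m'"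
    then have e: "(\<Sum>i. of_bool (m' i) * rate i) = (\<Sum>i. of_bool (m i) * rate i)" by (simp add: shift_scale_def)
    define k where "k = (LEAST k. m k \<noteq> m' k)"
    from ne have "\<exists>k. m k \<noteq> m' k" by auto
    then have k: "m k \<noteq> m' k" unfolding k_def by (rule LeastI_ex)
    have kl: "m i = m' i" if "i < k" for i using not_less_Least[OF that[unfolded k_def]] by simp
    have k0: "0 < k" using k z by (cases k) auto
    show False
    proof (cases "m k")
      case True
      with less[of k m m'] k kl k0 e show False by simp
    next
      case False
      with less[of k m' m] k kl k0 e show False by simp
    qed
  qed
qed

lemma uncountable_shift_scales: "uncountable (shift_scale ` {m. \<not> m 0})"
proof
  assume "countable (shift_scale ` {m. \<not> m 0})"
  then have c: "countable {m :: nat \<Rightarrow> bool. \<not> m 0}" by (rule countable_image_inj_on[OF _ inj_shift_scale])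
  define f where "f = from_nat_into {m :: nat \<Rightarrow> bool. \<not> m 0}"
  have "(\<lambda>_. False) \<in> {m :: nat \<Rightarrow> bool. \<not> m 0}" by simp
  then have r: "range f = {m. \<not> m 0}" unfolding f_def using c by (intro range_from_nat_into) auto
  \<comment> \<open>Cantor's diagonal, moved up by one place because place 0 has to stay
    \<open>False\<close>.\<close>
  define d where "d k = (k \<noteq> 0 \<and> \<not> f (k - 1) k)" for k
  have "d \<in> range f" unfolding r by (simp add: d_def)
  then obtain n where "d = f n" by auto
  then have "d (Suc n) = f n (Suc n)" by simp
  then show False by (simp add: d_def)
qed

section \<open>The spectral measure\<close>

text \<open>The positive weight keeps the null sets, hence quasi-invariance, rigidity and the
  absence of atoms. Since \<open>x ^ (2 * n) \<le> fact n * exp (x\<^sup>2)\<close>, it yields the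
  moment bound with constant 1.\<close>

definition spectral_law :: "real measure" where
  "spectral_law = density scale_law (\<lambda>x. ennreal (exp (- x\<^sup>2)))"

lemma sets_spectral_law: "sets spectral_law = sets borel"
  by (simp add: spectral_law_def)

lemma space_spectral_law: "space spectral_law = UNIV"
  by (simp add: spectral_law_def)

lemma emeasure_spectral_law_eq_0:
  assumes "A \<in> sets borel"
  shows "emeasure spectral_law A = 0 \<longleftrightarrow> emeasure scale_law A = 0"
proof -
  have "A \<in> null_sets spectral_law \<longleftrightarrow> A \<in> null_sets scale_law"
    unfolding spectral_law_def using assms
    by (subst null_sets_density_iff) (auto simp: AE_iff_null_sets)
  then show ?thesis using assms by (simp add: null_sets_def sets_spectral_law)
qed

lemma integrable_spectral_law:
  assumes [measurable]: "f \<in> borel_measurable borel" and b: "\<And>x. \<bar>f x\<bar> \<le> K * exp (x\<^sup>2)"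
  shows "integrable spectral_law f" "(\<integral>x. f x \<partial>spectral_law) \<le> K"
proof -
  interpret L: prob_space scale_law by (rule prob_space_scale_law)
  have b': "\<bar>exp (- x\<^sup>2) * f x\<bar> \<le> K" for x
  proof -
    have "exp (- x\<^sup>2) * \<bar>f x\<bar> \<le> exp (- x\<^sup>2) * (K * exp (x\<^sup>2))" by (intro mult_left_mono b) simp
    also have "\<dots> = K" by (simp add: exp_minus)
    finally show ?thesis by (simp add: abs_mult)
  qed
  have i: "integrable scale_law (\<lambda>x. exp (- x\<^sup>2) * f x)"
    by (rule L.integrable_const_bound[where B = K]) (use b' in auto)
  then show "integrable spectral_law f"
    unfolding spectral_law_def by (subst integrable_density) auto
  have "(\<integral>x. f x \<partial>spectral_law) = (\<integral>x. exp (- x\<^sup>2) * f x \<partial>scale_law)"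
    unfolding spectral_law_def by (subst integral_density) auto
  also have "\<dots> \<le> K" by (rule L.integral_le_const[OF i]) (use b' in \<open>auto simp: abs_le_iff\<close>)
  finally show "(\<integral>x. f x \<partial>spectral_law) \<le> K" .
qed

lemma power_le_fact_exp: "0 \<le> y \<Longrightarrow> y ^ n \<le> fact n * exp y" for y :: real
proof -
  assume y: "0 \<le> y"
  have "(\<Sum>k\<in>{n}. inverse (fact k) * y ^ k) \<le> (\<Sum>k. inverse (fact k) * y ^ k)"
    by (rule sum_le_suminf[OF summable_exp]) (use y in auto)
  then have "inverse (fact n) * y ^ n \<le> exp y" by (simp add: exp_def)
  then show ?thesis by (simp add: field_simps)
qed

lemma finite_symmetric_spectral_law: "finite_symmetric_borel_measure spectral_law"
proof -
  have d: "density scale_law (\<lambda>x. ennreal (exp (- x\<^sup>2))) = density (distr scale_law borel uminus) (\<lambda>x. ennreal (exp (- x\<^sup>2)))"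
    by (simp add: scale_law_symmetric)
  have "distr spectral_law borel uminus = spectral_law"
  proof (rule measure_eqI)
    fix A assume "A \<in> sets (distr spectral_law borel uminus)"
    then have A[measurable]: "A \<in> sets borel" by simp
    have mA[measurable]: "uminus -` A \<in> sets borel" using measurable_sets_borel[of uminus borel A] by simp
    have "emeasure (distr spectral_law borel uminus) A = emeasure spectral_law (uminus -` A)"
      by (subst emeasure_distr) (auto simp: measurable_cong_sets[OF sets_spectral_law refl] space_spectral_law)
    also have "\<dots> = (\<integral>\<^sup>+x. ennreal (exp (- x\<^sup>2)) * indicator (uminus -` A) x \<partial>scale_law)"
      unfolding spectral_law_def by (rule emeasure_density) auto
    also have "\<dots> = (\<integral>\<^sup>+x. ennreal (exp (- (- x)\<^sup>2)) * indicator A (- x) \<partial>scale_law)"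
      by (simp add: indicator_def)
    also have "\<dots> = (\<integral>\<^sup>+x. ennreal (exp (- x\<^sup>2)) * indicator A x \<partial>distr scale_law borel uminus)"
      by (rule nn_integral_distr[symmetric]) auto
    also have "\<dots> = emeasure spectral_law A"
      unfolding scale_law_symmetric spectral_law_def by (rule emeasure_density[symmetric]) auto
    finally show "emeasure (distr spectral_law borel uminus) A = emeasure spectral_law A" .
  qed (simp add: sets_spectral_law)
  moreover have "integrable spectral_law (\<lambda>_. 1 :: real)"
    by (rule integrable_spectral_law[where K = 1]) auto
  then have "finite_measure spectral_law"
    by (intro finite_measureI) (simp add: integrable_iff_bounded)
  ultimately show ?thesis by (simp add: finite_symmetric_borel_measure_def sets_spectral_law)
qed

interpretation spectral: spectral_measure spectral_law
proof
  show "finite_symmetric_borel_measure spectral_law" by (rule finite_symmetric_spectral_law)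
  show "integrable spectral_law (\<lambda>x. exp (r * \<bar>x\<bar>))" for r
  proof (rule integrable_spectral_law)
    fix x :: real
    have "0 \<le> (\<bar>x\<bar> - r / 2)\<^sup>2" by simp
    then have "r * \<bar>x\<bar> \<le> r\<^sup>2 / 4 + x\<^sup>2" by (simp add: power2_diff power_divide algebra_simps)
    then have "exp (r * \<bar>x\<bar>) \<le> exp (r\<^sup>2 / 4 + x\<^sup>2)" by simp
    then show "\<bar>exp (r * \<bar>x\<bar>)\<bar> \<le> exp (r\<^sup>2 / 4) * exp (x\<^sup>2)" by (simp add: exp_add)
  qed measurable
  have "(\<integral>x. x ^ (2 * n) \<partial>spectral_law) \<le> 1 * fact n" for n
    using integrable_spectral_law(2)[of "\<lambda>x. x ^ (2 * n)" "fact n"] power_le_fact_exp[of "_\<^sup>2" n]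
    by (simp add: power_mult)
  then show "\<exists>K. \<forall>n. (\<integral>x. x ^ (2 * n) \<partial>spectral_law) \<le> K * fact n" by blast
qed

lemma spectral_law_atomless: "emeasure spectral_law {a} = 0"
  by (simp add: emeasure_spectral_law_eq_0 scale_law_atomless)

lemma spectral_law_pos: "0 < measure spectral_law UNIV"
proof -
  interpret L: prob_space scale_law by (rule prob_space_scale_law)
  have "emeasure spectral_law UNIV \<noteq> 0"
    using L.emeasure_space_1 by (simp add: emeasure_spectral_law_eq_0)
  then show ?thesis by (simp add: spectral.emeasure_eq_measure zero_less_measure_iff)
qed

lemma spectral_law_rigid: "AE x in spectral_law. (\<lambda>n. cis (rigid_time n * x)) \<longlonglongrightarrow> 1"
proof -
  have [measurable]: "(\<lambda>x. cis (c * x)) \<in> borel_measurable borel" for c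
    by (intro borel_measurable_continuous_onI continuous_intros)
  have "AE w in digits.\<mu>. (\<lambda>n. cis (rigid_time n * scale_of w)) \<longlonglongrightarrow> 1"
    using AE_good by eventually_elim (rule good_rigid)
  then have "AE x in scale_law. (\<lambda>n. cis (rigid_time n * x)) \<longlonglongrightarrow> 1"
    unfolding scale_law_def by (subst AE_distr_iff) measurable
  then show ?thesis unfolding spectral_law_def by (subst AE_density) auto
qed

lemma spectral_law_quasi_invariant:
  assumes m: "\<not> m 0" and A: "A \<in> sets borel"
  shows "emeasure spectral_law ((\<lambda>x. x / shift_scale m) -` A) = 0 \<longleftrightarrow> emeasure spectral_law A = 0"
proof -
  let ?B = "(\<lambda>x. x / shift_scale m) -` A"
  have B: "?B \<in> sets borel" using measurable_sets_borel[of "\<lambda>x. x / shift_scale m" borel A] A by simp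
  have "shift_scale m \<noteq> 0" by (simp add: shift_scale_def)
  then have "(\<lambda>y. shift_scale m * y) -` ?B = A" by (auto simp: vimage_def)
  with scale_law_shift[where m = m, OF m B] have "emeasure scale_law A = 0 \<longleftrightarrow> emeasure scale_law ?B = 0"
    by auto
  then show ?thesis using A B by (simp add: emeasure_spectral_law_eq_0)
qed

theorem theorem0p1:
  shows "\<exists>(M :: path measure) (T :: real \<Rightarrow> path \<Rightarrow> path).
           gaussian_flow M T \<and> weakly_mixing M T \<and>
           uncountable (self_similarities M T) \<and>
           meager_in (top_of_set (UNIV - {0 :: real})) (self_similarities M T)"
proof -
  obtain M where M: "prob_space M" "sets M = sets path_algebra"
    "\<And>p. (\<integral>f. cis (lin p f) \<partial>M) = exp (- nsq spectral_law (ev p) / 2)"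
    using spectral.path_law_exists by blast
  interpret gaussian_paths spectral_law M
    by (intro gaussian_paths.intro spectral.spectral_measure_axioms gaussian_paths_axioms.intro M)
  have "shift_scale m \<in> self_similarities M translate" if "\<not> m 0" for m
  proof (rule self_similarity_of_quasi_invariance)
    show "shift_scale m \<noteq> 0" by (simp add: shift_scale_def)
  qed (rule spectral_law_quasi_invariant[where m = m, OF that])
  then have "shift_scale ` {m. \<not> m 0} \<subseteq> self_similarities M translate" by auto
  then have "uncountable (self_similarities M translate)"
    using uncountable_shift_scales countable_subset by blast
  moreover have "gaussian_flow M translate" by (rule gaussian_flow_translate[OF spectral_law_pos])
  moreover have "weakly_mixing M translate" by (rule weakly_mixing_translate[OF spectral_law_atomless])
  moreover have "meager_in (top_of_set (UNIV - {0 :: real})) (self_similarities M translate)"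
    by (rule meager_self_similarities[OF spectral_law_rigid rigid_time_at_top spectral_law_pos spectral_law_atomless])
  ultimately show ?thesis by blast
qed

end
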